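(* Let $m\ge 1$. Then: (1) $\mathrm{GL}_\infty(\mathbb S_m)=U(K)\ltimes E_\infty(\mathbb S_m)$, and $E_\infty(\mathbb S_m)=\ker(\overline{\det})$. More precisely, $\overline{\det}:\mathrm{GL}_\infty(\mathbb S_m)\to K^*$ is a surjective group homomorphism, and every $a\in \mathrm{GL}_\infty(\mathbb S_m)$ is the unique product $a=\mu(\lambda)\,e$ with $\lambda=\overline{\det}(a)\in K^*$ and $e=\mu(\overline{\det}(a))^{-1}a\in E_\infty(\mathbb S_m)$. (2) $\mathrm{K}_1(\mathbb S_m)\simeq K^*$.
   Context: $K$ is a field with unit group $K^*$. For $m\ge1$, $\mathbb S_m$ is the $K$-algebra generated by $x_1,\dots,x_m,y_1,\dots,y_m$ subject to the defining relations $y_ix_i=1$ for all $i$, and $[x_i,y_j]=[x_i,x_j]=[y_i,y_j]=0$ for all $i\neq j$ (where $[a,b]=ab-ba$). For $1\le i\le m$ let $E_{00}(i):=1-x_iy_i$; let $\mathfrak a_m$ be the ideal of $\mathbb S_m$ generated by $E_{00}(1),\dots,E_{00}(m)$. Then $\mathbb S_m/\mathfrak a_m\simeq L_m:=K[x_1^{\pm1},\dots,x_m^{\pm1}]$ (Laurent polynomial algebra, $x_i\mapsto x_i$, $y_i\mapsto x_i^{-1}$). For a ring $A$, $\mathrm{GL}_\infty(A)=\bigcup_d \mathrm{GL}_d(A)$ is the group of invertible $\mathbb N\times\mathbb N$ matrices over $A$ differing from the identity in finitely many entries, and $E_\infty(A)$ is its subgroup generated by the elementary matrices $1+aE_{ij}$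 ($a\in A$, $i\ne j$); $\mathrm{K}_1(A)=\mathrm{GL}_\infty(A)/E_\infty(A)$. $\overline{\det}:\mathrm{GL}_\infty(\mathbb S_m)\to L_m^*$ is the composition of the map $\mathrm{GL}_\infty(\mathbb S_m)\to \mathrm{GL}_\infty(L_m)$ induced by $\mathbb S_m\to\mathbb S_m/\mathfrak a_m=L_m$ with the determinant $\mathrm{GL}_\infty(L_m)\to L_m^*$. For $\lambda\in K^*$, $\mu(\lambda):=\mathrm{diag}(\lambda,1,1,\dots)$ and $U(K):=\{\mu(\lambda):\lambda\in K^*\}\simeq K^*$. *)

theory Defs
  imports "HOL-Algebra.Algebra" "HOL-Combinatorics.Permutations"
begin

type_synonym 'a imat = "nat \<Rightarrow> nat \<Rightarrow> 'a"

definition idm :: "('a,'b) ring_scheme \<Rightarrow> 'a imat" where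
  "idm R = (\<lambda>i j. if i = j then \<one>\<^bsub>R\<^esub> else \<zero>\<^bsub>R\<^esub>)"

definition fsupp :: "('a,'b) ring_scheme \<Rightarrow> 'a imat \<Rightarrow> bool" where
  "fsupp R A \<longleftrightarrow> (\<forall>i j. A i j \<in> carrier R) \<and> finite {(i,j). A i j \<noteq> idm R i j}"

definition mmult :: "('a,'b) ring_scheme \<Rightarrow> 'a imat \<Rightarrow> 'a imat \<Rightarrow> 'a imat" where
  "mmult R A B = (\<lambda>i j. finsum R (\<lambda>k. A i k \<otimes>\<^bsub>R\<^esub> B k j)
                        {k. A i k \<noteq> \<zero>\<^bsub>R\<^esub> \<and> B k j \<noteq> \<zero>\<^bsub>R\<^esub>})"

definition GLinf :: "('a,'b) ring_scheme \<Rightarrow> 'a imat set" where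
  "GLinf R = {A. fsupp R A \<and> (\<exists>B. fsupp R B \<and> mmult R A B = idm R \<and> mmult R B A = idm R)}"

definition GLgrp :: "('a,'b) ring_scheme \<Rightarrow> 'a imat monoid" where
  "GLgrp R = \<lparr>carrier = GLinf R, monoid.mult = mmult R, one = idm R\<rparr>"

definition elem :: "('a,'b) ring_scheme \<Rightarrow> nat \<Rightarrow> nat \<Rightarrow> 'a \<Rightarrow> 'a imat" where
  "elem R i j a = (\<lambda>p q. if p = i \<and> q = j then a else idm R p q)"

definition Einf :: "('a,'b) ring_scheme \<Rightarrow> 'a imat set" where
  "Einf R = generate (GLgrp R) {elem R i j a | i j a. i \<noteq> j \<and> a \<in> carrier R}"

definition K1 :: "('a,'b) ring_scheme \<Rightarrow> 'a imat set monoid" where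
  "K1 R = GLgrp R Mod Einf R"

definition detn :: "('a,'b) ring_scheme \<Rightarrow> nat \<Rightarrow> 'a imat \<Rightarrow> 'a" where
  "detn R n A = finsum R (\<lambda>p. let t = finprod R (\<lambda>i. A i (p i)) {..<n}
                               in if evenperm p then t else \<ominus>\<^bsub>R\<^esub> t)
                  {p. p permutes {..<n}}"

text \<open>Determinant of a matrix differing from the identity only inside a finite block
  (this is the determinant on GL_infinity, it is stable under enlarging the block).\<close>
definition detinf :: "('a,'b) ring_scheme \<Rightarrow> 'a imat \<Rightarrow> 'a" where
  "detinf R A = detn R (LEAST n. \<forall>i j. (n \<le> i \<or> n \<le> j) \<longrightarrow> A i j = idm R i j) A"

text \<open>Letters: (i,True) is x_i, (i,False) is y_i. The free associative K-algebra on
  x_1..x_m,y_1..y_m: finitely supported K-valued functions on words over these letters,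
  with concatenation-convolution product.\<close>
type_synonym letter = "nat \<times> bool"
type_synonym 'k ncpoly = "letter list \<Rightarrow> 'k"

definition fmul :: "'k::field ncpoly \<Rightarrow> 'k ncpoly \<Rightarrow> 'k ncpoly" where
  "fmul f g = (\<lambda>w. \<Sum>k\<in>{0..length w}. f (take k w) * g (drop k w))"

definition fconst :: "'k::field \<Rightarrow> 'k ncpoly" where
  "fconst c = (\<lambda>w. if w = [] then c else 0)"

definition FreeAlg :: "nat \<Rightarrow> 'k::field ncpoly ring" where
  "FreeAlg m = \<lparr>carrier = {f. finite {w. f w \<noteq> 0} \<and>
                                (\<forall>w. f w \<noteq> 0 \<longrightarrow> set w \<subseteq> {1..m} \<times> UNIV)},
                monoid.mult = fmul, one = fconst 1,
                ring.zero = (\<lambda>_. 0), ring.add = (\<lambda>f g w. f w + g w)\<rparr>"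

definition gen :: "letter \<Rightarrow> 'k::field ncpoly" where
  "gen l = (\<lambda>w. if w = [l] then 1 else 0)"

definition fsub :: "'k::field ncpoly \<Rightarrow> 'k ncpoly \<Rightarrow> 'k ncpoly" where
  "fsub f g = (\<lambda>w. f w - g w)"

definition fcomm :: "'k::field ncpoly \<Rightarrow> 'k ncpoly \<Rightarrow> 'k ncpoly" where
  "fcomm f g = fsub (fmul f g) (fmul g f)"

definition rels :: "nat \<Rightarrow> 'k::field ncpoly set" where
  "rels m = {fsub (fmul (gen (i,False)) (gen (i,True))) (fconst 1) | i. i \<in> {1..m}}
     \<union> {fcomm (gen (i,b)) (gen (j,c)) | i j b c. i \<in> {1..m} \<and> j \<in> {1..m} \<and> i \<noteq> j}"

definition Sm :: "nat \<Rightarrow> 'k::field ncpoly set ring" where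
  "Sm m = FreeAlg m Quot genideal (FreeAlg m) (rels m)"

definition toS :: "nat \<Rightarrow> 'k::field ncpoly \<Rightarrow> 'k ncpoly set" where
  "toS m f = genideal (FreeAlg m) (rels m) +>\<^bsub>FreeAlg m\<^esub> f"

definition xS :: "nat \<Rightarrow> nat \<Rightarrow> 'k::field ncpoly set" where
  "xS m i = toS m (gen (i,True))"

definition yS :: "nat \<Rightarrow> nat \<Rightarrow> 'k::field ncpoly set" where
  "yS m i = toS m (gen (i,False))"

definition scS :: "nat \<Rightarrow> 'k::field \<Rightarrow> 'k ncpoly set" where
  "scS m c = toS m (fconst c)"

definition E00 :: "nat \<Rightarrow> nat \<Rightarrow> 'k::field ncpoly set" where
  "E00 m i = \<one>\<^bsub>Sm m\<^esub> \<ominus>\<^bsub>Sm m\<^esub> (xS m i \<otimes>\<^bsub>Sm m\<^esub> yS m i)"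

definition am :: "nat \<Rightarrow> 'k::field ncpoly set set" where
  "am m = genideal (Sm m) {E00 m i | i. i \<in> {1..m}}"

text \<open>L_m = S_m / a_m (isomorphic to the Laurent polynomial algebra).\<close>
definition Lm :: "nat \<Rightarrow> 'k::field ncpoly set set ring" where
  "Lm m = Sm m Quot am m"

definition toL :: "nat \<Rightarrow> 'k::field ncpoly set \<Rightarrow> 'k ncpoly set set" where
  "toL m s = am m +>\<^bsub>Sm m\<^esub> s"

definition scL :: "nat \<Rightarrow> 'k::field \<Rightarrow> 'k ncpoly set set" where
  "scL m c = toL m (scS m c)"

definition detbar :: "nat \<Rightarrow> 'k::field ncpoly set imat \<Rightarrow> 'k ncpoly set set" where
  "detbar m A = detinf (Lm m) (\<lambda>i j. toL m (A i j))"

definition mu :: "nat \<Rightarrow> 'k::field \<Rightarrow> 'k ncpoly set imat" where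
  "mu m c = (\<lambda>i j. if i = 0 \<and> j = 0 then scS m c else idm (Sm m) i j)"

definition UK :: "nat \<Rightarrow> 'k::field ncpoly set imat set" where
  "UK m = mu m ` {c. c \<noteq> 0}"

definition Kstar :: "'k::field monoid" where
  "Kstar = \<lparr>carrier = {c. c \<noteq> 0}, monoid.mult = (*), one = 1\<rparr>"

end

theory Submission
  imports Defs "HOL-Library.Poly_Mapping" "HOL-Library.Function_Algebras"
    "HOL-Computational_Algebra.Fraction_Field" "HOL-Computational_Algebra.Polynomial"
begin

text \<open>
  The algebra \<open>S\<^sub>m\<close> is realised as the monoid algebra of \<open>m\<close> copies of the bicyclic monoid. Let \<open>S(A, B)\<close>
  be its subalgebra generated by \<open>x\<^sub>i\<close> (\<open>i \<in> A\<close>) and \<open>y\<^sub>j\<close> (\<open>j \<in> B\<close>). One shows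
  \<open>GL\<^sub>\<infinity>(S(A, B)) = U(K) E\<^sub>\<infinity>(S(A, B))\<close> by induction on \<open>A \<inter> B\<close>.

  Induction step: let \<open>T\<close> extend \<open>R\<close> by \<open>x, y\<close> commuting with \<open>R\<close> and \<open>y x = 1\<close>. Up to elementary
  matrices an invertible matrix over \<open>T\<close> is \<open>a = a\<^sub>0 + a\<^sub>1 x + b\<^sub>1 y\<close> with coefficients over \<open>R\<close>. Writing
  \<open>a\<^sup>-\<^sup>1 (1 - x y) = u (1 - x y)\<close> with \<open>u\<close> polynomial in \<open>x\<close> with constant term \<open>u\<^sub>0\<close>, one gets
  \<open>a = (1 + b\<^sub>1 u\<^sub>0 y) u\<^sub>0\<^sup>-\<^sup>1 (1 + u\<^sub>0 a\<^sub>1 x)\<close> with all three factors invertible, over \<open>R[y]\<close>, \<open>R\<close> and \<open>R[x]\<close>.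

  Base case: for \<open>A \<inter> B = {}\<close> the algebra is a commutative polynomial ring, and variables are moved one at a
  time from the coefficient field into the polynomial ring. If an invertible matrix over \<open>R[t]\<close> is elementary up to
  \<open>\<mu>\<close> after inverting monic polynomials, then clearing denominators compares it with matrices equivalent to linear
  pencils \<open>t - \<tau>\<close>, and \<open>g l = l' h\<close> for such pencils \<open>l, l'\<close> forces \<open>g\<close> and \<open>h\<close> to agree modulo \<open>E\<^sub>\<infinity>(R[t])\<close>.

  Finally the determinant over the commutative ring \<open>L\<^sub>m\<close> is invariant under elementary row operations, so it
  separates the \<open>\<mu>(\<lambda>)\<close>.
\<close>

section \<open>Column-finite matrices and elementary matrices\<close>

text \<open>The family S(A, B) is forced by the factorization: two of its factors adjoin only x or
  only y, so an induction over \<open>m\<close> would leave its own class of rings, whereas R, R[x]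
  and R[y] all lower the size of A \<inter> B. The corner 1 - x y makes the step possible: on T(1 -
  x y), a copy of R[x], the element y acts as the backward shift, and its local nilpotency is what
  makes the factor over R[x] invertible over R[x] and not merely over T. In the base case the
  obstacle is to return from a localization. Inverting monic polynomials enlarges the elementary
  group, and elementary matrices with denominators say nothing directly about K[W]. Linear pencils
  carry the information back because division by them is possible with a unique remainder constant
  in t; the comparison of two intertwined pencils then rests on 1 + ab and 1 + ba having the same
  class modulo elementary matrices. Units of L_m other than constants, such as monomials, do not
  occur as determinants: the factorization of invertible matrices excludes them.\<close>

no_notation var (\<open>X\<index>\<close>)

text \<open>Column-finite matrices form a ring with identity, so finite perturbations of 1, infinite
  scalar matrices and index shifts can all be multiplied inside one type of class
  \<open>ring_1\<close>.\<close>

typedef (overloaded) 'a cfm = "{A :: nat \<Rightarrow> nat \<Rightarrow> 'a::zero. \<forall>j. finite {i. A i j \<noteq> 0}}"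
  morphisms ent Abs_cfm
  by (rule exI[of _ "\<lambda>_ _. 0"]) simp

setup_lifting type_definition_cfm

lemma cfm_eqI: "(\<And>i j. ent A i j = ent B i j) \<Longrightarrow> A = B"
  by transfer auto

lemma finite_ent_col [simp]: "finite {i. ent A i j \<noteq> 0}"
  by transfer auto

lemma finite_diag: "finite {i. (if i = (j::nat) then a else 0) \<noteq> (0::'a::zero)}"
  by (rule finite_subset[of _ "{j}"]) auto

instantiation cfm :: (ring_1) ring_1
begin

lift_definition zero_cfm :: "'a cfm" is "\<lambda>_ _. 0" by simp
lift_definition one_cfm :: "'a cfm" is "\<lambda>i j. if i = j then 1 else 0" by (simp add: finite_diag)
lift_definition plus_cfm :: "'a cfm \<Rightarrow> 'a cfm \<Rightarrow> 'a cfm" is "\<lambda>A B i j. A i j + B i j"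
  subgoal for A B j by (rule finite_subset[of _ "{i. A i j \<noteq> 0} \<union> {i. B i j \<noteq> 0}"]) auto done
lift_definition uminus_cfm :: "'a cfm \<Rightarrow> 'a cfm" is "\<lambda>A i j. - A i j"
  by simp
lift_definition minus_cfm :: "'a cfm \<Rightarrow> 'a cfm \<Rightarrow> 'a cfm" is "\<lambda>A B i j. A i j - B i j"
  subgoal for A B j by (rule finite_subset[of _ "{i. A i j \<noteq> 0} \<union> {i. B i j \<noteq> 0}"]) auto done
lift_definition times_cfm :: "'a cfm \<Rightarrow> 'a cfm \<Rightarrow> 'a cfm"
  is "\<lambda>A B i j. \<Sum>k\<in>{k. B k j \<noteq> 0}. A i k * B k j"
proof -
  fix A B :: "nat \<Rightarrow> nat \<Rightarrow> 'a" and j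
  assume *: "\<And>j. finite {i. A i j \<noteq> 0}" "\<And>j. finite {i. B i j \<noteq> 0}"
  have "{i. (\<Sum>k\<in>{k. B k j \<noteq> 0}. A i k * B k j) \<noteq> 0} \<subseteq> (\<Union>k\<in>{k. B k j \<noteq> 0}. {i. A i k \<noteq> 0})"
  proof
    fix i assume "i \<in> {i. (\<Sum>k\<in>{k. B k j \<noteq> 0}. A i k * B k j) \<noteq> 0}"
    then have "\<exists>k\<in>{k. B k j \<noteq> 0}. A i k * B k j \<noteq> 0"
      by (metis (mono_tags, lifting) mem_Collect_eq sum.not_neutral_contains_not_neutral)
    then show "i \<in> (\<Union>k\<in>{k. B k j \<noteq> 0}. {i. A i k \<noteq> 0})" by auto
  qed
  then show "finite {i. (\<Sum>k\<in>{k. B k j \<noteq> 0}. A i k * B k j) \<noteq> 0}"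
    by (rule finite_subset) (use * in auto)
qed

lemma ent_times_raw:
  assumes "finite J" "\<And>k. k \<notin> J \<Longrightarrow> ent B k j = 0"
  shows "ent (A * B) i j = (\<Sum>k\<in>J. ent A i k * ent (B :: 'a cfm) k j)"
proof -
  have "ent (A * B) i j = (\<Sum>k\<in>{k. ent B k j \<noteq> 0}. ent A i k * ent B k j)"
    by transfer simp
  also have "\<dots> = (\<Sum>k\<in>J. ent A i k * ent B k j)"
    using assms by (intro sum.mono_neutral_left) auto
  finally show ?thesis .
qed

instance
proof
  fix A B C :: "'a cfm"
  show "A * B * C = A * (B * C)"
  proof (rule cfm_eqI)
    fix i j
    define J where "J = {k. ent C k j \<noteq> 0}"
    define L where "L = (\<Union>k\<in>J. {l. ent B l k \<noteq> 0})"
    have J: "finite J" "\<And>k. k \<notin> J \<Longrightarrow> ent C k j = 0" by (auto simp: J_def)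
    have L: "finite L" "\<And>l k. k \<in> J \<Longrightarrow> l \<notin> L \<Longrightarrow> ent B l k = 0"
      using J(1) by (auto simp: L_def)
    have BC: "ent (B * C) l j = (\<Sum>k\<in>J. ent B l k * ent C k j)" for l
      by (rule ent_times_raw[OF J])
    have "ent (A * B * C) i j = (\<Sum>k\<in>J. ent (A * B) i k * ent C k j)"
      by (rule ent_times_raw[OF J])
    also have "\<dots> = (\<Sum>k\<in>J. (\<Sum>l\<in>L. ent A i l * ent B l k) * ent C k j)"
      using L by (intro sum.cong refl arg_cong[of _ _ "\<lambda>x. x * _"] ent_times_raw) auto
    also have "\<dots> = (\<Sum>l\<in>L. ent A i l * ent (B * C) l j)"
      by (simp add: BC sum_distrib_left sum_distrib_right mult.assoc) (rule sum.swap)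
    also have "\<dots> = ent (A * (B * C)) i j"
      using L by (intro ent_times_raw[symmetric]) (auto simp: BC)
    finally show "ent (A * B * C) i j = ent (A * (B * C)) i j" .
  qed
  show "1 * A = A"
  proof (rule cfm_eqI)
    fix i j
    have "ent (1 * A) i j = (\<Sum>k\<in>insert i {k. ent A k j \<noteq> 0}. ent 1 i k * ent A k j)"
      by (rule ent_times_raw) auto
    also have "\<dots> = (\<Sum>k\<in>insert i {k. ent A k j \<noteq> 0}. if k = i then ent A i j else 0)"
      by (intro sum.cong refl) (auto simp: one_cfm.rep_eq)
    finally show "ent (1 * A) i j = ent A i j" by (simp add: sum.delta)
  qed
  show "A * 1 = A"
  proof (rule cfm_eqI)
    fix i j
    have "ent (A * 1) i j = (\<Sum>k\<in>{j}. ent A i k * ent 1 k j)"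
      by (rule ent_times_raw) (auto simp: one_cfm.rep_eq)
    then show "ent (A * 1) i j = ent A i j" by (simp add: one_cfm.rep_eq)
  qed
  show "(A + B) * C = A * C + B * C"
    by transfer (auto simp: fun_eq_iff sum.distrib distrib_right)
  show "A * (B + C) = A * B + A * C"
  proof (rule cfm_eqI)
    fix i j
    let ?J = "{k. ent B k j \<noteq> 0} \<union> {k. ent C k j \<noteq> 0}"
    have "ent (A * (B + C)) i j = (\<Sum>k\<in>?J. ent A i k * ent (B + C) k j)"
      "ent (A * B) i j = (\<Sum>k\<in>?J. ent A i k * ent B k j)"
      "ent (A * C) i j = (\<Sum>k\<in>?J. ent A i k * ent C k j)"
      by (rule ent_times_raw; auto simp: plus_cfm.rep_eq)+
    then show "ent (A * (B + C)) i j = ent (A * B + A * C) i j"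
      by (simp add: plus_cfm.rep_eq sum.distrib distrib_left)
  qed
  show "(0::'a cfm) \<noteq> 1" by transfer (auto simp: fun_eq_iff)
qed (transfer; auto simp: fun_eq_iff)+

end

lemmas ent_simps [simp] = zero_cfm.rep_eq plus_cfm.rep_eq uminus_cfm.rep_eq minus_cfm.rep_eq
lemmas ent_one = one_cfm.rep_eq

lemma ent_times:
  fixes A B :: "'a::ring_1 cfm"
  assumes "finite J" "\<And>k. k \<notin> J \<Longrightarrow> ent A i k = 0 \<or> ent B k j = 0"
  shows "ent (A * B) i j = (\<Sum>k\<in>J. ent A i k * ent B k j)"
proof -
  have "ent (A * B) i j = (\<Sum>k\<in>J \<union> {k. ent B k j \<noteq> 0}. ent A i k * ent B k j)"
    by (rule ent_times_raw) (use assms in auto)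
  also have "\<dots> = (\<Sum>k\<in>J. ent A i k * ent B k j)"
    using assms by (intro sum.mono_neutral_right) force+
  finally show ?thesis .
qed

lemma ent_times_single:
  fixes A B :: "'a::ring_1 cfm"
  assumes "\<And>k. k \<noteq> l \<Longrightarrow> ent A i k = 0 \<or> ent B k j = 0"
  shows "ent (A * B) i j = ent A i l * ent B l j"
  using ent_times[of "{l}" A i B j] assms by simp

lift_definition sc :: "'a::ring_1 \<Rightarrow> 'a cfm" is "\<lambda>a i j. if i = j then a else 0"
  by (simp add: finite_diag)
lift_definition ue :: "nat \<Rightarrow> nat \<Rightarrow> 'a::ring_1 \<Rightarrow> 'a cfm"
  is "\<lambda>i j a p q. if p = i \<and> q = j then a else 0"
  by (rule finite_subset[of _ "{i}" for i]) auto
lift_definition pr :: "nat set \<Rightarrow> 'a::ring_1 cfm" is "\<lambda>I i j. if i = j \<and> i \<in> I then 1 else 0"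
  by (rule finite_subset[of _ "{j}" for j]) auto
text \<open>\<open>sh\<close> and its left inverse \<open>sht\<close> translate the index set by n;
  they make room for an off-diagonal block in \<open>swap_eqE\<close>.\<close>

lift_definition sh :: "nat \<Rightarrow> 'a::ring_1 cfm" is "\<lambda>n i j. if i = j + n then 1 else 0"
  by (rule finite_subset[of _ "{j}" for j]) auto
lift_definition sht :: "nat \<Rightarrow> 'a::ring_1 cfm" is "\<lambda>n i j. if j = i + n then 1 else 0"
  subgoal for n j by (rule finite_subset[of _ "{..j}"]) auto done

lemma ent_sc_times [simp]: "ent (sc a * A) i j = a * ent A i j"
  by (subst ent_times_single[of i]) (auto simp: sc.rep_eq)
lemma ent_times_sc [simp]: "ent (A * sc a) i j = ent A i j * a"
  by (subst ent_times_single[of j]) (auto simp: sc.rep_eq)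
lemma ent_pr_times [simp]: "ent (pr I * A) i j = (if i \<in> I then ent A i j else 0)"
  by (subst ent_times_single[of i]) (auto simp: pr.rep_eq)
lemma ent_times_pr [simp]: "ent (A * pr I) i j = (if j \<in> I then ent A i j else 0)"
  by (subst ent_times_single[of j]) (auto simp: pr.rep_eq)
lemma ent_ue_times [simp]: "ent (ue i j a * A) p q = (if p = i then a * ent A j q else 0)"
  by (subst ent_times_single[of j]) (auto simp: ue.rep_eq)
lemma ent_times_ue [simp]: "ent (A * ue i j a) p q = (if q = j then ent A p i * a else 0)"
  by (subst ent_times_single[of i]) (auto simp: ue.rep_eq)
lemma ent_sh_times [simp]: "ent (sh n * A) i j = (if n \<le> i then ent A (i - n) j else 0)"
  by (subst ent_times_single[of "i - n"]) (auto simp: sh.rep_eq)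
lemma ent_times_sht [simp]: "ent (A * sht n) i j = (if n \<le> j then ent A i (j - n) else 0)"
  by (subst ent_times_single[of "j - n"]) (auto simp: sht.rep_eq)

lemma sht_sh [simp]: "sht n * sh n = 1"
  by (rule cfm_eqI, subst ent_times_single[of "i + n" for i]) (auto simp: sh.rep_eq sht.rep_eq ent_one)

lemma sc_simps [simp]: "sc 0 = 0" "sc 1 = 1" "sc (a * b) = sc a * sc b" "sc (a + b) = sc a + sc b"
  "sc (- a) = - sc a" "sc (a - b) = sc a - sc b"
  by (rule cfm_eqI; simp add: sc.rep_eq ent_one)+

lemma ue_ue: "ue i j a * ue k l b = (if j = k then ue i l (a * b) else 0)"
  by (rule cfm_eqI) (auto simp: ue.rep_eq)

lemma ue_simps [simp]: "ue i j 0 = 0" "ue i j (a + b) = ue i j a + ue i j b" "ue i j (- a) = - ue i j a"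
  by (rule cfm_eqI; simp add: ue.rep_eq)+

lemma pr_pr [simp]: "pr I * pr J = pr (I \<inter> J)"
  by (rule cfm_eqI) (auto simp: pr.rep_eq)

lemma pr_UNIV [simp]: "pr UNIV = 1"
  by (rule cfm_eqI) (auto simp: pr.rep_eq ent_one)


section \<open>Finite perturbations of the identity, subrings and elementary groups\<close>

definition fin :: "'a::ring_1 cfm \<Rightarrow> bool" where
  "fin A \<longleftrightarrow> (\<exists>n. \<forall>i j. n \<le> i \<or> n \<le> j \<longrightarrow> ent A i j = 0)"

definition mat_over :: "'a set \<Rightarrow> 'a::ring_1 cfm \<Rightarrow> bool" where
  "mat_over B A \<longleftrightarrow> (\<forall>i j. ent A i j \<in> B)"

text \<open>Subrings are sets in a fixed type because the induction ranges over many subrings of one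
  ring; inclusions then need no embedding maps.\<close>

definition sring :: "'a::ring_1 set \<Rightarrow> bool" where
  "sring B \<longleftrightarrow> 0 \<in> B \<and> 1 \<in> B \<and> (\<forall>a\<in>B. \<forall>b\<in>B. a + b \<in> B \<and> a * b \<in> B) \<and> (\<forall>a\<in>B. - a \<in> B)"

lemma sringD [simp]:
  assumes "sring B"
  shows "0 \<in> B" "1 \<in> B" "a \<in> B \<Longrightarrow> b \<in> B \<Longrightarrow> a + b \<in> B" "a \<in> B \<Longrightarrow> b \<in> B \<Longrightarrow> a * b \<in> B"
    "a \<in> B \<Longrightarrow> - a \<in> B" "a \<in> B \<Longrightarrow> b \<in> B \<Longrightarrow> a - b \<in> B"
  using assms unfolding sring_def by (auto, metis (full_types) diff_conv_add_uminus)

lemma sring_sum [simp]: "sring B \<Longrightarrow> (\<And>i. i \<in> I \<Longrightarrow> f i \<in> B) \<Longrightarrow> sum f I \<in> B"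
  by (induction I rule: infinite_finite_induct) auto

lemma sring_power [simp]: "sring B \<Longrightarrow> a \<in> B \<Longrightarrow> a ^ n \<in> B"
  by (induction n) auto

lemma mat_overD: "mat_over B A \<Longrightarrow> ent A i j \<in> B"
  by (simp add: mat_over_def)

lemma mat_over_simps [simp]:
  assumes "sring B"
  shows "mat_over B 0" "mat_over B 1" "mat_over B X \<Longrightarrow> mat_over B Y \<Longrightarrow> mat_over B (X + Y)"
    "mat_over B X \<Longrightarrow> mat_over B Y \<Longrightarrow> mat_over B (X * Y)" "mat_over B X \<Longrightarrow> mat_over B (- X)"
    "mat_over B X \<Longrightarrow> mat_over B Y \<Longrightarrow> mat_over B (X - Y)" "a \<in> B \<Longrightarrow> mat_over B (sc a)" "a \<in> B \<Longrightarrow> mat_over B (ue i j a)"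
    "mat_over B (pr I)" "mat_over B (sh n)" "mat_over B (sht n)"
proof -
  assume X: "mat_over B X" and Y: "mat_over B Y"
  show "mat_over B (X * Y)" unfolding mat_over_def
  proof (intro allI)
    fix i j
    have "ent (X * Y) i j = (\<Sum>k\<in>{k. ent Y k j \<noteq> 0}. ent X i k * ent Y k j)"
      by (rule ent_times) auto
    then show "ent (X * Y) i j \<in> B" using assms X Y by (auto intro!: sring_sum simp: mat_over_def)
  qed
qed (use assms in \<open>auto simp: mat_over_def ent_one sc.rep_eq ue.rep_eq pr.rep_eq sh.rep_eq sht.rep_eq\<close>)

lemma mat_over_mono: "B \<subseteq> C \<Longrightarrow> mat_over B A \<Longrightarrow> mat_over C A"
  by (auto simp: mat_over_def)

lemma finE:
  assumes "fin A" "fin B"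
  obtains n where "\<And>i j. n \<le> i \<or> n \<le> j \<Longrightarrow> ent A i j = 0" "\<And>i j. n \<le> i \<or> n \<le> j \<Longrightarrow> ent B i j = 0"
proof -
  obtain n m where n: "\<forall>i j. n \<le> i \<or> n \<le> j \<longrightarrow> ent A i j = 0" "\<forall>i j. m \<le> i \<or> m \<le> j \<longrightarrow> ent B i j = 0"
    using assms unfolding fin_def by auto
  show thesis by (rule that[of "max n m"]) (use n in auto)
qed

lemma fin_add [simp]: "fin A \<Longrightarrow> fin B \<Longrightarrow> fin (A + B)"
  by (erule (1) finE, unfold fin_def, rule_tac x=n in exI) auto
lemma fin_diff [simp]: "fin A \<Longrightarrow> fin B \<Longrightarrow> fin (A - B)"
  by (erule (1) finE, unfold fin_def, rule_tac x=n in exI) auto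
lemma fin_uminus [simp]: "fin (- A) \<longleftrightarrow> fin A"
  by (auto simp: fin_def)
lemma fin_zero [simp]: "fin 0"
  by (auto simp: fin_def)

lemma fin_times [simp]:
  assumes "fin A" "fin B" shows "fin (A * B)"
proof -
  obtain n where n: "\<And>i j. n \<le> i \<or> n \<le> j \<Longrightarrow> ent A i j = 0" "\<And>i j. n \<le> i \<or> n \<le> j \<Longrightarrow> ent B i j = 0"
    using finE[OF assms] by blast
  have "ent (A * B) i j = 0" if "n \<le> i \<or> n \<le> j" for i j
    by (subst ent_times[of "{..<n}"]) (use n that in auto)
  then show ?thesis unfolding fin_def by blast
qed

lemma fin_ue [simp]: "fin (ue i j a)"
  unfolding fin_def by (rule exI[of _ "Suc (max i j)"]) (auto simp: ue.rep_eq)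

lemma fin_pr [simp]: "finite I \<Longrightarrow> fin (pr I)"
  unfolding fin_def
  by (rule exI[of _ "Suc (Max I)"]) (auto simp: pr.rep_eq not_less_eq_eq dest: Max_ge)

lemma fin_sc_times [simp]: "fin A \<Longrightarrow> fin (sc a * A)" "fin A \<Longrightarrow> fin (A * sc a)"
  by (auto simp: fin_def) (metis mult_zero_right mult_zero_left)+

definition Fin1 :: "'a set \<Rightarrow> 'a::ring_1 cfm set" where
  "Fin1 B = {A. fin (A - 1) \<and> mat_over B A}"

definition GLm :: "'a set \<Rightarrow> 'a::ring_1 cfm set" where
  "GLm B = {A \<in> Fin1 B. \<exists>A'\<in>Fin1 B. A * A' = 1 \<and> A' * A = 1}"

text \<open>Over a subring the inverse of a generator is again a generator, so left multiplication
  by generators already produces the whole group.\<close>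

inductive_set Em :: "'a set \<Rightarrow> 'a::ring_1 cfm set" for B where
  Em_one: "1 \<in> Em B"
| Em_step: "i \<noteq> j \<Longrightarrow> b \<in> B \<Longrightarrow> X \<in> Em B \<Longrightarrow> (1 + ue i j b) * X \<in> Em B"

lemma fin_minus_one_times:
  assumes "fin (A - 1)" "fin (B - 1)" shows "fin (A * B - (1::'a::ring_1 cfm))"
proof -
  have "A * B - 1 = (A - 1) * (B - 1) + (A - 1) + (B - 1)" by (simp add: algebra_simps)
  then show ?thesis using assms by (metis fin_add fin_times)
qed

lemma Fin1_times [simp]: "sring B \<Longrightarrow> X \<in> Fin1 B \<Longrightarrow> Y \<in> Fin1 B \<Longrightarrow> X * Y \<in> Fin1 B"
  by (auto simp: Fin1_def fin_minus_one_times)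

lemma Fin1_one [simp]: "sring B \<Longrightarrow> 1 \<in> Fin1 B"
  by (auto simp: Fin1_def)

lemma Fin1_add [simp]: "sring B \<Longrightarrow> mat_over B X \<Longrightarrow> fin X \<Longrightarrow> 1 + X \<in> Fin1 B"
  by (auto simp: Fin1_def)

lemma GLmI: "A \<in> Fin1 B \<Longrightarrow> A' \<in> Fin1 B \<Longrightarrow> A * A' = 1 \<Longrightarrow> A' * A = 1 \<Longrightarrow> A \<in> GLm B"
  by (auto simp: GLm_def)

lemma GLmE:
  assumes "A \<in> GLm B"
  obtains A' where "A' \<in> GLm B" "A * A' = 1" "A' * A = 1"
  using assms unfolding GLm_def by auto

lemma GLm_Fin1: "A \<in> GLm B \<Longrightarrow> A \<in> Fin1 B"
  by (auto simp: GLm_def)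

lemma GLm_over: "A \<in> GLm B \<Longrightarrow> mat_over B A"
  by (auto simp: GLm_def Fin1_def)

lemma GLm_one [simp]: "sring B \<Longrightarrow> 1 \<in> GLm B"
  by (rule GLmI[of _ _ 1]) auto

lemma inverse_times:
  fixes X :: "'a::ring_1"
  assumes "X * X' = 1" "Y * Y' = 1" shows "X * Y * (Y' * X') = 1"
  by (metis assms mult.assoc mult_1_right)

lemma GLm_times [simp]:
  assumes "sring B" "X \<in> GLm B" "Y \<in> GLm B" shows "X * Y \<in> GLm B"
proof -
  obtain X' Y' where "X' \<in> Fin1 B" "Y' \<in> Fin1 B" "X * X' = 1" "X' * X = 1" "Y * Y' = 1" "Y' * Y = 1"
    using assms by (auto simp: GLm_def)
  then show ?thesis
    using assms by (intro GLmI[of _ _ "Y' * X'"]) (auto simp: GLm_Fin1 inverse_times)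
qed

lemma Em_times [simp]: "X \<in> Em B \<Longrightarrow> Y \<in> Em B \<Longrightarrow> X * Y \<in> Em B"
  by (induction rule: Em.induct) (auto simp: mult.assoc intro: Em.intros)

lemma Em_gen: "i \<noteq> j \<Longrightarrow> b \<in> B \<Longrightarrow> 1 + ue i j b \<in> Em B"
  using Em_step[OF _ _ Em_one, of i j b B] by simp

lemma elementary_inverse: "i \<noteq> j \<Longrightarrow> (1 + ue i j b) * (1 + ue i j (- b)) = 1"
  by (simp add: algebra_simps ue_ue)

lemma Em_inverse:
  assumes "sring B" "X \<in> Em B"
  shows "\<exists>X'\<in>Em B. X * X' = 1 \<and> X' * X = 1"
  using assms(2)
proof induction
  case Em_one
  then show ?case by (intro bexI[of _ 1]) (auto intro: Em.intros)
next
  case (Em_step i j b X)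
  then obtain X' where X': "X' \<in> Em B" "X * X' = 1" "X' * X = 1" by blast
  have "X' * (1 + ue i j (- b)) \<in> Em B"
    using Em_step assms X' Em_gen[of i j "-b" B] by (metis Em_times sringD(5))
  then show ?case
    using X' elementary_inverse[OF Em_step(1), of b] elementary_inverse[OF Em_step(1), of "-b"]
    by (intro bexI[of _ "X' * (1 + ue i j (- b))"] conjI inverse_times) simp_all
qed

lemma Em_subset_Fin1: "sring B \<Longrightarrow> X \<in> Em B \<Longrightarrow> X \<in> Fin1 B"
  by (erule Em.induct) auto

lemma Em_GLm: "sring B \<Longrightarrow> X \<in> Em B \<Longrightarrow> X \<in> GLm B"
  by (meson Em_inverse Em_subset_Fin1 GLmI)

lemma Em_mono: "B \<subseteq> C \<Longrightarrow> X \<in> Em B \<Longrightarrow> X \<in> Em C"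
  by (rotate_tac, induction rule: Em.induct) (auto intro: Em.intros)

lemma GLm_mono: "B \<subseteq> C \<Longrightarrow> X \<in> GLm B \<Longrightarrow> X \<in> GLm C"
  by (auto simp: GLm_def Fin1_def intro: mat_over_mono)

text \<open>Matrices supported on rows in I and columns outside I have zero product with one
  another, so \<open>1 + a\<close> is the product of the elementary matrices of its entries; the
  induction peels off one entry at a time.\<close>

lemma Em_block:
  assumes "sring B" "mat_over B a" "fin a" "\<And>i j. ent a i j \<noteq> 0 \<Longrightarrow> i \<in> I \<and> j \<notin> I"
  shows "1 + a \<in> Em B"
proof -
  obtain n where n: "\<forall>i j. n \<le> i \<or> n \<le> j \<longrightarrow> ent a i j = 0" using assms(3) fin_def by blast
  have "finite {(i, j). ent a i j \<noteq> 0}"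
    by (rule finite_subset[of _ "{..<n} \<times> {..<n}"]) (use n in \<open>auto simp: not_le[symmetric]\<close>)
  then show ?thesis using assms(2,4)
  proof (induction "card {(i, j). ent a i j \<noteq> 0}" arbitrary: a)
    case 0
    then have "a = 0" by (intro cfm_eqI) auto
    then show ?case by (simp add: Em_one)
  next
    case (Suc k)
    then obtain i j where ij: "ent a i j \<noteq> 0" by force
    let ?a = "a - ue i j (ent a i j)"
    have *: "{(p, q). ent a p q \<noteq> 0} = insert (i, j) {(p, q). ent ?a p q \<noteq> 0}"
      using ij by (auto simp: ue.rep_eq split: if_splits)
    have "card {(p, q). ent ?a p q \<noteq> 0} = k" "finite {(p, q). ent ?a p q \<noteq> 0}"
      using Suc(2,3) by (auto simp: * card_insert_if ue.rep_eq)
    moreover have "mat_over B ?a" using Suc.prems assms(1) by (simp add: mat_over_def)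
       (metis (no_types, lifting) Suc.prems(2) mat_over_def assms(1) mat_over_simps(8) sringD(6))
    moreover have "p \<in> I \<and> q \<notin> I" if "ent ?a p q \<noteq> 0" for p q
      using that Suc.prems(3)[of p q] by (auto simp: ue.rep_eq split: if_splits)
    ultimately have "1 + ?a \<in> Em B" using Suc(1) by blast
    moreover have "i \<noteq> j" using Suc.prems(3)[OF ij] by auto
    ultimately have "(1 + ue i j (ent a i j)) * (1 + ?a) \<in> Em B"
      using Suc.prems by (auto intro: Em_step simp: mat_over_def)
    \<comment> \<open>As j is the column of an entry, it lies outside I; row j of \<open>a\<close>
      is therefore zero and the product below has no cross term.\<close>
    moreover have "ent a j q = 0" for q
      using Suc.prems(3)[OF ij] Suc.prems(3)[of j q] by blast
    then have "ue i j (ent a i j) * ?a = 0"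
      using Suc.prems(3)[OF ij] by (intro cfm_eqI) (auto simp: ue.rep_eq)
    ultimately show ?case by (simp add: algebra_simps)
  qed
qed

section \<open>Normality of the elementary group and linearization\<close>

lemma fin_Fin1_times:
  assumes "fin (A - 1)" "fin C" shows "fin (A * C)" "fin (C * A)"
proof -
  have "A * C = (A - 1) * C + C" "C * A = C * (A - 1) + C" by (simp_all add: algebra_simps)
  then show "fin (A * C)" "fin (C * A)" using assms by (metis fin_add fin_times)+
qed

lemma Fin1D: "A \<in> Fin1 B \<Longrightarrow> fin (A - 1)" "A \<in> Fin1 B \<Longrightarrow> mat_over B A"
  by (auto simp: Fin1_def)

lemma commutator_square_zero:
  fixes c r :: "'a::ring_1"
  assumes "c * c = 0" "r * r = 0" "r * c = 0"
  shows "(1 + c) * (1 + r) * (1 - c) * (1 - r) = 1 + c * r"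
proof -
  have "r * (c * z) = 0" "c * (c * z) = 0" "r * (r * z) = 0" for z
    using assms by (simp_all flip: mult.assoc)
  then show ?thesis using assms by (simp add: algebra_simps)
qed

text \<open>The conjugate of an elementary matrix is 1 plus a column times a row. Routing both
  through a fresh index k writes this as a commutator of two block-elementary matrices;
  \<open>r * c = 0\<close> is an off-diagonal entry of \<open>A' * A = 1\<close>.\<close>

lemma Em_conj_gen:
  assumes B: "sring B" and A: "A \<in> Fin1 B" "A' \<in> Fin1 B" "A' * A = 1" and ij: "i \<noteq> j" and b: "b \<in> B"
  shows "1 + A * ue i j b * A' \<in> Em B"
proof -
  obtain n where n: "\<And>p q. n \<le> p \<or> n \<le> q \<Longrightarrow> ent (A - 1) p q = 0"
     "\<And>p q. n \<le> p \<or> n \<le> q \<Longrightarrow> ent (A' - 1) p q = 0"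
    using finE[of "A - 1" "A' - 1"] A by (auto simp: Fin1_def)
  \<comment> \<open>Beyond the blocks of \<open>A\<close> and \<open>A'\<close>, so column i of
    \<open>A\<close> and row j of \<open>A'\<close> vanish at k and \<open>c\<close>,
    \<open>r\<close> have no diagonal entry.\<close>
  define k where "k = Suc (max n (max i j))"
  have k: "k \<noteq> i" "k \<noteq> j" "n \<le> k" by (auto simp: k_def)
  define c where "c = A * ue i k b"
  define r where "r = ue k j 1 * A'"
  have z: "ent A k i = 0" "ent A' j k = 0"
    using n(1)[of k i] n(2)[of j k] k by (auto simp: ent_one)
  have cr: "c * r = A * ue i j b * A'"
    by (simp add: c_def r_def mult.assoc) (simp add: ue_ue flip: mult.assoc)
  have "r * c = ue k j 1 * (A' * A) * ue i k b" by (simp add: c_def r_def mult.assoc)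
  then have rc: "r * c = 0" using A ij by (simp add: ue_ue)
  have ent_c: "ent c p q = (if q = k then ent A p i * b else 0)" for p q by (simp add: c_def)
  have ent_r: "ent r p q = (if p = k then ent A' j q else 0)" for p q by (simp add: r_def)
  have cc: "c * c = 0"
    by (rule cfm_eqI) (subst ent_times[of "{k}"], auto simp: ent_c z)
  have rr: "r * r = 0"
    by (rule cfm_eqI) (subst ent_times[of "{k}"], auto simp: ent_r z)
  have fo: "mat_over B c" "mat_over B r" "fin c" "fin r"
    using A b B by (auto simp: c_def r_def Fin1D intro: fin_Fin1_times)
  have "1 + c \<in> Em B" "1 + (- c) \<in> Em B"
    by (rule Em_block[of _ _ "- {k}"]; use fo B z in \<open>auto simp: ent_c split: if_splits\<close>)+
  moreover have "1 + r \<in> Em B" "1 + (- r) \<in> Em B"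
    by (rule Em_block[of _ _ "{k}"]; use fo B z in \<open>auto simp: ent_r split: if_splits\<close>)+
  ultimately have "(1 + c) * (1 + r) * (1 - c) * (1 - r) \<in> Em B" by simp
  then show ?thesis by (simp add: commutator_square_zero cc rr rc cr)
qed

lemma Em_conj:
  assumes B: "sring B" and A: "A \<in> Fin1 B" "A' \<in> Fin1 B" "A' * A = 1" "A * A' = 1" and e: "e \<in> Em B"
  shows "A * e * A' \<in> Em B"
  using e
proof induction
  case Em_one
  then show ?case using A by (simp add: Em.Em_one)
next
  case (Em_step i j b e)
  have "A * ((1 + ue i j b) * e) * A' = A * (1 + ue i j b) * (A' * A) * e * A'"
    using A by (simp add: mult.assoc)
  also have "\<dots> = (A * (1 + ue i j b) * A') * (A * e * A')" by (simp add: mult.assoc)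
  also have "A * (1 + ue i j b) * A' = 1 + A * ue i j b * A'"
    using A by (simp add: distrib_left distrib_right)
  finally show ?case using Em_conj_gen[OF B A(1-3) Em_step(1,2)] Em_step by simp
qed

text \<open>One-sided multiplication suffices: for invertible G, a right factor e becomes the left
  factor G e G^-1, elementary by \<open>Em_conj\<close>. This is \<open>eqE_Em\<close>.\<close>

definition eqE :: "'a set \<Rightarrow> 'a::ring_1 cfm \<Rightarrow> 'a cfm \<Rightarrow> bool" where
  "eqE B G H \<longleftrightarrow> (\<exists>e\<in>Em B. G = e * H)"

lemma eqE_refl [simp]: "eqE B G G"
  unfolding eqE_def by (rule bexI[of _ 1]) (auto intro: Em_one)

lemma eqE_sym:
  assumes "sring B" "eqE B G H" shows "eqE B H G"
proof -
  obtain e where e: "e \<in> Em B" "G = e * H" using assms by (auto simp: eqE_def)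
  then obtain e' where "e' \<in> Em B" "e' * e = 1" using assms Em_inverse by blast
  then show ?thesis using e unfolding eqE_def by (intro bexI[of _ e']) (simp_all flip: mult.assoc)
qed

lemma eqE_trans [trans]: "eqE B G H \<Longrightarrow> eqE B H K \<Longrightarrow> eqE B G K"
  unfolding eqE_def by (metis Em_times mult.assoc)

text \<open>The elementary factor of \<open>H\<close> is conjugated through \<open>G1\<close>;
  normality of the elementary group enters here.\<close>

lemma eqE_mult:
  assumes B: "sring B" and "eqE B G G1" "eqE B H H1" "G1 \<in> GLm B"
  shows "eqE B (G * H) (G1 * H1)"
proof -
  obtain e f where ef: "e \<in> Em B" "f \<in> Em B" "G = e * G1" "H = f * H1"
    using assms by (auto simp: eqE_def)
  obtain G' where G': "G' \<in> GLm B" "G1 * G' = 1" "G' * G1 = 1" using assms by (auto elim: GLmE)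
  have "G * H = e * (G1 * f * G') * (G1 * H1)"
    using G'(3) by (simp add: ef mult.assoc) (simp flip: mult.assoc)
  moreover have "G1 * f * G' \<in> Em B"
    using G' assms ef by (intro Em_conj) (auto simp: GLm_Fin1)
  ultimately show ?thesis unfolding eqE_def using ef(1) by (metis Em_times mult.assoc)
qed

lemma eqE_Em: "sring B \<Longrightarrow> G \<in> GLm B \<Longrightarrow> e \<in> Em B \<Longrightarrow> eqE B (G * e) G"
  using eqE_mult[of B G G e 1] by (metis eqE_def eqE_refl mult_1_right)

text \<open>The formal geometric series gives the inverse of 1 + ba as 1 - b (1 + ab)^-1 a.\<close>

lemma one_plus_swap_inverse:
  fixes a b u :: "'a::ring_1"
  assumes "(1 + a * b) * u = 1" "u * (1 + a * b) = 1"
  shows "(1 + b * a) * (1 - b * u * a) = 1" "(1 - b * u * a) * (1 + b * a) = 1"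
proof -
  have "(1 + b * a) * (1 - b * u * a) = 1 + b * a - b * ((1 + a * b) * u) * a" by (simp add: algebra_simps)
  then show "(1 + b * a) * (1 - b * u * a) = 1" using assms by simp
  have "(1 - b * u * a) * (1 + b * a) = 1 + b * a - b * (u * (1 + a * b)) * a" by (simp add: algebra_simps)
  then show "(1 - b * u * a) * (1 + b * a) = 1" using assms by simp
qed

lemma GLm_swap:
  assumes "sring B" "mat_over B a" "mat_over B b" "fin a" "fin b" "1 + a * b \<in> GLm B"
  shows "1 + b * a \<in> GLm B"
proof -
  obtain u where u: "u \<in> GLm B" "(1 + a * b) * u = 1" "u * (1 + a * b) = 1"
    using assms by (auto elim: GLmE)
  have "fin (b * u * a)"
    using assms u by (intro fin_times[OF fin_Fin1_times(2)]) (auto intro: GLm_Fin1 Fin1D)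
  then have "1 + (- (b * u * a)) \<in> Fin1 B"
    using assms u by (intro Fin1_add) (auto simp: GLm_over)
  then show ?thesis
    using assms by (intro GLmI[OF _ _ one_plus_swap_inverse[OF u(2,3)]]) auto
qed

text \<open>Block elimination in a 2 x 2 block matrix: both \<open>1 + a * b\<close> and
  \<open>1 + b * a\<close> are carried to the common matrix 1 + b - a, the first by left factors
  only, the second by one factor on each side.\<close>

lemma swap_eqE_disjoint:
  assumes B: "sring B" and ab: "mat_over B a" "mat_over B b" "fin a" "fin b"
    and a: "\<And>i j. ent a i j \<noteq> 0 \<Longrightarrow> i \<in> I \<and> j \<notin> I"
    and b: "\<And>i j. ent b i j \<noteq> 0 \<Longrightarrow> i \<notin> I \<and> j \<in> I"
    and G: "1 + a * b \<in> GLm B"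
  shows "eqE B (1 + a * b) (1 + b * a)"
proof -
  obtain u where u: "u \<in> GLm B" "(1 + a * b) * u = 1" "u * (1 + a * b) = 1"
    using G by (auto elim: GLmE)
  have finu: "fin (u - 1)" and ou: "mat_over B u" using u GLm_Fin1 Fin1D by blast+
  have aa: "a * a = 0" and bb: "b * b = 0"
    by (rule cfm_eqI, subst ent_times[of "{}"], use a b in \<open>(auto, blast+)\<close>)+
  have aaz: "a * (a * z) = 0" and bbz: "b * (b * z) = 0" for z
    using aa bb by (simp_all flip: mult.assoc)
  \<comment> \<open>Rewrites \<open>b * u\<close> so that it visibly ends in \<open>b\<close>; hence
    it is supported on the same off-diagonal block as \<open>b\<close>.\<close>
  have "u = 1 - u * (a * b)" using u by (simp add: algebra_simps)
  then have bu: "b * u = b - b * u * a * b" by (metis mult.assoc mult_1_right right_diff_distrib)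
  have b_pr: "b * pr I = b" "pr (- I) * b = b"
    using b by (intro cfm_eqI; force)+
  have "(b - b * u * a * b) * pr I = b - b * u * a * b"
    by (simp add: left_diff_distrib mult.assoc b_pr)
  then have bu_pr: "b * u * pr I = b * u" "pr (- I) * (b * u) = b * u"
    using bu b_pr(2) by (simp_all flip: mult.assoc)
  have bus: "i \<in> - I \<and> j \<notin> - I" if "ent (b * u) i j \<noteq> 0" for i j
    using arg_cong[OF bu_pr(1), of "\<lambda>A. ent A i j"] arg_cong[OF bu_pr(2), of "\<lambda>A. ent A i j"] that
    by (auto split: if_splits)
  have E: "1 + b * u \<in> Em B" "1 + b \<in> Em B" "1 - a \<in> Em B"
    subgoal by (rule Em_block[OF B _ _ bus]) (use B ab ou finu in \<open>auto intro: fin_Fin1_times\<close>)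
    subgoal by (rule Em_block[OF B, of _ "-I"]) (use B ab b in auto)
    subgoal using Em_block[OF B, of "-a" I] B ab a by simp
    done
  have "(1 - a) * (1 + b * u) * (1 + a * b) = (1 - a) * (1 + a * b + b * (u * (1 + a * b)))"
    by (simp add: algebra_simps)
  also have "\<dots> = (1 + b) * (1 + b * a) * (1 - a)"
    using u(3) by (simp add: algebra_simps aa bb aaz bbz)
  finally have eq: "(1 - a) * (1 + b * u) * (1 + a * b) = (1 + b) * (1 + b * a) * (1 - a)" .
  have GL: "1 + b * a \<in> GLm B" using GLm_swap assms by blast
  have "eqE B ((1 - a) * (1 + b * u) * (1 + a * b)) (1 + a * b)"
    unfolding eqE_def by (rule bexI[of _ "(1 - a) * (1 + b * u)"]) (use E in auto)
  moreover have "eqE B ((1 + b) * (1 + b * a) * (1 - a)) ((1 + b) * (1 + b * a))"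
    by (rule eqE_Em[OF B GLm_times[OF B Em_GLm[OF B E(2)] GL] E(3)])
  moreover have "eqE B ((1 + b) * (1 + b * a)) (1 + b * a)"
    unfolding eqE_def using E by auto
  ultimately show ?thesis using eq B by (metis eqE_sym eqE_trans)
qed

text \<open>The relation \<open>1 + ab \<sim> 1 + ba\<close>; moving one factor to a disjoint set of indices makes
  \<open>a\<close> and \<open>b\<close> off-diagonal blocks.\<close>
lemma swap_eqE:
  assumes B: "sring B" and ab: "mat_over B a" "mat_over B b" "fin a" "fin b"
    and G: "1 + a * b \<in> GLm B"
  shows "eqE B (1 + a * b) (1 + b * a)"
proof -
  obtain n where n: "\<And>i j. n \<le> i \<or> n \<le> j \<Longrightarrow> ent a i j = 0" "\<And>i j. n \<le> i \<or> n \<le> j \<Longrightarrow> ent b i j = 0"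
    using finE[OF ab(3,4)] by blast
  have fin_sht: "fin (c * sht n)" "fin (sh n * c)" if fc: "fin c" for c :: "'a cfm"
  proof -
    obtain k where k: "\<And>i j. k \<le> i \<or> k \<le> j \<Longrightarrow> ent c i j = 0" using fc unfolding fin_def by blast
    show "fin (c * sht n)" "fin (sh n * c)"
      unfolding fin_def by (intro exI[of _ "k + n"] allI impI, simp, intro impI k, linarith)+
  qed
  have cancel: "sht n * (sh n * z) = z" for z :: "'a cfm" by (simp flip: mult.assoc)
  \<comment> \<open>Inserting the shifts leaves the product \<open>c * d\<close> unchanged but makes
    \<open>c * sht n\<close> and \<open>sh n * d\<close> off-diagonal blocks; swapping them moves
    \<open>d * c\<close> to indices from n on.\<close>
  have disj: "eqE B (1 + c * d) (1 + sh n * (d * c) * sht n)"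
    if cd: "mat_over B c" "mat_over B d" "fin c" "fin d" "1 + c * d \<in> GLm B"
     and c: "\<And>i j. n \<le> i \<or> n \<le> j \<Longrightarrow> ent c i j = 0" and d: "\<And>i j. n \<le> i \<or> n \<le> j \<Longrightarrow> ent d i j = 0" for c d
  proof -
    have eq: "c * sht n * (sh n * d) = c * d" by (simp add: mult.assoc cancel)
    have "eqE B (1 + (c * sht n) * (sh n * d)) (1 + (sh n * d) * (c * sht n))"
    proof (rule swap_eqE_disjoint[of _ _ _ "{..<n}"])
      show "i \<in> {..<n} \<and> j \<notin> {..<n}" if "ent (c * sht n) i j \<noteq> 0" for i j
        using that c[of i "j - n"] by (force split: if_splits)
      show "i \<notin> {..<n} \<and> j \<in> {..<n}" if "ent (sh n * d) i j \<noteq> 0" for i j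
        using that d[of "i - n" j] by (force split: if_splits)
    qed (use cd B fin_sht eq in simp_all)
    then show ?thesis by (simp add: mult.assoc cancel)
  qed
  have G': "1 + b * a \<in> GLm B" using GLm_swap assms by blast
  have *: "eqE B (1 + a * b) (1 + sh n * (b * a) * sht n)"
    by (rule disj[OF ab G n])
  have ban: "b * a * pr {..<n} = b * a" "pr {..<n} * (b * a) = b * a"
  proof -
    have "a * pr {..<n} = a" "pr {..<n} * b = b"
      using n by (intro cfm_eqI; simp add: not_less)+
    then show "b * a * pr {..<n} = b * a" "pr {..<n} * (b * a) = b * a"
      by (simp_all add: mult.assoc) (simp flip: mult.assoc)
  qed
  have "ent (b * a) i j = 0" if "n \<le> i \<or> n \<le> j" for i j
    using arg_cong[OF ban(1), of "\<lambda>A. ent A i j"] arg_cong[OF ban(2), of "\<lambda>A. ent A i j"] that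
    by (auto split: if_splits)
  \<comment> \<open>The same move for the factors \<open>b * a\<close> and \<open>pr {..<n}\<close>:
    it shifts \<open>1 + b * a\<close> onto the matrix already reached from
    \<open>1 + a * b\<close>.\<close>
  then have "eqE B (1 + b * a * pr {..<n}) (1 + sh n * (pr {..<n} * (b * a)) * sht n)"
    using B ab G' by (intro disj) (auto simp: ban pr.rep_eq)
  then have "eqE B (1 + b * a) (1 + sh n * (b * a) * sht n)" by (simp only: ban)
  from eqE_trans[OF * eqE_sym[OF B this]] show ?thesis .
qed

section \<open>Higman linearization\<close>

text \<open>Higman's trick: a product entry at (i, j) is split by passing through an index k where
  \<open>A\<close> is trivial, leaving the two factors in separate entries.\<close>

lemma higman_step:
  assumes B: "sring B" and A: "\<And>p. ent (A - 1) k p = 0" "\<And>p. ent (A - 1) p k = 0"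
    and ij: "i \<noteq> k" "j \<noteq> k" and vw: "v \<in> B" "w \<in> B"
  shows "\<exists>g\<in>Em B. \<exists>h\<in>Em B. A + ue i j (v * w) = g * (A - ue i k v + ue k j w) * h"
proof -
  have "ue i k v * (A - 1) = 0" "(A - 1) * ue k j w = 0"
    using A by (intro cfm_eqI; auto)+
  then have *: "ue i k v * A = ue i k v" "A * ue k j w = ue k j w" by (simp_all add: algebra_simps)
  have "(1 + ue i k v) * (A - ue i k v + ue k j w) * (1 + ue k j (- w)) = A + ue i j (v * w)"
    using ij by (simp add: algebra_simps * ue_ue)
  then show ?thesis using B vw ij
    by (intro bexI[of _ "1 + ue i k v"] bexI[of _ "1 + ue k j (- w)"] Em_gen) auto
qed

lemma fin_sum_list: "(\<And>A. A \<in> set As \<Longrightarrow> fin A) \<Longrightarrow> fin (sum_list As)"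
  by (induction As) auto

text \<open>A term \<open>(i, j, ws)\<close> stands for the product of the word \<open>ws\<close> at
  (i, j). Splitting the first letter off a word shortens it by one, and words of length at most one
  are absorbed into \<open>A\<close> because V is closed under addition; the measure counts each
  word with one extra unit so that absorption decreases it too.\<close>

lemma linearize_terms:
  assumes B: "sring B" and V: "V \<subseteq> B" "0 \<in> V" "1 \<in> V" "\<And>a b. a \<in> V \<Longrightarrow> b \<in> V \<Longrightarrow> a + b \<in> V" "\<And>a. a \<in> V \<Longrightarrow> - a \<in> V"
    and A: "fin (A - 1)" "mat_over V A"
    and ts: "\<And>i j ws. (i, j, ws) \<in> set ts \<Longrightarrow> set ws \<subseteq> V"
  shows "\<exists>g\<in>Em B. \<exists>h\<in>Em B. \<exists>A1. fin (A1 - 1) \<and> mat_over V A1 \<and>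
           A + sum_list (map (\<lambda>(i, j, ws). ue i j (prod_list ws)) ts) = g * A1 * h"
  using A ts
proof (induction "sum_list (map (\<lambda>(i, j, ws). Suc (length ws)) ts)" arbitrary: A ts rule: less_induct)
  case less
  let ?S = "\<lambda>ts. sum_list (map (\<lambda>(i, j, ws). ue i j (prod_list ws)) ts)"
  show ?case
  proof (cases ts)
    case Nil
    then show ?thesis using less.prems
      by (intro bexI[of _ 1] exI[of _ A]) (auto intro: Em_one)
  next
    case (Cons t ts')
    obtain i j ws where t: "t = (i, j, ws)" by (cases t)
    have V_ue: "mat_over V (A' + ue p q v)" if "mat_over V A'" "v \<in> V" for A' p q v
      using that V by (auto simp: mat_over_def ue.rep_eq)
    have fin_ue': "fin (A' + ue p q v - 1)" if "fin (A' - 1)" for A' :: "'a cfm" and p q v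
    proof -
      have "A' + ue p q v - 1 = (A' - 1) + ue p q v" by simp
      then show ?thesis using that fin_add fin_ue by metis
    qed
    show ?thesis
    proof (cases "length ws \<le> 1")
      case True
      have "prod_list ws \<in> V"
        using True V less.prems(3)[of i j ws] by (cases ws) (auto simp: Cons t)
      then have "\<exists>g\<in>Em B. \<exists>h\<in>Em B. \<exists>A1. fin (A1 - 1) \<and> mat_over V A1 \<and>
           (A + ue i j (prod_list ws)) + ?S ts' = g * A1 * h"
        using less.prems by (intro less.hyps) (auto simp: Cons t intro!: V_ue fin_ue')
      then show ?thesis by (simp add: Cons t add.assoc)
    next
      case False
      then obtain v w where ws: "ws = v # w" by (cases ws) auto
      let ?A = "A + ?S ts'"
      have "?A - 1 = (A - 1) + ?S ts'" by simp
      then have "fin (?A - 1)" using less.prems(1)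
        by (simp only:) (auto intro!: fin_add fin_sum_list)
      then obtain n where n: "\<And>p q. n \<le> p \<or> n \<le> q \<Longrightarrow> ent (?A - 1) p q = 0"
        unfolding fin_def by blast
      define k where "k = Suc (max n (max i j))"
      have vw: "v \<in> V" "set w \<subseteq> V" using less.prems(3)[of i j ws] by (auto simp: Cons t ws)
      have wB: "prod_list w \<in> B" using vw(2) B V(1) by (induction w) auto
      have nk: "ent (?A - 1) k p = 0" "ent (?A - 1) p k = 0" for p
        by (rule n, simp add: k_def max_def)+
      have ik: "i \<noteq> k" "j \<noteq> k" by (auto simp: k_def)
      obtain g h where gh: "g \<in> Em B" "h \<in> Em B"
        "?A + ue i j (v * prod_list w) = g * (?A - ue i k v + ue k j (prod_list w)) * h"
        using higman_step[OF B nk ik _ wB, of v] vw V(1) by blast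
      have "\<exists>g\<in>Em B. \<exists>h\<in>Em B. \<exists>A1. fin (A1 - 1) \<and> mat_over V A1 \<and>
           (A + ue i k (- v)) + ?S ((k, j, w) # ts') = g * A1 * h"
      proof (rule less.hyps)
        show "sum_list (map (\<lambda>(i, j, ws). Suc (length ws)) ((k, j, w) # ts'))
          < sum_list (map (\<lambda>(i, j, ws). Suc (length ws)) ts)" by (simp add: Cons t ws)
        show "fin (A + ue i k (- v) - 1)" by (rule fin_ue') (rule less.prems)
        show "mat_over V (A + ue i k (- v))" using vw V less.prems by (intro V_ue) auto
        show "\<And>p q w'. (p, q, w') \<in> set ((k, j, w) # ts') \<Longrightarrow> set w' \<subseteq> V"
          using vw less.prems(3) by (auto simp: Cons) blast
      qed
      then obtain g' h' A1 where *: "g' \<in> Em B" "h' \<in> Em B" "fin (A1 - 1)" "mat_over V A1"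
         "(A + ue i k (- v)) + ?S ((k, j, w) # ts') = g' * A1 * h'" by blast
      have "A + ?S ts = ?A + ue i j (v * prod_list w)" by (simp add: Cons t ws algebra_simps)
      also have "\<dots> = g * ((A + ue i k (- v)) + ?S ((k, j, w) # ts')) * h"
        unfolding gh(3) by (simp add: algebra_simps)
      also have "\<dots> = (g * g') * A1 * (h' * h)" unfolding *(5) by (simp add: mult.assoc)
      finally show ?thesis using * gh by (metis Em_times)
    qed
  qed
qed

lemma ent_sum: "ent (sum f I) i j = (\<Sum>k\<in>I. ent (f k) i j)"
  by (induction I rule: infinite_finite_induct) auto

lemma fin_decompose:
  assumes "\<And>i j. n \<le> i \<or> n \<le> j \<Longrightarrow> ent A i j = 0"
  shows "A = (\<Sum>i<n. \<Sum>j<n. ue i j (ent A i j))"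
proof (rule cfm_eqI)
  fix p q
  have "ent (\<Sum>i<n. \<Sum>j<n. ue i j (ent A i j)) p q = (\<Sum>i<n. \<Sum>j<n. if i = p \<and> j = q then ent A i j else 0)"
    by (simp add: ent_sum ue.rep_eq eq_commute cong: conj_cong if_cong)
  also have "\<dots> = (\<Sum>i<n. if i = p then (\<Sum>j<n. if j = q then ent A i j else 0) else 0)"
    by (intro sum.cong refl) auto
  also have "\<dots> = ent A p q" using assms[of p q] by (auto simp: not_less)
  finally show "ent A p q = ent (\<Sum>i<n. \<Sum>j<n. ue i j (ent A i j)) p q" by simp
qed

text \<open>The entries of \<open>A - 1\<close> are expanded into sums of words in V and handed to
  \<open>linearize_terms\<close> with start matrix 1.\<close>

lemma linearize:
  assumes B: "sring B" and V: "V \<subseteq> B" "0 \<in> V" "1 \<in> V" "\<And>a b. a \<in> V \<Longrightarrow> b \<in> V \<Longrightarrow> a + b \<in> V" "\<And>a. a \<in> V \<Longrightarrow> - a \<in> V"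
    and gen: "\<And>z. z \<in> B \<Longrightarrow> \<exists>wss. (\<forall>ws\<in>set wss. set ws \<subseteq> V) \<and> z = sum_list (map prod_list wss)"
    and A: "A \<in> Fin1 B"
  obtains g h A1 where "g \<in> Em B" "h \<in> Em B" "fin (A1 - 1)" "mat_over V A1" "A = g * A1 * h"
proof -
  let ?S = "\<lambda>ts. sum_list (map (\<lambda>(i, j, ws). ue i j (prod_list ws)) ts)"
  define P where "P M \<longleftrightarrow> (\<exists>ts. (\<forall>t\<in>set ts. set (snd (snd t)) \<subseteq> V) \<and> M = ?S ts)" for M
  have P0: "P 0" unfolding P_def by (rule exI[of _ "[]"]) auto
  have Padd: "P (M + N)" if MN: "P M" "P N" for M N
  proof -
    obtain s t where "\<forall>t\<in>set s. set (snd (snd t)) \<subseteq> V" "M = ?S s" "\<forall>t\<in>set t. set (snd (snd t)) \<subseteq> V" "N = ?S t"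
      using MN unfolding P_def by blast
    then show ?thesis unfolding P_def by (intro exI[of _ "s @ t"]) auto
  qed
  have Psum: "P (sum f I)" if "\<And>i. i \<in> I \<Longrightarrow> P (f i)" for f and I :: "nat set"
    using that by (induction I rule: infinite_finite_induct) (auto simp: P0 Padd)
  have Pue: "P (ue i j b)" if b: "b \<in> B" for i j b
  proof -
    obtain wss where wss: "\<forall>ws\<in>set wss. set ws \<subseteq> V" "b = sum_list (map prod_list wss)"
      using gen[OF b] by blast
    have "ue i j (sum_list (map prod_list wss)) = ?S (map (\<lambda>ws. (i, j, ws)) wss)"
      by (induction wss) auto
    then show ?thesis unfolding P_def using wss
      by (intro exI[of _ "map (\<lambda>ws. (i, j, ws)) wss"]) auto
  qed
  obtain n where n: "\<And>i j. n \<le> i \<or> n \<le> j \<Longrightarrow> ent (A - 1) i j = 0"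
    using A unfolding Fin1_def fin_def by blast
  have "mat_over B (A - 1)" using A B by (simp add: Fin1_def)
  then have "P (\<Sum>i<n. \<Sum>j<n. ue i j (ent (A - 1) i j))"
    by (intro Psum Pue mat_overD)
  then have "P (A - 1)"
    using fin_decompose[of n "A - 1", OF n] by metis
  then obtain ts where ts: "\<forall>t\<in>set ts. set (snd (snd t)) \<subseteq> V" "A - 1 = ?S ts" unfolding P_def by blast
  have "\<exists>g\<in>Em B. \<exists>h\<in>Em B. \<exists>A1. fin (A1 - 1) \<and> mat_over V A1 \<and> 1 + ?S ts = g * A1 * h"
    by (rule linearize_terms[OF B V]) (use V ts in \<open>fastforce simp: mat_over_def ent_one\<close>)+
  then show thesis using that ts(2) by (metis add_diff_cancel_left' diff_add_cancel add.commute)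
qed

section \<open>Wiener-Hopf factorization over a Toeplitz extension\<close>

definition mum :: "'a::ring_1 \<Rightarrow> 'a cfm" where
  "mum c = 1 + ue 0 0 (c - 1)"

lemma mum_one [simp]: "mum 1 = 1"
  by (simp add: mum_def)

lemma ent_mum: "ent (mum c) i j = (if i = j then (if i = 0 then c else 1) else 0)"
  by (simp add: mum_def ent_one ue.rep_eq)

lemma mum_mult: "mum (c * d) = mum c * mum d"
proof -
  have "ue 0 0 (c * d - 1) = ue 0 0 (c - 1) + ue 0 0 (d - 1) + ue 0 0 ((c - 1) * (d - 1))"
    by (rule cfm_eqI) (simp add: ue.rep_eq algebra_simps)
  then show ?thesis by (simp add: mum_def algebra_simps ue_ue)
qed

text \<open>The set C of admissible diagonal entries is a parameter because in the base case it is
  the unit group of a field of rational functions that changes along the induction.\<close>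

definition Good :: "'a set \<Rightarrow> 'a::ring_1 set \<Rightarrow> bool" where
  "Good C B \<longleftrightarrow> (\<forall>A\<in>GLm B. \<exists>c\<in>C. eqE B A (mum c))"

definition unit_group :: "'a::ring_1 set \<Rightarrow> 'a set \<Rightarrow> bool" where
  "unit_group B C \<longleftrightarrow> C \<subseteq> B \<and> 1 \<in> C \<and> (\<forall>c\<in>C. \<forall>d\<in>C. c * d \<in> C) \<and> (\<forall>c\<in>C. \<exists>d\<in>C. c * d = 1 \<and> d * c = 1)"

lemma unit_group_mono: "unit_group B C \<Longrightarrow> B \<subseteq> B' \<Longrightarrow> unit_group B' C"
  by (auto simp: unit_group_def)

lemma mum_Fin1: "sring B \<Longrightarrow> c \<in> B \<Longrightarrow> mum c \<in> Fin1 B"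
  unfolding mum_def by (intro Fin1_add) auto

lemma mum_GLm:
  assumes "sring B" "unit_group B C" "c \<in> C" shows "mum c \<in> GLm B"
proof -
  obtain d where "d \<in> C" "c * d = 1" "d * c = 1" using assms by (auto simp: unit_group_def)
  then show ?thesis using assms
    by (intro GLmI[of _ _ "mum d"]) (auto simp: unit_group_def mum_Fin1 simp flip: mum_mult)
qed

text \<open>The guard \<open>f 0 = 0\<close> keeps columns finite for every f; all maps used satisfy
  it.\<close>

lift_definition mapm :: "('a::zero \<Rightarrow> 'b::zero) \<Rightarrow> 'a cfm \<Rightarrow> 'b cfm"
  is "\<lambda>f A i j. if f 0 = 0 then f (A i j) else 0"
  subgoal for f A j by (rule finite_subset[of _ "{i. A i j \<noteq> 0}"]) auto
  done

lemma ent_mapm [simp]: "f 0 = 0 \<Longrightarrow> ent (mapm f A) i j = f (ent A i j)"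
  by transfer simp

lemma fin_mapm:
  assumes "fin (A - 1)" "f 0 = 0"
  shows "f 1 = 1 \<Longrightarrow> fin (mapm f A - 1)" "f 1 = 0 \<Longrightarrow> fin (mapm f A)"
proof -
  obtain n where n: "\<And>i j. n \<le> i \<or> n \<le> j \<Longrightarrow> ent (A - 1) i j = 0" using assms unfolding fin_def by blast
  then have *: "ent A i j = (if i = j then 1 else 0)" if "n \<le> i \<or> n \<le> j" for i j
    using that by (fastforce simp: ent_one)
  show "f 1 = 1 \<Longrightarrow> fin (mapm f A - 1)" "f 1 = 0 \<Longrightarrow> fin (mapm f A)"
    unfolding fin_def by (intro exI[of _ n]; simp add: * assms ent_one)+
qed

lemma sc_commute: "(\<And>r. r \<in> R \<Longrightarrow> r * x = x * r) \<Longrightarrow> mat_over R M \<Longrightarrow> M * sc x = sc x * M"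
  by (rule cfm_eqI) (simp add: mat_over_def)

text \<open>In the Toeplitz picture \<open>e\<close> projects to the lowest basis vector and
  \<open>u\<close> is the compression of \<open>Z = A^-1\<close> to it. Compressing
  \<open>A * Z = 1\<close> and \<open>Z * A = 1\<close> to this corner gives the two equations, once
  Y Z e and e Z X are expressed through \<open>u\<close>.\<close>

lemma wiener_hopf_corner:
  fixes A0 A1 B1 X Y Z e u :: "'b::ring_1"
  assumes YX: "Y * X = 1" and e: "e = 1 - X * Y"
    and comm: "A0 * X = X * A0" "A1 * X = X * A1" "B1 * X = X * B1" "u * X = X * u"
      "A0 * Y = Y * A0" "A1 * Y = Y * A1" "B1 * Y = Y * B1" "u * Y = Y * u"
    and A: "A = A0 + A1 * X + B1 * Y" and Z: "A * Z = 1" "Z * A = 1" and u: "e * Z * e = u * e"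
  shows "(A0 - B1 * u * A1) * u * e = e" "u * (A0 - B1 * u * A1) * e = e"
proof -
  have YXz: "Y * (X * z) = z" for z using YX by (simp flip: mult.assoc)
  have eX: "e * X = 0" unfolding e by (simp add: left_diff_distrib mult.assoc YX)
  have Ye: "Y * e = 0" unfolding e by (simp add: right_diff_distrib YXz)
  have "e * (1 - X * Y) = e - e * X * Y" by (simp add: right_diff_distrib mult.assoc)
  then have ee: "e * e = e" using eX e by simp
  have XY: "X * Y = 1 - e" using e by simp
  have push: "X * M = M * X" "X * (M * z) = M * (X * z)" "Y * M = M * Y" "Y * (M * z) = M * (Y * z)"
    "e * M = M * e" "e * (M * z) = M * (e * z)" if "M * X = X * M" "M * Y = Y * M" for M z
    using that unfolding e
    by (simp_all add: algebra_simps) (metis mult.assoc)+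
  note p = push[OF comm(1,5)] push[OF comm(2,6)] push[OF comm(3,7)] push[OF comm(4,8)]
  have z: "Y * (X * z) = z" "X * (Y * z) = z - e * z" "e * (X * z) = 0" "Y * (e * z) = 0" "e * (e * z) = e * z"
    "A * (Z * z) = z" "Z * (A * z) = z" for z
    using YX XY eX Ye ee Z by (simp_all add: left_diff_distrib flip: mult.assoc)
  note nf = p z YX XY eX Ye ee Z mult.assoc distrib_left distrib_right left_diff_distrib right_diff_distrib
  have eA: "e * A = A0 * e + B1 * (e * Y)" by (simp add: A nf)
  have Ae: "A * e = A0 * e + A1 * (X * e)" by (simp add: A nf)
  have YA: "Y * A = A * Y + A1 * e" by (simp add: A nf)
  have AX: "A * X = X * A + B1 * e" by (simp add: A nf)
  \<comment> \<open>The product is Y e = 0; commuting Y past A costs only the term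
    \<open>A1 * e\<close>, which determines Y Z e.\<close>
  have "0 = Y * A * (Z * e)" by (simp add: nf)
  also have "\<dots> = A * (Y * Z * e) + A1 * (e * Z * e)" by (simp add: YA distrib_right mult.assoc)
  finally have "Z * (A * (Y * Z * e)) = - (Z * (A1 * (e * Z * e)))"
    by (metis add_eq_0_iff2 mult_minus_right)
  then have YZe: "Y * Z * e = - (Z * (A1 * (u * e)))" using u by (simp add: z)
  have "e * (Y * Z * e) = - (e * Z * (A1 * (u * e)))" unfolding YZe by (simp add: mult.assoc)
  also have "A1 * (u * e) = e * (A1 * (u * e))" by (simp add: nf)
  also have "e * Z * (e * (A1 * (u * e))) = (e * Z * e) * (A1 * (u * e))" by (simp add: mult.assoc)
  finally have eYZe: "e * (Y * Z * e) = - (u * (A1 * (u * e)))" unfolding u by (simp add: nf)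
  have "e = e * A * (Z * e)" by (simp add: mult.assoc z ee)
  also have "\<dots> = A0 * (e * Z * e) + B1 * (e * (Y * Z * e))" by (simp add: eA distrib_right mult.assoc)
  also have "\<dots> = (A0 - B1 * u * A1) * u * e" unfolding eYZe u by (simp add: nf)
  finally show "(A0 - B1 * u * A1) * u * e = e" by simp
  \<comment> \<open>Mirror image of the previous computation: e X = 0, and moving X to the left of A
    costs \<open>B1 * e\<close>.\<close>
  have "0 = e * (Z * A) * X" using Z eX by simp
  also have "\<dots> = e * Z * X * A + e * Z * (B1 * e)" by (simp add: mult.assoc AX distrib_left)
  also have "B1 * e = e * B1" by (simp add: p)
  also have "e * Z * (e * B1) = u * e * B1" using u by (simp flip: mult.assoc)
  finally have "e * Z * X * A = - (u * e * B1)" by (simp add: add_eq_0_iff2)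
  then have "e * Z * X * A * Z = - (u * e * B1) * Z" by simp
  then have eZX: "e * Z * X = - (u * e * B1) * Z" using Z by (simp add: mult.assoc)
  have "u * e * B1 * Z * e = u * B1 * (e * Z * e)" by (simp add: p mult.assoc)
  then have eZXe: "e * Z * X * e = - (u * B1 * (u * e))" by (simp add: eZX u)
  have "e = e * (Z * (A * e))" by (simp add: z ee)
  also have "\<dots> = (e * Z * e) * A0 + (e * Z * X * e) * A1"
    by (simp add: Ae distrib_left mult.assoc p)
  also have "\<dots> = u * (A0 - B1 * u * A1) * e" unfolding eZXe u by (simp add: nf)
  finally show "u * (A0 - B1 * u * A1) * e = e" by simp
qed

lemma left_right_inverse_eq:
  fixes Q :: "'a::ring_1"
  assumes "L * Q = 1" "Q * R = 1" shows "R * Q = 1" "Q * L = 1"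
proof -
  have "L = L * (Q * R)" using assms by simp
  also have "\<dots> = (L * Q) * R" by (simp only: mult.assoc)
  also have "\<dots> = R" using assms by simp
  finally show "R * Q = 1" "Q * L = 1" using assms by simp_all
qed

section \<open>Factorization over a Toeplitz extension\<close>

text \<open>Rx and Ry stand for R[x] and R[y]. By \<open>left\<close> and \<open>faithful\<close>,
  right multiplication by \<epsilon> identifies Rx with T \<epsilon>, on which x acts by
  multiplication and y as the backward shift; \<open>nil\<close> expresses that y is locally
  nilpotent there. \<open>split\<close> separates the constant term.\<close>

locale toeplitz =
  fixes R Rx Ry T :: "'a::ring_1 set" and x y \<epsilon> :: 'a
  assumes sr: "sring R" "sring Rx" "sring Ry" "sring T"
    and sub: "R \<subseteq> Rx" "R \<subseteq> Ry" "Rx \<subseteq> T" "Ry \<subseteq> T"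
    and xy: "x \<in> Rx" "y \<in> Ry" "y * x = 1"
    and eps: "\<epsilon> = 1 - x * y"
    and comm: "\<And>r. r \<in> R \<Longrightarrow> r * x = x * r" "\<And>r. r \<in> R \<Longrightarrow> r * y = y * r"
    and gen: "\<And>z. z \<in> T \<Longrightarrow> \<exists>wss. (\<forall>ws\<in>set wss. set ws \<subseteq> {a + b * x + c * y | a b c. a \<in> R \<and> b \<in> R \<and> c \<in> R})
                 \<and> z = sum_list (map prod_list wss)"
    and left: "\<And>z. z \<in> T \<Longrightarrow> \<exists>p\<in>Rx. z * \<epsilon> = p * \<epsilon>"
    and right: "\<And>z. z \<in> T \<Longrightarrow> \<exists>q\<in>Ry. \<epsilon> * z = \<epsilon> * q"
    and split: "\<And>p. p \<in> Rx \<Longrightarrow> \<exists>r\<in>R. \<exists>p'\<in>Rx. p = r + x * p'"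
    and faithful: "\<And>p. p \<in> Rx \<Longrightarrow> p * \<epsilon> = 0 \<Longrightarrow> p = 0" "\<And>q. q \<in> Ry \<Longrightarrow> \<epsilon> * q = 0 \<Longrightarrow> q = 0"
    and nil: "\<And>p. p \<in> Rx \<Longrightarrow> \<exists>k. y ^ k * p * \<epsilon> = 0"
begin

lemma mat_faithful:
  "mat_over Rx M \<Longrightarrow> M * sc \<epsilon> = 0 \<Longrightarrow> M = 0"
  "mat_over Ry M \<Longrightarrow> sc \<epsilon> * M = 0 \<Longrightarrow> M = 0"
proof -
  assume *: "mat_over Rx M" "M * sc \<epsilon> = 0"
  show "M = 0"
    using faithful(1)[OF mat_overD[OF *(1)]] arg_cong[OF *(2), of ent]
    by (intro cfm_eqI) (simp add: fun_eq_iff flip: ent_times_sc)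
next
  assume *: "mat_over Ry M" "sc \<epsilon> * M = 0"
  show "M = 0"
    using faithful(2)[OF mat_overD[OF *(1)]] arg_cong[OF *(2), of ent]
    by (intro cfm_eqI) (simp add: fun_eq_iff flip: ent_sc_times)
qed

text \<open>Only finitely many entries are nonzero, so the largest of their exponents works for
  all.\<close>

lemma mat_nil:
  assumes "fin M" "mat_over Rx M" shows "\<exists>k. sc (y ^ k) * M * sc \<epsilon> = 0"
proof -
  obtain n where n: "\<And>i j. n \<le> i \<or> n \<le> j \<Longrightarrow> ent M i j = 0" using assms(1) unfolding fin_def by blast
  have "\<forall>i j. \<exists>k. y ^ k * ent M i j * \<epsilon> = 0" using nil assms(2) by (simp add: mat_over_def)
  then obtain k where k: "\<And>i j. y ^ k i j * ent M i j * \<epsilon> = 0" by metis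
  define K where "K = Max (insert 0 ((\<lambda>(i, j). k i j) ` ({..<n} \<times> {..<n})))"
  have "y ^ K * ent M i j * \<epsilon> = 0" for i j
  proof (cases "i < n \<and> j < n")
    case True
    then have "k i j \<le> K" unfolding K_def by (intro Max_ge) auto
    then have "y ^ K = y ^ (K - k i j) * y ^ k i j" by (simp flip: power_add)
    then show ?thesis using k[of i j] by (simp add: mult.assoc)
  next
    case False
    then show ?thesis using n[of i j] by (auto simp: not_less)
  qed
  then show ?thesis by (intro exI[of _ K] cfm_eqI) simp
qed

text \<open>The inverses of the outer factors come from representatives of Z: \<open>U\<close> over
  Rx with \<open>Z * e = U * e\<close> gives Q^-1 = U w, and \<open>W\<close> over Ry with
  \<open>e * Z = e * W\<close> gives P^-1 = w W.\<close>

lemma linear_factor: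
  assumes A: "A \<in> GLm T" and V: "mat_over {a + b * x + c * y | a b c. a \<in> R \<and> b \<in> R \<and> c \<in> R} A"
  shows "\<exists>P\<in>GLm Ry. \<exists>w\<in>GLm R. \<exists>Q\<in>GLm Rx. A = P * w * Q"
proof -
  let ?V = "{a + b * x + c * y | a b c. a \<in> R \<and> b \<in> R \<and> c \<in> R}"
  \<comment> \<open>The coefficients of a linear element are chosen, not assumed unique. Prescribing
    them at 0 and 1 makes the entrywise maps preserve finite perturbations; the same device recurs
    in \<open>hp\<close>, \<open>hq\<close>, \<open>hr\<close> and \<open>hs\<close>.\<close>
  define \<Phi> where "\<Phi> z a b c \<longleftrightarrow> (z \<in> ?V \<longrightarrow> a \<in> R \<and> b \<in> R \<and> c \<in> R \<and> z = a + b * x + c * y \<and>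
      (z = 0 \<longrightarrow> a = 0 \<and> b = 0 \<and> c = 0) \<and> (z = 1 \<longrightarrow> a = 1 \<and> b = 0 \<and> c = 0))" for z a b c
  have "\<exists>a b c. \<Phi> z a b c" for z
  proof -
    consider "z = 0" | "z = 1" | "z \<noteq> 0" "z \<noteq> 1" by blast
    then show ?thesis
    proof cases
      case 1 then have "\<Phi> z 0 0 0" using sr(1) by (simp add: \<Phi>_def)
      then show ?thesis by blast
    next
      case 2 then have "\<Phi> z 1 0 0" using sr(1) by (simp add: \<Phi>_def)
      then show ?thesis by blast
    next
      case 3 then show ?thesis unfolding \<Phi>_def by auto
    qed
  qed
  then obtain fa fb fc where "\<And>z. \<Phi> z (fa z) (fb z) (fc z)" by metis
  then have f: "z \<in> ?V \<longrightarrow> fa z \<in> R \<and> fb z \<in> R \<and> fc z \<in> R \<and> z = fa z + fb z * x + fc z * y \<and>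
      (z = 0 \<longrightarrow> fa z = 0 \<and> fb z = 0 \<and> fc z = 0) \<and> (z = 1 \<longrightarrow> fa z = 1 \<and> fb z = 0 \<and> fc z = 0)" for z
    unfolding \<Phi>_def by blast
  have V01: "0 \<in> ?V" "1 \<in> ?V"
    by (rule CollectI, rule exI[of _ 0], rule exI[of _ 0], rule exI[of _ 0], use sr(1) in simp)
       (rule CollectI, rule exI[of _ 1], rule exI[of _ 0], rule exI[of _ 0], use sr(1) in simp)
  have f0: "fa 0 = 0" "fb 0 = 0" "fc 0 = 0" "fa 1 = 1" "fb 1 = 0" "fc 1 = 0"
    using f[of 0, THEN mp, OF V01(1)] f[of 1, THEN mp, OF V01(2)] by simp_all
  define A0 where "A0 = mapm fa A"
  define A1 where "A1 = mapm fb A"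
  define B1 where "B1 = mapm fc A"
  have oR: "mat_over R A0" "mat_over R A1" "mat_over R B1"
    using f V by (auto simp: mat_over_def A0_def A1_def B1_def f0)
  have finA: "fin (A - 1)" using A GLm_Fin1 Fin1D by blast
  have finR: "fin (A0 - 1)" "fin A1" "fin B1"
    using fin_mapm[OF finA] f0 by (auto simp: A0_def A1_def B1_def)
  define X where "X = sc x"
  define Y where "Y = sc y"
  define e where "e = sc \<epsilon>"
  have AA: "A = A0 + A1 * X + B1 * Y"
    using f V by (intro cfm_eqI) (simp add: A0_def A1_def B1_def f0 X_def Y_def mat_over_def)
  have YX: "Y * X = 1" using xy by (simp add: X_def Y_def flip: sc_simps)
  have eXY: "e = 1 - X * Y" by (simp add: e_def X_def Y_def eps)
  have cX: "M * X = X * M" and cY: "M * Y = Y * M" if "mat_over R M" for M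
    using sc_commute[OF comm(1) that] sc_commute[OF comm(2) that] by (auto simp: X_def Y_def)
  have cXz: "X * (M * z) = M * (X * z)" if "mat_over R M" for M z
    using cX[OF that] by (metis mult.assoc)
  have YXz: "Y * (X * z) = z" for z using YX by (simp flip: mult.assoc)
  have eX: "e * X = 0" unfolding eXY by (simp add: left_diff_distrib mult.assoc YX)
  have Ye: "Y * e = 0" unfolding eXY by (simp add: right_diff_distrib YXz)
  have "e * (1 - X * Y) = e - e * X * Y" by (simp add: right_diff_distrib mult.assoc)
  then have ee: "e * e = e" using eX eXY by simp
  have ce: "M * e = e * M" if "mat_over R M" for M
  proof -
    have "M * (X * Y) = X * Y * M" using cX[OF that] cY[OF that] by (metis mult.assoc)
    then show ?thesis by (simp add: eXY algebra_simps)
  qed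
  obtain Z where Z: "Z \<in> GLm T" "A * Z = 1" "Z * A = 1" using A by (auto elim: GLmE)
  have Z1: "fin (Z - 1)" "mat_over T Z" using Z GLm_Fin1 Fin1D by blast+
  have "\<forall>z. \<exists>p. z \<in> T \<longrightarrow> p \<in> Rx \<and> z * \<epsilon> = p * \<epsilon> \<and> (z = 0 \<longrightarrow> p = 0) \<and> (z = 1 \<longrightarrow> p = 1)"
    using left sr(2) by (metis sringD(1,2) zero_neq_one)
  then obtain hp where hp: "\<And>z. z \<in> T \<longrightarrow> hp z \<in> Rx \<and> z * \<epsilon> = hp z * \<epsilon> \<and> (z = 0 \<longrightarrow> hp z = 0) \<and> (z = 1 \<longrightarrow> hp z = 1)"
    by metis
  have hp0: "hp 0 = 0" "hp 1 = 1" using hp[of 0] hp[of 1] sr(4) by auto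
  have "\<forall>z. \<exists>p. z \<in> T \<longrightarrow> p \<in> Ry \<and> \<epsilon> * z = \<epsilon> * p \<and> (z = 0 \<longrightarrow> p = 0) \<and> (z = 1 \<longrightarrow> p = 1)"
    using right sr(3) by (metis sringD(1,2) zero_neq_one)
  then obtain hq where hq: "\<And>z. z \<in> T \<longrightarrow> hq z \<in> Ry \<and> \<epsilon> * z = \<epsilon> * hq z \<and> (z = 0 \<longrightarrow> hq z = 0) \<and> (z = 1 \<longrightarrow> hq z = 1)"
    by metis
  have hq0: "hq 0 = 0" "hq 1 = 1" using hq[of 0] hq[of 1] sr(4) by auto
  have "\<forall>p. \<exists>r s. p \<in> Rx \<longrightarrow> r \<in> R \<and> s \<in> Rx \<and> p = r + x * s \<and> (p = 0 \<longrightarrow> r = 0 \<and> s = 0) \<and> (p = 1 \<longrightarrow> r = 1 \<and> s = 0)"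
  proof
    fix p :: 'a
    consider "p = 0" | "p = 1" | "p \<noteq> 0" "p \<noteq> 1" by blast
    then show "\<exists>r s. p \<in> Rx \<longrightarrow> r \<in> R \<and> s \<in> Rx \<and> p = r + x * s \<and> (p = 0 \<longrightarrow> r = 0 \<and> s = 0) \<and> (p = 1 \<longrightarrow> r = 1 \<and> s = 0)"
    proof cases
      case 1 then show ?thesis using sr by (intro exI[of _ 0]) auto
    next
      case 2 then show ?thesis using sr by (intro exI[of _ 1] exI[of _ 0]) auto
    next
      case 3 then show ?thesis using split[of p] by auto
    qed
  qed
  then obtain hr hs where hrs: "\<And>p. p \<in> Rx \<longrightarrow> hr p \<in> R \<and> hs p \<in> Rx \<and> p = hr p + x * hs p \<and> (p = 0 \<longrightarrow> hr p = 0 \<and> hs p = 0) \<and> (p = 1 \<longrightarrow> hr p = 1 \<and> hs p = 0)"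
    by metis
  have hrs0: "hr 0 = 0" "hs 0 = 0" "hr 1 = 1" "hs 1 = 0" using hrs[of 0] hrs[of 1] sr(2) by auto
  define U where "U = mapm hp Z"
  define u where "u = mapm hr U"
  define U' where "U' = mapm hs U"
  define W where "W = mapm hq Z"
  have U: "mat_over Rx U" "fin (U - 1)" and W: "mat_over Ry W" "fin (W - 1)"
    using hp hq Z1 fin_mapm(1)[OF Z1(1) hp0] fin_mapm(1)[OF Z1(1) hq0]
    by (auto simp: U_def W_def mat_over_def hp0 hq0)
  have ZU: "Z * e = U * e" and ZW: "e * Z = e * W"
    using hp hq Z1 by (auto intro!: cfm_eqI simp: U_def W_def e_def mat_over_def hp0 hq0)
  have u: "mat_over R u" "fin (u - 1)" and U': "mat_over Rx U'"
    using hrs U fin_mapm(1)[OF U(2) hrs0(1,3)] by (auto simp: u_def U'_def mat_over_def hrs0)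
  have Uu: "U = u + X * U'"
    using hrs U by (intro cfm_eqI) (auto simp: u_def U'_def mat_over_def hrs0 X_def)
  have "e * Z * e = e * U * e" by (simp add: ZU mult.assoc)
  also have "\<dots> = u * e"
    using eX ee ce[OF u(1)] by (simp add: Uu algebra_simps flip: mult.assoc)
       (metis ee mult.assoc)
  finally have eZe: "e * Z * e = u * e" .
  define w where "w = A0 - B1 * u * A1"
  have w: "mat_over R w" using sr(1) oR u by (simp add: w_def)
  have "w - 1 = (A0 - 1) - B1 * u * A1" by (simp add: w_def)
  moreover have "fin (B1 * u * A1)"
    by (intro fin_times[OF fin_Fin1_times(2)] u finR)
  ultimately have finw: "fin (w - 1)" using finR by (metis fin_diff)
  have RX: "mat_over R M \<Longrightarrow> mat_over Rx M" and RY: "mat_over R M \<Longrightarrow> mat_over Ry M" for M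
    using sub mat_over_mono by blast+
  note wh = wiener_hopf_corner[OF YX eXY cX[OF oR(1)] cX[OF oR(2)] cX[OF oR(3)] cX[OF u(1)]
      cY[OF oR(1)] cY[OF oR(2)] cY[OF oR(3)] cY[OF u(1)] AA Z(2,3) eZe, folded w_def]
  have "w * u - 1 = 0" "u * w - 1 = 0"
    by (rule mat_faithful(1); use wh w u sr(1) sub(1) in \<open>simp add: RX algebra_simps flip: e_def\<close>)+
  then have wu: "w * u = 1" "u * w = 1" by simp_all
  then have wGL: "w \<in> GLm R" "u \<in> GLm R"
    using w u finw by (auto intro!: GLmI[of w _ u] GLmI[of u _ w] simp: Fin1_def)
  have wuz: "w * (u * z) = z" "u * (w * z) = z" for z using wu by (simp_all flip: mult.assoc)
  define P where "P = 1 + B1 * u * Y"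
  define Q where "Q = 1 + u * A1 * X"
  have A_eq: "A = P * w * Q"
  proof -
    have "Y * w = w * Y" "Y * (u * z) = u * (Y * z)" "Y * (A1 * z) = A1 * (Y * z)" "Y * (w * z) = w * (Y * z)" for z
      using cY[OF w] cY[OF u(1)] cY[OF oR(2)] by (simp_all flip: mult.assoc)
    then have "P * w * Q = w + A1 * X + B1 * Y + B1 * u * A1"
      by (simp add: P_def Q_def algebra_simps wu wuz YX YXz)
    then show ?thesis by (simp add: AA w_def)
  qed
  have X1: "mat_over Rx X" and Y1: "mat_over Ry Y" using xy sr by (auto simp: X_def Y_def)
  \<comment> \<open>\<open>D = 0\<close> says \<open>Q * U = u\<close>, which gives Q a right
    inverse over Rx; a left inverse over T is then forced to coincide with it.\<close>
  define D where "D = U + u * A1 * X * U - u"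
  have "D = 0"
  proof -
    have Yue: "Y * (u * e) = u * (Y * e)" by (metis cY[OF u(1)] mult.assoc)
    have YU: "Y * (U * e) = U' * e"
      by (simp add: Uu distrib_left distrib_right mult.assoc Yue Ye YXz)
    have "(A0 * U + A1 * X * U + B1 * U') * e = A * (U * e)"
      by (simp add: AA distrib_right mult.assoc YU)
    also have "\<dots> = A * Z * e" by (simp add: ZU mult.assoc)
    also have "\<dots> = e" using Z(2) by simp
    finally have "(A0 * U + A1 * X * U + B1 * U' - 1) * sc \<epsilon> = 0"
      by (simp add: left_diff_distrib e_def)
    moreover have "mat_over Rx (A0 * U + A1 * X * U + B1 * U' - 1)"
      by (intro mat_over_simps(2,3,4,6) sr(2) U(1) U' X1 RX oR)
    ultimately have "A0 * U + A1 * X * U + B1 * U' - 1 = 0" using mat_faithful(1) by blast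
    \<comment> \<open>After multiplication by X, only X U' = U - u occurs, and the equation can be
      expressed through \<open>D\<close>.\<close>
    then have "X * (A0 * U + A1 * X * U + B1 * U') = X" by simp
    moreover have "X * (B1 * U') = B1 * (X * U')" by (metis cX[OF oR(3)] mult.assoc)
    ultimately have eq: "X * A0 * U + X * A1 * X * U + B1 * (X * U') - X = 0"
      by (simp add: distrib_left mult.assoc)
    have XU': "X * U' = U - u" by (simp add: Uu)
    have A0w: "A0 = w + B1 * u * A1" by (simp add: w_def)
    have "X * (B1 * (u * (A1 * U))) = B1 * (u * (A1 * (X * U)))"
      by (simp only: cXz[OF oR(3)] cXz[OF u(1)] cXz[OF oR(2)])
    then have "(X * w + B1) * D = X * A0 * U + X * A1 * X * U + B1 * (X * U') - X"
      by (simp add: D_def XU' A0w algebra_simps wu wuz)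
    then have "X * w * D + B1 * D = 0" using eq by (simp add: distrib_right)
    then have XD: "X * (w * D) = - (B1 * u) * (w * D)"
      using wu by (simp add: mult.assoc wuz add_eq_0_iff2)
    \<comment> \<open>The relation X E = C E iterates to X^k E = C^k E, hence E = C^k Y^k E. For
      large k the nilpotency of y makes \<open>E * e\<close> vanish, and faithfulness gives E =
      0.\<close>
    define E where "E = w * D"
    define C where "C = - (B1 * u)"
    have C: "mat_over R C" using oR u sr(1) by (simp add: C_def)
    have XE: "X ^ k * E = C ^ k * E" for k
    proof (induction k)
      case (Suc k)
      have "X ^ Suc k * E = X ^ k * (X * E)" by (simp only: power_Suc2 mult.assoc)
      also have "\<dots> = X ^ k * C * E" using XD by (simp add: E_def C_def mult.assoc)
      also have "X ^ k * C = C * X ^ k" using cX[OF C]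
        by (induction k) (simp_all add: mult.assoc, metis mult.assoc)
      finally show ?case using Suc by (simp add: mult.assoc)
    qed simp
    have YXk: "Y ^ k * X ^ k = 1" for k
    proof (induction k)
      case (Suc k)
      have "Y ^ Suc k * X ^ Suc k = Y ^ k * (Y * X) * X ^ k" by (simp only: power_Suc2[of Y] power_Suc[of X] mult.assoc)
      then show ?case using Suc YX by simp
    qed simp
    have YCk: "Y ^ k * C ^ l = C ^ l * Y ^ k" for k l
    proof -
      have "Y * C ^ l = C ^ l * Y"
        using cY[OF C] by (induction l) (simp_all add: mult.assoc, metis mult.assoc)
      then show ?thesis by (induction k) (simp_all add: mult.assoc, metis mult.assoc)
    qed
    have oE: "mat_over Rx E" unfolding E_def D_def by (intro mat_over_simps(2,3,4,6) sr(2) U(1) X1 RX w u oR)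
    have "D = (U - 1) - (u - 1) + u * (A1 * X) * U" by (simp add: D_def mult.assoc)
    moreover have "fin (u * (A1 * X) * U)"
      using u(2) U(2) finR(2) fin_Fin1_times by (metis X_def fin_sc_times(2))
    ultimately have "fin D" using u(2) U(2) by (metis fin_add fin_diff)
    then have "fin E" using finw fin_Fin1_times by (simp add: E_def)
    then obtain k where k: "sc (y ^ k) * E * e = 0" using mat_nil[OF _ oE] by (auto simp: e_def)
    have "sc (y ^ k) = Y ^ k" by (induction k) (simp_all add: Y_def)
    then have "Y ^ k * E * e = 0" using k by simp
    moreover have "E * e = C ^ k * (Y ^ k * E * e)"
    proof -
      have "E = Y ^ k * X ^ k * E" by (simp add: YXk)
      also have "\<dots> = Y ^ k * C ^ k * E" by (simp add: XE mult.assoc)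
      also have "\<dots> = C ^ k * (Y ^ k * E)" by (simp add: YCk mult.assoc)
      finally show ?thesis by (metis mult.assoc)
    qed
    ultimately have "E * e = 0" by simp
    then have "E = 0" using mat_faithful(1)[OF oE] by (simp add: e_def)
    then have "u * (w * D) = 0" by (simp add: E_def)
    then show ?thesis by (simp add: wuz)
  qed
  then have "Q * U = u" by (simp add: Q_def D_def distrib_right)
  then have Qr: "Q * (U * w) = 1" using wu by (simp flip: mult.assoc)
  have "Z * P * w * Q = 1" using Z(3) A_eq by (simp add: mult.assoc)
  then have Ql: "U * w * Q = 1" by (rule left_right_inverse_eq(1)[OF _ Qr])
  have finPQ: "fin (u * A1 * X)" "fin (B1 * u * Y)"
    unfolding X_def Y_def
    by (rule fin_sc_times(2)[OF fin_Fin1_times(1)[OF u(2) finR(2)]], rule fin_sc_times(2)[OF fin_Fin1_times(2)[OF u(2) finR(3)]])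
  have "Q \<in> Fin1 Rx" unfolding Q_def
    by (rule Fin1_add[OF sr(2) _ finPQ(1)]) (intro mat_over_simps(4) sr X1 RX u oR)
  moreover have "P \<in> Fin1 Ry" unfolding P_def
    by (rule Fin1_add[OF sr(3) _ finPQ(2)]) (intro mat_over_simps(4) sr Y1 RY u oR)
  moreover have "U * w \<in> Fin1 Rx" "w * W \<in> Fin1 Ry"
    using sr(2,3) U W finw RX[OF w] RY[OF w] by (simp_all add: Fin1_def fin_minus_one_times)
  \<comment> \<open>Multiplying Z A = 1 by e on the left removes Q, since e Q = e; what remains is
    an identity over Ry that faithfulness frees from e.\<close>
  moreover have "w * W * P = 1" 
  proof -
    have "e * (u * A1) = u * A1 * e"
      by (rule ce[symmetric]) (intro mat_over_simps(4) sr(1) u oR)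
    then have "e * (u * A1 * X) = u * A1 * (e * X)" by (simp only: mult.assoc[symmetric])
    then have eQ: "e * Q = e" using eX by (simp add: Q_def distrib_left)
    then have eQ': "e * (U * w) = e" using Qr by (metis mult.assoc mult_1_right)
    have "e * W * P * w * Q = e" using ZW Z(3) A_eq by (metis mult.assoc mult_1_right)
    then have "e * W * P * w * (Q * (U * w)) = e * (U * w)" by (simp flip: mult.assoc)
    then have "e * W * P * w = e" using Qr eQ' by simp
    then have "e * W * P = e * u" using wu by (metis mult.assoc mult_1_right)
    then have "sc \<epsilon> * (W * P - u) = 0" by (simp add: right_diff_distrib e_def mult.assoc)
    moreover have "mat_over Ry (W * P - u)"
      by (intro mat_over_simps(2,3,4,6) sr(3) W(1) RY u Fin1D(2)[OF \<open>P \<in> Fin1 Ry\<close>])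
    ultimately have "W * P - u = 0" using mat_faithful(2) by blast
    then show ?thesis using wu by (simp add: mult.assoc)
  qed
  \<comment> \<open>A Z = 1 provides a right inverse of P over T, which must equal the left inverse
    just found.\<close>
  moreover have "P * (w * W) = 1"
  proof -
    have "P * (w * Q * Z) = 1" using A_eq Z(2) by (simp add: mult.assoc)
    from left_right_inverse_eq(2)[OF \<open>w * W * P = 1\<close> this] show ?thesis .
  qed
  ultimately have "P \<in> GLm Ry" "Q \<in> GLm Rx" using Qr Ql by (auto intro: GLmI)
  then show ?thesis using A_eq wGL by blast
qed

text \<open>After linearization each of the three factors has a diagonal representative over its own
  ring; over T these multiply, and \<open>mum_mult\<close> merges them into one.\<close>

lemma Good_toeplitz:
  assumes C: "unit_group R C" and G: "Good C R" "Good C Rx" "Good C Ry"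
  shows "Good C T"
  unfolding Good_def
proof
  fix A assume A: "A \<in> GLm T"
  let ?V = "{a + b * x + c * y | a b c. a \<in> R \<and> b \<in> R \<and> c \<in> R}"
  have VT: "?V \<subseteq> T" using sub xy sr(4) by (auto intro!: sringD(3,4))
  have V1: "0 \<in> ?V" "1 \<in> ?V"
    by (rule CollectI, rule exI[of _ 0], rule exI[of _ 0], rule exI[of _ 0], use sr(1) in simp)
       (rule CollectI, rule exI[of _ 1], rule exI[of _ 0], rule exI[of _ 0], use sr(1) in simp)
  have V2: "a + b \<in> ?V" if ab: "a \<in> ?V" "b \<in> ?V" for a b
  proof -
    obtain a1 a2 a3 b1 b2 b3 where *: "a = a1 + a2 * x + a3 * y" "b = b1 + b2 * x + b3 * y"
      "a1 \<in> R" "a2 \<in> R" "a3 \<in> R" "b1 \<in> R" "b2 \<in> R" "b3 \<in> R" using ab by blast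
    then show ?thesis using sr(1)
      by (intro CollectI exI[of _ "a1 + b1"] exI[of _ "a2 + b2"] exI[of _ "a3 + b3"]) (simp add: algebra_simps)
  qed
  have V3: "- a \<in> ?V" if a: "a \<in> ?V" for a
  proof -
    obtain a1 a2 a3 where *: "a = a1 + a2 * x + a3 * y" "a1 \<in> R" "a2 \<in> R" "a3 \<in> R" using a by blast
    then show ?thesis using sr(1)
      by (intro CollectI exI[of _ "- a1"] exI[of _ "- a2"] exI[of _ "- a3"]) (simp add: algebra_simps)
  qed
  obtain g h A1 where gh: "g \<in> Em T" "h \<in> Em T" "fin (A1 - 1)" "mat_over ?V A1" "A = g * A1 * h"
    using linearize[OF sr(4) VT V1 V2 V3 gen GLm_Fin1[OF A]] by blast
  obtain g' where g': "g' \<in> Em T" "g' * g = 1" using Em_inverse[OF sr(4) gh(1)] by blast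
  obtain h' where h': "h' \<in> Em T" "h * h' = 1" using Em_inverse[OF sr(4) gh(2)] by blast
  have "g' * A * h' = (g' * g) * A1 * (h * h')" unfolding gh(5) by (simp only: mult.assoc)
  then have "A1 = g' * A * h'" using g' h' by simp
  then have A1: "A1 \<in> GLm T" using A g' h' sr(4) by (metis Em_GLm GLm_times)
  obtain P w Q where f: "P \<in> GLm Ry" "w \<in> GLm R" "Q \<in> GLm Rx" "A1 = P * w * Q"
    using linear_factor[OF A1 gh(4)] by blast
  obtain c1 where c1: "c1 \<in> C" "eqE Ry P (mum c1)" using G(3) f(1) unfolding Good_def by blast
  obtain c2 where c2: "c2 \<in> C" "eqE R w (mum c2)" using G(1) f(2) unfolding Good_def by blast
  obtain c3 where c3: "c3 \<in> C" "eqE Rx Q (mum c3)" using G(2) f(3) unfolding Good_def by blast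
  have CT: "unit_group T C" using C sub by (meson unit_group_mono subset_trans)
  have mono: "eqE T M N" if "eqE B M N" "B \<subseteq> T" for B M N
    using that Em_mono unfolding eqE_def by blast
  have e3: "eqE T P (mum c1)" "eqE T w (mum c2)" "eqE T Q (mum c3)"
    using mono[OF c1(2)] mono[OF c2(2)] mono[OF c3(2)] sub by auto
  have m: "mum c \<in> GLm T" if "c \<in> C" for c using mum_GLm[OF sr(4) CT that] .
  have "eqE T A1 (mum c1 * mum c2 * mum c3)"
    unfolding f(4) by (intro eqE_mult sr(4) e3 GLm_times m c1 c2 c3)
  moreover have "eqE T A A1"
  proof -
    have "eqE T (g * A1 * h) (g * A1)" by (intro eqE_Em sr GLm_times Em_GLm gh A1)
    moreover have "eqE T (g * A1) A1" using gh by (auto simp: eqE_def)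
    ultimately show ?thesis using gh(5) eqE_trans by blast
  qed
  ultimately have "eqE T A (mum (c1 * c2 * c3))" using eqE_trans by (simp add: mum_mult) blast
  then show "\<exists>c\<in>C. eqE T A (mum c)" using C c1 c2 c3 by (auto simp: unit_group_def)
qed

end

section \<open>Linear pencils over a polynomial ring\<close>

lemma nontrivial_kernel:
  fixes M :: "'i \<Rightarrow> 'j \<Rightarrow> 'a::field"
  assumes "finite I" "finite J" "card I < card J"
  shows "\<exists>v. (\<exists>j\<in>J. v j \<noteq> 0) \<and> (\<forall>i\<in>I. (\<Sum>j\<in>J. M i j * v j) = 0)"
  using assms
proof (induction I arbitrary: J M rule: finite_induct)
  case empty
  then obtain j where "j \<in> J" by fastforce
  then show ?case by (intro exI[of _ "\<lambda>_. 1"]) auto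
next
  case (insert i I)
  show ?case
  proof (cases "\<forall>j\<in>J. M i j = 0")
    case True
    obtain v where v: "\<exists>j\<in>J. v j \<noteq> 0" "\<forall>i\<in>I. (\<Sum>j\<in>J. M i j * v j) = 0"
      using insert.IH[of J M] insert.prems insert.hyps by auto
    have "(\<Sum>j\<in>J. M i j * v j) = 0" using True by (intro sum.neutral) auto
    then show ?thesis using v by auto
  next
    case False
    then obtain k where k: "k \<in> J" "M i k \<noteq> 0" by blast
    let ?J = "J - {k}"
    let ?M = "\<lambda>p j. M p j - M p k * M i j / M i k"
    have "card I < card ?J" using insert.prems insert.hyps k by auto
    then obtain v where v: "\<exists>j\<in>?J. v j \<noteq> 0" "\<forall>p\<in>I. (\<Sum>j\<in>?J. ?M p j * v j) = 0"
      using insert.IH[of ?J ?M] insert.prems by auto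
    define s where "s = (\<Sum>j\<in>?J. M i j * v j)"
    define v' where "v' = v(k := - s / M i k)"
    have sum: "(\<Sum>j\<in>J. M p j * v' j) = M p k * (- s / M i k) + (\<Sum>j\<in>?J. M p j * v j)" for p
    proof -
      have "(\<Sum>j\<in>J. M p j * v' j) = M p k * v' k + (\<Sum>j\<in>?J. M p j * v' j)"
        using insert.prems k by (simp add: sum.remove)
      also have "(\<Sum>j\<in>?J. M p j * v' j) = (\<Sum>j\<in>?J. M p j * v j)"
        by (intro sum.cong) (auto simp: v'_def)
      finally show ?thesis by (simp add: v'_def)
    qed
    have "(\<Sum>j\<in>J. M p j * v' j) = 0" if "p \<in> I" for p
    proof -
      have "0 = (\<Sum>j\<in>?J. ?M p j * v j)" using v(2) that by simp
      also have "\<dots> = (\<Sum>j\<in>?J. M p j * v j - M p k / M i k * (M i j * v j))"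
        by (intro sum.cong refl) (simp add: algebra_simps)
      also have "\<dots> = (\<Sum>j\<in>?J. M p j * v j) - M p k / M i k * s"
        by (simp only: sum_subtractf s_def sum_distrib_left)
      finally show ?thesis by (simp add: sum)
    qed
    moreover have "(\<Sum>j\<in>J. M i j * v' j) = 0" using k by (simp add: sum s_def)
    moreover have "\<exists>j\<in>J. v' j \<noteq> 0" using v(1) by (auto simp: v'_def)
    ultimately show ?thesis by (intro exI[of _ v']) auto
  qed
qed

text \<open>\<open>pr J\<close> factors through the index set I, so a nonzero kernel vector of
  \<open>u'\<close> supported on J would be killed by \<open>pr J\<close>. Serves to show that
  intertwined pencils have blocks of equal size.\<close>

lemma invertible_card_le:
  fixes u u' :: "'a::field cfm"
  assumes "finite I" "finite J" "u' = pr I * u'" "u * u' = pr J"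
  shows "card J \<le> card I"
proof (rule ccontr)
  assume "\<not> card J \<le> card I"
  then obtain v where v: "\<exists>j\<in>J. v j \<noteq> 0" "\<forall>i\<in>I. (\<Sum>j\<in>J. ent u' i j * v j) = 0"
    using nontrivial_kernel[OF assms(1,2), of "ent u'"] by auto
  define V where "V = (\<Sum>j\<in>J. ue j 0 (v j))"
  have entV: "ent V i j = (if i \<in> J \<and> j = 0 then v i else 0)" for i j
  proof -
    have "ent V i j = (\<Sum>k\<in>J. if k = i then (if j = 0 then v k else 0) else 0)"
      unfolding V_def ent_sum by (intro sum.cong refl) (auto simp: ue.rep_eq)
    also have "\<dots> = (if i \<in> J \<and> j = 0 then v i else 0)"
      using assms(2) by (subst sum.delta) auto
    finally show ?thesis .
  qed
  have "u' * V = 0"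
  proof (rule cfm_eqI)
    fix i j
    have "ent (u' * V) i j = (\<Sum>k\<in>J. ent u' i k * ent V k j)"
      using assms(2) by (intro ent_times) (auto simp: entV)
    also have "\<dots> = 0"
    proof (cases "i \<in> I \<and> j = 0")
      case True
      then show ?thesis using v(2) by (simp add: entV)
    next
      case False
      moreover have "ent u' i k = 0" if "i \<notin> I" for k
        using arg_cong[OF assms(3), of "\<lambda>A. ent A i k"] that by simp
      ultimately show ?thesis by (auto simp: entV intro!: sum.neutral)
    qed
    finally show "ent (u' * V) i j = ent 0 i j" by simp
  qed
  then have "u * u' * V = 0" by (simp add: mult.assoc)
  then have "pr J * V = 0" using assms(4) by simp
  obtain j where j: "j \<in> J" "v j \<noteq> 0" using v(1) by blast
  from arg_cong[OF \<open>pr J * V = 0\<close>, of "\<lambda>A. ent A j 0"] show False using j by (simp add: entV)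
qed

text \<open>Gaussian elimination from the last index downwards. The pivot is made 1 by adding
  multiples of other rows, since rescaling a row is not elementary; the last 1 x 1 block is the
  diagonal entry that remains.\<close>

lemma Good_field:
  fixes F :: "'a::field set"
  assumes F: "sring F" "\<And>c. c \<in> F \<Longrightarrow> inverse c \<in> F"
  shows "Good (F - {0}) F"
proof -
  have div: "a / b \<in> F" if "a \<in> F" "b \<in> F" for a b
    using that F by (simp add: field_class.field_divide_inverse)
  have "\<exists>c\<in>F - {0}. eqE F A (mum c)"
    if "A \<in> GLm F" "\<And>i j. Suc n \<le> i \<or> Suc n \<le> j \<Longrightarrow> ent (A - 1) i j = 0" for n A
    using that
  proof (induction n arbitrary: A)
    case 0
    have A: "A = mum (ent A 0 0)"
    proof (rule cfm_eqI)
      fix i j show "ent A i j = ent (mum (ent A 0 0)) i j"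
        using 0(2)[of i j] by (cases i; cases j) (auto simp: ent_mum ent_one)
    qed
    obtain A' where A': "A * A' = 1" using 0(1) by (auto elim: GLmE)
    have "ent (mum (ent A 0 0) * A') 0 0 = 1" using A A' by (metis ent_one)
    then have "ent A 0 0 * ent A' 0 0 = 1" by (subst (asm) ent_times_single[of 0]) (auto simp: ent_mum)
    then have "ent A 0 0 \<noteq> 0" by auto
    moreover have "ent A 0 0 \<in> F" using 0(1) GLm_over mat_overD by blast
    ultimately show ?case using A by (metis DiffI eqE_refl singletonD)
  next
    case (Suc n)
    define d where "d = Suc n"
    have bnd: "ent A i j = (if i = j then 1 else 0)" if "d < i \<or> d < j" for i j
    proof -
      have "Suc (Suc n) \<le> i \<or> Suc (Suc n) \<le> j" using that by (auto simp: d_def)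
      from Suc.prems(2)[OF this] show ?thesis by (simp add: ent_one)
    qed
    \<comment> \<open>Target of the first stage: pivot 1 at (d, d), with the identity kept beyond
      d.\<close>
    define \<Psi> where "\<Psi> M \<longleftrightarrow> (\<forall>i j. d < i \<or> d < j \<longrightarrow> ent M i j = (if i = j then 1 else 0)) \<and> ent M d d = 1" for M :: "'a cfm"
    have E1: "\<exists>g\<in>Em F. \<Psi> (g * A)"
    proof -
      have key: "\<exists>g\<in>Em F. \<Psi> (g * M)"
        if M: "mat_over F M" "\<And>i j. d < i \<or> d < j \<Longrightarrow> ent M i j = (if i = j then 1 else 0)" "i < d" "ent M i d \<noteq> 0" for M i
      proof -
        let ?g = "1 + ue d i ((1 - ent M d d) / ent M i d)"
        have "?g \<in> Em F" using M F(1) by (intro Em_gen div) (auto simp: mat_over_def)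
        moreover have "ent (?g * M) p q = (if p = q then 1 else 0)" if "d < p \<or> d < q" for p q
          using M(2)[of p q] M(2)[of i q] M(3) that by (auto simp: distrib_right)
        moreover have "ent (?g * M) d d = 1" using M(4) by (simp add: distrib_right)
        ultimately show ?thesis unfolding \<Psi>_def by blast
      qed
      have AF: "mat_over F A" using Suc.prems(1) GLm_over by blast
      show ?thesis
      proof (cases "\<exists>i<d. ent A i d \<noteq> 0")
        case True
        then obtain i where "i < d" "ent A i d \<noteq> 0" by blast
        from key[OF AF bnd this] show ?thesis .
      next
        \<comment> \<open>Column d then has only its diagonal entry, nonzero by invertibility;
          adding row d to row 0 leads back to the first case.\<close>
        case False
        obtain A' where A': "A' * A = 1" using Suc.prems(1) by (auto elim: GLmE)
        have "ent A d d \<noteq> 0"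
        proof
          assume 0: "ent A d d = 0"
          have "ent A k d = 0" for k
            using False 0 bnd[of k d] by (cases "k < d"; cases "k = d") auto
          then have "ent (A' * A) d d = 0" by (subst ent_times[of "{}"]) auto
          then show False using A' by (simp add: ent_one)
        qed
        let ?M = "(1 + ue 0 d 1) * A"
        have g: "1 + ue 0 d 1 \<in> Em F" using F(1) by (intro Em_gen) (auto simp: d_def)
        have "\<exists>g\<in>Em F. \<Psi> (g * ?M)"
        proof (rule key[of _ 0])
          show "mat_over F ?M" using AF F(1) by simp
          show "ent ?M i j = (if i = j then 1 else 0)" if "d < i \<or> d < j" for i j
            using bnd[of i j] bnd[of d j] that by (auto simp: distrib_right)
          show "0 < d" by (simp add: d_def)
          show "ent ?M 0 d \<noteq> 0" using False \<open>ent A d d \<noteq> 0\<close> by (simp add: distrib_right d_def)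
        qed
        then show ?thesis using g by (metis Em_times mult.assoc)
      qed
    qed
    then obtain g where g: "g \<in> Em F" "\<Psi> (g * A)" by blast
    define A1 where "A1 = g * A"
    have A1: "A1 \<in> GLm F" using Em_GLm[OF F(1) g(1)] F(1) Suc.prems(1) by (simp add: A1_def)
    have a1: "ent A1 i j = (if i = j then 1 else 0)" if "d < i \<or> d < j" for i j
      using g(2) that unfolding A1_def \<Psi>_def by blast
    have a1d: "ent A1 d d = 1" using g by (simp add: A1_def \<Psi>_def)
    \<comment> \<open>The part of column d off the diagonal, cleared by one block-elementary factor;
      \<open>r\<close> below does the same for row d.\<close>
    define c where "c = (A1 - 1) * pr {d}"
    have ent_c: "ent c i j = (if j = d then ent A1 i d - (if i = d then 1 else 0) else 0)" for i j
      by (simp add: c_def ent_one)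
    have fo: "fin (A1 - 1)" "mat_over F A1" using A1 GLm_Fin1 Fin1D by blast+
    have "1 + (- c) \<in> Em F"
    proof (rule Em_block[of _ _ "- {d}"])
      show "mat_over F (- c)" using fo F(1) by (simp add: c_def)
      show "fin (- c)" using fo by (simp add: c_def)
      show "\<And>i j. ent (- c) i j \<noteq> 0 \<Longrightarrow> i \<in> - {d} \<and> j \<notin> - {d}"
        using a1d by (auto simp: ent_c split: if_splits)
    qed fact
    define A2 where "A2 = (1 - c) * A1"
    have A2: "A2 \<in> GLm F" using Em_GLm[OF F(1) \<open>1 + (- c) \<in> Em F\<close>] A1 F(1) by (simp add: A2_def)
    have a2: "ent A2 i j = ent A1 i j - ent c i d * ent A1 d j" for i j
      unfolding A2_def left_diff_distrib by simp (subst ent_times_single[of d]; simp add: ent_c)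
    define r where "r = pr {d} * (A2 - 1)"
    have ent_r: "ent r i j = (if i = d then ent A2 d j - (if j = d then 1 else 0) else 0)" for i j
      by (simp add: r_def ent_one)
    have a2d: "ent A2 i d = (if i = d then 1 else 0)" for i
      by (simp add: a2 ent_c a1d)
    have fo2: "fin (A2 - 1)" "mat_over F A2" using A2 GLm_Fin1 Fin1D by blast+
    have "1 + (- r) \<in> Em F"
    proof (rule Em_block[of _ _ "{d}"])
      show "mat_over F (- r)" using fo2 F(1) by (simp add: r_def)
      show "fin (- r)" using fo2 by (simp add: r_def)
      show "\<And>i j. ent (- r) i j \<noteq> 0 \<Longrightarrow> i \<in> {d} \<and> j \<notin> {d}"
        using a2d by (auto simp: ent_r split: if_splits)
    qed fact
    define A3 where "A3 = A2 * (1 - r)"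
    have A3: "A3 \<in> GLm F" using Em_GLm[OF F(1) \<open>1 + (- r) \<in> Em F\<close>] A2 F(1) by (simp add: A3_def)
    have a3: "ent A3 i j = ent A2 i j - ent A2 i d * ent r d j" for i j
      unfolding A3_def right_diff_distrib by simp (subst ent_times_single[of d]; simp add: ent_r)
    have "ent (A3 - 1) i j = 0" if ij: "Suc n \<le> i \<or> Suc n \<le> j" for i j
    proof -
      consider "i = d" | "j = d" | "i \<noteq> d" "d < i \<or> d < j" "j \<noteq> d" using ij unfolding d_def by linarith
      then show ?thesis
      proof cases
        case 1 then show ?thesis by (simp add: a3 ent_r a2d ent_one)
      next
        case 2 then show ?thesis by (simp add: a3 ent_r a2d ent_one)
      next
        case 3
        then have "ent c i d * ent A1 d j = 0" using a1[of i d] a1[of d j] by (auto simp: ent_c)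
        then show ?thesis using 3 by (simp add: a3 a2d a2[of i j] ent_one a1)
      qed
    qed
    from Suc.IH[OF A3 this] obtain k where k: "k \<in> F - {0}" "eqE F A3 (mum k)" by blast
    have "eqE F A3 A2"
      unfolding A3_def using eqE_Em[OF F(1) A2 \<open>1 + (- r) \<in> Em F\<close>] by simp
    moreover have "eqE F A2 A1" unfolding eqE_def A2_def using \<open>1 + (- c) \<in> Em F\<close> by auto
    moreover have "eqE F A1 A" unfolding eqE_def A1_def using g(1) by auto
    ultimately have "eqE F A A3" using eqE_sym[OF F(1)] eqE_trans by blast
    then show ?case using k eqE_trans by blast
  qed
  then have main: "\<And>n A. A \<in> GLm F \<Longrightarrow> (\<And>i j. Suc n \<le> i \<or> Suc n \<le> j \<Longrightarrow> ent (A - 1) i j = 0) \<Longrightarrow> \<exists>c\<in>F - {0}. eqE F A (mum c)" .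
  show ?thesis unfolding Good_def
  proof
    fix A assume A: "A \<in> GLm F"
    then have "fin (A - 1)" using GLm_Fin1 Fin1D by blast
    then obtain n where "\<And>i j. n \<le> i \<or> n \<le> j \<Longrightarrow> ent (A - 1) i j = 0" unfolding fin_def by blast
    then show "\<exists>c\<in>F - {0}. eqE F A (mum c)" by (intro main[of A n] A) auto
  qed
qed

lemma sum_closed_pred:
  assumes "P 0" "\<And>a b. P a \<Longrightarrow> P b \<Longrightarrow> P (a + b)" "\<And>i. i \<in> S \<Longrightarrow> P (f i)"
  shows "P (sum f S)"
  using assms(3) by (induction S rule: infinite_finite_induct) (auto intro: assms)

lemma pr_empty [simp]: "pr {} = 0"
  by (rule cfm_eqI) (simp add: pr.rep_eq)

text \<open>The signed transposition as the usual product of three elementary matrices; it serves as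
  an elementary substitute for a permutation matrix.\<close>

lemma rotation_Em:
  assumes "sring B" "k \<noteq> l"
  shows "pr (- {k, l}) + ue k l 1 - ue l k 1 \<in> Em B"
proof -
  have "pr (- {k, l}) + ue k l 1 - ue l k 1 = (1 + ue k l 1) * ((1 + ue l k (- 1)) * (1 + ue k l 1))"
    using assms(2) by (intro cfm_eqI) (auto simp: algebra_simps ue_ue pr.rep_eq ue.rep_eq ent_one)
  then show ?thesis using assms by (metis Em_gen Em_times sringD(2,5))
qed

section \<open>Division by linear pencils\<close>

text \<open>R is a subring of an ambient field and t is transcendental over it, so \<open>B\<close>
  below is the polynomial ring R[t]; the ambient field leaves room for the localizations compared
  later.\<close>

locale polynomial_extension =
  fixes R :: "'a::field set" and t :: 'a
  assumes sR: "sring R"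
    and transcendental: "\<And>p. (\<And>i. Polynomial.coeff p i \<in> R) \<Longrightarrow> poly p t = 0 \<Longrightarrow> p = 0"
begin

definition B where "B = {poly p t | p. \<forall>i. Polynomial.coeff p i \<in> R}"

text \<open>The pencil t - \<tau> on the block I, completed by the identity so that it is a finite
  perturbation of 1.\<close>

definition Lin where "Lin I \<tau> = sc t * pr I - \<tau> + pr (- I)"

definition lin_data :: "nat set \<Rightarrow> 'a cfm \<Rightarrow> bool" where
  "lin_data I \<tau> \<longleftrightarrow> finite I \<and> mat_over R \<tau> \<and> (\<forall>i j. ent \<tau> i j \<noteq> 0 \<longrightarrow> i \<in> I \<and> j \<in> I)"

definition LL where "LL = {g * Lin I \<tau> * h | g h I \<tau>. g \<in> Em B \<and> h \<in> Em B \<and> lin_data I \<tau>}"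

lemma BI: "(\<And>i. Polynomial.coeff p i \<in> R) \<Longrightarrow> poly p t \<in> B"
  unfolding B_def by blast

lemma RB: "R \<subseteq> B"
proof
  fix r assume "r \<in> R"
  then have "poly [:r:] t \<in> B" using sR by (intro BI) (auto simp: coeff_pCons split: nat.split)
  then show "r \<in> B" by simp
qed

lemma tB: "t \<in> B"
  using BI[of "[:0, 1:]"] sR by (auto simp: coeff_pCons split: nat.split)

lemma sB: "sring B"
  unfolding sring_def
proof (intro conjI ballI)
  show "0 \<in> B" "1 \<in> B" using RB sR by auto
next
  fix a b assume "a \<in> B" "b \<in> B"
  then obtain p q where pq: "a = poly p t" "b = poly q t" "\<forall>i. Polynomial.coeff p i \<in> R" "\<forall>i. Polynomial.coeff q i \<in> R"
    unfolding B_def by blast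
  show "a + b \<in> B" "a * b \<in> B"
    using BI[of "p + q"] BI[of "p * q"] pq sR by (auto simp: coeff_mult)
next
  fix a assume "a \<in> B"
  then obtain p where "a = poly p t" "\<forall>i. Polynomial.coeff p i \<in> R" unfolding B_def by blast
  then show "- a \<in> B" using BI[of "- p"] sR by auto
qed

lemma pr_compl: "pr (- I) = 1 - pr I"
  by (rule cfm_eqI) (auto simp: pr.rep_eq ent_one)

lemma lin_dataD:
  assumes "lin_data I \<tau>"
  shows "finite I" "mat_over R \<tau>" "pr I * \<tau> = \<tau>" "\<tau> * pr I = \<tau>"
proof -
  have "ent \<tau> i j = 0" if "i \<notin> I \<or> j \<notin> I" for i j using assms that unfolding lin_data_def by blast
  then show "pr I * \<tau> = \<tau>" "\<tau> * pr I = \<tau>" by (auto intro!: cfm_eqI)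
qed (use assms lin_data_def in blast)+

lemma fin_lin_data:
  assumes "lin_data I \<tau>" shows "fin \<tau>"
proof -
  obtain n where "I \<subseteq> {..<n}" using lin_dataD(1)[OF assms] finite_nat_iff_bounded by blast
  then have "ent \<tau> i j = 0" if "n \<le> i \<or> n \<le> j" for i j
    using assms that unfolding lin_data_def by (meson lessThan_iff not_le subsetD)
  then show ?thesis unfolding fin_def by blast
qed

lemma sc_comm: "sc a * M = M * sc (a::'a)"
  by (rule cfm_eqI) (simp add: mult.commute)

lemma mat_over_RB: "mat_over R M \<Longrightarrow> mat_over B M"
  using RB mat_over_mono by blast

lemma Lin_Fin1: assumes "lin_data I \<tau>" shows "Lin I \<tau> \<in> Fin1 B"
proof -
  have "Lin I \<tau> = 1 + (sc t * pr I - \<tau> - pr I)" by (simp add: Lin_def pr_compl)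
  moreover have "mat_over B (sc t * pr I - \<tau> - pr I)"
    by (intro mat_over_simps sB tB mat_over_RB lin_dataD[OF assms])
  moreover have "fin (sc t * pr I - \<tau> - pr I)"
    using lin_dataD(1)[OF assms] fin_lin_data[OF assms] by simp
  ultimately show ?thesis using Fin1_add[OF sB] by metis
qed

lemma Lin_mult:
  assumes "lin_data I \<tau>" "J \<inter> I = {}"
  shows "Lin I \<tau> * pr J = pr J" "pr J * Lin I \<tau> = pr J"
proof -
  have J: "I \<inter> J = {}" "- I \<inter> J = J" "J \<inter> - I = J" using assms by auto
  have "\<tau> * pr J = \<tau> * (pr I * pr J)" "pr J * \<tau> = pr J * pr I * \<tau>"
    using lin_dataD[OF assms(1)] by (metis mult.assoc)+
  then have z: "\<tau> * pr J = 0" "pr J * \<tau> = 0" using assms J by simp_all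
  show "Lin I \<tau> * pr J = pr J"
    by (simp add: Lin_def left_diff_distrib distrib_right z J mult.assoc)
  have "pr J * (sc t * pr I) = sc t * (pr J * pr I)" by (metis mult.assoc sc_comm)
  then show "pr J * Lin I \<tau> = pr J"
    using assms by (simp add: Lin_def right_diff_distrib distrib_left z J)
qed

lemma ent_Lin: "ent (Lin I \<tau>) i j = (if i = j then (if i \<in> I then t else 1) else 0) - ent \<tau> i j"
  by (simp add: Lin_def pr.rep_eq sc.rep_eq)

text \<open>The pencil is monic of degree one in t, so multiplication by it raises the highest
  degree occurring in the block; a matrix constant in t is a multiple only if it is zero. This is
  uniqueness of the remainder.\<close>

lemma Lin_inj:
  assumes L: "lin_data I \<tau>" and M: "mat_over B M" and u: "mat_over R u" "pr I * u = u"
    and eq: "u = Lin I \<tau> * M"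
  shows "u = 0 \<and> M = 0"
proof -
  have I: "finite I" using lin_dataD[OF L] by blast
  have "pr (- I) * M = pr (- I) * Lin I \<tau> * M" using Lin_mult[OF L, of "- I"] by simp
  also have "\<dots> = pr (- I) * (pr I * u)" using eq u by (simp add: mult.assoc)
  also have "\<dots> = 0" by (rule cfm_eqI) simp
  finally have out0: "pr (- I) * M = 0" .
  have out: "ent M i j = 0" if "i \<notin> I" for i j
    using arg_cong[OF out0, of "\<lambda>A. ent A i j"] that by simp
  have *: "ent u i j = t * ent M i j - (\<Sum>k\<in>I. ent \<tau> i k * ent M k j)" if "i \<in> I" for i j
  proof -
    have "ent u i j = ent (sc t * pr I * M - \<tau> * M + pr (- I) * M) i j"
      using eq by (simp add: Lin_def distrib_right left_diff_distrib)
    also have "\<dots> = t * ent M i j - ent (\<tau> * M) i j" using that by (simp add: mult.assoc)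
    also have "ent (\<tau> * M) i j = (\<Sum>k\<in>I. ent \<tau> i k * ent M k j)"
      using I L by (intro ent_times) (auto simp: lin_data_def)
    finally show ?thesis .
  qed
  have main: "ent M i j = 0 \<and> ent u i j = 0" if i: "i \<in> I" for i j
  proof -
    have "\<forall>k. \<exists>p. ent M k j = poly p t \<and> (\<forall>n. Polynomial.coeff p n \<in> R)"
      using M unfolding mat_over_def B_def by blast
    then obtain p where p: "\<And>k. ent M k j = poly (p k) t" "\<And>k n. Polynomial.coeff (p k) n \<in> R" by metis
    have eqp: "pCons 0 (p k) - (\<Sum>l\<in>I. [:ent \<tau> k l:] * p l) - [:ent u k j:] = 0" if "k \<in> I" for k
    proof (rule transcendental)
      show "poly (pCons 0 (p k) - (\<Sum>l\<in>I. [:ent \<tau> k l:] * p l) - [:ent u k j:]) t = 0"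
        using *[OF that, of j] by (simp add: p(1) poly_sum)
      show "Polynomial.coeff (pCons 0 (p k) - (\<Sum>l\<in>I. [:ent \<tau> k l:] * p l) - [:ent u k j:]) n \<in> R" for n
        using p(2) sR u(1) lin_dataD(2)[OF L]
        by (auto simp: coeff_sum coeff_pCons mat_over_def split: nat.split intro!: sringD(6) sring_sum)
    qed
    have p0: "p k = 0" if "k \<in> I" for k
    proof (rule ccontr)
      assume "p k \<noteq> 0"
      \<comment> \<open>Among the nonzero entries one of highest degree d is selected; its
        contribution t p has a term of degree d + 1 that neither \<tau> nor u can cancel.\<close>
      define S where "S = {l\<in>I. p l \<noteq> 0}"
      have S: "finite S" "S \<noteq> {}" using I that \<open>p k \<noteq> 0\<close> by (auto simp: S_def)
      have "Max ((\<lambda>l. Polynomial.degree (p l)) ` S) \<in> (\<lambda>l. Polynomial.degree (p l)) ` S"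
        using S by (intro Max_in) auto
      then obtain l where l: "l \<in> S" "Polynomial.degree (p l) = Max ((\<lambda>l. Polynomial.degree (p l)) ` S)" by force
      have l_max: "Polynomial.degree (p l') \<le> Polynomial.degree (p l)" if "l' \<in> S" for l'
        unfolding l(2) using S(1) that by (intro Max_ge) auto
      let ?d = "Polynomial.degree (p l)"
      have "Polynomial.coeff (p l') (Suc ?d) = 0" if "l' \<in> I" for l'
        using l_max[of l'] that by (cases "p l' = 0") (auto simp: S_def intro!: coeff_eq_0)
      then have "(\<Sum>l'\<in>I. ent \<tau> l l' * Polynomial.coeff (p l') (Suc ?d)) = 0" by (intro sum.neutral) auto
      then have top: "Polynomial.coeff (pCons 0 (p l) - (\<Sum>l'\<in>I. [:ent \<tau> l l':] * p l') - [:ent u l j:]) (Suc ?d) = Polynomial.coeff (p l) ?d"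
        by (simp add: coeff_sum coeff_pCons)
      have "l \<in> I" using l(1) by (simp add: S_def)
      from top[unfolded eqp[OF this]] have "Polynomial.coeff (p l) ?d = 0" by simp
      then show False using l(1) by (simp add: S_def)
    qed
    then have "ent M k j = 0" if "k \<in> I" for k using that p(1) by simp
    then show ?thesis using *[OF i, of j] i by simp
  qed
  have "u = 0"
  proof (rule cfm_eqI)
    fix i j show "ent u i j = ent 0 i j"
      using main[of i j] arg_cong[OF u(2), of "\<lambda>A. ent A i j"] by (cases "i \<in> I") auto
  qed
  moreover have "M = 0"
  proof (rule cfm_eqI)
    fix i j show "ent M i j = ent 0 i j" using main[of i j] out[of i j] by (cases "i \<in> I") auto
  qed
  ultimately show ?thesis by simp
qed

text \<open>Modulo the pencil, t acts on the block as \<tau>. The divisible matrices are closed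
  under addition and multiplication by t and contain the constants, hence all polynomial matrices of
  finite size.\<close>

lemma Lin_division:
  assumes L: "lin_data I \<tau>" and G: "fin G" "mat_over B G"
  shows "\<exists>u M. mat_over R u \<and> pr I * u = u \<and> mat_over B M \<and> G = u + Lin I \<tau> * M" (is "?P G")
    and "\<exists>u M. mat_over R u \<and> u * pr I = u \<and> mat_over B M \<and> G = u + M * Lin I \<tau>" (is "?Q G")
proof -
  \<comment> \<open>This identity and the next replace t by \<tau> modulo right, respectively left,
    multiples of the pencil.\<close>
  have tpr: "sc t * pr I = Lin I \<tau> * pr I + \<tau>"
    using lin_dataD[OF L] by (simp add: Lin_def algebra_simps)
  have tpr': "sc t * pr I = pr I * Lin I \<tau> + \<tau>"
    using lin_dataD[OF L] by (simp add: Lin_def algebra_simps pr_compl sc_comm) (simp flip: mult.assoc)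
  have P_add: "?P (G + H)" if GH: "?P G" "?P H" for G H
  proof -
    obtain u M u' M' where *: "mat_over R u" "pr I * u = u" "mat_over B M" "G = u + Lin I \<tau> * M"
      "mat_over R u'" "pr I * u' = u'" "mat_over B M'" "H = u' + Lin I \<tau> * M'" using GH by blast
    show ?thesis
      by (rule exI[of _ "u + u'"], rule exI[of _ "M + M'"]) (use * sR sB in \<open>simp add: algebra_simps\<close>)
  qed
  have Q_add: "?Q (G + H)" if GH: "?Q G" "?Q H" for G H
  proof -
    obtain u M u' M' where *: "mat_over R u" "u * pr I = u" "mat_over B M" "G = u + M * Lin I \<tau>"
      "mat_over R u'" "u' * pr I = u'" "mat_over B M'" "H = u' + M' * Lin I \<tau>" using GH by blast
    show ?thesis
      by (rule exI[of _ "u + u'"], rule exI[of _ "M + M'"]) (use * sR sB in \<open>simp add: algebra_simps\<close>)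
  qed
  have P_t: "?P (sc t * G)" if GH: "?P G" for G
  proof -
    obtain u M where *: "mat_over R u" "pr I * u = u" "mat_over B M" "G = u + Lin I \<tau> * M" using GH by blast
    have "sc t * u = (sc t * pr I) * u" using *(2) by (simp add: mult.assoc)
    also have "\<dots> = \<tau> * u + Lin I \<tau> * u" using *(2) by (simp add: tpr distrib_right mult.assoc)
    finally have "sc t * G = \<tau> * u + Lin I \<tau> * (u + sc t * M)"
      by (simp add: *(4) distrib_left) (simp add: sc_comm mult.assoc)
    moreover have "pr I * (\<tau> * u) = \<tau> * u" using lin_dataD(3)[OF L] by (simp flip: mult.assoc)
    moreover have "mat_over R (\<tau> * u)" "mat_over B (u + sc t * M)"
      using * lin_dataD(2)[OF L] sR sB tB by (auto simp: mat_over_RB)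
    ultimately show ?thesis by blast
  qed
  have Q_t: "?Q (sc t * G)" if GH: "?Q G" for G
  proof -
    obtain u M where *: "mat_over R u" "u * pr I = u" "mat_over B M" "G = u + M * Lin I \<tau>" using GH by blast
    have "sc t * u = u * (sc t * pr I)" using *(2) by (simp add: sc_comm[of t] mult.assoc) (metis mult.assoc sc_comm *(2))
    also have "\<dots> = u * \<tau> + u * Lin I \<tau>" using *(2) by (simp add: tpr' distrib_left flip: mult.assoc)
    finally have "sc t * G = u * \<tau> + (u + sc t * M) * Lin I \<tau>"
      by (simp add: *(4) distrib_left distrib_right mult.assoc)
    moreover have "u * \<tau> * pr I = u * \<tau>" using lin_dataD(4)[OF L] by (simp add: mult.assoc)
    moreover have "mat_over R (u * \<tau>)" "mat_over B (u + sc t * M)"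
      using * lin_dataD(2)[OF L] sR sB tB by (auto simp: mat_over_RB)
    ultimately show ?thesis by blast
  qed
  have PR: "?P G" "?Q G" if "mat_over R G" for G
  proof -
    have "G = pr I * G + Lin I \<tau> * (pr (- I) * G)" "G = G * pr I + G * pr (- I) * Lin I \<tau>"
    proof -
      have "Lin I \<tau> * pr (- I) = pr (- I)" "pr (- I) * Lin I \<tau> = pr (- I)"
        using Lin_mult[OF L, of "- I"] by auto
      then have "Lin I \<tau> * (pr (- I) * G) = pr (- I) * G" "G * pr (- I) * Lin I \<tau> = G * pr (- I)"
        by (simp_all add: mult.assoc) (simp flip: mult.assoc)
      then show "G = pr I * G + Lin I \<tau> * (pr (- I) * G)" "G = G * pr I + G * pr (- I) * Lin I \<tau>"
        by (simp_all add: pr_compl algebra_simps)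
    qed
    moreover have "mat_over R (pr I * G)" "mat_over R (G * pr I)" "mat_over B (pr (- I) * G)" "mat_over B (G * pr (- I))"
      using that sR by (auto intro!: mat_over_RB)
    moreover have "pr I * (pr I * G) = pr I * G" "G * pr I * pr I = G * pr I"
      by (simp_all flip: mult.assoc) (simp add: mult.assoc)
    ultimately show "?P G" "?Q G" by metis+
  qed
  have ue: "?P (ue i j (poly p t)) \<and> ?Q (ue i j (poly p t))" if "\<forall>n. Polynomial.coeff p n \<in> R" for i j p
    using that
  proof (induction p)
    case 0
    then show ?case using PR[of 0] sR by simp
  next
    case (pCons a p)
    have "\<forall>n. Polynomial.coeff p n \<in> R" using pCons.prems by (metis coeff_pCons_Suc)
    then have IH: "?P (ue i j (poly p t))" "?Q (ue i j (poly p t))" using pCons.IH by blast+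
    have a: "a \<in> R" using pCons.prems by (metis coeff_pCons_0)
    have eq: "ue i j (poly (pCons a p) t) = ue i j a + sc t * ue i j (poly p t)"
      by (rule cfm_eqI) (simp add: ue.rep_eq sc.rep_eq)
    show ?case unfolding eq using a sR
      by (intro conjI P_add Q_add P_t Q_t IH PR) auto
  qed
  obtain n where n: "\<And>i j. n \<le> i \<or> n \<le> j \<Longrightarrow> ent G i j = 0" using G(1) unfolding fin_def by blast
  have all: "?P (ue i j (ent G i j)) \<and> ?Q (ue i j (ent G i j))" for i j
    using mat_overD[OF G(2), of i j] ue unfolding B_def by auto
  have zero: "?P 0" "?Q 0" using sR by (intro PR; simp)+
  have "?P (\<Sum>i<n. \<Sum>j<n. ue i j (ent G i j))" 
    by (rule sum_closed_pred[of ?P, OF zero(1) P_add], assumption, assumption,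
        rule sum_closed_pred[of ?P, OF zero(1) P_add], assumption, assumption, rule all[THEN conjunct1])
  then show "?P G" using fin_decompose[of n G, OF n] by metis
  have "?Q (\<Sum>i<n. \<Sum>j<n. ue i j (ent G i j))" 
    by (rule sum_closed_pred[of ?Q, OF zero(2) Q_add], assumption, assumption,
        rule sum_closed_pred[of ?Q, OF zero(2) Q_add], assumption, assumption, rule all[THEN conjunct2])
  then show "?Q G" using fin_decompose[of n G, OF n] by metis
qed

end

section \<open>Monic diagonal factors become linear pencils\<close>

context polynomial_extension
begin

lemma LL_mult:
  assumes "g \<in> Em B" "h \<in> Em B" "Y \<in> LL" shows "g * Y * h \<in> LL"
proof -
  obtain g' h' I \<tau> where *: "g' \<in> Em B" "h' \<in> Em B" "lin_data I \<tau>" "Y = g' * Lin I \<tau> * h'"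
    using assms(3) unfolding LL_def by blast
  have "g * Y * h = (g * g') * Lin I \<tau> * (h' * h)" by (simp add: *(4) mult.assoc)
  then show ?thesis unfolding LL_def using * assms by (blast intro: Em_times)
qed

lemma Lin_LL: "lin_data I \<tau> \<Longrightarrow> Lin I \<tau> \<in> LL"
  unfolding LL_def by (simp, rule exI[of _ 1], rule exI[of _ 1]) (auto intro: Em_one)

text \<open>Horner's scheme: one step replaces the diagonal entry \<open>c + t q\<close> at \<open>k\<close> by \<open>t\<close> at \<open>k\<close> and
  \<open>q\<close> at a fresh index \<open>l\<close>.\<close>
lemma horner_LL:
  assumes "\<And>i. Polynomial.coeff p i \<in> R" "Polynomial.lead_coeff p = 1" "Polynomial.degree p \<noteq> 0"
    and "finite I" "k \<notin> I" "mat_over R \<sigma>" "\<And>i j. ent \<sigma> i j \<noteq> 0 \<Longrightarrow> i \<in> insert k I \<and> j \<in> insert k I"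
  shows "sc t * pr I - \<sigma> + ue k k (poly p t) + pr (- insert k I) \<in> LL"
  using assms
proof (induction p arbitrary: I k \<sigma>)
  case 0
  then show ?case by simp
next
  case (pCons c q)
  have q: "Polynomial.coeff q i \<in> R" for i using pCons.prems(1)[of "Suc i"] by simp
  have c: "c \<in> R" using pCons.prems(1)[of 0] by simp
  have q0: "q \<noteq> 0" using pCons.prems(3) by (auto split: if_splits)
  have lead: "Polynomial.lead_coeff q = 1" using pCons.prems(2) q0 by simp
  have \<sigma>: "ent \<sigma> i j = 0" if "i \<notin> insert k I \<or> j \<notin> insert k I" for i j
    using pCons.prems(7)[of i j] that by blast
  show ?case
  proof (cases "Polynomial.degree q = 0")
    case True
    then obtain a where "q = [:a:]" using degree_eq_zeroE by blast
    then have "q = 1" using lead by simp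
    then have "sc t * pr I - \<sigma> + ue k k (poly (pCons c q) t) + pr (- insert k I) = Lin (insert k I) (\<sigma> - ue k k c)"
      using pCons.prems(5) by (intro cfm_eqI) (auto simp: ent_Lin ue.rep_eq pr.rep_eq sc.rep_eq)
    moreover have "lin_data (insert k I) (\<sigma> - ue k k c)"
      unfolding lin_data_def using pCons.prems(4,6) \<sigma> c sR by (auto simp: ue.rep_eq split: if_splits)
    ultimately show ?thesis using Lin_LL by metis
  next
    case False
    obtain l where l: "l \<notin> insert k I" using pCons.prems(4) by (metis ex_new_if_finite finite_insert infinite_UNIV_nat)
    \<comment> \<open>Contains the constant term c only; the missing entry
      \<open>t * poly q t\<close> is the product to be split by \<open>higman_step\<close>.\<close>
    define N where "N = sc t * pr I - \<sigma> + ue k k c + pr (- insert k I)"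
    have entN: "ent N i j = (if i = j then (if i \<in> I then t else if i = k then c else 1) else 0) - ent \<sigma> i j" for i j
      using pCons.prems(5) by (auto simp: N_def ue.rep_eq pr.rep_eq sc.rep_eq)
    have N: "ent (N - 1) l j = 0" "ent (N - 1) j l = 0" for j
      using l \<sigma> by (auto simp: entN ent_one)
    have lk: "k \<noteq> l" using l by auto
    obtain g h where gh: "g \<in> Em B" "h \<in> Em B"
      "N + ue k k (t * poly q t) = g * (N - ue k l t + ue l k (poly q t)) * h"
      using higman_step[OF sB N lk lk tB BI[OF q]] by blast
    \<comment> \<open>The splitting leaves -t at (k, l) and q at (l, k); exchanging columns k and l
      with a sign puts t and q on the diagonal.\<close>
    define \<rho> where "\<rho> = pr (- {k, l}) + ue k l 1 - ue l k (1::'a)"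
    have \<rho>: "\<rho> \<in> Em B" using rotation_Em[OF sB lk] by (simp add: \<rho>_def)
    then obtain \<rho>' where \<rho>': "\<rho>' \<in> Em B" "\<rho> * \<rho>' = 1" using Em_inverse[OF sB] by blast
    \<comment> \<open>The constants after the column exchange: column k of \<sigma>, corrected by c,
      has moved to l, and the former diagonal 1 at l now sits at (l, k).\<close>
    define \<sigma>' where "\<sigma>' = \<sigma> * pr I + (\<sigma> - ue k k c) * ue k l 1 + ue l k 1"
    have ent\<sigma>': "ent \<sigma>' i j = (if j \<in> I then ent \<sigma> i j else 0)
        + (if j = l then ent \<sigma> i k - (if i = k then c else 0) else 0) + (if i = l \<and> j = k then 1 else 0)" for i j
      by (simp add: \<sigma>'_def ue.rep_eq)
    have "(N - ue k l t + ue l k (poly q t)) * \<rho>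
        = sc t * pr (insert k I) - \<sigma>' + ue l l (poly q t) + pr (- insert l (insert k I))" (is "?M * \<rho> = ?X")
    proof (rule cfm_eqI)
      fix i j
      have "ent (?M * \<rho>) i j = (if j = k then - ent ?M i l else if j = l then ent ?M i k else ent ?M i j)"
        using lk by (simp add: \<rho>_def right_diff_distrib distrib_left del: ent_simps(2) add: plus_cfm.rep_eq)
      also have "\<dots> = ent ?X i j"
        using lk l \<sigma>[of i l] \<sigma>[of l j] \<sigma>[of l k] \<sigma>[of l l] \<sigma>[of i j] pCons.prems(5)
        by (auto simp: entN ent\<sigma>' ue.rep_eq pr.rep_eq sc.rep_eq)
      finally show "ent (?M * \<rho>) i j = ent ?X i j" .
    qed
    moreover have "?X \<in> LL"
    proof (rule pCons.IH)
      show "finite (insert k I)" "l \<notin> insert k I" using pCons.prems(4) l by auto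
      show "mat_over R \<sigma>'" unfolding \<sigma>'_def using pCons.prems(6) sR c by simp
      show "\<And>i j. ent \<sigma>' i j \<noteq> 0 \<Longrightarrow> i \<in> insert l (insert k I) \<and> j \<in> insert l (insert k I)"
        using \<sigma> by (auto simp: ent\<sigma>' split: if_splits)
    qed (use q lead False in auto)
    ultimately have "?M * \<rho> \<in> LL" by simp
    then have "g * (?M * \<rho>) * (\<rho>' * h) \<in> LL" using gh \<rho>' by (intro LL_mult Em_times) auto
    moreover have "g * (?M * \<rho>) * (\<rho>' * h) = g * ?M * (\<rho> * \<rho>') * h" by (simp only: mult.assoc)
    ultimately have "N + ue k k (t * poly q t) \<in> LL" using gh(3) \<rho>'(2) by simp
    moreover have "sc t * pr I - \<sigma> + ue k k (poly (pCons c q) t) + pr (- insert k I) = N + ue k k (t * poly q t)"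
      by (simp add: N_def)
    ultimately show ?thesis by (simp only:)
  qed
qed

text \<open>An elementary conjugation parks the monic polynomial at a fresh index k, where the
  pencil is trivial. Pushing the pencil through the conjugating matrices needs division with
  remainder of the row \<open>r\<close>; what is left is a case of \<open>horner_LL\<close>.\<close>

lemma LL_absorb:
  assumes Y: "Y \<in> LL" and Q: "Q \<in> GLm B" "Q' \<in> GLm B" "Q * Q' = 1" "Q' * Q = 1"
    and p: "\<And>i. Polynomial.coeff p i \<in> R" "Polynomial.lead_coeff p = 1"
  shows "Y * (Q * mum (poly p t) * Q') \<in> LL"
proof (cases "Polynomial.degree p = 0")
  case True
  then obtain a where "p = [:a:]" using degree_eq_zeroE by blast
  then have "p = 1" using p by simp
  then show ?thesis using Y Q by simp
next
  case False
  obtain g h I \<tau> where gh: "g \<in> Em B" "h \<in> Em B" "lin_data I \<tau>" "Y = g * Lin I \<tau> * h"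
    using Y unfolding LL_def by blast
  obtain h' where h': "h' \<in> Em B" "h * h' = 1" "h' * h = 1" using Em_inverse[OF sB gh(2)] by blast
  define f where "f = poly p t"
  have fB: "f \<in> B" unfolding f_def using BI p by blast
  define L where "L = Lin I \<tau>"
  define H where "H = h * Q"
  define H' where "H' = Q' * h'"
  have H: "H \<in> GLm B" "H' \<in> GLm B" using Q gh h' Em_GLm[OF sB] sB by (auto simp: H_def H'_def)
  have HH: "H * H' = 1" "H' * H = 1" using inverse_times[OF h'(2) Q(3)] inverse_times[OF Q(4) h'(3)] by (simp_all add: H_def H'_def)
  have finH: "fin (H - 1)" "fin (H' - 1)" "mat_over B H" "mat_over B H'" using H GLm_Fin1 Fin1D by blast+
  have L1: "fin (L - 1)" "mat_over B L" using Lin_Fin1[OF gh(3)] by (auto simp: L_def Fin1_def)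
  obtain n where n: "\<And>i j. n \<le> i \<or> n \<le> j \<Longrightarrow> ent (H - 1) i j = 0" "\<And>i j. n \<le> i \<or> n \<le> j \<Longrightarrow> ent (H' - 1) i j = 0"
    using finE[OF finH(1,2)] by blast
  obtain n' where n': "I \<subseteq> {..<n'}" using lin_dataD(1)[OF gh(3)] finite_nat_iff_bounded by blast
  \<comment> \<open>Outside the block I, so that L is trivial at k, and outside the blocks of
    \<open>H\<close> and \<open>H'\<close>, so that \<open>c\<close> and \<open>r\<close> square to
    zero.\<close>
  define k where "k = Suc (max n n')"
  have k: "k \<noteq> 0" "n \<le> k" "k \<notin> I" using n' by (auto simp: k_def)
  have zk: "ent H k 0 = 0" "ent H' 0 k = 0"
    using n(1)[of k 0] n(2)[of 0 k] k by (auto simp: ent_one)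
  define c where "c = H * ue 0 k 1"
  define r where "r = ue k 0 1 * H'"
  define d where "d = ue k k (1::'a)"
  have ent_c: "ent c i j = (if j = k then ent H i 0 else 0)" for i j by (simp add: c_def)
  have ent_r: "ent r i j = (if i = k then ent H' 0 j else 0)" for i j by (simp add: r_def)
  have "r * c = ue k 0 1 * (H' * H) * ue 0 k 1" by (simp only: c_def r_def mult.assoc)
  then have rc: "r * c = d" using HH by (simp add: ue_ue d_def)
  have cc: "c * c = 0" by (rule cfm_eqI) (subst ent_times[of "{k}"], auto simp: ent_c zk)
  have rr: "r * r = 0" by (rule cfm_eqI) (subst ent_times[of "{k}"], auto simp: ent_r zk)
  have cd: "c * d = c" "d * r = r" "d * c = 0" "r * d = 0" "d * d = d"
    by (rule cfm_eqI; auto simp: d_def ent_c ent_r zk ue.rep_eq)+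
  have fo: "mat_over B c" "mat_over B r" "fin c" "fin r"
    unfolding c_def r_def using finH sB by (auto intro: fin_Fin1_times)
  have z: "r * (c * z) = d * z" "c * (c * z) = 0" "r * (r * z) = 0" "c * (d * z) = c * z" "d * (r * z) = r * z"
    "d * (c * z) = 0" "r * (d * z) = 0" "d * (d * z) = d * z" for z
    using rc cc rr cd by (simp_all flip: mult.assoc)
  define \<phi> where "\<phi> = sc (f - 1)"
  have \<phi>_comm: "M * (\<phi> * N) = \<phi> * (M * N)" for M N
    unfolding \<phi>_def by (metis mult.assoc sc_comm)
  have HdH: "H * mum f * H' = 1 + \<phi> * (c * r)"
  proof -
    have "ue 0 0 (f - 1) = \<phi> * (ue 0 k 1 * ue k 0 1)" by (simp add: ue_ue \<phi>_def, rule cfm_eqI) (simp add: ue.rep_eq sc.rep_eq ent_one)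
    then have "H * ue 0 0 (f - 1) * H' = \<phi> * (c * r)"
      unfolding c_def r_def \<phi>_def by (simp only:) (simp only: mult.assoc sc_comm)
    then show ?thesis using HH by (simp add: mum_def distrib_left distrib_right)
  qed
  \<comment> \<open>Since \<open>r * c = d\<close>, this triple product of block-elementary matrices
    conjugates the idempotent \<open>c * r\<close> into the coordinate idempotent
    \<open>d\<close>.\<close>
  define \<epsilon> where "\<epsilon> = (1 + c) * (1 - r) * (1 + c)"
  define \<epsilon>' where "\<epsilon>' = (1 - c) * (1 + r) * (1 - c)"
  have \<epsilon>'_eq: "\<epsilon>' = 1 - c + r - d - c * r"
    by (simp add: \<epsilon>'_def algebra_simps rc cc rr cd z)
  have "c * r * \<epsilon>' = - c" "\<epsilon>' * d = - c"
    unfolding \<epsilon>'_eq by (simp_all add: algebra_simps rc cc rr cd z)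
  then have crd: "c * r * \<epsilon>' = \<epsilon>' * d" by simp
  have E: "1 + c \<in> Em B" "1 + (- c) \<in> Em B"
    by (rule Em_block[of _ _ "- {k}"]; use fo sB zk in \<open>auto simp: ent_c split: if_splits\<close>)+
  have E': "1 + r \<in> Em B" "1 + (- r) \<in> Em B"
    by (rule Em_block[of _ _ "{k}"]; use fo sB zk in \<open>auto simp: ent_r split: if_splits\<close>)+
  have \<epsilon>E: "\<epsilon> \<in> Em B" using E E' by (simp add: \<epsilon>_def)
  have \<epsilon>\<epsilon>: "\<epsilon>' * \<epsilon> = 1"
    unfolding \<epsilon>'_eq \<epsilon>_def by (simp add: algebra_simps rc cc rr cd z)
  define \<delta> where "\<delta> = 1 + \<phi> * d"
  have "H * mum f * H' * \<epsilon>' = \<epsilon>' * \<delta>"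
  proof -
    have "H * mum f * H' * \<epsilon>' = \<epsilon>' + \<phi> * (c * r * \<epsilon>')" unfolding HdH by (simp add: distrib_right mult.assoc)
    also have "\<dots> = \<epsilon>' + \<epsilon>' * (\<phi> * d)" unfolding crd \<phi>_def by (metis mult.assoc sc_comm)
    finally show ?thesis by (simp add: \<delta>_def distrib_left)
  qed
  then have "H * mum f * H' * (\<epsilon>' * \<epsilon>) = \<epsilon>' * \<delta> * \<epsilon>" by (simp flip: mult.assoc)
  then have HdH2: "H * mum f * H' = \<epsilon>' * \<delta> * \<epsilon>" using \<epsilon>\<epsilon> by simp
  have Ld: "L * d = d" "d * L = d"
  proof -
    have "d = pr {k}" by (rule cfm_eqI) (auto simp: d_def ue.rep_eq pr.rep_eq)
    then show "L * d = d" "d * L = d" using Lin_mult[OF gh(3), of "{k}"] k by (auto simp: L_def)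
  qed
  have cL: "c * L = c" and Lr: "L * r = r"
    using Ld cd by (metis mult.assoc)+
  \<comment> \<open>Division moves L across \<open>1 + r\<close>: the result is
    \<open>(1 + r1) * (L + r0)\<close>, where the constant remainder \<open>r0\<close> can be
    incorporated into the pencil.\<close>
  obtain u M where uM: "mat_over R u" "u * pr I = u" "mat_over B M" "r = u + M * L"
    using Lin_division(2)[OF gh(3) fo(4) fo(2)] by (auto simp: L_def)
  define r0 where "r0 = d * u"
  define r1 where "r1 = d * M"
  have r01: "r = r0 + r1 * L" using uM(4) cd(2) by (simp add: r0_def r1_def mult.assoc) (metis distrib_left)
  have r0: "mat_over R r0" "r0 * pr I = r0" using uM sR by (auto simp: r0_def d_def mult.assoc)
  have "pr I * d = 0" using k by (intro cfm_eqI) (auto simp: d_def ue.rep_eq pr.rep_eq)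
  then have r0d: "r0 * d = 0" using r0(2) by (metis mult.assoc mult_zero_right)
  have dr: "d * r0 = r0" "d * r1 = r1" using cd by (simp_all add: r0_def r1_def z)
  have "r * d = r0 * d + r1 * (L * d)" using r01 by (simp add: distrib_right mult.assoc)
  then have r1d: "r1 * d = 0" using Ld cd r0d by simp
  have r1r0: "r1 * r0 = 0" using r1d dr by (metis mult.assoc mult_zero_left)
  \<comment> \<open>The quotient of \<open>Lin_division\<close> carries no finiteness claim; it is
    recovered from that of \<open>r1 * L\<close>, as L is the identity in far columns.\<close>
  have r1L_fin: "fin r1"
  proof -
    have "r1 * L = r1 + r1 * (L - 1)" by (simp add: algebra_simps)
    have "\<exists>m. \<forall>j\<ge>m. ent (r1 * L) k j = 0"
    proof -
      have "fin r0" using r0(2) dr(1) lin_dataD(1)[OF gh(3)] unfolding fin_def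
      proof -
        have "ent r0 i j = 0" if "k < i \<or> k < j" for i j
          using arg_cong[OF r0(2), of "\<lambda>A. ent A i j"] arg_cong[OF dr(1), of "\<lambda>A. ent A i j"] that n'
          by (auto simp: d_def k_def split: if_splits)
        then show "\<exists>n. \<forall>i j. n \<le> i \<or> n \<le> j \<longrightarrow> ent r0 i j = 0" by (intro exI[of _ "Suc k"]) auto
      qed
      then have "fin (r - r0)" using fo by simp
      then have "fin (r1 * L)" using r01 by simp
      then show ?thesis unfolding fin_def by blast
    qed
    then obtain m where m: "\<And>j. m \<le> j \<Longrightarrow> ent (r1 * L) k j = 0" by blast
    have "ent r1 i j = 0" if "Suc (max m k) \<le> i \<or> Suc (max m k) \<le> j" for i j
    proof (cases "i = k")
      case False
      then show ?thesis using arg_cong[OF dr(2), of "\<lambda>A. ent A i j"] by (simp add: d_def)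
    next
      case True
      then have j: "j \<notin> I" "m \<le> j" using that n' by (auto simp: k_def)
      have "r1 * L * pr {j} = r1 * pr {j}" using Lin_mult(1)[OF gh(3), of "{j}"] j by (simp add: L_def mult.assoc)
      from arg_cong[OF this, of "\<lambda>A. ent A k j"] show ?thesis using m[OF j(2)] True by simp
    qed
    then show ?thesis unfolding fin_def by blast
  qed
  have "1 + r1 \<in> Em B"
  proof (rule Em_block[of _ _ "{k}"])
    show "mat_over B r1" using uM sB by (simp add: r1_def d_def)
    show "i \<in> {k} \<and> j \<notin> {k}" if "ent r1 i j \<noteq> 0" for i j
      using arg_cong[OF dr(2), of "\<lambda>A. ent A i j"] arg_cong[OF r1d, of "\<lambda>A. ent A i j"] that
      by (auto simp: d_def split: if_splits)
  qed (use sB r1L_fin in auto)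
  moreover have "1 + (- (L * c)) \<in> Em B"
  proof (rule Em_block[of _ _ "- {k}"])
    show "mat_over B (- (L * c))" using L1 fo sB by simp
    show "fin (- (L * c))" using L1 fo by (simp add: fin_Fin1_times)
    have Lc: "d * (L * c) = 0" "L * c * d = L * c"
      using Ld cd by (metis mult.assoc, simp add: mult.assoc)
    show "i \<in> - {k} \<and> j \<notin> - {k}" if "ent (- (L * c)) i j \<noteq> 0" for i j
      using that arg_cong[OF Lc(1), of "\<lambda>A. ent A i j"] arg_cong[OF Lc(2), of "\<lambda>A. ent A i j"]
      by (auto simp: d_def split: if_splits)
  qed (use sB in auto)
  moreover have "1 + (- (sc f * c)) \<in> Em B"
    by (rule Em_block[of _ _ "- {k}"]) (use fo sB zk fB in \<open>auto simp: ent_c split: if_splits\<close>)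
  \<comment> \<open>The pencil bordered by the polynomial at k, with \<sigma> =
    \<open>\<tau> - r0\<close>.\<close>
  moreover have "(L + r0) * \<delta> \<in> LL"
  proof -
    have "(L + r0) * \<delta> = L + r0 + \<phi> * (L * d + r0 * d)"
      by (simp add: \<delta>_def distrib_left distrib_right \<phi>_comm)
    also have "\<dots> = sc t * pr I - (\<tau> - r0) + ue k k (poly p t) + pr (- insert k I)"
      unfolding Ld r0d using k by (intro cfm_eqI) (auto simp: L_def ent_Lin d_def \<phi>_def f_def ue.rep_eq pr.rep_eq sc.rep_eq ent_one)
    also have "\<dots> \<in> LL"
    proof (rule horner_LL)
      show "mat_over R (\<tau> - r0)" using r0 lin_dataD(2)[OF gh(3)] sR by simp
      show "i \<in> insert k I \<and> j \<in> insert k I" if "ent (\<tau> - r0) i j \<noteq> 0" for i j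
        using that arg_cong[OF r0(2), of "\<lambda>A. ent A i j"] arg_cong[OF dr(1), of "\<lambda>A. ent A i j"] gh(3)
        unfolding lin_data_def by (auto simp: d_def split: if_splits)
    qed (use p False k lin_dataD(1)[OF gh(3)] in auto)
    finally show ?thesis .
  qed
  moreover have "L * \<epsilon>' * \<delta> = (1 + (- (L * c))) * (1 + r1) * ((L + r0) * \<delta>) * (1 + (- (sc f * c)))"
  proof -
    have 1: "L * (1 - c) = (1 - L * c) * L" using cL by (simp add: algebra_simps)
    have 2: "L * (1 + r) = (1 + r1) * (L + r0)"
      using Lr r1r0 r01 by (simp add: algebra_simps)
    have 3: "(1 - c) * \<delta> = \<delta> * (1 - sc f * c)"
    proof -
      have "c * \<delta> = c + \<phi> * c" using cd by (simp add: \<delta>_def distrib_left \<phi>_comm)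
      also have "\<dots> = sc f * c" by (simp add: \<phi>_def algebra_simps)
      finally have 1: "c * \<delta> = sc f * c" .
      have "d * (sc f * c) = sc f * (d * c)" by (metis mult.assoc sc_comm)
      then have "\<delta> * (sc f * c) = sc f * c" using cd by (simp add: \<delta>_def distrib_right mult.assoc)
      then show ?thesis using 1 by (simp add: algebra_simps)
    qed
    have "L * \<epsilon>' * \<delta> = (L * (1 - c)) * (1 + r) * ((1 - c) * \<delta>)" by (simp only: \<epsilon>'_def mult.assoc)
    also have "\<dots> = (1 - L * c) * (L * (1 + r)) * (\<delta> * (1 - sc f * c))" by (simp only: 1 3 mult.assoc)
    also have "\<dots> = (1 + (- (L * c))) * (1 + r1) * ((L + r0) * \<delta>) * (1 + (- (sc f * c)))"
      unfolding 2 by (simp only: mult.assoc diff_conv_add_uminus)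
    finally show ?thesis .
  qed
  ultimately have "L * \<epsilon>' * \<delta> \<in> LL" by (metis Em_times LL_mult)
  then have "g * (L * \<epsilon>' * \<delta>) * (\<epsilon> * h) \<in> LL" by (rule LL_mult[OF gh(1) Em_times[OF \<epsilon>E gh(2)]])
  moreover have "g * (L * \<epsilon>' * \<delta>) * (\<epsilon> * h) = g * L * (\<epsilon>' * \<delta> * \<epsilon>) * h" by (simp only: mult.assoc)
  moreover have "g * L * (\<epsilon>' * \<delta> * \<epsilon>) * h = g * L * (h * (Q * mum f * Q') * (h' * h))"
    unfolding HdH2[symmetric] by (simp only: H_def H'_def mult.assoc)
  ultimately show ?thesis using h' by (simp add: gh(4) L_def f_def mult.assoc)
qed

end

section \<open>Intertwined pencils\<close>

lift_definition bmx :: "nat set \<Rightarrow> (nat \<Rightarrow> nat) \<Rightarrow> 'a::ring_1 cfm"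
  is "\<lambda>D b i j. if j \<in> D \<and> i = b j then 1 else 0"
  subgoal for D b j by (rule finite_subset[of _ "{b j}"]) auto
  done

lemma bmx_mult: "bmx D b * bmx E c = bmx {j\<in>E. c j \<in> D} (b \<circ> c)"
proof (rule cfm_eqI)
  fix i j
  show "ent (bmx D b * bmx E c) i j = ent (bmx {j\<in>E. c j \<in> D} (b \<circ> c)) i j"
    by (subst ent_times_single[of "c j"]) (auto simp: bmx.rep_eq)
qed

lemma bmx_pr: "(\<And>j. j \<in> D \<Longrightarrow> b j = j) \<Longrightarrow> bmx D b = pr D"
  by (rule cfm_eqI) (auto simp: bmx.rep_eq pr.rep_eq)

text \<open>Inside I \<union> I' the two complements have equally many elements, so a bijection
  between them exists. Its matrices later complete an isomorphism of the blocks I and I' to an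
  invertible matrix.\<close>

lemma equal_card_complement_matrices:
  assumes "finite I" "finite I'" "card I = card I'"
  obtains P P' :: "'a::ring_1 cfm" where "P * P' = pr (- I')" "P' * P = pr (- I)"
    "pr (- I') * P = P" "P * pr (- I) = P" "pr (- I) * P' = P'" "P' * pr (- I') = P'"
    "fin (P - pr (- I))" "fin (P' - pr (- I'))"
    "\<And>B. sring B \<Longrightarrow> mat_over B P" "\<And>B. sring B \<Longrightarrow> mat_over B P'"
proof -
  define J where "J = I \<union> I'"
  have J: "finite J" using assms by (simp add: J_def)
  have "card (J - I) = card (J - I')"
    using assms by (simp add: J_def card_Diff_subset)
  then obtain b where b: "bij_betw b (J - I) (J - I')"
    using J by (metis finite_Diff finite_same_card_bij)
  \<comment> \<open>Identity outside \<open>J\<close>, so that the matrices differ from the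
    projections only in a finite block.\<close>
  define \<beta> where "\<beta> j = (if j \<in> J then b j else j)" for j
  have "bij_betw \<beta> (J - I) (J - I')" using b by (rule bij_betw_cong[THEN iffD1, rotated]) (auto simp: \<beta>_def)
  moreover have "bij_betw \<beta> (- J) (- J)" by (rule bij_betw_cong[THEN iffD1, OF _ bij_betw_id]) (auto simp: \<beta>_def)
  ultimately have "bij_betw \<beta> ((J - I) \<union> - J) ((J - I') \<union> - J)" by (rule bij_betw_combine) auto
  moreover have "(J - I) \<union> - J = - I" "(J - I') \<union> - J = - I'" by (auto simp: J_def)
  ultimately have \<beta>: "bij_betw \<beta> (- I) (- I')" by simp
  define \<gamma> where "\<gamma> = inv_into (- I) \<beta>"
  have \<gamma>: "\<gamma> (\<beta> j) = j" if "j \<in> - I" for j using bij_betw_inv_into_left[OF \<beta> that] by (simp add: \<gamma>_def)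
  have \<gamma>': "\<beta> (\<gamma> j) = j" "\<gamma> j \<in> - I" if "j \<in> - I'" for j
    using bij_betw_inv_into_right[OF \<beta> that] bij_betwE[OF bij_betw_inv_into[OF \<beta>]] that by (auto simp: \<gamma>_def)
  have \<beta>': "\<beta> j \<in> - I'" if "j \<in> - I" for j using bij_betwE[OF \<beta>] that by blast
  define P where "P = (bmx (- I) \<beta> :: 'a cfm)"
  define P' where "P' = (bmx (- I') \<gamma> :: 'a cfm)"
  obtain n where n: "J \<subseteq> {..<n}" using J finite_nat_iff_bounded by blast
  obtain n1 where n1: "b ` J \<subseteq> {..<n1}" using J finite_nat_iff_bounded by blast
  have id: "\<beta> j = j" "\<gamma> j = j" if "n \<le> j" for j
  proof -
    have j: "j \<notin> J" using that n by auto
    then show "\<beta> j = j" by (simp add: \<beta>_def)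
    then show "\<gamma> j = j" using \<gamma>[of j] j by (simp add: J_def)
  qed
  have fin1: "fin (bmx (- D) f - pr (- D) :: 'a cfm)" if f: "\<And>j. n \<le> j \<Longrightarrow> f j = j" for D f
  proof -
    obtain k where k: "f ` {..<n} \<subseteq> {..<k}" using finite_nat_iff_bounded by blast
    have "ent (bmx (- D) f - pr (- D) :: 'a cfm) i j = 0" if "max n k \<le> i \<or> max n k \<le> j" for i j
    proof (cases "n \<le> j")
      case True
      then show ?thesis using f[OF True] by (auto simp: bmx.rep_eq pr.rep_eq)
    next
      case False
      then have "f j \<in> f ` {..<n}" by simp
      then have "f j < k" using k by blast
      then show ?thesis using that False by (auto simp: bmx.rep_eq pr.rep_eq)
    qed
    then show ?thesis unfolding fin_def by blast
  qed
  show thesis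
  proof (rule that[of P P'])
    show "P * P' = pr (- I')" unfolding P_def P'_def bmx_mult
      using \<gamma>' by (subst bmx_pr) (auto intro!: arg_cong[of _ _ pr])
    show "P' * P = pr (- I)" unfolding P_def P'_def bmx_mult
      using \<gamma> \<beta>' by (subst bmx_pr) (auto intro!: arg_cong[of _ _ pr])
    show "pr (- I') * P = P" "P * pr (- I) = P" "pr (- I) * P' = P'" "P' * pr (- I') = P'"
      using \<beta>' \<gamma>' by (auto intro!: cfm_eqI simp: P_def P'_def bmx.rep_eq)
    show "fin (P - pr (- I))" "fin (P' - pr (- I'))" unfolding P_def P'_def
      by (rule fin1, rule id, assumption)+
    show "\<And>B. sring B \<Longrightarrow> mat_over B P" "\<And>B. sring B \<Longrightarrow> mat_over B P'"
      by (auto simp: mat_over_def P_def P'_def bmx.rep_eq)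
  qed
qed

context polynomial_extension
begin

text \<open>Division of \<open>G\<close> by the left pencil leaves a constant u. The intertwining
  relation makes a second constant matrix a multiple of that pencil, so it is zero by
  \<open>Lin_inj\<close>, and the identities for \<open>H\<close> and for u follow.\<close>

lemma Lin_intertwine:
  assumes L: "lin_data I \<tau>" "lin_data I' \<tau>'" and G: "G \<in> Fin1 B" "H \<in> Fin1 B" and eq: "G * Lin I \<tau> = Lin I' \<tau>' * H"
  obtains u M where "mat_over R u" "pr I' * u = u" "u * pr I = u" "mat_over B M"
    "G = u + Lin I' \<tau>' * M" "H = u + M * Lin I \<tau>" "u * Lin I \<tau> = Lin I' \<tau>' * u"
proof -
  define L where "L = Lin I \<tau>"
  define L' where "L' = Lin I' \<tau>'"
  have oL: "mat_over B L" "mat_over B L'" using Lin_Fin1[OF assms(1)] Lin_Fin1[OF assms(2)] by (auto simp: L_def L'_def Fin1_def)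
  \<comment> \<open>Division applies to finite matrices, hence to \<open>G - 1\<close>; the identity
    is put back by \<open>pr I'\<close> in u and by \<open>pr (- I')\<close> in M.\<close>
  obtain u0 M0 where 0: "mat_over R u0" "pr I' * u0 = u0" "mat_over B M0" "G - 1 = u0 + L' * M0"
    using Lin_division(1)[OF L(2), of "G - 1"] G sB by (auto simp: L'_def Fin1_def)
  define u where "u = u0 + pr I'"
  define M where "M = M0 + pr (- I')"
  have L'pr: "L' * pr (- I') = pr (- I')" using Lin_mult(1)[OF L(2), of "- I'"] by (simp add: L'_def)
  have u: "mat_over R u" "pr I' * u = u" "mat_over B M" using 0 sR sB by (auto simp: u_def M_def distrib_left)
  have "G = u0 + L' * M0 + 1" using 0(4) by (metis diff_add_cancel)
  then have Gu: "G = u + L' * M" by (simp add: u_def M_def distrib_left L'pr) (simp add: pr_compl)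
  have L'I: "L' * pr I' = sc t * pr I' - \<tau>'"
    using lin_dataD(4)[OF L(2)] by (simp add: L'_def Lin_def left_diff_distrib distrib_right mult.assoc)
  have t': "sc t * (pr I' * N) = L' * (pr I' * N) + \<tau>' * N" for N
    by (simp add: L'I left_diff_distrib flip: mult.assoc)
  have "u * L = sc t * (u * pr I) - u * \<tau> + u * pr (- I)"
    unfolding L_def Lin_def right_diff_distrib distrib_left by (metis mult.assoc sc_comm)
  also have "u * pr I = pr I' * (u * pr I)" using u(2) by (simp flip: mult.assoc)
  also have "sc t * (pr I' * (u * pr I)) = L' * (u * pr I) + \<tau>' * (u * pr I)"
    using t'[of "u * pr I"] u(2) by (simp flip: mult.assoc)
  finally have uL: "u * L = L' * (u * pr I) + (\<tau>' * (u * pr I) - u * \<tau> + u * pr (- I))" by (simp add: algebra_simps)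
  \<comment> \<open>The part of \<open>u * L\<close> not yet exhibited as a left multiple of
    \<open>L'\<close>; it is constant in t.\<close>
  define N where "N = \<tau>' * (u * pr I) - u * \<tau> + u * pr (- I)"
  have "u * L + L' * M * L = L' * H" using eq Gu by (simp add: L_def L'_def distrib_right)
  then have "N = L' * (H - M * L - u * pr I)" using uL by (simp add: N_def algebra_simps)
  moreover have "mat_over R N" unfolding N_def
    by (intro mat_over_simps sR u lin_dataD(2)[OF L(1)] lin_dataD(2)[OF L(2)])
  moreover have "pr I' * N = N"
    using u(2) lin_dataD(3)[OF L(2)] by (simp add: N_def distrib_left right_diff_distrib flip: mult.assoc)
  moreover have "mat_over B (H - M * L - u * pr I)"
    by (intro mat_over_simps sB u oL mat_over_RB Fin1D(2)[OF G(2)])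
  ultimately have z: "N = 0" "H - M * L - u * pr I = 0" using Lin_inj[OF L(2)] unfolding L'_def by blast+
  have "N * pr (- I) = u * pr (- I)"
  proof -
    have 1: "pr I * pr (- I) = (0::'a cfm)" "\<tau> * pr (- I) = 0"
      using lin_dataD(4)[OF L(1)] by (simp_all, metis mult.assoc mult_zero_right Compl_disjoint pr_empty pr_pr)
    show ?thesis unfolding N_def by (simp add: distrib_right left_diff_distrib mult.assoc 1)
  qed
  then have u3: "u * pr I = u" using z by (simp add: pr_compl right_diff_distrib)
  have "u * L = L' * u" using uL z(1) u3 by (simp add: N_def)
  moreover have "H = u + M * L" using z(2) u3 by (simp add: algebra_simps)
  ultimately show thesis using u u3 Gu by (intro that[of u M]) (simp_all add: L_def L'_def)
qed

text \<open>The constant remainders of G and its inverse are mutually inverse between the blocks I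
  and I'. Completed to an invertible \<open>w\<close> with \<open>w * L = L' * w\<close>, they
  reduce the claim to w^-1 G = 1 + L C and w^-1 H = 1 + C L, which \<open>swap_eqE\<close>
  identifies.\<close>

lemma Lin_intertwine_eqE:
  assumes L: "lin_data I \<tau>" "lin_data I' \<tau>'" and G: "G \<in> GLm B" "H \<in> GLm B" and eq: "G * Lin I \<tau> = Lin I' \<tau>' * H"
  shows "eqE B G H"
proof -
  define L where "L = Lin I \<tau>"
  define L' where "L' = Lin I' \<tau>'"
  have L1: "L \<in> Fin1 B" "L' \<in> Fin1 B" using Lin_Fin1[OF assms(1)] Lin_Fin1[OF assms(2)] by (auto simp: L_def L'_def)
  obtain G' H' where G': "G' \<in> GLm B" "G * G' = 1" "G' * G = 1" and H': "H' \<in> GLm B" "H * H' = 1" "H' * H = 1"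
    using G by (metis GLmE)
  obtain u M where u: "mat_over R u" "pr I' * u = u" "u * pr I = u" "mat_over B M"
    "G = u + L' * M" "H = u + M * L" "u * L = L' * u"
    using Lin_intertwine[OF L GLm_Fin1[OF G(1)] GLm_Fin1[OF G(2)] eq] unfolding L_def L'_def by blast
  have "G' * (G * L) * H' = G' * (L' * H) * H'" using eq by (simp add: L_def L'_def)
  then have "(G' * G) * L * H' = G' * L' * (H * H')" by (simp only: mult.assoc)
  then have eq': "G' * L' = L * H'" using G' H' by simp
  \<comment> \<open>The inverse matrices intertwine in the opposite direction, which supplies the
    inverse of u between the blocks.\<close>
  obtain v N where v: "mat_over R v" "pr I * v = v" "v * pr I' = v" "mat_over B N"
    "G' = v + L * N" "H' = v + N * L'" "v * L' = L * v"
    using Lin_intertwine[OF L(2,1) GLm_Fin1[OF G'(1)] GLm_Fin1[OF H'(1)]] eq' unfolding L_def L'_def by blast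
  have prI: "Lin J \<rho> * pr (- J) = pr (- J)" "pr (- J) * Lin J \<rho> = pr (- J)" if "lin_data J \<rho>" for J \<rho>
    using Lin_mult[OF that, of "- J"] by auto
  have prod: "a * b = pr J"
    if a: "mat_over R a" "pr J * a = a" and b: "mat_over R b" and d: "lin_data J \<rho>" and X: "mat_over B X"
      and e: "a * b + Lin J \<rho> * X = 1" for a b X J \<rho>
  proof -
    have "a * b - pr J = Lin J \<rho> * (pr (- J) - X)"
      using e prI[OF d] by (simp add: right_diff_distrib pr_compl algebra_simps)
    moreover have "mat_over R (a * b - pr J)" using a b sR by simp
    moreover have "pr J * (a * b - pr J) = a * b - pr J" using a by (simp add: right_diff_distrib flip: mult.assoc)
    moreover have "mat_over B (pr (- J) - X)" using X sB by simp
    ultimately have "a * b - pr J = 0" using Lin_inj[OF d] by blast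
    then show ?thesis by simp
  qed
  have oo: "mat_over B G" "mat_over B H" "mat_over B G'" "mat_over B H'"
    using G G' H' GLm_over by blast+
  have "1 = (u + L' * M) * v + G * L * N" using G'(2) by (simp add: u(5)[symmetric] v(5) distrib_left mult.assoc)
  also have "\<dots> = u * v + L' * (M * v + H * N)" using eq by (simp add: L_def L'_def algebra_simps)
  finally have uv: "u * v = pr I'"
    by (intro prod[where J = I' and \<rho> = \<tau>' and X = "M * v + H * N"] u v L) (use u v oo sB mat_over_RB in \<open>auto simp: L'_def\<close>)
  have "1 = (v + L * N) * u + G' * L' * M" using G'(3) by (simp add: v(5)[symmetric] u(5) distrib_left mult.assoc)
  also have "\<dots> = v * u + L * (N * u + H' * M)" using eq' by (simp add: algebra_simps)
  finally have vu: "v * u = pr I"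
    by (intro prod[where J = I and \<rho> = \<tau> and X = "N * u + H' * M"] u v L) (use u v oo sB mat_over_RB in \<open>auto simp: L_def\<close>)
  have I: "finite I" "finite I'" using lin_dataD L by blast+
  have "card I = card I'"
    using invertible_card_le[OF I v(2)[symmetric] uv] invertible_card_le[OF I(2,1) u(2)[symmetric] vu] by simp
  then obtain P P' :: "'a cfm" where P: "P * P' = pr (- I')" "P' * P = pr (- I)"
    "pr (- I') * P = P" "P * pr (- I) = P" "pr (- I) * P' = P'" "P' * pr (- I') = P'"
    "fin (P - pr (- I))" "fin (P' - pr (- I'))" and oP: "mat_over R P" "mat_over R P'"
    using equal_card_complement_matrices[OF I] sR by metis
  have zero: "a * b = 0" if "a * pr J = a" "pr (- J) * b = b" for a b :: "'a cfm" and J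
  proof -
    have "a * b = a * (pr J * pr (- J)) * b" using that by (metis mult.assoc)
    then show ?thesis by simp
  qed
  have zero': "a * b = 0" if "a * pr (- J) = a" "pr J * b = b" for a b :: "'a cfm" and J
    using zero[of a "- J" b] that by simp
  \<comment> \<open>u is invertible only between the blocks; P adds a bijection of the complements,
    where both pencils are trivial, so \<open>w\<close> still intertwines them.\<close>
  define w where "w = u + P"
  define w' where "w' = v + P'"
  have ww: "w * w' = 1" "w' * w = 1"
    using zero[OF u(3) P(5)] zero'[OF P(4) v(2)] zero[OF v(3) P(3)] zero'[OF P(6) u(2)]
    by (simp_all add: w_def w'_def algebra_simps uv vu P) (simp_all add: pr_compl)
  have "fin w0" if w0: "w0 = pr J * w0" "w0 * pr J' = w0" "finite J" "finite J'" for w0 :: "'a cfm" and J J'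
  proof -
    obtain n where n: "J \<union> J' \<subseteq> {..<n}" using w0(3,4) finite_nat_iff_bounded by (metis finite_UnI)
    have "ent w0 i j = 0" if "n \<le> i \<or> n \<le> j" for i j
      using arg_cong[OF w0(1), of "\<lambda>A. ent A i j"] arg_cong[OF w0(2), of "\<lambda>A. ent A i j"] n that
      by (auto split: if_splits)
    then show ?thesis unfolding fin_def by blast
  qed
  note fin_uv = this[OF u(2)[symmetric] u(3) I(2,1)] this[OF v(2)[symmetric] v(3) I]
  have "w - 1 = u + (P - pr (- I)) - pr I" "w' - 1 = v + (P' - pr (- I')) - pr I'"
    by (simp_all add: w_def w'_def pr_compl)
  then have "fin (w - 1)" "fin (w' - 1)" using fin_uv P I by (metis fin_add fin_diff fin_pr)+
  then have wF: "w \<in> Fin1 R" "w' \<in> Fin1 R" using u v oP sR by (auto simp: Fin1_def w_def w'_def)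
  then have wGL: "w \<in> GLm B" "w' \<in> GLm B"
    using ww GLm_mono[OF RB] by (metis GLmI)+
  have L'P: "L' * P = P" using P(3) prI(1)[OF L(2)] by (metis L'_def mult.assoc)
  have PL: "P * L = P" using P(4) prI(2)[OF L(1)] by (metis L_def mult.assoc)
  define M2 where "M2 = M - P"
  have Gw: "G = w + L' * M2" and Hw: "H = w + M2 * L"
    by (simp_all add: u(5,6) w_def M2_def algebra_simps L'P PL)
  have "w * L = L' * w" using u(7) L'P PL by (simp add: w_def algebra_simps)
  then have "w' * (w * L) * w' = w' * (L' * w) * w'" by simp
  then have "(w' * w) * L * w' = w' * L' * (w * w')" by (simp only: mult.assoc)
  then have w'L: "w' * L' = L * w'" using ww by simp
  define C where "C = w' * M2"
  have GC: "w' * G = 1 + L * C" using w'L by (simp add: Gw C_def distrib_left ww) (metis mult.assoc)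
  have HC: "w' * H = 1 + C * L" by (simp add: Hw C_def distrib_left ww mult.assoc)
  have oC: "mat_over B C"
    unfolding C_def M2_def by (intro mat_over_simps sB u mat_over_RB oP Fin1D(2)[OF wF(2)])
  have "w' * G \<in> Fin1 B" using GLm_Fin1[OF wGL(2)] GLm_Fin1[OF G(1)] sB by simp
  then have "fin (L * C)" by (simp add: GC Fin1_def)
  then obtain n0 where n0: "\<And>i j. n0 \<le> i \<or> n0 \<le> j \<Longrightarrow> ent (L * C) i j = 0" unfolding fin_def by blast
  obtain n1 where n1: "I \<subseteq> {..<n1}" using I finite_nat_iff_bounded by blast
  define n where "n = max n0 n1"
  have LCn: "ent (L * C) i j = 0" if "n \<le> i \<or> n \<le> j" for i j using n0[of i j] that by (auto simp: n_def)
  have In: "I \<subseteq> {..<n}" using n1 by (auto simp: n_def)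
  \<comment> \<open>C inherits the bound of \<open>L * C\<close>: for columns because L has no
    kernel, for rows because L is trivial off I.\<close>
  have Cn: "ent C i j = 0" if "n \<le> i \<or> n \<le> j" for i j
  proof (cases "n \<le> j")
    case True
    have "L * (C * pr {j}) = 0" using LCn True by (intro cfm_eqI) (simp flip: mult.assoc)
    then have "C * pr {j} = 0"
      using Lin_inj[OF L(1), of "C * pr {j}" 0] oC sB sR by (simp add: L_def)
    from arg_cong[OF this, of "\<lambda>A. ent A i j"] show ?thesis by simp
  next
    case False
    then have i: "n \<le> i" "i \<notin> I" using that In by auto
    have "pr {i} * (L * C) = pr {i} * C" using Lin_mult(2)[OF L(1), of "{i}"] i by (simp add: L_def flip: mult.assoc)
    from arg_cong[OF this, of "\<lambda>A. ent A i j"] show ?thesis using LCn[of i j] i by simp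
  qed
  have finC: "fin C" unfolding fin_def using Cn by blast
  have Cpr: "pr {..<n} * C = C" "C * pr {..<n} = C" using Cn by (auto intro!: cfm_eqI)
  have Lpr: "L * pr {..<n} = pr {..<n} * L"
  proof -
    have disj: "- {..<n} \<inter> I = {}" using In by blast
    have "L * pr (- {..<n}) = pr (- {..<n})" "pr (- {..<n}) * L = pr (- {..<n})"
      unfolding L_def by (rule Lin_mult[OF L(1) disj])+
    then show ?thesis unfolding pr_compl by (simp add: algebra_simps)
  qed
  have "C * (L * pr {..<n}) = (C * pr {..<n}) * L" unfolding Lpr by (simp only: mult.assoc)
  then have ab: "L * pr {..<n} * C = L * C" "C * (L * pr {..<n}) = C * L"
    unfolding Cpr(2) by (simp_all only: mult.assoc Cpr(1))
  \<comment> \<open>L itself is not finite, but its truncation is and has the same products with C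
    on both sides.\<close>
  have "eqE B (1 + (L * pr {..<n}) * C) (1 + C * (L * pr {..<n}))"
  proof (rule swap_eqE[OF sB _ oC _ finC])
    show "mat_over B (L * pr {..<n})" using L1 sB by (simp add: Fin1_def)
    show "fin (L * pr {..<n})" using L1 by (intro fin_Fin1_times) (auto simp: Fin1_def)
    show "1 + L * pr {..<n} * C \<in> GLm B" using wGL G sB by (simp add: ab flip: GC)
  qed
  then have "eqE B (w' * G) (w' * H)" by (simp add: ab GC HC)
  then have "eqE B (w * (w' * G)) (w * (w' * H))" by (rule eqE_mult[OF sB eqE_refl _ wGL(1)])
  then show ?thesis using ww by (simp flip: mult.assoc)
qed

end

section \<open>Descent from a localization at monic polynomials\<close>

lift_definition dg :: "(nat \<Rightarrow> 'a::ring_1) \<Rightarrow> 'a cfm" is "\<lambda>\<phi> i j. if i = j then \<phi> i else 0"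
  subgoal for \<phi> j by (rule finite_subset[of _ "{j}"]) auto
  done

lemma ent_dg_times [simp]: "ent (dg \<phi> * A) i j = \<phi> i * ent A i j"
  by (subst ent_times_single[of i]) (auto simp: dg.rep_eq)
lemma ent_times_dg [simp]: "ent (A * dg \<phi>) i j = ent A i j * \<phi> j"
  by (subst ent_times_single[of j]) (auto simp: dg.rep_eq)

lemma one_plus_sc_pr: "1 + sc z * pr S = dg (\<lambda>i. if i \<in> S then 1 + z else 1)"
  by (rule cfm_eqI) (auto simp: dg.rep_eq ent_one pr.rep_eq sc.rep_eq)

context polynomial_extension
begin

text \<open>Products of conjugates of monic diagonal matrices. \<open>LL\<close> absorbs such
  factors one at a time; this set is moreover closed under products and conjugation, as clearing
  denominators requires.\<close>

inductive_set DD where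
  DD_one: "1 \<in> DD"
| DD_step: "Y \<in> DD \<Longrightarrow> Q \<in> GLm B \<Longrightarrow> Q' \<in> GLm B \<Longrightarrow> Q * Q' = 1 \<Longrightarrow> Q' * Q = 1 \<Longrightarrow>
    (\<And>i. Polynomial.coeff p i \<in> R) \<Longrightarrow> Polynomial.lead_coeff p = 1 \<Longrightarrow> Y * (Q * mum (poly p t) * Q') \<in> DD"

lemma DD_LL: "Y \<in> DD \<Longrightarrow> Y \<in> LL"
proof (induction rule: DD.induct)
  case DD_one
  have "lin_data {} 0" using sR by (simp add: lin_data_def)
  then have "Lin {} 0 \<in> LL" by (rule Lin_LL)
  then show ?case by (simp add: Lin_def)
next
  case (DD_step Y Q Q' p)
  then show ?case by (intro LL_absorb) auto
qed

lemma DD_mult: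
  assumes "Y \<in> DD" "Z \<in> DD" shows "Y * Z \<in> DD"
  using assms(2)
proof (induction rule: DD.induct)
  case DD_one
  then show ?case using assms by simp
next
  case (DD_step Z Q Q' p)
  then have "(Y * Z) * (Q * mum (poly p t) * Q') \<in> DD" by (intro DD.DD_step) auto
  then show ?case by (simp add: mult.assoc)
qed

lemma DD_conj:
  assumes g: "g \<in> GLm B" "g' \<in> GLm B" "g * g' = 1" "g' * g = 1" and Y: "Y \<in> DD"
  shows "g * Y * g' \<in> DD"
  using Y
proof (induction rule: DD.induct)
  case DD_one
  then show ?case using g by (simp add: DD.DD_one)
next
  case (DD_step Y Q Q' p)
  have "(g * Y * g') * ((g * Q) * mum (poly p t) * (Q' * g')) \<in> DD"
  proof (rule DD.DD_step)
    show "g * Q * (Q' * g') = 1" by (rule inverse_times) fact+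
    show "Q' * g' * (g * Q) = 1" by (rule inverse_times) fact+
  qed (use DD_step g sB in auto)
  moreover have "(g * Y * g') * ((g * Q) * mum (poly p t) * (Q' * g')) = g * Y * (g' * g) * (Q * mum (poly p t) * Q') * g'"
    by (simp only: mult.assoc)
  ultimately show ?case using g by (simp add: mult.assoc)
qed

lemma DD_diag:
  assumes p: "\<And>i. Polynomial.coeff p i \<in> R" "Polynomial.lead_coeff p = 1" and S: "finite S"
  shows "1 + sc (poly p t - 1) * pr S \<in> DD"
  using S
proof induction
  case empty
  then show ?case by (simp add: DD_one)
next
  case (insert i S)
  define f where "f = poly p t"
  have one: "1 + ue i i (f - 1) \<in> DD"
  proof (cases "i = 0")
    case True
    have "1 * (1 * mum (poly p t) * 1) \<in> DD" by (rule DD_step[OF DD_one]) (use p sB in auto)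
    then show ?thesis using True by (simp add: mum_def f_def)
  next
    case False
    \<comment> \<open>\<open>DD\<close> offers the polynomial at index 0; conjugation by a signed
      transposition carries it to i.\<close>
    define \<rho> where "\<rho> = pr (- {i, 0}) + ue i 0 1 - ue 0 i (1::'a)"
    define \<rho>' where "\<rho>' = pr (- {0, i}) + ue 0 i 1 - ue i 0 (1::'a)"
    have \<rho>: "\<rho> \<in> GLm B" "\<rho>' \<in> GLm B"
      using rotation_Em[OF sB, of i 0] rotation_Em[OF sB, of 0 i] False Em_GLm[OF sB] by (auto simp: \<rho>_def \<rho>'_def)
    have \<rho>\<rho>: "\<rho> * \<rho>' = 1" "\<rho>' * \<rho> = 1"
      using False by (auto intro!: cfm_eqI simp: \<rho>_def \<rho>'_def algebra_simps ue_ue pr.rep_eq ue.rep_eq ent_one)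
    have "1 * (\<rho> * mum (poly p t) * \<rho>') \<in> DD" by (rule DD_step[OF DD_one \<rho> \<rho>\<rho> p])
    moreover have "\<rho> * ue 0 0 (f - 1) = ue i 0 (f - 1)" "ue i 0 (f - 1) * \<rho>' = ue i i (f - 1)"
      using False by (auto intro!: cfm_eqI simp: \<rho>_def \<rho>'_def algebra_simps ue_ue pr.rep_eq ue.rep_eq)
    ultimately show ?thesis using \<rho>\<rho> by (simp add: mum_def f_def distrib_left distrib_right)
  qed
  have "(1 + sc (f - 1) * pr S) * (1 + ue i i (f - 1)) \<in> DD"
    using insert.IH one by (intro DD_mult) (auto simp: f_def)
  moreover have "(1 + sc (f - 1) * pr S) * (1 + ue i i (f - 1)) = 1 + sc (f - 1) * pr (insert i S)"
    unfolding one_plus_sc_pr using insert.hyps by (intro cfm_eqI) (auto simp: dg.rep_eq ue.rep_eq ent_one)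
  ultimately show ?case by (simp add: f_def)
qed

text \<open>The matrix accumulated on the left is scalar on the first d indices, hence commutes with
  elementary matrices inside that block. The claim covers all large d because later elementary
  factors may involve larger indices.\<close>

lemma clear_denominators:
  assumes den: "\<And>b'. b' \<in> B' \<Longrightarrow> \<exists>p. (\<forall>i. Polynomial.coeff p i \<in> R) \<and> Polynomial.lead_coeff p = 1 \<and> b' * poly p t \<in> B"
    and e: "e \<in> Em B'"
  shows "\<exists>d0. \<forall>d\<ge>d0. \<exists>z Y \<epsilon>. 1 + sc z * pr {..<d} \<in> DD \<and> Y \<in> DD \<and> \<epsilon> \<in> Em B \<and> (1 + sc z * pr {..<d}) * e = Y * \<epsilon>"
  using e
proof induction
  case Em_one
  have "\<exists>z Y \<epsilon>. 1 + sc z * pr {..<d} \<in> DD \<and> Y \<in> DD \<and> \<epsilon> \<in> Em B \<and> (1 + sc z * pr {..<d}) * 1 = Y * \<epsilon>" for d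
    by (rule exI[of _ 0], rule exI[of _ 1], rule exI[of _ 1]) (simp add: DD_one Em.Em_one)
  then show ?case by blast
next
  case (Em_step i j b' e)
  then obtain d0 where d0: "\<And>d. d \<ge> d0 \<Longrightarrow> \<exists>z Y \<epsilon>. 1 + sc z * pr {..<d} \<in> DD \<and> Y \<in> DD \<and> \<epsilon> \<in> Em B \<and> (1 + sc z * pr {..<d}) * e = Y * \<epsilon>"
    by blast
  obtain p where p: "\<And>i. Polynomial.coeff p i \<in> R" "Polynomial.lead_coeff p = 1" "b' * poly p t \<in> B"
    using den[OF Em_step(2)] by blast
  define f where "f = poly p t"
  define b where "b = b' * f"
  have b: "b \<in> B" using p by (simp add: b_def f_def)
  show ?case
  proof (intro exI[of _ "max d0 (Suc (max i j))"] allI impI)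
    fix d assume d: "max d0 (Suc (max i j)) \<le> d"
    then have "d0 \<le> d" by simp
    from d0[OF this] obtain z Y \<epsilon> where *: "1 + sc z * pr {..<d} \<in> DD" "Y \<in> DD" "\<epsilon> \<in> Em B"
      "(1 + sc z * pr {..<d}) * e = Y * \<epsilon>" by blast
    define \<Psi> where "\<Psi> = 1 + sc z * pr {..<d}"
    define F where "F S = 1 + sc (f - 1) * pr S" for S
    have F: "F S \<in> DD" if "finite S" for S using DD_diag[OF p(1,2) that] by (simp add: F_def f_def)
    define \<eta> where "\<eta> = 1 + ue i j b"
    have \<eta>: "\<eta> \<in> Em B" using Em_gen[OF Em_step(1) b] by (simp add: \<eta>_def)
    obtain \<eta>' where \<eta>': "\<eta>' \<in> Em B" "\<eta> * \<eta>' = 1" "\<eta>' * \<eta> = 1" using Em_inverse[OF sB \<eta>] by blast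
    have ij: "i < d" "j < d" using d by auto
    have comm: "\<Psi> * (1 + ue i j b') = (1 + ue i j b') * \<Psi>"
      unfolding \<Psi>_def one_plus_sc_pr using ij by (intro cfm_eqI) (auto simp: ue.rep_eq ent_one)
    \<comment> \<open>Scaling row i by f from the left is traded for scaling column i from the
      right; this turns the entry b' into b = b' f, which has no denominator.\<close>
    have Fe: "F {..<d} * (1 + ue i j b') = F ({..<d} - {i}) * \<eta> * F {i}"
    proof (rule cfm_eqI)
      fix r s
      have F_dg: "F S = dg (\<lambda>i. if i \<in> S then f else 1)" for S unfolding F_def one_plus_sc_pr by (simp add: algebra_simps cong: if_cong)
      show "ent (F {..<d} * (1 + ue i j b')) r s = ent (F ({..<d} - {i}) * \<eta> * F {i}) r s"
      proof (cases "r = i")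
        case True
        then show ?thesis using ij Em_step(1)
          by (cases "s = j"; cases "s = i") (simp_all add: F_dg \<eta>_def ue.rep_eq ent_one b_def)
      next
        case False
        then show ?thesis using ij
          by (cases "s = r") (simp_all add: F_dg \<eta>_def ue.rep_eq ent_one)
      qed
    qed
    have F\<Psi>: "F {..<d} * \<Psi> = 1 + sc (f * (1 + z) - 1) * pr {..<d}"
      unfolding F_def \<Psi>_def one_plus_sc_pr by (rule cfm_eqI) (auto simp: dg.rep_eq algebra_simps)
    have "F {..<d} * \<Psi> * ((1 + ue i j b') * e) = (F {..<d} * (1 + ue i j b')) * (\<Psi> * e)"
    proof -
      have "F {..<d} * \<Psi> * ((1 + ue i j b') * e) = F {..<d} * (\<Psi> * (1 + ue i j b')) * e" by (simp only: mult.assoc)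
      also have "\<dots> = (F {..<d} * (1 + ue i j b')) * (\<Psi> * e)" unfolding comm by (simp only: mult.assoc)
      finally show ?thesis .
    qed
    also have "\<dots> = F ({..<d} - {i}) * \<eta> * F {i} * (Y * \<epsilon>)" using *(4) by (simp add: Fe \<Psi>_def)
    \<comment> \<open>\<eta> travels to the right by conjugating what it passes, and
      \<open>DD\<close> is stable under this.\<close>
    also have "\<dots> = F ({..<d} - {i}) * (\<eta> * (F {i} * Y) * \<eta>') * (\<eta> * \<epsilon>)"
    proof -
      have "\<eta> * (F {i} * Y) * \<eta>' * (\<eta> * \<epsilon>) = \<eta> * (F {i} * Y) * (\<eta>' * \<eta>) * \<epsilon>" by (simp only: mult.assoc)
      then show ?thesis using \<eta>' by (simp add: mult.assoc)
    qed
    finally have eq: "F {..<d} * \<Psi> * ((1 + ue i j b') * e) = F ({..<d} - {i}) * (\<eta> * (F {i} * Y) * \<eta>') * (\<eta> * \<epsilon>)" .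
    have "F {..<d} * \<Psi> \<in> DD" using F *(1) by (intro DD_mult) (auto simp: \<Psi>_def)
    moreover have "F ({..<d} - {i}) * (\<eta> * (F {i} * Y) * \<eta>') \<in> DD"
      by (intro DD_mult F DD_conj Em_GLm sB \<eta> \<eta>' *(2)) auto
    moreover have "\<eta> * \<epsilon> \<in> Em B" using \<eta> * by simp
    ultimately show "\<exists>z Y \<epsilon>. 1 + sc z * pr {..<d} \<in> DD \<and> Y \<in> DD \<and> \<epsilon> \<in> Em B \<and> (1 + sc z * pr {..<d}) * ((1 + ue i j b') * e) = Y * \<epsilon>"
      using eq unfolding F\<Psi> by blast
  qed
qed

text \<open>Up to a constant, A becomes \<alpha> with
  \<open>\<alpha> * mum (poly q t) = e * mum (poly p t)\<close>, where e is elementary over the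
  localization. Cleared of denominators, both sides are a pencil times an invertible matrix over B,
  and the comparison of pencils forces \<alpha> to be elementary over B.\<close>

lemma Good_descend:
  assumes B': "sring B'" "B \<subseteq> B'"
    and den: "\<And>b'. b' \<in> B' \<Longrightarrow> \<exists>p. (\<forall>i. Polynomial.coeff p i \<in> R) \<and> Polynomial.lead_coeff p = 1 \<and> b' * poly p t \<in> B"
    and C: "unit_group B C"
    and C': "\<And>c'. c' \<in> C' \<Longrightarrow> \<exists>c\<in>C. \<exists>p q. (\<forall>i. Polynomial.coeff p i \<in> R) \<and> Polynomial.lead_coeff p = 1 \<and>
       (\<forall>i. Polynomial.coeff q i \<in> R) \<and> Polynomial.lead_coeff q = 1 \<and> c' * poly q t = c * poly p t"
    and G: "Good C' B'"
  shows "Good C B"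
  unfolding Good_def
proof
  fix A assume A: "A \<in> GLm B"
  then have "A \<in> GLm B'" using GLm_mono[OF B'(2)] by blast
  then obtain c' e where c': "c' \<in> C'" "e \<in> Em B'" "A = e * mum c'" using G unfolding Good_def eqE_def by blast
  obtain c p q where cpq: "c \<in> C" "\<And>i. Polynomial.coeff p i \<in> R" "Polynomial.lead_coeff p = 1"
     "\<And>i. Polynomial.coeff q i \<in> R" "Polynomial.lead_coeff q = 1" "c' * poly q t = c * poly p t"
    using C'[OF c'(1)] by blast
  obtain c1 where c1: "c1 \<in> C" "c * c1 = 1" using C cpq(1) unfolding unit_group_def by blast
  define \<alpha> where "\<alpha> = A * mum c1"
  have \<alpha>: "\<alpha> \<in> GLm B" using A mum_GLm[OF sB C c1(1)] sB by (simp add: \<alpha>_def)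
  obtain \<alpha>' where \<alpha>': "\<alpha>' \<in> GLm B" "\<alpha> * \<alpha>' = 1" "\<alpha>' * \<alpha> = 1" using \<alpha> by (auto elim: GLmE)
  have "\<alpha> * mum (poly q t) = e * mum (c' * c1 * poly q t)"
    by (simp only: \<alpha>_def c'(3) mum_mult mult.assoc)
  also have "c' * c1 * poly q t = (c' * poly q t) * c1" by simp
  also have "\<dots> = poly p t" using cpq(6) c1(2) by (simp add: mult.commute mult.left_commute)
  finally have \<alpha>q: "\<alpha> * mum (poly q t) = e * mum (poly p t)" .
  obtain d z Y \<epsilon> where d: "1 + sc z * pr {..<d} \<in> DD" "Y \<in> DD" "\<epsilon> \<in> Em B" "(1 + sc z * pr {..<d}) * e = Y * \<epsilon>"
    using clear_denominators[OF den c'(2)] by blast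
  obtain \<epsilon>' where \<epsilon>': "\<epsilon>' \<in> Em B" "\<epsilon> * \<epsilon>' = 1" "\<epsilon>' * \<epsilon> = 1" using Em_inverse[OF sB d(3)] by blast
  define \<Psi> where "\<Psi> = 1 + sc z * pr {..<d}"
  \<comment> \<open>Conjugating by \<alpha> here, and by \<epsilon> on the other side, splits each
    side into an element of \<open>DD\<close> followed by \<alpha> or \<epsilon>.\<close>
  have "\<Psi> * (\<alpha> * mum (poly q t) * \<alpha>') \<in> DD"
    by (rule DD_step) (use d \<alpha> \<alpha>' cpq in \<open>auto simp: \<Psi>_def\<close>)
  then obtain g1 h1 I1 \<tau>1 where 1: "g1 \<in> Em B" "h1 \<in> Em B" "lin_data I1 \<tau>1"
    "\<Psi> * (\<alpha> * mum (poly q t) * \<alpha>') = g1 * Lin I1 \<tau>1 * h1" using DD_LL unfolding LL_def by blast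
  have "Y * (\<epsilon> * mum (poly p t) * \<epsilon>') \<in> DD"
    by (rule DD_step) (use d \<epsilon>' cpq Em_GLm[OF sB] in auto)
  then obtain g2 h2 I2 \<tau>2 where 2: "g2 \<in> Em B" "h2 \<in> Em B" "lin_data I2 \<tau>2"
    "Y * (\<epsilon> * mum (poly p t) * \<epsilon>') = g2 * Lin I2 \<tau>2 * h2" using DD_LL unfolding LL_def by blast
  have "g1 * Lin I1 \<tau>1 * h1 * \<alpha> = \<Psi> * (\<alpha> * mum (poly q t)) * (\<alpha>' * \<alpha>)"
    unfolding 1(4)[symmetric] by (simp only: mult.assoc)
  also have "\<dots> = (\<Psi> * e) * mum (poly p t)" using \<alpha>' \<alpha>q by (simp add: mult.assoc)
  also have "\<dots> = Y * \<epsilon> * mum (poly p t) * (\<epsilon>' * \<epsilon>)" using d \<epsilon>' by (simp add: \<Psi>_def)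
  also have "\<dots> = g2 * Lin I2 \<tau>2 * h2 * \<epsilon>" unfolding 2(4)[symmetric] by (simp only: mult.assoc)
  finally have key: "g1 * Lin I1 \<tau>1 * h1 * \<alpha> = g2 * Lin I2 \<tau>2 * h2 * \<epsilon>" .
  obtain g2' where g2': "g2' \<in> Em B" "g2' * g2 = 1" using Em_inverse[OF sB 2(1)] by blast
  obtain h1' where h1': "h1' \<in> Em B" "h1 * h1' = 1" "h1' * h1 = 1" using Em_inverse[OF sB 1(2)] by blast
  obtain h2' where h2': "h2' \<in> Em B" "h2' * h2 = 1" using Em_inverse[OF sB 2(2)] by blast
  define H where "H = h2 * \<epsilon> * \<alpha>' * h1'"
  have "g2' * (g1 * Lin I1 \<tau>1 * h1 * \<alpha>) * \<alpha>' * h1' = g2' * (g2 * Lin I2 \<tau>2 * h2 * \<epsilon>) * \<alpha>' * h1'"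
    using key by simp
  moreover have "g2' * (g1 * Lin I1 \<tau>1 * h1 * \<alpha>) * \<alpha>' * h1' = g2' * g1 * Lin I1 \<tau>1 * (h1 * (\<alpha> * \<alpha>') * h1')"
    by (simp only: mult.assoc)
  moreover have "g2' * (g2 * Lin I2 \<tau>2 * h2 * \<epsilon>) * \<alpha>' * h1' = (g2' * g2) * Lin I2 \<tau>2 * H"
    by (simp only: H_def mult.assoc)
  ultimately have "(g2' * g1) * Lin I1 \<tau>1 = Lin I2 \<tau>2 * H" using \<alpha>' h1' g2' by simp
  moreover have "g2' * g1 \<in> GLm B" "H \<in> GLm B"
    unfolding H_def using \<alpha>' 1 2 d g2' h1' Em_GLm[OF sB] sB by auto
  ultimately have "eqE B (g2' * g1) H" using Lin_intertwine_eqE[OF 1(3) 2(3)] by blast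
  then have "eqE B H (g2' * g1)" using eqE_sym[OF sB] by blast
  \<comment> \<open>The left intertwiner is elementary, so the right one is; unwinding
    \<open>H\<close> shows that the inverse of \<alpha> is elementary.\<close>
  then have "H \<in> Em B" unfolding eqE_def using g2' 1 by auto
  then have "\<epsilon>' * h2' * H * h1 \<in> Em B" using \<epsilon>' h2' 1 by simp
  moreover have "\<epsilon>' * h2' * H * h1 = \<epsilon>' * (h2' * h2) * \<epsilon> * \<alpha>' * (h1' * h1)" by (simp only: H_def mult.assoc)
  ultimately have "\<alpha>' \<in> Em B" using \<epsilon>' h2' h1' by simp
  then obtain \<beta> where \<beta>: "\<beta> \<in> Em B" "\<beta> * \<alpha>' = 1" using Em_inverse[OF sB] by blast
  have "\<beta> = \<beta> * (\<alpha>' * \<alpha>)" using \<alpha>' by simp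
  also have "\<dots> = \<alpha>" using \<beta> by (simp flip: mult.assoc)
  finally have "\<alpha> \<in> Em B" using \<beta> by simp
  moreover have "A = \<alpha> * mum c" using c1 by (simp add: \<alpha>_def mult.assoc mult.commute[of c] flip: mum_mult)
  ultimately show "\<exists>c\<in>C. eqE B A (mum c)" using cpq(1) unfolding eqE_def by blast
qed

end

section \<open>Commutative polynomial rings\<close>

definition shom :: "('a::ring_1 \<Rightarrow> 'b::ring_1) \<Rightarrow> 'a set \<Rightarrow> bool" where
  "shom h B \<longleftrightarrow> h 0 = 0 \<and> h 1 = 1 \<and> (\<forall>a\<in>B. \<forall>b\<in>B. h (a + b) = h a + h b \<and> h (a * b) = h a * h b)"

lemma shom_sum:
  assumes "shom h B" "sring B" "\<And>i. i \<in> I \<Longrightarrow> f i \<in> B"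
  shows "h (sum f I) = (\<Sum>i\<in>I. h (f i))"
  using assms(3) by (induction I rule: infinite_finite_induct) (use assms(1,2) in \<open>auto simp: shom_def\<close>)

lemma mapm_simps:
  assumes h: "shom h B" and B: "sring B"
  shows "mat_over B M \<Longrightarrow> mat_over B N \<Longrightarrow> mapm h (M * N) = mapm h M * mapm h N"
    "mat_over B M \<Longrightarrow> mat_over B N \<Longrightarrow> mapm h (M + N) = mapm h M + mapm h N"
    "mapm h 1 = 1" "mapm h (ue i j b) = ue i j (h b)"
proof -
  have h0: "h 0 = 0" "h 1 = 1" using h by (auto simp: shom_def)
  show "mapm h 1 = 1" "mapm h (ue i j b) = ue i j (h b)"
    by (rule cfm_eqI; simp add: h0 ent_one ue.rep_eq)+
  show "mapm h (M + N) = mapm h M + mapm h N" if "mat_over B M" "mat_over B N"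
    using h that by (intro cfm_eqI) (simp add: h0 shom_def mat_over_def)
  show "mapm h (M * N) = mapm h M * mapm h N" if MN: "mat_over B M" "mat_over B N"
  proof (rule cfm_eqI)
    fix i j
    let ?J = "{k. ent N k j \<noteq> 0}"
    have "ent (mapm h (M * N)) i j = h (\<Sum>k\<in>?J. ent M i k * ent N k j)"
      by (simp add: h0) (rule arg_cong[of _ _ h], rule ent_times, auto)
    also have "\<dots> = (\<Sum>k\<in>?J. h (ent M i k * ent N k j))"
      using B MN by (intro shom_sum[OF h]) (auto simp: mat_over_def)
    also have "\<dots> = (\<Sum>k\<in>?J. ent (mapm h M) i k * ent (mapm h N) k j)"
      using h MN by (intro sum.cong refl) (simp add: h0 shom_def mat_over_def)
    also have "\<dots> = ent (mapm h M * mapm h N) i j"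
      by (rule ent_times[symmetric]) (auto simp: h0)
    finally show "ent (mapm h (M * N)) i j = ent (mapm h M * mapm h N) i j" .
  qed
qed

text \<open>An elementary factorization over the image lifts generator by generator, and injectivity
  turns the image of the lifted identity into the identity itself.\<close>

lemma Good_transfer:
  assumes h: "shom h B" "inj_on h B" and B: "sring B" "sring (h ` B)"
    and C: "C \<subseteq> B" and G: "Good (h ` C) (h ` B)"
  shows "Good C B"
  unfolding Good_def
proof
  fix A assume A: "A \<in> GLm B"
  have h0: "h 0 = 0" "h 1 = 1" using h by (auto simp: shom_def)
  obtain A' where A': "A' \<in> GLm B" "A * A' = 1" "A' * A = 1" using A by (auto elim: GLmE)
  have F: "mapm h M \<in> Fin1 (h ` B)" if "M \<in> Fin1 B" for M
    using that fin_mapm(1)[of M h] h0 by (auto simp: Fin1_def mat_over_def)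
  have o: "mat_over B A" "mat_over B A'" using A A' GLm_over by blast+
  have "mapm h A * mapm h A' = 1" "mapm h A' * mapm h A = 1"
    using A' mapm_simps[OF h(1) B(1)] o by metis+
  then have "mapm h A \<in> GLm (h ` B)" using A A' F GLm_Fin1 by (intro GLmI[of _ _ "mapm h A'"]) auto
  then obtain c where c: "c \<in> C" "eqE (h ` B) (mapm h A) (mum (h c))" using G unfolding Good_def by blast
  then obtain e where e: "e \<in> Em (h ` B)" "mapm h A = e * mum (h c)" unfolding eqE_def by blast
  have "\<exists>e0\<in>Em B. mapm h e0 = e" using e(1)
  proof induction
    case Em_one
    then show ?case using mapm_simps(3)[OF h(1) B(1)] Em.Em_one by blast
  next
    case (Em_step i j b X)
    then obtain e0 b0 where *: "e0 \<in> Em B" "mapm h e0 = X" "b0 \<in> B" "b = h b0" by blast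
    have "mapm h ((1 + ue i j b0) * e0) = (1 + ue i j b) * X"
      using * B(1) Em_subset_Fin1[OF B(1) *(1)] by (simp add: mapm_simps[OF h(1) B(1)] Fin1_def)
    moreover have "(1 + ue i j b0) * e0 \<in> Em B" using Em_step(1) * by (intro Em.Em_step) auto
    ultimately show ?case by blast
  qed
  then obtain e0 where e0: "e0 \<in> Em B" "mapm h e0 = e" by blast
  have cB: "c \<in> B" using c C by blast
  have "mapm h (mum c) = mum (h c)"
    by (rule cfm_eqI) (simp add: h0 ent_mum)
  moreover have oe: "mat_over B e0" "mat_over B (mum c)"
    using Em_subset_Fin1[OF B(1) e0(1)] mum_Fin1[OF B(1) cB] by (auto simp: Fin1_def)
  ultimately have "mapm h A = mapm h (e0 * mum c)"
    using e(2) e0(2) mapm_simps(1)[OF h(1) B(1)] by simp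
  then have "h (ent A i j) = h (ent (e0 * mum c) i j)" for i j
    by (metis ent_mapm h0(1))
  moreover have "mat_over B (e0 * mum c)" using oe B(1) by simp
  ultimately have "A = e0 * mum c"
    using h(2) o(1) by (intro cfm_eqI) (auto simp: inj_on_def mat_over_def)
  then show "\<exists>c\<in>C. eqE B A (mum c)" using c(1) e0(1) unfolding eqE_def by blast
qed

lemma shom_inv_into:
  assumes "shom h B" "inj_on h B" "sring B"
  shows "shom (inv_into B h) (h ` B)" "inj_on (inv_into B h) (h ` B)" "inv_into B h ` (h ` B) = B"
proof -
  have inv: "inv_into B h (h b) = b" if "b \<in> B" for b using assms(2) that by simp
  have "h 0 = 0" "h 1 = 1" using assms by (auto simp: shom_def)
  then have "inv_into B h 0 = 0" "inv_into B h 1 = 1" using inv[of 0] inv[of 1] assms(3) by auto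
  moreover have "inv_into B h (h a + h b) = a + b" "inv_into B h (h a * h b) = a * b" if "a \<in> B" "b \<in> B" for a b
    using assms that inv[of "a + b"] inv[of "a * b"] by (auto simp: shom_def)
  ultimately show "shom (inv_into B h) (h ` B)" using inv by (auto simp: shom_def)
  show "inj_on (inv_into B h) (h ` B)" by (rule inj_on_inv_into) auto
  show "inv_into B h ` (h ` B) = B" using inv by force
qed

lemma shom_uminus:
  assumes "shom h B" "sring B" "b \<in> B" shows "h (- b) = - h b"
proof -
  have "h (b + - b) = h b + h (- b)" using assms unfolding shom_def by (metis sringD(5))
  then show ?thesis using assms by (simp add: shom_def eq_neg_iff_add_eq_0 add.commute)
qed

lemma sring_image:
  assumes h: "shom h B" and B: "sring B" shows "sring (h ` B)"
  unfolding sring_def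
proof (intro conjI ballI)
  have "h 0 = 0" "h 1 = 1" using h by (auto simp: shom_def)
  then show "0 \<in> h ` B" "1 \<in> h ` B" using B by (metis imageI sringD(1,2))+
next
  fix a b assume "a \<in> h ` B" "b \<in> h ` B"
  then obtain x y where xy: "x \<in> B" "y \<in> B" "a = h x" "b = h y" by blast
  then have "a + b = h (x + y)" "a * b = h (x * y)" using h by (auto simp: shom_def)
  then show "a + b \<in> h ` B" "a * b \<in> h ` B" using B xy by auto
next
  fix a assume "a \<in> h ` B"
  then obtain x where x: "x \<in> B" "a = h x" by blast
  then have "- a = h (- x)" using shom_uminus[OF h B] by simp
  then show "- a \<in> h ` B" using B x by auto
qed

lemma poly_mapping_expand: "p = (\<Sum>k\<in>Poly_Mapping.keys p. Poly_Mapping.single k (Poly_Mapping.lookup p k))"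
proof (rule poly_mapping_eqI)
  fix l
  have "Poly_Mapping.lookup (\<Sum>k\<in>Poly_Mapping.keys p. Poly_Mapping.single k (Poly_Mapping.lookup p k)) l
     = (\<Sum>k\<in>Poly_Mapping.keys p. if k = l then Poly_Mapping.lookup p k else 0)"
    by (simp add: lookup_sum lookup_single when_def)
  also have "\<dots> = Poly_Mapping.lookup p l"
    by (auto simp: not_in_keys_iff_lookup_eq_zero)
  finally show "Poly_Mapping.lookup p l = Poly_Mapping.lookup (\<Sum>k\<in>Poly_Mapping.keys p. Poly_Mapping.single k (Poly_Mapping.lookup p k)) l" by simp
qed

lemma single_eq_0_iff [simp]: "Poly_Mapping.single k c = 0 \<longleftrightarrow> c = 0"
  by (metis lookup_single_eq lookup_zero single_zero)

lemma poly_mapping_induct_keys: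
  fixes p :: "'i \<Rightarrow>\<^sub>0 'k::comm_monoid_add"
  assumes "P 0" "\<And>k c. k \<in> Poly_Mapping.keys p \<Longrightarrow> P (Poly_Mapping.single k c)" "\<And>a b. P a \<Longrightarrow> P b \<Longrightarrow> P (a + b)"
  shows "P p"
proof -
  have "P (\<Sum>k\<in>Poly_Mapping.keys p. Poly_Mapping.single k (Poly_Mapping.lookup p k))"
    by (rule sum_closed_pred) (use assms in auto)
  then show ?thesis by (simp flip: poly_mapping_expand)
qed

lemma sring_keys:
  assumes "Q 0" "\<And>k l. Q k \<Longrightarrow> Q l \<Longrightarrow> Q (k + l)"
  shows "sring {p :: 'i::monoid_add \<Rightarrow>\<^sub>0 'k::ring_1. \<forall>k\<in>Poly_Mapping.keys p. Q k}"
  unfolding sring_def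
proof (intro conjI ballI)
  fix a b :: "'i \<Rightarrow>\<^sub>0 'k"
  assume a: "a \<in> {p. \<forall>k\<in>Poly_Mapping.keys p. Q k}" and b: "b \<in> {p. \<forall>k\<in>Poly_Mapping.keys p. Q k}"
  show "a + b \<in> {p. \<forall>k\<in>Poly_Mapping.keys p. Q k}" using a b Poly_Mapping.keys_add[of a b] by blast
  show "a * b \<in> {p. \<forall>k\<in>Poly_Mapping.keys p. Q k}" using a b keys_mult[of a b] assms(2) by blast
qed (use assms(1) in \<open>auto simp: in_keys_iff\<close>)

section \<open>Polynomials over rational function fields\<close>

type_synonym 'k mp = "(nat \<Rightarrow>\<^sub>0 nat) \<Rightarrow>\<^sub>0 'k"

definition pvars :: "nat set \<Rightarrow> 'k::field mp set" where
  "pvars W = {p. \<forall>k\<in>Poly_Mapping.keys p. Poly_Mapping.keys k \<subseteq> W}"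

lemma sring_pvars [simp]: "sring (pvars W)"
  unfolding pvars_def by (rule sring_keys) (auto dest: Poly_Mapping.keys_add[THEN subsetD])

lemma pvars_01 [simp]: "0 \<in> pvars W" "1 \<in> pvars W"
  by (auto simp: pvars_def)

lemma pvars_mono: "V \<subseteq> W \<Longrightarrow> pvars V \<subseteq> pvars W"
  by (auto simp: pvars_def)

lemma single_pvars: "Poly_Mapping.keys k \<subseteq> W \<Longrightarrow> Poly_Mapping.single k c \<in> pvars W"
  by (auto simp: pvars_def)

text \<open>The ring K(V)[W] inside the rational function field in all variables.\<close>

definition SF :: "nat set \<Rightarrow> nat set \<Rightarrow> 'k::field mp fract set" where
  "SF V W = {Fract p q | p q. p \<in> pvars (V \<union> W) \<and> q \<in> pvars V \<and> q \<noteq> 0}"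

lemma SFI: "p \<in> pvars (V \<union> W) \<Longrightarrow> q \<in> pvars V \<Longrightarrow> q \<noteq> 0 \<Longrightarrow> Fract p q \<in> SF V W"
  unfolding SF_def by blast

lemma sring_SF [simp]: "sring (SF V W :: 'k::field mp fract set)"
  unfolding sring_def
proof (intro conjI ballI)
  show "0 \<in> SF V W" "1 \<in> SF V W"
    unfolding Zero_fract_def One_fract_def using sring_pvars by (auto intro!: SFI)
next
  fix a b :: "'k mp fract" assume "a \<in> SF V W" "b \<in> SF V W"
  then obtain p q r s where *: "a = Fract p q" "b = Fract r s" "p \<in> pvars (V \<union> W)" "r \<in> pvars (V \<union> W)"
    "q \<in> pvars V" "s \<in> pvars V" "q \<noteq> 0" "s \<noteq> 0" unfolding SF_def by blast
  have **: "q \<in> pvars (V \<union> W)" "s \<in> pvars (V \<union> W)" using * pvars_mono[of V "V \<union> W"] by auto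
  show "a + b \<in> SF V W" "a * b \<in> SF V W"
    using * ** by (auto intro!: SFI)
next
  fix a :: "'k mp fract" assume "a \<in> SF V W"
  then obtain p q where *: "a = Fract p q" "p \<in> pvars (V \<union> W)" "q \<in> pvars V" "q \<noteq> 0" unfolding SF_def by blast
  then show "- a \<in> SF V W" by (auto intro!: SFI)
qed

lemma SF_01 [simp]: "0 \<in> SF V W" "1 \<in> SF V W"
  by (simp_all add: sring_SF)

lemma SF_mono: "V \<subseteq> V' \<Longrightarrow> V \<union> W \<subseteq> V' \<union> W' \<Longrightarrow> SF V W \<subseteq> SF V' W'"
  unfolding SF_def using pvars_mono[of V V'] pvars_mono[of "V \<union> W" "V' \<union> W'"] by blast

lemma SF_inverse: "c \<in> SF V {} \<Longrightarrow> inverse c \<in> SF V {}"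
proof -
  assume "c \<in> SF V {}"
  then obtain p q where *: "c = Fract p q" "p \<in> pvars V" "q \<in> pvars V" "q \<noteq> 0" unfolding SF_def by auto
  show ?thesis
  proof (cases "p = 0")
    case True
    then show ?thesis using * by (simp add: rat_number_collapse fract_collapse)
  next
    case False
    then show ?thesis using * by (auto intro!: SFI)
  qed
qed

abbreviation xmon :: "nat \<Rightarrow> 'k::field mp" where "xmon v \<equiv> Poly_Mapping.single (Poly_Mapping.single v 1) 1"

lemma Fract_power: "Fract (a ^ n) 1 = Fract a 1 ^ n"
proof (induction n)
  case (Suc n)
  have "Fract (a ^ Suc n) 1 = Fract a 1 * Fract (a ^ n) 1" by simp
  then show ?case using Suc by simp
qed (simp add: One_fract_def)

text \<open>Every monomial of \<open>xmon v * C\<close> contains v and no monomial of A does, so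
  they cannot cancel.\<close>

lemma pvars_split:
  fixes A C :: "'k::field mp"
  assumes "A \<in> pvars W" "v \<notin> W" "A + xmon v * C = 0"
  shows "A = 0 \<and> C = 0"
proof -
  have "A = - (xmon v * C)" using assms(3) by (simp add: eq_neg_iff_add_eq_0)
  then have "Poly_Mapping.keys A \<subseteq> Poly_Mapping.keys (xmon v * C)" by (auto simp: in_keys_iff)
  also have "\<dots> \<subseteq> {a + b | a b. a \<in> Poly_Mapping.keys (xmon v :: 'k mp) \<and> b \<in> Poly_Mapping.keys C}" by (rule keys_mult)
  finally have "Poly_Mapping.keys A \<subseteq> {k. Poly_Mapping.lookup k v \<noteq> 0}" by (auto simp: lookup_add lookup_single)
  moreover have "Poly_Mapping.lookup k v = 0" if "k \<in> Poly_Mapping.keys A" for k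
  proof -
    have "Poly_Mapping.keys k \<subseteq> W" using assms(1) that by (auto simp: pvars_def)
    then have "v \<notin> Poly_Mapping.keys k" using assms(2) by blast
    then show ?thesis by (simp add: in_keys_iff)
  qed
  ultimately have "Poly_Mapping.keys A = {}" by blast
  then have "A = 0" by simp
  then show ?thesis using assms(3) by auto
qed

text \<open>Transcendence by induction on the polynomial: with denominators free of v cleared,
  \<open>pvars_split\<close> annihilates the constant term and the rest separately.\<close>

lemma SF_polynomial_extension:
  assumes v: "v \<notin> V \<union> W"
  shows "polynomial_extension (SF V W :: 'k::field mp fract set) (Fract (xmon v) 1)"
proof
  show "sring (SF V W :: 'k mp fract set)" by (rule sring_SF)
next
  let ?t = "Fract (xmon v) 1 :: 'k mp fract"
  have tB: "?t \<in> SF V (insert v W)" by (auto intro!: SFI single_pvars)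
  have RB: "SF V W \<subseteq> (SF V (insert v W) :: 'k mp fract set)" by (rule SF_mono) auto
  fix p :: "'k mp fract poly"
  assume "\<And>i. Polynomial.coeff p i \<in> SF V W" "poly p ?t = 0"
  then show "p = 0"
  proof (induction p)
    case (pCons a p)
    have p: "Polynomial.coeff p i \<in> SF V W" for i using pCons.prems(1)[of "Suc i"] by simp
    have a: "a \<in> SF V W" using pCons.prems(1)[of 0] by simp
    have "poly p ?t \<in> SF V (insert v W)" unfolding poly_altdef
      using subsetD[OF RB p] tB by (intro sring_sum sringD(4) sring_power) auto
    then obtain r s where rs: "poly p ?t = Fract r s" "s \<in> pvars V" "s \<noteq> 0" unfolding SF_def by blast
    obtain b q where bq: "a = Fract b q" "b \<in> pvars (V \<union> W)" "q \<in> pvars V" "q \<noteq> 0" using a unfolding SF_def by blast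
    have "Fract b q + ?t * Fract r s = 0" using pCons.prems(2) rs bq by simp
    then have "b * s + xmon v * (r * q) = 0" using rs bq by (simp add: Zero_fract_def eq_fract algebra_simps)
    moreover have "b * s \<in> pvars (V \<union> W)" using bq rs pvars_mono[of V "V \<union> W"] by (intro sringD(4)) auto
    ultimately have "b * s = 0" "r * q = 0" using pvars_split v by blast+
    then have "b = 0" "r = 0" using rs bq by auto
    then have "a = 0" "poly p ?t = 0" using bq rs by (auto simp: Zero_fract_def eq_fract)
    then show ?case using pCons.IH[OF p] by simp
  qed simp
qed

text \<open>For the inclusion from right to left, the power of v is stripped off each monomial of
  the numerator; the denominator does not involve v.\<close>

lemma SF_B:
  assumes v: "v \<notin> V \<union> W"
  shows "polynomial_extension.B (SF V W :: 'k::field mp fract set) (Fract (xmon v) 1) = SF V (insert v W)"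
proof -
  let ?t = "Fract (xmon v) 1 :: 'k mp fract"
  interpret polynomial_extension "SF V W :: 'k mp fract set" ?t by (rule SF_polynomial_extension[OF v])
  have tB': "?t \<in> SF V (insert v W)" by (auto intro!: SFI single_pvars)
  have RB': "SF V W \<subseteq> (SF V (insert v W) :: 'k mp fract set)" by (rule SF_mono) auto
  have "B \<subseteq> SF V (insert v W)"
  proof
    fix b assume "b \<in> B"
    then obtain p where "b = poly p ?t" "\<And>i. Polynomial.coeff p i \<in> SF V W" unfolding B_def by blast
    then show "b \<in> SF V (insert v W)" unfolding poly_altdef
      using RB' tB' by (auto intro!: sring_sum sringD(4) sring_power)
  qed
  moreover have "SF V (insert v W) \<subseteq> B"
  proof
    fix b :: "'k mp fract" assume "b \<in> SF V (insert v W)"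
    then obtain p q where pq: "b = Fract p q" "p \<in> pvars (V \<union> insert v W)" "q \<in> pvars V" "q \<noteq> 0" unfolding SF_def by blast
    have "Fract p 1 \<in> B"
    proof (rule poly_mapping_induct_keys[of "\<lambda>p. Fract p 1 \<in> B"])
      show "Fract 0 1 \<in> B" using sB by (simp add: fract_collapse)
      show "Fract (a + b) 1 \<in> B" if "Fract a 1 \<in> B" "Fract b 1 \<in> B" for a b
        using sringD(3)[OF sB that] by simp
      fix k :: "nat \<Rightarrow>\<^sub>0 nat" and c :: 'k
      assume k: "k \<in> Poly_Mapping.keys p"
      define k' where "k' = Poly_Mapping.update v 0 k"
      define n where "n = Poly_Mapping.lookup k v"
      have kk: "k = k' + Poly_Mapping.single v n"
        by (rule poly_mapping_eqI) (auto simp: k'_def n_def lookup_add lookup_update lookup_single when_def)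
      have xn: "xmon v ^ n = (Poly_Mapping.single (Poly_Mapping.single v n) 1 :: 'k mp)" for n
        by (induction n) (auto simp: mult_single simp flip: single_add)
      have "Poly_Mapping.single k c = Poly_Mapping.single k' c * xmon v ^ n"
        unfolding xn mult_single using kk by simp
      moreover have "Fract (xmon v ^ n) 1 = ?t ^ n"
        by (rule Fract_power)
      ultimately have eq: "Fract (Poly_Mapping.single k c) 1 = Fract (Poly_Mapping.single k' c) 1 * ?t ^ n"
        by (metis mult_fract mult_1_right)
      have "Poly_Mapping.keys k' \<subseteq> V \<union> W"
      proof
        fix j assume "j \<in> Poly_Mapping.keys k'"
        then have "j \<noteq> v" "j \<in> Poly_Mapping.keys k"
          by (auto simp: k'_def in_keys_iff lookup_update split: if_splits)
        then show "j \<in> V \<union> W" using pq(2) k unfolding pvars_def by blast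
      qed
      then have "Fract (Poly_Mapping.single k' c) 1 \<in> SF V W" by (intro SFI single_pvars) auto
      then show "Fract (Poly_Mapping.single k c) 1 \<in> B" unfolding eq using RB tB sB by (intro sringD(4) sring_power) auto
    qed
    moreover have "Fract 1 q \<in> B" using RB pq by (intro subsetD[OF RB] SFI) auto
    moreover have "b = Fract p 1 * Fract 1 q" using pq by simp
    ultimately show "b \<in> B" using sringD(4)[OF sB] by metis
  qed
  ultimately show ?thesis by blast
qed

text \<open>The coefficients lie in the field K(V), so the leading one splits off as a unit.\<close>

lemma SF_monic:
  fixes q :: "'k::field mp"
  assumes v: "v \<notin> V" and q: "q \<in> pvars (insert v V)" "q \<noteq> 0"
  shows "\<exists>c\<in>SF V {} - {0}. \<exists>p. (\<forall>i. Polynomial.coeff p i \<in> SF V {}) \<and> Polynomial.lead_coeff p = 1 \<and>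
    Fract q 1 = c * poly p (Fract (xmon v) 1)"
proof -
  have v': "v \<notin> V \<union> {}" using v by simp
  have "Fract q 1 \<in> SF V {v}" using q by (intro SFI) auto
  then have "Fract q 1 \<in> polynomial_extension.B (SF V {}) (Fract (xmon v) 1 :: 'k mp fract)"
    using SF_B[OF v', where 'k='k] by simp
  then obtain g where g: "Fract q 1 = poly g (Fract (xmon v) 1)" "\<And>i. Polynomial.coeff g i \<in> SF V {}"
    unfolding polynomial_extension.B_def[OF SF_polynomial_extension[OF v']] by blast
  have "g \<noteq> 0" using g(1) q(2) by (auto simp: Zero_fract_def eq_fract)
  define c where "c = Polynomial.lead_coeff g"
  have c: "c \<noteq> 0" "c \<in> SF V {}" using \<open>g \<noteq> 0\<close> g by (auto simp: c_def)
  show ?thesis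
  proof (intro bexI[of _ c] exI[of _ "Polynomial.smult (inverse c) g"] conjI allI)
    show "Polynomial.coeff (Polynomial.smult (inverse c) g) i \<in> SF V {}" for i
      using g(2) SF_inverse[OF c(2)] by simp
    show "Polynomial.lead_coeff (Polynomial.smult (inverse c) g) = 1" using c by (simp add: c_def)
    show "Fract q 1 = c * poly (Polynomial.smult (inverse c) g) (Fract (xmon v) 1)" using c g by simp
    show "c \<in> SF V {} - {0}" using c by simp
  qed
qed

text \<open>The variable v is first treated as a coefficient: K(V, v)[W] is covered by the induction
  hypothesis, and it is K(V)[W, v] with the monic polynomials in v over K(V) inverted. Hence V must
  be arbitrary in the induction.\<close>

lemma Good_SF:
  assumes "finite W" "V \<inter> W = {}"
  shows "Good (SF V {} - {0}) (SF V W :: 'k::field mp fract set)"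
  using assms
proof (induction W arbitrary: V rule: finite_induct)
  case empty
  show ?case by (rule Good_field) (auto intro: sring_SF SF_inverse)
next
  case (insert v W)
  have v: "v \<notin> V \<union> W" "v \<notin> V" using insert by auto
  let ?t = "Fract (xmon v) 1 :: 'k mp fract"
  interpret polynomial_extension "SF V W :: 'k mp fract set" ?t by (rule SF_polynomial_extension[OF v(1)])
  have B: "B = SF V (insert v W)" by (rule SF_B[OF v(1)])
  have sub: "SF V {} \<subseteq> (SF V W :: 'k mp fract set)" by (rule SF_mono) auto
  have IH: "Good (SF (insert v V) {} - {0}) (SF (insert v V) W :: 'k mp fract set)"
    using insert by (intro insert.IH) auto
  have "Good (SF V {} - {0}) B"
  proof (rule Good_descend[OF _ _ _ _ _ IH])
    show "sring (SF (insert v V) W :: 'k mp fract set)" by (rule sring_SF)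
    show "B \<subseteq> SF (insert v V) W" unfolding B by (rule SF_mono) auto
    show "unit_group B (SF V {} - {0})"
      unfolding unit_group_def
    proof (intro conjI ballI)
      show "SF V {} - {0} \<subseteq> B" using sub RB by blast
      show "1 \<in> SF V {} - {0}" by auto
      show "\<exists>d\<in>SF V {} - {0}. c * d = 1 \<and> d * c = 1" if "c \<in> SF V {} - {0}" for c
        using that SF_inverse by (intro bexI[of _ "inverse c"]) auto
    qed auto
    show "\<exists>p. (\<forall>i. Polynomial.coeff p i \<in> SF V W) \<and> Polynomial.lead_coeff p = 1 \<and> b' * poly p ?t \<in> B"
      if b': "b' \<in> SF (insert v V) W" for b'
    proof -
      obtain p q where pq: "b' = Fract p q" "p \<in> pvars (insert v V \<union> W)" "q \<in> pvars (insert v V)" "q \<noteq> 0"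
        using b' unfolding SF_def by blast
      obtain c g where cg: "c \<in> SF V {} - {0}" "\<And>i. Polynomial.coeff g i \<in> SF V {}" "Polynomial.lead_coeff g = 1"
        "Fract q 1 = c * poly g ?t" using SF_monic[OF v(2) pq(3,4)] by blast
      have "b' * Fract q 1 = Fract p 1" using pq by (simp add: eq_fract)
      then have "b' * poly g ?t = inverse c * Fract p 1" using cg(1,4) by (auto simp: field_simps)
      moreover have "Fract p 1 \<in> B" unfolding B using pq by (intro SFI) auto
      moreover have "inverse c \<in> B" using SF_inverse[of c V] cg(1) sub RB by blast
      ultimately have "b' * poly g ?t \<in> B" using sB by simp
      then show ?thesis using cg sub by blast
    qed
    show "\<exists>c\<in>SF V {} - {0}. \<exists>p q. (\<forall>i. Polynomial.coeff p i \<in> SF V W) \<and> Polynomial.lead_coeff p = 1 \<and>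
       (\<forall>i. Polynomial.coeff q i \<in> SF V W) \<and> Polynomial.lead_coeff q = 1 \<and> c' * poly q ?t = c * poly p ?t"
      if c': "c' \<in> SF (insert v V) {} - {0}" for c'
    proof -
      obtain p q where pq: "c' = Fract p q" "p \<in> pvars (insert v V)" "q \<in> pvars (insert v V)" "q \<noteq> 0"
        using c' unfolding SF_def by auto
      have "p \<noteq> 0" using c' pq by (auto simp: fract_collapse)
      then obtain c g where cg: "c \<in> SF V {} - {0}" "\<And>i. Polynomial.coeff g i \<in> SF V {}" "Polynomial.lead_coeff g = 1"
        "Fract p 1 = c * poly g ?t" using SF_monic[OF v(2) pq(2)] by blast
      obtain d h where dh: "d \<in> SF V {} - {0}" "\<And>i. Polynomial.coeff h i \<in> SF V {}" "Polynomial.lead_coeff h = 1"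
        "Fract q 1 = d * poly h ?t" using SF_monic[OF v(2) pq(3,4)] by blast
      have "c' * Fract q 1 = Fract p 1" using pq by (simp add: eq_fract)
      then have "c' * poly h ?t = (c * inverse d) * poly g ?t" using cg(4) dh(1,4) by (auto simp: field_simps)
      moreover have "c * inverse d \<in> SF V {} - {0}" using cg(1) dh(1) SF_inverse[of d V] by auto
      ultimately show ?thesis using cg dh sub by blast
    qed
  qed
  then show ?case unfolding B .
qed

definition kconsts :: "('i::monoid_add \<Rightarrow>\<^sub>0 'k::field) set" where
  "kconsts = Poly_Mapping.single 0 ` (UNIV - {0})"

text \<open>K[W] is \<open>SF {} W\<close>, because denominators without variables are constants and
  can be divided out.\<close>

lemma Good_pvars:
  assumes "finite W" shows "Good kconsts (pvars W :: 'k::field mp set)"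
proof (rule Good_transfer[of "\<lambda>p. Fract p 1"])
  show "shom (\<lambda>p. Fract p 1) (pvars W :: 'k mp set)" by (auto simp: shom_def Zero_fract_def One_fract_def)
  show "inj_on (\<lambda>p. Fract p 1) (pvars W :: 'k mp set)" by (auto simp: inj_on_def eq_fract)
  show "sring (pvars W :: 'k mp set)" by (rule sring_pvars)
  show "kconsts \<subseteq> (pvars W :: 'k mp set)" by (auto simp: kconsts_def intro: single_pvars)
  have p0: "q \<in> pvars {} \<longleftrightarrow> (\<exists>c. q = Poly_Mapping.single 0 c)" for q :: "'k mp"
  proof
    assume "q \<in> pvars {}"
    then have "Poly_Mapping.keys q \<subseteq> {0}" by (auto simp: pvars_def)
    then have "q = Poly_Mapping.single 0 (Poly_Mapping.lookup q 0)"
      by (intro poly_mapping_eqI) (auto simp: lookup_single when_def in_keys_iff)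
    then show "\<exists>c. q = Poly_Mapping.single 0 c" ..
  qed (auto intro: single_pvars)
  have S: "(\<lambda>p. Fract p 1) ` pvars X = (SF {} X :: 'k mp fract set)" for X
  proof
    show "(\<lambda>p. Fract p 1) ` pvars X \<subseteq> (SF {} X :: 'k mp fract set)"
      by (auto intro!: SFI)
    show "SF {} X \<subseteq> (\<lambda>p. Fract p 1) ` (pvars X :: 'k mp set)"
    proof
      fix z :: "'k mp fract" assume "z \<in> SF {} X"
      then obtain p c where *: "z = Fract p (Poly_Mapping.single 0 c)" "p \<in> pvars X" "Poly_Mapping.single 0 c \<noteq> (0 :: 'k mp)"
        unfolding SF_def p0 by auto
      then have c: "c \<noteq> 0" by auto
      have "z = Fract (p * Poly_Mapping.single 0 (inverse c)) 1"
        using * c by (simp add: eq_fract mult.assoc mult_single)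
      moreover have "p * Poly_Mapping.single 0 (inverse c) \<in> pvars X"
        using * by (intro sringD(4)) (auto intro: single_pvars)
      ultimately show "z \<in> (\<lambda>p. Fract p 1) ` pvars X" by blast
    qed
  qed
  show "sring ((\<lambda>p. Fract p 1) ` pvars W :: 'k mp fract set)" unfolding S by (rule sring_SF)
  have "pvars {} - {0} = (kconsts :: 'k mp set)" unfolding kconsts_def
    by (auto simp: p0 image_iff) (metis DiffI UNIV_I singletonD)
  moreover have "(\<lambda>p. Fract p 1) ` (pvars {} - {0}) = (\<lambda>p. Fract p 1) ` pvars {} - {0 :: 'k mp fract}"
    by (auto simp: Zero_fract_def eq_fract)
  ultimately have "(\<lambda>p. Fract p 1) ` kconsts = (SF {} {} - {0} :: 'k mp fract set)" using S[of "{}"] by metis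
  then show "Good ((\<lambda>p. Fract p 1) ` kconsts) ((\<lambda>p. Fract p 1) ` pvars W :: 'k mp fract set)"
    unfolding S using Good_SF[OF assms, of "{}"] by simp
qed

section \<open>The monoid algebra of a power of the bicyclic monoid\<close>

text \<open>\<open>BC a b\<close> encodes x^a y^b, the normal form under y x = 1; truncated
  subtraction in the sum cancels the inner powers. The monoid is written additively so that its
  elements can serve as exponents of \<open>Poly_Mapping\<close>.\<close>

datatype bicyc = BC (xd: nat) (yd: nat)

instantiation bicyc :: monoid_add
begin
definition zero_bicyc where "0 = BC 0 0"
definition plus_bicyc where "k + l = BC (xd k + (xd l - yd k)) (yd l + (yd k - xd l))"
instance
proof
  fix a b c :: bicyc
  show "a + b + c = a + (b + c)" unfolding plus_bicyc_def by (cases a; cases b; cases c) auto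
  show "0 + a = a" "a + 0 = a" unfolding plus_bicyc_def zero_bicyc_def by (cases a; auto)+
qed
end

lemma bicyc_simps [simp]: "xd (k + l) = xd k + (xd l - yd k)" "yd (k + l) = yd l + (yd k - xd l)" "xd 0 = 0" "yd 0 = 0"
  by (simp_all add: plus_bicyc_def zero_bicyc_def)

lemma bicyc_eqI: "xd k = xd l \<Longrightarrow> yd k = yd l \<Longrightarrow> k = l"
  by (cases k; cases l) simp

type_synonym 'k salg = "(nat \<Rightarrow> bicyc) \<Rightarrow>\<^sub>0 'k"

abbreviation smono :: "(nat \<Rightarrow> bicyc) \<Rightarrow> 'k::field salg" where "smono k \<equiv> Poly_Mapping.single k 1"

text \<open>The subalgebra S(A, B): exponents of x occur only at indices in A, exponents of y only
  at indices in B.\<close>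

definition SW :: "nat set \<Rightarrow> nat set \<Rightarrow> 'k::field salg set" where
  "SW A B = {p. \<forall>k\<in>Poly_Mapping.keys p. \<forall>i. (xd (k i) \<noteq> 0 \<longrightarrow> i \<in> A) \<and> (yd (k i) \<noteq> 0 \<longrightarrow> i \<in> B)}"

lemma sring_SW [simp]: "sring (SW A B)"
  unfolding SW_def by (rule sring_keys) auto

lemma SW_mono: "A \<subseteq> A' \<Longrightarrow> B \<subseteq> B' \<Longrightarrow> SW A B \<subseteq> SW A' B'"
  unfolding SW_def by blast

lemma single_SW: "(\<And>i. xd (k i) \<noteq> 0 \<Longrightarrow> i \<in> A) \<Longrightarrow> (\<And>i. yd (k i) \<noteq> 0 \<Longrightarrow> i \<in> B) \<Longrightarrow> Poly_Mapping.single k c \<in> SW A B"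
  unfolding SW_def by auto

lemma SW_induct:
  assumes "p \<in> SW A B" "P 0" "\<And>a b. P a \<Longrightarrow> P b \<Longrightarrow> P (a + b)"
    "\<And>k c. (\<And>i. xd (k i) \<noteq> 0 \<Longrightarrow> i \<in> A) \<Longrightarrow> (\<And>i. yd (k i) \<noteq> 0 \<Longrightarrow> i \<in> B) \<Longrightarrow> P (Poly_Mapping.single k c)"
  shows "P p"
  by (rule poly_mapping_induct_keys) (use assms in \<open>auto simp: SW_def\<close>)

definition bat :: "nat \<Rightarrow> bicyc \<Rightarrow> nat \<Rightarrow> bicyc" where "bat i b = (\<lambda>j. if j = i then b else 0)"

lemma bat_power: "smono (bat i (BC 1 0)) ^ n = smono (bat i (BC n 0))" "smono (bat i (BC 0 1)) ^ n = smono (bat i (BC 0 n))"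
proof -
  have "bat i (BC 1 0) + bat i (BC n 0) = bat i (BC (Suc n) 0)" "bat i (BC 0 1) + bat i (BC 0 n) = bat i (BC 0 (Suc n))" for n
    by (auto simp: bat_def fun_eq_iff plus_bicyc_def zero_bicyc_def)
  moreover have "bat i (BC 0 0) = 0" by (auto simp: bat_def fun_eq_iff zero_bicyc_def)
  ultimately show "smono (bat i (BC 1 0)) ^ n = smono (bat i (BC n 0))" "smono (bat i (BC 0 1)) ^ n = smono (bat i (BC 0 n))"
    by (induction n) (auto simp: mult_single)
qed

lemma single_factor:
  "Poly_Mapping.single k c = Poly_Mapping.single (k(i := 0)) c * smono (bat i (BC (xd (k i)) 0)) * smono (bat i (BC 0 (yd (k i))))"
proof -
  have "k(i := 0) + bat i (BC (xd (k i)) 0) + bat i (BC 0 (yd (k i))) = k"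
    by (auto simp: bat_def fun_eq_iff intro!: bicyc_eqI)
  then show ?thesis by (simp add: mult_single)
qed

text \<open>By \<open>single_factor\<close> a monomial is r x^a y^b with r free of index i, hence
  commuting with x and y. Most axioms are additive and are verified on monomials; the two
  faithfulness axioms compare supports.\<close>

lemma toeplitz_SW:
  fixes A B :: "nat set"
  assumes i: "i \<in> A" "i \<in> B"
  shows "toeplitz (SW (A - {i}) (B - {i}) :: 'k::field salg set) (SW A (B - {i})) (SW (A - {i}) B) (SW A B)
    (smono (bat i (BC 1 0))) (smono (bat i (BC 0 1))) (1 - smono (bat i (BC 1 0)) * smono (bat i (BC 0 1)))"
proof -
  let ?R = "SW (A - {i}) (B - {i}) :: 'k salg set" and ?Rx = "SW A (B - {i}) :: 'k salg set"
    and ?Ry = "SW (A - {i}) B :: 'k salg set" and ?T = "SW A B :: 'k salg set"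
  define x where "x = (smono (bat i (BC 1 0)) :: 'k salg)"
  define y where "y = (smono (bat i (BC 0 1)) :: 'k salg)"
  define e where "e = 1 - x * y"
  let ?V = "{a + b * x + c * y | a b c. a \<in> ?R \<and> b \<in> ?R \<and> c \<in> ?R}"
  have yx: "y * x = 1"
  proof -
    have "bat i (BC 0 1) + bat i (BC 1 0) = 0" by (auto simp: bat_def fun_eq_iff intro!: bicyc_eqI)
    then show ?thesis by (simp add: x_def y_def mult_single)
  qed
  have ye: "y * e = 0" and ex: "e * x = 0"
  proof -
    have "y * e = y - (y * x) * y" "e * x = x - x * (y * x)" by (simp_all add: e_def algebra_simps)
    then show "y * e = 0" "e * x = 0" using yx by simp_all
  qed
  have xn: "x ^ n = smono (bat i (BC n 0))" "y ^ n = smono (bat i (BC 0 n))" for n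
    by (simp_all only: x_def y_def bat_power)
  have xR: "x \<in> ?Rx" "y \<in> ?Ry" using i by (auto simp: x_def y_def bat_def intro!: single_SW split: if_splits)
  have fac: "Poly_Mapping.single k c = Poly_Mapping.single (k(i := 0)) c * x ^ xd (k i) * y ^ yd (k i)" for k and c :: 'k
    unfolding xn by (rule single_factor)
  have fac0: "Poly_Mapping.single (k(i := 0)) c \<in> SW (A' - {i}) (B' - {i})"
    if "\<And>j. xd (k j) \<noteq> 0 \<Longrightarrow> j \<in> A'" "\<And>j. yd (k j) \<noteq> 0 \<Longrightarrow> j \<in> B'" for k A' B' and c :: 'k
    using that by (intro single_SW) (auto split: if_splits)
  have comm: "r * x = x * r \<and> r * y = y * r" if "r \<in> ?R" for r
    using that
  proof (rule SW_induct)
    fix k and c :: 'k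
    assume k: "\<And>j. xd (k j) \<noteq> 0 \<Longrightarrow> j \<in> A - {i}" "\<And>j. yd (k j) \<noteq> 0 \<Longrightarrow> j \<in> B - {i}"
    have "xd (k i) = 0" "yd (k i) = 0" using k by blast+
    then have "k i = 0" by (intro bicyc_eqI) auto
    then have "k + bat i b = bat i b + k" for b by (auto simp: bat_def fun_eq_iff)
    then show "Poly_Mapping.single k c * x = x * Poly_Mapping.single k c \<and> Poly_Mapping.single k c * y = y * Poly_Mapping.single k c"
      by (simp add: x_def y_def mult_single)
  qed (auto simp: distrib_left distrib_right)
  have sub: "?R \<subseteq> ?Rx" "?R \<subseteq> ?Ry" "?Rx \<subseteq> ?T" "?Ry \<subseteq> ?T" by (rule SW_mono; blast)+
  show ?thesis unfolding x_def[symmetric] y_def[symmetric] e_def[symmetric]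
  proof
    show "sring ?R" "sring ?Rx" "sring ?Ry" "sring ?T" by simp_all
    show "?R \<subseteq> ?Rx" "?R \<subseteq> ?Ry" "?Rx \<subseteq> ?T" "?Ry \<subseteq> ?T" by fact+
    show "x \<in> ?Rx" "y \<in> ?Ry" "y * x = 1" "e = 1 - x * y" by (fact xR yx e_def)+
    show "r * x = x * r" "r * y = y * r" if "r \<in> ?R" for r using comm[OF that] by auto
  next
    fix z assume z: "z \<in> ?T"
    show "\<exists>wss. (\<forall>ws\<in>set wss. set ws \<subseteq> ?V) \<and> z = sum_list (map prod_list wss)"
      using z
    proof (rule SW_induct)
      show "\<exists>wss. (\<forall>ws\<in>set wss. set ws \<subseteq> ?V) \<and> 0 = sum_list (map prod_list wss)" by (rule exI[of _ "[]"]) simp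
    next
      fix a b
      assume "\<exists>wss. (\<forall>ws\<in>set wss. set ws \<subseteq> ?V) \<and> a = sum_list (map prod_list wss)"
        "\<exists>wss. (\<forall>ws\<in>set wss. set ws \<subseteq> ?V) \<and> b = sum_list (map prod_list wss)"
      then obtain u v where uv: "\<forall>ws\<in>set u. set ws \<subseteq> ?V" "a = sum_list (map prod_list u)"
        "\<forall>ws\<in>set v. set ws \<subseteq> ?V" "b = sum_list (map prod_list v)" by blast
      show "\<exists>wss. (\<forall>ws\<in>set wss. set ws \<subseteq> ?V) \<and> a + b = sum_list (map prod_list wss)"
        by (rule exI[of _ "u @ v"]) (use uv in \<open>simp add: ball_Un\<close>)
    next
      fix k and c :: 'k
      assume k: "\<And>j. xd (k j) \<noteq> 0 \<Longrightarrow> j \<in> A" "\<And>j. yd (k j) \<noteq> 0 \<Longrightarrow> j \<in> B"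
      let ?r = "Poly_Mapping.single (k(i := 0)) c"
      let ?ws = "[?r] @ replicate (xd (k i)) x @ replicate (yd (k i)) y"
      have "?r \<in> ?R" using fac0[OF k] by blast
      then have "?r \<in> ?V" by (intro CollectI exI[of _ ?r] exI[of _ 0]) simp
      moreover have "x \<in> ?V" by (rule CollectI, rule exI[of _ 0], rule exI[of _ 1], rule exI[of _ 0]) simp
      moreover have "y \<in> ?V" by (rule CollectI, rule exI[of _ 0], rule exI[of _ 0], rule exI[of _ 1]) simp
      ultimately have "set ?ws \<subseteq> ?V" by (simp only: set_append set_replicate_conv_if) auto
      moreover have "Poly_Mapping.single k c = prod_list ?ws"
        by (subst fac) (simp add: mult.assoc prod_list_replicate)
      ultimately show "\<exists>wss. (\<forall>ws\<in>set wss. set ws \<subseteq> ?V) \<and> Poly_Mapping.single k c = sum_list (map prod_list wss)"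
        by (intro exI[of _ "[?ws]"]) simp
    qed
    show "\<exists>p\<in>?Rx. z * e = p * e" using z
    proof (rule SW_induct)
      fix k and c :: 'k
      assume k: "\<And>j. xd (k j) \<noteq> 0 \<Longrightarrow> j \<in> A" "\<And>j. yd (k j) \<noteq> 0 \<Longrightarrow> j \<in> B"
      show "\<exists>p\<in>?Rx. Poly_Mapping.single k c * e = p * e"
      proof (cases "yd (k i)")
        case 0
        then have "Poly_Mapping.single k c \<in> ?Rx" using k by (intro single_SW) auto
        then show ?thesis by blast
      next
        case (Suc n)
        have "Poly_Mapping.single k c * e = Poly_Mapping.single (k(i := 0)) c * x ^ xd (k i) * y ^ n * (y * e)"
          by (subst fac) (simp only: Suc power_Suc2 mult.assoc)
        then show ?thesis using ye by (intro bexI[of _ 0]) simp_all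
      qed
    next
      fix a b :: "'k salg" assume "\<exists>p\<in>?Rx. a * e = p * e" "\<exists>p\<in>?Rx. b * e = p * e"
      then obtain p q where "p \<in> ?Rx" "q \<in> ?Rx" "a * e = p * e" "b * e = q * e" by blast
      then show "\<exists>p\<in>?Rx. (a + b) * e = p * e" by (intro bexI[of _ "p + q"]) (simp_all add: distrib_right)
    qed (rule bexI[of _ 0]; simp)
    show "\<exists>q\<in>?Ry. e * z = e * q" using z
    proof (rule SW_induct)
      fix k and c :: 'k
      assume k: "\<And>j. xd (k j) \<noteq> 0 \<Longrightarrow> j \<in> A" "\<And>j. yd (k j) \<noteq> 0 \<Longrightarrow> j \<in> B"
      show "\<exists>q\<in>?Ry. e * Poly_Mapping.single k c = e * q"
      proof (cases "xd (k i)")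
        case 0
        then have "Poly_Mapping.single k c \<in> ?Ry" using k by (intro single_SW) auto
        then show ?thesis by blast
      next
        case (Suc n)
        let ?r = "Poly_Mapping.single (k(i := 0)) c"
        have "?r \<in> ?R" using fac0[OF k] by blast
        then have rx: "?r * x = x * ?r" using comm by blast
        have "e * Poly_Mapping.single k c = e * (?r * x) * x ^ n * y ^ yd (k i)"
          by (subst fac) (simp only: Suc power_Suc mult.assoc)
        also have "\<dots> = (e * x) * ?r * x ^ n * y ^ yd (k i)" unfolding rx by (simp only: mult.assoc)
        finally show ?thesis using ex by (intro bexI[of _ 0]) simp_all
      qed
    next
      fix a b :: "'k salg" assume "\<exists>q\<in>?Ry. e * a = e * q" "\<exists>q\<in>?Ry. e * b = e * q"
      then obtain p q where "p \<in> ?Ry" "q \<in> ?Ry" "e * a = e * p" "e * b = e * q" by blast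
      then show "\<exists>q\<in>?Ry. e * (a + b) = e * q" by (intro bexI[of _ "p + q"]) (simp_all add: distrib_left)
    qed (rule bexI[of _ 0]; simp)
  next
    fix p assume p: "p \<in> ?Rx"
    show "\<exists>r\<in>?R. \<exists>p'\<in>?Rx. p = r + x * p'" using p
    proof (rule SW_induct)
      fix k and c :: 'k
      assume k: "\<And>j. xd (k j) \<noteq> 0 \<Longrightarrow> j \<in> A" "\<And>j. yd (k j) \<noteq> 0 \<Longrightarrow> j \<in> B - {i}"
      let ?r = "Poly_Mapping.single (k(i := 0)) c"
      have "?r \<in> SW (A - {i}) (B - {i} - {i})" by (rule fac0) (use k in auto)
      then have r: "?r \<in> ?R" by simp
      have y0: "yd (k i) = 0" using k by blast
      show "\<exists>r\<in>?R. \<exists>p'\<in>?Rx. Poly_Mapping.single k c = r + x * p'"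
      proof (cases "xd (k i)")
        case 0
        then have "Poly_Mapping.single k c = ?r" using y0 by (subst fac) simp
        then show ?thesis using r by (intro bexI[of _ ?r] bexI[of _ 0]) simp_all
      next
        case (Suc n)
        have "?r * x = x * ?r" using comm r by blast
        have "Poly_Mapping.single k c = (?r * x) * x ^ n" by (subst fac) (simp add: y0 Suc mult.assoc)
        also have "\<dots> = x * (?r * x ^ n)" unfolding \<open>?r * x = x * ?r\<close> by (simp only: mult.assoc)
        finally show ?thesis using r xR sub by (intro bexI[of _ 0] bexI[of _ "?r * x ^ n"]) (auto intro!: sringD(4))
      qed
    next
      fix a b :: "'k salg" assume "\<exists>r\<in>?R. \<exists>p'\<in>?Rx. a = r + x * p'" "\<exists>r\<in>?R. \<exists>p'\<in>?Rx. b = r + x * p'"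
      then obtain r p r' p' where "r \<in> ?R" "r' \<in> ?R" "p \<in> ?Rx" "p' \<in> ?Rx" "a = r + x * p" "b = r' + x * p'" by blast
      then show "\<exists>r\<in>?R. \<exists>p'\<in>?Rx. a + b = r + x * p'"
        by (intro bexI[of _ "r + r'"] bexI[of _ "p + p'"]) (simp_all add: algebra_simps)
    qed (rule bexI[of _ 0], rule bexI[of _ 0], simp_all)
    show "p = 0" if "p * e = 0"
    proof -
      \<comment> \<open>If right multiplication by x y fixes p, every monomial of p ends in y at
        index i, which membership in Rx forbids.\<close>
      have "p = p * (x * y)" using that by (simp add: e_def right_diff_distrib)
      moreover have "x * y = smono (bat i (BC 1 1))"
      proof -
        have "bat i (BC 1 0) + bat i (BC 0 1) = bat i (BC 1 1)" by (auto simp: bat_def fun_eq_iff plus_bicyc_def zero_bicyc_def)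
        then show ?thesis by (simp add: x_def y_def mult_single)
      qed
      ultimately have eq: "p * smono (bat i (BC 1 1)) = p" by simp
      have "Poly_Mapping.keys p \<subseteq> {a + b | a b. a \<in> Poly_Mapping.keys p \<and> b \<in> Poly_Mapping.keys (smono (bat i (BC 1 1)) :: 'k salg)}"
        using keys_mult[of p "smono (bat i (BC 1 1))"] by (simp only: eq)
      then have "yd (k i) \<noteq> 0" if "k \<in> Poly_Mapping.keys p" for k
        using that by (force simp: bat_def)
      moreover have "yd (k i) = 0" if "k \<in> Poly_Mapping.keys p" for k using p that unfolding SW_def by blast
      ultimately have "Poly_Mapping.keys p = {}" by blast
      then show ?thesis by simp
    qed
    show "\<exists>n. y ^ n * p * e = 0" using p
    proof (rule SW_induct)
      fix k and c :: 'k
      assume k: "\<And>j. xd (k j) \<noteq> 0 \<Longrightarrow> j \<in> A" "\<And>j. yd (k j) \<noteq> 0 \<Longrightarrow> j \<in> B - {i}"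
      let ?r = "Poly_Mapping.single (k(i := 0)) c"
      have "?r \<in> SW (A - {i}) (B - {i} - {i})" by (rule fac0) (use k in auto)
      then have r: "?r \<in> ?R" by simp
      have y0: "yd (k i) = 0" using k by blast
      let ?a = "xd (k i)"
      have "y ^ n * ?r = ?r * y ^ n" for n
      proof (induction n)
        case (Suc n)
        have "y ^ Suc n * ?r = y * (y ^ n * ?r)" by (simp only: power_Suc mult.assoc)
        also have "\<dots> = (y * ?r) * y ^ n" unfolding Suc by (simp only: mult.assoc)
        also have "y * ?r = ?r * y" using comm r by simp
        finally show ?case by (simp only: power_Suc mult.assoc)
      qed simp
      \<comment> \<open>With one y more than there are x, a single y survives and annihilates
        \<open>e\<close>.\<close>
      moreover have "y ^ Suc ?a * x ^ ?a = y"
      proof -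
        have "y ^ Suc ?a * x ^ ?a = smono (bat i (BC 0 (Suc ?a)) + bat i (BC ?a 0))"
          unfolding xn mult_single by simp
        also have "bat i (BC 0 (Suc ?a)) + bat i (BC ?a 0) = bat i (BC 0 1)"
          by (auto simp: bat_def fun_eq_iff intro!: bicyc_eqI)
        finally show ?thesis by (simp only: y_def)
      qed
      ultimately have "y ^ Suc ?a * Poly_Mapping.single k c = ?r * y"
        by (subst fac) (simp only: y0 power_0 mult_1_right mult.assoc[symmetric], simp only: mult.assoc)
      then have "y ^ Suc ?a * Poly_Mapping.single k c * e = ?r * (y * e)" by (simp only: mult.assoc)
      then show "\<exists>n. y ^ n * Poly_Mapping.single k c * e = 0" using ye by (intro exI[of _ "Suc ?a"]) simp
    next
      fix a b :: "'k salg" assume "\<exists>n. y ^ n * a * e = 0" "\<exists>n. y ^ n * b * e = 0"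
      then obtain n m where nm: "y ^ n * a * e = 0" "y ^ m * b * e = 0" by blast
      have 1: "y ^ (m + n) * a * e = y ^ m * (y ^ n * a * e)" by (simp only: power_add mult.assoc)
      have "y ^ (n + m) * b * e = y ^ n * (y ^ m * b * e)" by (simp only: power_add mult.assoc)
      then have "y ^ (m + n) * b * e = y ^ n * (y ^ m * b * e)" by (simp only: add.commute)
      with 1 have "y ^ (m + n) * (a + b) * e = 0" using nm by (simp add: distrib_left distrib_right)
      then show "\<exists>n. y ^ n * (a + b) * e = 0" by blast
    qed (rule exI[of _ 0], simp)
  next
    fix q assume q: "q \<in> ?Ry" "e * q = 0"
    have "q = (x * y) * q" using q(2) by (simp add: e_def left_diff_distrib)
    moreover have "x * y = smono (bat i (BC 1 1))"
    proof -
      have "bat i (BC 1 0) + bat i (BC 0 1) = bat i (BC 1 1)" by (auto simp: bat_def fun_eq_iff plus_bicyc_def zero_bicyc_def)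
      then show ?thesis by (simp add: x_def y_def mult_single)
    qed
    ultimately have eq: "smono (bat i (BC 1 1)) * q = q" by simp
    have "Poly_Mapping.keys q \<subseteq> {a + b | a b. a \<in> Poly_Mapping.keys (smono (bat i (BC 1 1)) :: 'k salg) \<and> b \<in> Poly_Mapping.keys q}"
      using keys_mult[of "smono (bat i (BC 1 1))" q] by (simp only: eq)
    then have "xd (k i) \<noteq> 0" if "k \<in> Poly_Mapping.keys q" for k
      using that by (force simp: bat_def)
    moreover have "xd (k i) = 0" if "k \<in> Poly_Mapping.keys q" for k using q(1) that unfolding SW_def by blast
    ultimately have "Poly_Mapping.keys q = {}" by blast
    then show "q = 0" by simp
  qed
qed

section \<open>Maps out of monoid algebras and the induction on A \<inter> B\<close>

text \<open>Under the hypotheses of \<open>shom_lin\<close>, this is the map given by the universal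
  property of the monoid algebra: a monoid map on exponents, a commuting ring map on
  coefficients.\<close>

definition lin :: "('i \<Rightarrow> 'b::ring_1) \<Rightarrow> ('k \<Rightarrow> 'b) \<Rightarrow> ('i \<Rightarrow>\<^sub>0 'k::zero) \<Rightarrow> 'b" where
  "lin \<phi> \<kappa> p = (\<Sum>k\<in>Poly_Mapping.keys p. \<kappa> (Poly_Mapping.lookup p k) * \<phi> k)"

lemma shom_lin:
  fixes \<kappa> :: "'k::field \<Rightarrow> 'b::ring_1" and \<phi> :: "'i::monoid_add \<Rightarrow> 'b"
  assumes \<kappa>: "\<kappa> 0 = 0" "\<kappa> 1 = 1" "\<And>a b. \<kappa> (a + b) = \<kappa> a + \<kappa> b" "\<And>a b. \<kappa> (a * b) = \<kappa> a * \<kappa> b"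
    and \<phi>: "\<phi> 0 = 1" "\<And>k l. \<phi> (k + l) = \<phi> k * \<phi> l" and c: "\<And>a k. \<kappa> a * \<phi> k = \<phi> k * \<kappa> a"
  shows "shom (lin \<phi> \<kappa>) UNIV" "lin \<phi> \<kappa> (Poly_Mapping.single k a) = \<kappa> a * \<phi> k"
proof -
  have single: "lin \<phi> \<kappa> (Poly_Mapping.single k a) = \<kappa> a * \<phi> k" for k a by (simp add: lin_def \<kappa>)
  show "lin \<phi> \<kappa> (Poly_Mapping.single k a) = \<kappa> a * \<phi> k" by (rule single)
  have add: "lin \<phi> \<kappa> (p + q) = lin \<phi> \<kappa> p + lin \<phi> \<kappa> q" for p q
    unfolding lin_def by (rule setsum_keys_plus_distrib) (simp_all add: \<kappa> distrib_right)
  have "lin \<phi> \<kappa> (p * q) = lin \<phi> \<kappa> p * lin \<phi> \<kappa> q" for p q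
  proof (rule poly_mapping_induct_keys[of "\<lambda>p. lin \<phi> \<kappa> (p * q) = lin \<phi> \<kappa> p * lin \<phi> \<kappa> q"])
    show "lin \<phi> \<kappa> (0 * q) = lin \<phi> \<kappa> 0 * lin \<phi> \<kappa> q" by (simp add: lin_def)
    show "lin \<phi> \<kappa> ((a + b) * q) = lin \<phi> \<kappa> (a + b) * lin \<phi> \<kappa> q"
      if "lin \<phi> \<kappa> (a * q) = lin \<phi> \<kappa> a * lin \<phi> \<kappa> q" "lin \<phi> \<kappa> (b * q) = lin \<phi> \<kappa> b * lin \<phi> \<kappa> q" for a b
      using that by (simp add: add distrib_right)
    fix k a
    show "lin \<phi> \<kappa> (Poly_Mapping.single k a * q) = lin \<phi> \<kappa> (Poly_Mapping.single k a) * lin \<phi> \<kappa> q"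
    proof (rule poly_mapping_induct_keys[of "\<lambda>q. lin \<phi> \<kappa> (Poly_Mapping.single k a * q) = lin \<phi> \<kappa> (Poly_Mapping.single k a) * lin \<phi> \<kappa> q"])
      fix l b
      have "\<kappa> a * \<kappa> b * (\<phi> k * \<phi> l) = \<kappa> a * (\<kappa> b * \<phi> k) * \<phi> l" by (simp only: mult.assoc)
      also have "\<dots> = \<kappa> a * \<phi> k * (\<kappa> b * \<phi> l)" unfolding c[of b k] by (simp only: mult.assoc)
      finally show "lin \<phi> \<kappa> (Poly_Mapping.single k a * Poly_Mapping.single l b) = lin \<phi> \<kappa> (Poly_Mapping.single k a) * lin \<phi> \<kappa> (Poly_Mapping.single l b)"
        by (simp add: mult_single single \<kappa> \<phi>)
    qed (simp_all add: add distrib_left, simp add: lin_def)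
  qed
  moreover have "lin \<phi> \<kappa> 1 = 1" using single[of 0 1] by (simp add: \<kappa> \<phi>)
  ultimately show "shom (lin \<phi> \<kappa>) UNIV" using add by (auto simp: shom_def lin_def)
qed

text \<open>No index carries both generators, so all generators commute and the algebra is a
  polynomial ring: the variable i goes to x_i for i in A and to y_i for i in B.\<close>

lemma Good_SW_disjoint:
  assumes "finite A" "finite B" "A \<inter> B = {}"
  shows "Good kconsts (SW A B :: 'k::field salg set)"
proof -
  define \<phi> :: "(nat \<Rightarrow>\<^sub>0 nat) \<Rightarrow> nat \<Rightarrow> bicyc" where
    "\<phi> k = (\<lambda>i. if i \<in> A then BC (Poly_Mapping.lookup k i) 0 else if i \<in> B then BC 0 (Poly_Mapping.lookup k i) else 0)" for k
  define h where "h = lin (\<lambda>k. smono (\<phi> k)) (Poly_Mapping.single 0 :: 'k \<Rightarrow> 'k salg)"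
  have \<phi>_add: "\<phi> (k + l) = \<phi> k + \<phi> l" for k l
    by (auto simp: \<phi>_def fun_eq_iff lookup_add plus_bicyc_def zero_bicyc_def)
  have \<phi>0: "\<phi> 0 = 0" by (auto simp: \<phi>_def fun_eq_iff zero_bicyc_def)
  have h: "shom h UNIV" "h (Poly_Mapping.single k a) = Poly_Mapping.single (\<phi> k) a" for k a
    unfolding h_def by (rule shom_lin(1); simp add: mult_single single_add \<phi>_add \<phi>0)
      (subst shom_lin(2); simp add: mult_single single_add \<phi>_add \<phi>0)
  have inj\<phi>: "k = l" if "Poly_Mapping.keys k \<subseteq> A \<union> B" "Poly_Mapping.keys l \<subseteq> A \<union> B" "\<phi> k = \<phi> l" for k l
  proof (rule poly_mapping_eqI)
    fix i
    show "Poly_Mapping.lookup k i = Poly_Mapping.lookup l i"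
    proof (cases "i \<in> A \<union> B")
      case True
      then show ?thesis using fun_cong[OF that(3), of i] by (auto simp: \<phi>_def split: if_splits)
    next
      case False
      then have "i \<notin> Poly_Mapping.keys k" "i \<notin> Poly_Mapping.keys l" using that by blast+
      then show ?thesis by (simp add: in_keys_iff)
    qed
  qed
  let ?P = "pvars (A \<union> B) :: 'k mp set"
  have hP: "shom h ?P" using h(1) by (auto simp: shom_def)
  have h_sum: "h p = (\<Sum>k\<in>Poly_Mapping.keys p. Poly_Mapping.single (\<phi> k) (Poly_Mapping.lookup p k))" for p
    unfolding h_def lin_def by (simp add: mult_single)
  have lookup_h: "Poly_Mapping.lookup (h p) (\<phi> l) = Poly_Mapping.lookup p l"
    if p: "p \<in> ?P" and l: "Poly_Mapping.keys l \<subseteq> A \<union> B" for p l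
  proof -
    have "Poly_Mapping.lookup (h p) (\<phi> l) = (\<Sum>k\<in>Poly_Mapping.keys p. if k = l then Poly_Mapping.lookup p k else 0)"
      unfolding h_sum lookup_sum
    proof (rule sum.cong[OF refl])
      fix k assume "k \<in> Poly_Mapping.keys p"
      then have "Poly_Mapping.keys k \<subseteq> A \<union> B" using p by (auto simp: pvars_def)
      then show "Poly_Mapping.lookup (Poly_Mapping.single (\<phi> k) (Poly_Mapping.lookup p k)) (\<phi> l) = (if k = l then Poly_Mapping.lookup p k else 0)"
        using inj\<phi>[OF _ l, of k] by (auto simp: lookup_single when_def)
    qed
    also have "\<dots> = Poly_Mapping.lookup p l" by (auto simp: not_in_keys_iff_lookup_eq_zero)
    finally show ?thesis .
  qed
  have inj: "inj_on h ?P"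
  proof (rule inj_onI, rule poly_mapping_eqI)
    fix p q l assume pq: "p \<in> ?P" "q \<in> ?P" "h p = h q"
    show "Poly_Mapping.lookup p l = Poly_Mapping.lookup q l"
    proof (cases "Poly_Mapping.keys l \<subseteq> A \<union> B")
      case True
      then show ?thesis using lookup_h[of p l] lookup_h[of q l] pq by simp
    next
      case False
      then have "l \<notin> Poly_Mapping.keys p" "l \<notin> Poly_Mapping.keys q" using pq by (auto simp: pvars_def)
      then show ?thesis by (simp add: in_keys_iff)
    qed
  qed
  have img: "h ` ?P = SW A B"
  proof
    show "h ` ?P \<subseteq> SW A B"
    proof
      fix z assume "z \<in> h ` ?P"
      then obtain p where "z = h p" by blast
      moreover have "Poly_Mapping.single (\<phi> k) a \<in> SW A B" for k a
        by (rule single_SW) (auto simp: \<phi>_def split: if_splits)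
      ultimately show "z \<in> SW A B" unfolding h_sum by (auto intro!: sring_sum)
    qed
    show "SW A B \<subseteq> h ` ?P"
    proof
      fix z :: "'k salg" assume "z \<in> SW A B"
      then show "z \<in> h ` ?P"
      proof (rule SW_induct)
        show "0 \<in> h ` ?P" using hP by (auto simp: shom_def intro!: image_eqI[of _ _ 0])
        show "a + b \<in> h ` ?P" if "a \<in> h ` ?P" "b \<in> h ` ?P" for a b
          using sringD(3)[OF sring_image[OF hP] that] by simp
        fix k and c :: 'k
        assume k: "\<And>j. xd (k j) \<noteq> 0 \<Longrightarrow> j \<in> A" "\<And>j. yd (k j) \<noteq> 0 \<Longrightarrow> j \<in> B"
        define l where "l = (\<Sum>i\<in>A \<union> B. Poly_Mapping.single i (xd (k i) + yd (k i)))"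
        have look: "Poly_Mapping.lookup l i = (if i \<in> A \<union> B then xd (k i) + yd (k i) else 0)" for i
        proof -
          have "Poly_Mapping.lookup l i = (\<Sum>j\<in>A \<union> B. if j = i then xd (k j) + yd (k j) else 0)"
            unfolding l_def lookup_sum by (intro sum.cong refl) (auto simp: lookup_single when_def)
          then show ?thesis using assms(1,2) by simp
        qed
        have "\<phi> l = k"
        proof
          fix i show "\<phi> l i = k i"
            using k(1)[of i] k(2)[of i] assms(3)
            by (intro bicyc_eqI) (auto simp: \<phi>_def look)
        qed
        moreover have "Poly_Mapping.keys l \<subseteq> A \<union> B" by (auto simp: in_keys_iff look split: if_splits)
        ultimately show "Poly_Mapping.single k c \<in> h ` ?P"
          using h(2)[of l c] by (intro image_eqI[of _ _ "Poly_Mapping.single l c"]) (auto intro: single_pvars)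
      qed
    qed
  qed
  \<comment> \<open>\<open>Good_transfer\<close> needs a map out of the ring in question, hence the
    inverse of \<open>h\<close>.\<close>
  let ?g = "inv_into ?P h"
  have g: "shom ?g (SW A B)" "inj_on ?g (SW A B)" "?g ` SW A B = ?P"
    using shom_inv_into[OF hP inj sring_pvars] unfolding img by auto
  have hc: "h ` kconsts = kconsts" unfolding kconsts_def image_image h(2) \<phi>0 ..
  have cP: "kconsts \<subseteq> ?P" unfolding kconsts_def by (auto intro: single_pvars)
  have gc: "?g ` kconsts = kconsts"
  proof -
    have "?g ` kconsts = ?g ` (h ` kconsts)" using hc by simp
    also have "\<dots> = kconsts" using cP inj by (simp add: image_inv_into_cancel inv_into_image_cancel)
    finally show ?thesis .
  qed
  show ?thesis
  proof (rule Good_transfer[OF g(1,2)])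
    show "kconsts \<subseteq> (SW A B :: 'k salg set)" unfolding kconsts_def by (auto intro!: single_SW)
    show "Good (?g ` kconsts) (?g ` SW A B)" unfolding g gc using Good_pvars assms by blast
  qed (simp_all add: g(3))
qed

theorem Good_SW:
  assumes "finite A" "finite B"
  shows "Good kconsts (SW A B :: 'k::field salg set)"
  using assms
proof (induction "card (A \<inter> B)" arbitrary: A B rule: less_induct)
  case less
  show ?case
  proof (cases "A \<inter> B = {}")
    case True
    then show ?thesis using Good_SW_disjoint less by blast
  next
    case False
    then obtain i where i: "i \<in> A" "i \<in> B" by blast
    interpret toeplitz "SW (A - {i}) (B - {i}) :: 'k salg set" "SW A (B - {i})" "SW (A - {i}) B" "SW A B"
      "smono (bat i (BC 1 0))" "smono (bat i (BC 0 1))" "1 - smono (bat i (BC 1 0)) * smono (bat i (BC 0 1))"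
      by (rule toeplitz_SW[OF i])
    have card: "card ((A - {i}) \<inter> (B - {i})) < card (A \<inter> B)" "card (A \<inter> (B - {i})) < card (A \<inter> B)" "card ((A - {i}) \<inter> B) < card (A \<inter> B)"
      using i less.prems by (auto intro!: psubset_card_mono)
    show ?thesis
    proof (rule Good_toeplitz)
      show "unit_group (SW (A - {i}) (B - {i}) :: 'k salg set) kconsts"
        unfolding unit_group_def kconsts_def
      proof (intro conjI ballI)
        show "Poly_Mapping.single 0 ` (UNIV - {0}) \<subseteq> (SW (A - {i}) (B - {i}) :: 'k salg set)" by (auto intro!: single_SW)
        show "1 \<in> Poly_Mapping.single 0 ` (UNIV - {0::'k})" by (rule image_eqI[of _ _ 1]) auto
        fix c d :: "'k salg" assume "c \<in> Poly_Mapping.single 0 ` (UNIV - {0})" "d \<in> Poly_Mapping.single 0 ` (UNIV - {0})"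
        then show "c * d \<in> Poly_Mapping.single 0 ` (UNIV - {0})" by (auto simp: mult_single)
      next
        fix c :: "'k salg" assume "c \<in> Poly_Mapping.single 0 ` (UNIV - {0})"
        then obtain a where a: "a \<noteq> 0" "c = Poly_Mapping.single 0 a" by auto
        then show "\<exists>d\<in>Poly_Mapping.single 0 ` (UNIV - {0}). c * d = 1 \<and> d * c = 1"
          by (intro bexI[of _ "Poly_Mapping.single 0 (inverse a)"]) (auto simp: mult_single)
      qed
    qed (intro less.hyps; use card less.prems in simp)+
  qed
qed

section \<open>The algebra given by generators and relations\<close>

text \<open>Indexing the convolution by factorizations of the word instead of cut positions turns
  associativity into a bijection between triples.\<close>

definition splits :: "'a list \<Rightarrow> ('a list \<times> 'a list) set" where
  "splits w = {(u, v). u @ v = w}"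

lemma in_splits [simp]: "(u, v) \<in> splits w \<longleftrightarrow> u @ v = w"
  by (simp add: splits_def)

lemma splits_eq: "splits w = (\<lambda>k. (take k w, drop k w)) ` {0..length w}"
proof
  show "splits w \<subseteq> (\<lambda>k. (take k w, drop k w)) ` {0..length w}"
  proof
    fix x assume "x \<in> splits w"
    then obtain u v where "x = (u, v)" "u @ v = w" by (auto simp: splits_def)
    then show "x \<in> (\<lambda>k. (take k w, drop k w)) ` {0..length w}"
      by (intro image_eqI[of _ _ "length u"]) auto
  qed
qed (auto simp: splits_def)

lemma finite_splits [simp]: "finite (splits w)"
  by (simp add: splits_eq)

lemma fmul_splits: "fmul f g w = (\<Sum>(u, v)\<in>splits w. f u * g v)"
proof -
  have "inj_on (\<lambda>k. (take k w, drop k w)) {0..length w}"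
    by (rule inj_onI) (metis atLeastAtMost_iff length_take min.absorb2 prod.inject)
  then show ?thesis unfolding fmul_def splits_eq by (simp add: sum.reindex)
qed

lemma fmul_assoc: "fmul (fmul f g) h = fmul f (fmul g h)"
proof
  fix w
  have "fmul (fmul f g) h w = (\<Sum>(p, v)\<in>splits w. \<Sum>(a, b)\<in>splits p. f a * g b * h v)"
    by (simp add: fmul_splits sum_distrib_right split_def)
  also have "\<dots> = (\<Sum>((p, v), (a, b))\<in>(SIGMA x:splits w. splits (fst x)). f a * g b * h v)"
    by (subst sum.Sigma[symmetric]) (auto simp: split_def)
  also have "\<dots> = (\<Sum>((a, p), (b, v))\<in>(SIGMA x:splits w. splits (snd x)). f a * g b * h v)"
    by (rule sum.reindex_bij_witness[where i = "\<lambda>((a, p), (b, v)). ((a @ b, v), (a, b))"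
          and j = "\<lambda>((p, v), (a, b)). ((a, b @ v), (b, v))"]) auto
  also have "\<dots> = (\<Sum>(a, p)\<in>splits w. \<Sum>(b, v)\<in>splits p. f a * g b * h v)"
    by (subst sum.Sigma[symmetric]) (auto simp: split_def)
  also have "\<dots> = fmul f (fmul g h) w"
    by (simp add: fmul_splits sum_distrib_left split_def mult.assoc)
  finally show "fmul (fmul f g) h w = fmul f (fmul g h) w" .
qed

lemma fmul_const: "fmul (fconst c) f = (\<lambda>w. c * f w)" "fmul f (fconst c) = (\<lambda>w. f w * c)"
proof -
  have "(\<Sum>(u, v)\<in>splits w. fconst c u * f v) = (\<Sum>x\<in>{([] :: letter list, w)}. c * f w)" for w
    by (rule sum.mono_neutral_cong_right) (auto simp: fconst_def split: if_splits)
  then show "fmul (fconst c) f = (\<lambda>w. c * f w)" by (auto simp: fmul_splits)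
  have "(\<Sum>(u, v)\<in>splits w. f u * fconst c v) = (\<Sum>x\<in>{(w, [] :: letter list)}. f w * c)" for w
    by (rule sum.mono_neutral_cong_right) (auto simp: fconst_def split: if_splits)
  then show "fmul f (fconst c) = (\<lambda>w. f w * c)" by (auto simp: fmul_splits)
qed

lemma fmul_nonzero: "fmul f g w \<noteq> 0 \<Longrightarrow> \<exists>u v. w = u @ v \<and> f u \<noteq> 0 \<and> g v \<noteq> 0"
proof -
  assume "fmul f g w \<noteq> 0"
  then obtain x where "x \<in> splits w" "(case x of (u, v) \<Rightarrow> f u * g v) \<noteq> 0"
    unfolding fmul_splits by (meson sum.not_neutral_contains_not_neutral)
  moreover obtain u v where "x = (u, v)" by (cases x)
  ultimately have "w = u @ v" "f u \<noteq> 0" "g v \<noteq> 0" by auto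
  then show ?thesis by blast
qed

definition fcarrier :: "nat \<Rightarrow> 'k::field ncpoly set" where
  "fcarrier m = {f. finite {w. f w \<noteq> 0} \<and> (\<forall>w. f w \<noteq> 0 \<longrightarrow> set w \<subseteq> {1..m} \<times> UNIV)}"

lemma FreeAlg_simps [simp]: "carrier (FreeAlg m) = fcarrier m" "monoid.mult (FreeAlg m) = fmul" "monoid.one (FreeAlg m) = fconst 1"
  "ring.zero (FreeAlg m) = (\<lambda>_. 0)" "ring.add (FreeAlg m) = (\<lambda>f g w. f w + g w)"
  by (simp_all add: FreeAlg_def fcarrier_def)

lemma fcarrier_closed:
  shows "(\<lambda>_. 0) \<in> fcarrier m" "fconst c \<in> fcarrier m" "f \<in> fcarrier m \<Longrightarrow> g \<in> fcarrier m \<Longrightarrow> (\<lambda>w. f w + g w) \<in> fcarrier m"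
    "f \<in> fcarrier m \<Longrightarrow> g \<in> fcarrier m \<Longrightarrow> fmul f g \<in> fcarrier m" "f \<in> fcarrier m \<Longrightarrow> (\<lambda>w. - f w) \<in> fcarrier m"
proof -
  show "(\<lambda>_. 0) \<in> fcarrier m" by (simp add: fcarrier_def)
  show "fconst c \<in> fcarrier m"
    unfolding fcarrier_def fconst_def by (auto intro: finite_subset[of _ "{[]}"])
  show "f \<in> fcarrier m \<Longrightarrow> (\<lambda>w. - f w) \<in> fcarrier m" by (simp add: fcarrier_def)
  assume f: "f \<in> fcarrier m" and g: "g \<in> fcarrier m"
  have "{w. f w + g w \<noteq> 0} \<subseteq> {w. f w \<noteq> 0} \<union> {w. g w \<noteq> 0}" by auto
  moreover have "finite ({w. f w \<noteq> 0} \<union> {w. g w \<noteq> 0})" using f g by (simp add: fcarrier_def)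
  ultimately have "finite {w. f w + g w \<noteq> 0}" by (rule finite_subset)
  moreover have "set w \<subseteq> {1..m} \<times> UNIV" if "f w + g w \<noteq> 0" for w
    using f g that unfolding fcarrier_def by (cases "f w = 0") auto
  ultimately show "(\<lambda>w. f w + g w) \<in> fcarrier m" unfolding fcarrier_def by blast
  have "{w. fmul f g w \<noteq> 0} \<subseteq> (\<lambda>(u, v). u @ v) ` ({w. f w \<noteq> 0} \<times> {w. g w \<noteq> 0})"
    using fmul_nonzero[of f g] by fastforce
  then have "finite {w. fmul f g w \<noteq> 0}" by (rule finite_subset) (use f g in \<open>auto simp: fcarrier_def\<close>)
  moreover have "set w \<subseteq> {1..m} \<times> UNIV" if "fmul f g w \<noteq> 0" for w
    using fmul_nonzero[OF that] f g unfolding fcarrier_def by fastforce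
  ultimately show "fmul f g \<in> fcarrier m" unfolding fcarrier_def by blast
qed

lemma ring_FreeAlg: "ring (FreeAlg m :: 'k::field ncpoly ring)"
proof (rule ringI)
  show "abelian_group (FreeAlg m :: 'k ncpoly ring)"
    by (rule abelian_groupI) (auto simp: fcarrier_closed add.assoc add.commute intro!: bexI[of _ "\<lambda>w. - _ w"])
  show "monoid (FreeAlg m :: 'k ncpoly ring)"
    by (rule monoidI) (auto simp: fcarrier_closed fmul_assoc fmul_const)
qed (auto simp: fun_eq_iff fmul_def sum.distrib distrib_left distrib_right)

definition wd :: "letter list \<Rightarrow> 'k::field ncpoly" where "wd w = (\<lambda>v. if v = w then 1 else 0)"

lemma wd_fmul: "fmul (wd u) (wd v) = (wd (u @ v) :: 'k::field ncpoly)"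
proof
  fix w
  have "(\<Sum>(a, b)\<in>splits w. wd u a * wd v b) = (\<Sum>x\<in>(if w = u @ v then {(u, v)} else {}). 1 :: 'k)"
    by (rule sum.mono_neutral_cong_right) (auto simp: wd_def split: if_splits)
  then show "fmul (wd u) (wd v) w = (wd (u @ v) w :: 'k)" by (auto simp: fmul_splits wd_def)
qed

lemma wd_gen: "wd [l] = gen l" "wd [] = fconst 1"
  by (auto simp: wd_def gen_def fconst_def)

lemma wd_carrier: "set w \<subseteq> {1..m} \<times> UNIV \<Longrightarrow> wd w \<in> fcarrier m"
  unfolding fcarrier_def wd_def by (auto intro: finite_subset[of _ "{w}"])

lemma fcarrier_induct [consumes 1, case_names zero add word]:
  assumes f: "f \<in> fcarrier m" and "P (\<lambda>_. 0)" and "\<And>f g. f \<in> fcarrier m \<Longrightarrow> g \<in> fcarrier m \<Longrightarrow> P f \<Longrightarrow> P g \<Longrightarrow> P (\<lambda>w. f w + g w)"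
    and "\<And>w c. set w \<subseteq> {1..m} \<times> UNIV \<Longrightarrow> P (fmul (fconst c) (wd w))"
  shows "P f"
proof -
  have main: "P (\<lambda>v. \<Sum>w\<in>S. f w * wd w v) \<and> (\<lambda>v. \<Sum>w\<in>S. f w * wd w v) \<in> fcarrier m"
    if "finite S" "S \<subseteq> {w. f w \<noteq> 0}" for S
    using that
  proof (induction S)
    case (insert w S)
    have w: "set w \<subseteq> {1..m} \<times> UNIV" using insert.prems f by (auto simp: fcarrier_def)
    have "fmul (fconst (f w)) (wd w) \<in> fcarrier m" using wd_carrier[OF w] by (intro fcarrier_closed)
    then have "P (\<lambda>v. fmul (fconst (f w)) (wd w) v + (\<Sum>w\<in>S. f w * wd w v)) \<and>
      (\<lambda>v. fmul (fconst (f w)) (wd w) v + (\<Sum>w\<in>S. f w * wd w v)) \<in> fcarrier m"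
      using insert w wd_carrier[OF w] by (intro conjI assms fcarrier_closed) auto
    then show ?case using insert.hyps by (simp add: fmul_const)
  qed (use assms fcarrier_closed in auto)
  have fin: "finite {w. f w \<noteq> 0}" using f by (simp add: fcarrier_def)
  have "(\<lambda>v. \<Sum>w\<in>{w. f w \<noteq> 0}. f w * wd w v) = f"
  proof
    fix v
    have "(\<Sum>w\<in>{w. f w \<noteq> 0}. f w * wd w v) = (\<Sum>w\<in>{w. f w \<noteq> 0}. if w = v then f w else 0)"
      by (intro sum.cong refl) (auto simp: wd_def)
    also have "\<dots> = f v" using fin by simp
    finally show "(\<Sum>w\<in>{w. f w \<noteq> 0}. f w * wd w v) = f v" .
  qed
  then show ?thesis using main[OF fin order_refl] by simp
qed

section \<open>Evaluation in the bicyclic monoid algebra\<close>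

fun lk :: "letter \<Rightarrow> nat \<Rightarrow> bicyc" where
  "lk (i, True) = bat i (BC 1 0)" | "lk (i, False) = bat i (BC 0 1)"

fun wk :: "letter list \<Rightarrow> nat \<Rightarrow> bicyc" where
  "wk [] = 0" | "wk (l # w) = lk l + wk w"

lemma wk_append: "wk (u @ v) = wk u + wk v"
  by (induction u) (simp_all add: add.assoc)

definition ev :: "'k::field ncpoly \<Rightarrow> 'k salg" where
  "ev f = (\<Sum>w\<in>{w. f w \<noteq> 0}. Poly_Mapping.single (wk w) (f w))"

lemma ev_super:
  assumes "finite S" "{w. f w \<noteq> 0} \<subseteq> S" shows "ev f = (\<Sum>w\<in>S. Poly_Mapping.single (wk w) (f w))"
  unfolding ev_def by (rule sum.mono_neutral_left) (use assms in auto)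

lemma ev_add:
  assumes "f \<in> fcarrier m" "g \<in> fcarrier m" shows "ev (\<lambda>w. f w + g w) = ev f + ev g"
proof -
  let ?S = "{w. f w \<noteq> 0} \<union> {w. g w \<noteq> 0}"
  have S: "finite ?S" using assms by (simp add: fcarrier_def)
  have "ev (\<lambda>w. f w + g w) = (\<Sum>w\<in>?S. Poly_Mapping.single (wk w) (f w + g w))" by (rule ev_super[OF S]) auto
  also have "\<dots> = ev f + ev g" by (subst (1 2) ev_super[OF S]) (auto simp: single_add sum.distrib)
  finally show ?thesis .
qed

text \<open>Both sides are sums over pairs of words; grouping the pairs by their concatenation
  yields the left-hand side.\<close>

lemma ev_mult:
  assumes f: "f \<in> fcarrier m" and g: "g \<in> fcarrier m" shows "ev (fmul f g) = ev f * ev g"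
proof -
  let ?S = "{w. f w \<noteq> 0} \<times> {w. g w \<noteq> 0}"
  let ?U = "(\<lambda>(u, v). u @ v) ` ?S"
  let ?F = "\<lambda>(u, v). Poly_Mapping.single (wk u + wk v) (f u * g v)"
  have S: "finite ?S" using f g by (simp add: fcarrier_def)
  have "{w. fmul f g w \<noteq> 0} \<subseteq> ?U" using fmul_nonzero[of f g] by fastforce
  then have "ev (fmul f g) = (\<Sum>w\<in>?U. Poly_Mapping.single (wk w) (fmul f g w))" using S by (intro ev_super) auto
  also have "\<dots> = (\<Sum>w\<in>?U. sum ?F {x\<in>?S. (\<lambda>(u, v). u @ v) x = w})"
  proof (rule sum.cong[OF refl])
    fix w
    have single_sum: "Poly_Mapping.single k (sum h T) = (\<Sum>x\<in>T. Poly_Mapping.single k (h x))" for k h and T :: "(letter list \<times> letter list) set"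
      by (induction T rule: infinite_finite_induct) (auto simp: single_add)
    have "Poly_Mapping.single (wk w) (fmul f g w) = (\<Sum>(u, v)\<in>splits w. Poly_Mapping.single (wk w) (f u * g v))"
      unfolding fmul_splits single_sum by (simp add: split_def)
    also have "\<dots> = sum ?F {x\<in>?S. (\<lambda>(u, v). u @ v) x = w}"
      by (rule sum.mono_neutral_cong_right) (auto simp: wk_append)
    finally show "Poly_Mapping.single (wk w) (fmul f g w) = sum ?F {x\<in>?S. (\<lambda>(u, v). u @ v) x = w}" .
  qed
  also have "\<dots> = sum ?F ?S" by (rule sum.group) (use S in auto)
  also have "\<dots> = ev f * ev g"
    unfolding ev_def sum_product sum.cartesian_product by (intro sum.cong refl) (auto simp: mult_single)
  finally show ?thesis .
qed

lemma ev_wd: "ev (wd w) = smono (wk w)"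
  by (subst ev_super[of "{w}"]) (auto simp: wd_def)

lemma ev_fconst: "ev (fconst c) = Poly_Mapping.single 0 c"
  by (subst ev_super[of "{[]}"]) (auto simp: fconst_def)

text \<open>Presents a type-class ring as a record, so that the homomorphism theorem for quotient
  rings can be applied to \<open>ev\<close>.\<close>

definition typering :: "'a::ring_1 ring" where
  "typering = \<lparr>carrier = UNIV, monoid.mult = (*), one = 1, ring.zero = 0, ring.add = (+)\<rparr>"

lemma typering_simps [simp]: "carrier typering = UNIV" "monoid.mult typering = (*)" "monoid.one typering = 1" "ring.zero typering = 0" "ring.add typering = (+)"
  by (simp_all add: typering_def)

lemma ring_typering: "ring (typering :: 'a::ring_1 ring)"
proof (rule ringI)
  show "abelian_group (typering :: 'a ring)"
    by (rule abelian_groupI) (auto simp: add.assoc add.commute intro: exI[of _ "- _"])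
  show "monoid (typering :: 'a ring)" by (rule monoidI) (auto simp: mult.assoc)
qed (auto simp: distrib_left distrib_right)

lemma ev_ring_hom: "ring_hom_ring (FreeAlg m) typering (ev :: 'k::field ncpoly \<Rightarrow> 'k salg)"
  by (rule ring_hom_ringI2[OF ring_FreeAlg ring_typering], rule ring_hom_memI)
     (auto simp: ev_mult ev_add ev_fconst)

definition relideal :: "nat \<Rightarrow> 'k::field ncpoly set" where
  "relideal m = genideal (FreeAlg m) (rels m)"

lemma gen_carrier: "i \<in> {1..m} \<Longrightarrow> gen (i, b) \<in> fcarrier m"
  using wd_carrier[of "[(i, b)]" m] by (simp add: wd_gen)

lemma fsub_carrier: "f \<in> fcarrier m \<Longrightarrow> g \<in> fcarrier m \<Longrightarrow> fsub f g \<in> fcarrier m"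
  using fcarrier_closed(3)[OF _ fcarrier_closed(5), of f m g] by (simp add: fsub_def)

lemma rels_carrier: "rels m \<subseteq> fcarrier m"
  unfolding rels_def fcomm_def by (auto intro!: fsub_carrier fcarrier_closed gen_carrier)

lemma ideal_relideal: "ideal (relideal m) (FreeAlg m)"
  unfolding relideal_def by (rule ring.genideal_ideal[OF ring_FreeAlg]) (simp add: rels_carrier)

lemma rels_relideal: "rels m \<subseteq> relideal m"
  unfolding relideal_def by (rule ring.genideal_self[OF ring_FreeAlg]) (simp add: rels_carrier)

lemma relideal_closed:
  assumes "a \<in> relideal m"
  shows "b \<in> relideal m \<Longrightarrow> (\<lambda>w. a w + b w) \<in> relideal m" "f \<in> fcarrier m \<Longrightarrow> fmul f a \<in> relideal m"
    "f \<in> fcarrier m \<Longrightarrow> fmul a f \<in> relideal m" "a \<in> fcarrier m"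
proof -
  interpret ideal "relideal m" "FreeAlg m" by (rule ideal_relideal)
  show "b \<in> relideal m \<Longrightarrow> (\<lambda>w. a w + b w) \<in> relideal m" using additive_subgroup.a_closed[OF ideal.axioms(1)[OF ideal_relideal] assms] by simp
  show "f \<in> fcarrier m \<Longrightarrow> fmul f a \<in> relideal m" using I_l_closed[OF assms] by simp
  show "f \<in> fcarrier m \<Longrightarrow> fmul a f \<in> relideal m" using I_r_closed[OF assms] by simp
  show "a \<in> fcarrier m" using Icarr[OF assms] by simp
qed

section \<open>Normal forms of words\<close>

text \<open>Equality of words modulo the relations; the type argument fixes the coefficient field,
  which words do not mention.\<close>

definition weq :: "'k::field itself \<Rightarrow> nat \<Rightarrow> letter list \<Rightarrow> letter list \<Rightarrow> bool" where
  "weq _ m u v \<longleftrightarrow> fsub (wd u) (wd v :: 'k ncpoly) \<in> relideal m"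

lemma relideal_zero: "(\<lambda>_. 0) \<in> relideal m"
proof -
  interpret ideal "relideal m" "FreeAlg m" by (rule ideal_relideal)
  show ?thesis using additive_subgroup.zero_closed[OF additive_subgroup_axioms] by simp
qed

lemma weq_refl [simp]: "weq T m u u"
  using relideal_zero by (simp add: weq_def fsub_def)

lemma weq_trans [trans]: "weq T m u v \<Longrightarrow> weq T m v w \<Longrightarrow> weq T m u w"
  unfolding weq_def using relideal_closed(1)[of "fsub (wd u) (wd v)" m "fsub (wd v) (wd w)"]
  by (simp add: fsub_def)

lemma weq_cong:
  assumes "weq T m u v" "set p \<subseteq> {1..m} \<times> UNIV" "set q \<subseteq> {1..m} \<times> UNIV"
  shows "weq T m (p @ u @ q) (p @ v @ q)"
proof -
  have d: "fmul f (fsub g h) = fsub (fmul f g) (fmul f h)" "fmul (fsub g h) f = fsub (fmul g f) (fmul h f)" for f g h :: "'a ncpoly"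
    by (simp_all add: fmul_def fsub_def fun_eq_iff algebra_simps sum_subtractf)
  have "fmul (wd p) (fmul (fsub (wd u) (wd v)) (wd q)) \<in> (relideal m :: 'a ncpoly set)"
    using assms by (intro relideal_closed(2)[OF relideal_closed(3)] wd_carrier) (auto simp: weq_def)
  then show ?thesis unfolding weq_def d wd_fmul .
qed

lemma weq_yx: "i \<in> {1..m} \<Longrightarrow> weq T m [(i, False), (i, True)] []"
proof -
  assume i: "i \<in> {1..m}"
  have "fsub (fmul (gen (i, False)) (gen (i, True))) (fconst 1) \<in> (rels m :: 'a ncpoly set)"
    unfolding rels_def using i by blast
  then have "fsub (fmul (gen (i, False)) (gen (i, True))) (fconst 1) \<in> (relideal m :: 'a ncpoly set)"
    using rels_relideal by blast
  then show ?thesis unfolding weq_def by (simp add: wd_fmul flip: wd_gen)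
qed

lemma weq_comm: "i \<in> {1..m} \<Longrightarrow> j \<in> {1..m} \<Longrightarrow> i \<noteq> j \<Longrightarrow> weq T m [(i, b), (j, c)] [(j, c), (i, b)]"
proof -
  assume i: "i \<in> {1..m}" "j \<in> {1..m}" "i \<noteq> j"
  have "fcomm (gen (i, b)) (gen (j, c)) \<in> (rels m :: 'a ncpoly set)"
    unfolding rels_def using i by blast
  then have "fcomm (gen (i, b)) (gen (j, c)) \<in> (relideal m :: 'a ncpoly set)"
    using rels_relideal by blast
  then show ?thesis unfolding weq_def fcomm_def by (simp add: wd_fmul flip: wd_gen)
qed

lemma weq_move:
  assumes "i \<in> {1..m}" "set p \<subseteq> ({1..m} - {i}) \<times> UNIV"
  shows "weq T m ((i, b) # p) (p @ [(i, b)])"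
  using assms(2)
proof (induction p)
  case (Cons l p)
  obtain j c where l: "l = (j, c)" by (cases l)
  have "weq T m ([] @ [(i, b), (j, c)] @ p) ([] @ [(j, c), (i, b)] @ p)"
    using Cons.prems assms(1) l by (intro weq_cong weq_comm) auto
  moreover have "weq T m ([(j, c)] @ ((i, b) # p) @ []) ([(j, c)] @ (p @ [(i, b)]) @ [])"
    using Cons l by (intro weq_cong) auto
  ultimately show ?case using l weq_trans by fastforce
qed simp

definition blk :: "(nat \<Rightarrow> bicyc) \<Rightarrow> nat \<Rightarrow> letter list" where
  "blk k i = replicate (xd (k i)) (i, True) @ replicate (yd (k i)) (i, False)"

text \<open>The word x_1^a y_1^b x_2^c y_2^d ...; words of this shape represent the monoid elements
  one to one.\<close>

definition nf :: "nat \<Rightarrow> (nat \<Rightarrow> bicyc) \<Rightarrow> letter list" where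
  "nf m k = concat (map (blk k) [1..<Suc m])"

lemma set_blk: "set (blk k i) \<subseteq> {i} \<times> UNIV"
  by (auto simp: blk_def)

text \<open>The letter commutes past the blocks of smaller index. In its own block an x is simply
  prepended, while a y cancels the leading x or, if there is none, joins the remaining letters
  y.\<close>

lemma weq_letter:
  assumes l: "l = (i, b)" and i: "i \<in> {1..m}"
  shows "weq T m (l # nf m k) (nf m (lk l + k))"
proof -
  let ?k = "lk l + k"
  have other: "?k j = k j" if "j \<noteq> i" for j using that l by (cases b) (auto simp: bat_def)
  have list: "[1..<Suc m] = [1..<i] @ [i] @ [Suc i..<Suc m]"
    using i upt_add_eq_append[of 1 i "Suc m - i"] upt_conv_Cons[of i "Suc m"] by simp
  define P where "P = concat (map (blk k) [1..<i])"
  define Q where "Q = concat (map (blk k) [Suc i..<Suc m])"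
  have nf1: "nf m k = P @ blk k i @ Q" unfolding nf_def list P_def Q_def by simp
  have "blk ?k j = blk k j" if "j \<noteq> i" for j using other[OF that] by (simp only: blk_def)
  then have m12: "map (blk ?k) [1..<i] = map (blk k) [1..<i]" "map (blk ?k) [Suc i..<Suc m] = map (blk k) [Suc i..<Suc m]"
    by (auto intro!: map_cong simp del: upt_Suc)
  have "nf m ?k = concat (map (blk ?k) [1..<i]) @ blk ?k i @ concat (map (blk ?k) [Suc i..<Suc m])"
    unfolding nf_def list by (simp del: upt_Suc)
  then have nf2: "nf m ?k = P @ blk ?k i @ Q" unfolding m12 P_def Q_def .
  have P: "set P \<subseteq> ({1..m} - {i}) \<times> UNIV" and Q: "set Q \<subseteq> {1..m} \<times> UNIV" and M: "set (blk k i) \<subseteq> {1..m} \<times> UNIV"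
    using i set_blk[of k] unfolding P_def Q_def by fastforce+
  have "weq T m ([] @ ((i, b) # P) @ (blk k i @ Q)) ([] @ (P @ [(i, b)]) @ (blk k i @ Q))"
    using P Q M i by (intro weq_cong weq_move) auto
  moreover have "weq T m (P @ ((i, b) # blk k i) @ Q) (P @ blk ?k i @ Q)"
  proof (rule weq_cong)
    show "weq T m ((i, b) # blk k i) (blk ?k i)"
    proof (cases b)
      case True
      then show ?thesis using l by (simp add: blk_def bat_def)
    next
      case b: False
      show ?thesis
      proof (cases "xd (k i)")
        case 0
        then show ?thesis using b l by (simp add: blk_def bat_def)
      next
        case (Suc n)
        have "weq T m ([] @ [(i, False), (i, True)] @ (replicate n (i, True) @ replicate (yd (k i)) (i, False)))
           ([] @ [] @ (replicate n (i, True) @ replicate (yd (k i)) (i, False)))"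
          using i by (intro weq_cong weq_yx) auto
        then show ?thesis using b l Suc by (simp add: blk_def bat_def)
      qed
    qed
  qed (use P Q in auto)
  ultimately have "weq T m ((i, b) # P @ blk k i @ Q) (P @ blk ?k i @ Q)"
    using weq_trans[of T m "(i, b) # P @ blk k i @ Q"] by simp
  then show ?thesis unfolding nf1 nf2 using l by simp
qed

lemma weq_nf: "set w \<subseteq> {1..m} \<times> UNIV \<Longrightarrow> weq T m w (nf m (wk w))"
proof (induction w)
  case Nil
  have "nf m (wk []) = []" by (simp add: nf_def blk_def zero_fun_def)
  then show ?case by (simp only: weq_refl)
next
  case (Cons l w)
  obtain i b where l: "l = (i, b)" by (cases l)
  have "weq T m ([l] @ w @ []) ([l] @ nf m (wk w) @ [])" using Cons by (intro weq_cong) auto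
  moreover have "weq T m (l # nf m (wk w)) (nf m (lk l + wk w))" using Cons.prems l by (intro weq_letter) auto
  ultimately have "weq T m (l # w) (nf m (lk l + wk w))" using weq_trans[of T m "l # w"] by simp
  then show ?case by (simp only: wk.simps)
qed

lemma wk_nf:
  assumes "\<And>i. xd (k i) \<noteq> 0 \<or> yd (k i) \<noteq> 0 \<Longrightarrow> i \<in> {1..m}"
  shows "wk (nf m k) = k"
proof -
  have rep: "wk (replicate n (i, True)) = bat i (BC n 0)" "wk (replicate n (i, False)) = bat i (BC 0 n)" for n i
    by (induction n) (auto simp: bat_def fun_eq_iff plus_bicyc_def zero_bicyc_def)
  have blk: "wk (blk k i) = bat i (k i)" for i
    by (auto simp: blk_def wk_append rep bat_def fun_eq_iff intro!: bicyc_eqI)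
  have "distinct is \<Longrightarrow> wk (concat (map (blk k) is)) = (\<lambda>i. if i \<in> set is then k i else 0)" for "is"
    by (induction "is") (auto simp: wk_append blk bat_def fun_eq_iff)
  then have "wk (nf m k) = (\<lambda>i. if i \<in> {1..m} then k i else 0)" unfolding nf_def by (auto simp del: upt_Suc)
  also have "\<dots> = k"
  proof
    fix i show "(if i \<in> {1..m} then k i else 0) = k i"
    proof (cases "i \<in> {1..m}")
      case False
      then have "xd (k i) = 0" "yd (k i) = 0" using assms[of i] by blast+
      then show ?thesis using False by (auto intro!: bicyc_eqI)
    qed simp
  qed
  finally show ?thesis .
qed

text \<open>The relations hold in the bicyclic algebra, so the ideal is contained in the kernel.
  Conversely, replacing each word by its normal form changes f only by the ideal, and the collected
  coefficients are those of \<open>ev f\<close>, hence zero.\<close>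

lemma ev_kernel: "a_kernel (FreeAlg m) typering (ev :: 'k::field ncpoly \<Rightarrow> 'k salg) = relideal m"
proof
  interpret ring_hom_ring "FreeAlg m" typering "ev :: 'k ncpoly \<Rightarrow> 'k salg" by (rule ev_ring_hom)
  have ker: "a_kernel (FreeAlg m) typering (ev :: 'k ncpoly \<Rightarrow> 'k salg) = {f \<in> fcarrier m. ev f = 0}"
    by (simp only: a_kernel_def' FreeAlg_simps typering_simps)
  have yx: "smono (bat i (BC 0 1)) * smono (bat i (BC 1 0)) = (1 :: 'k salg)" for i
  proof -
    have "bat i (BC 0 1) + bat i (BC 1 0) = 0" by (auto simp: bat_def fun_eq_iff intro!: bicyc_eqI)
    then show ?thesis by (simp add: mult_single)
  qed
  have evs: "ev (fsub f g) = ev f - ev g" if "f \<in> fcarrier m" "g \<in> fcarrier m" for f g :: "'k ncpoly"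
  proof -
    have "ev (\<lambda>w. fsub f g w + g w) = ev (fsub f g) + ev g" using that by (intro ev_add fsub_carrier)
    moreover have "(\<lambda>w. fsub f g w + g w) = f" by (simp add: fsub_def)
    ultimately show ?thesis by simp
  qed
  have "rels m \<subseteq> {f \<in> fcarrier m. ev f = (0 :: 'k salg)}"
  proof
    fix f :: "'k ncpoly" assume f: "f \<in> rels m"
    then have fc: "f \<in> fcarrier m" using rels_carrier by blast
    from f consider i where "i \<in> {1..m}" "f = fsub (fmul (gen (i, False)) (gen (i, True))) (fconst 1)"
      | i j b c where "i \<in> {1..m}" "j \<in> {1..m}" "i \<noteq> j" "f = fcomm (gen (i, b)) (gen (j, c))"
      unfolding rels_def by blast
    then have "ev f = 0"
    proof cases
      case 1
      have "ev f = ev (gen (i, False)) * ev (gen (i, True)) - ev (fconst 1)"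
      proof -
        have g: "gen (i, b) \<in> (fcarrier m :: 'k ncpoly set)" for b by (rule gen_carrier[OF 1(1)])
        show ?thesis unfolding 1(2) evs[OF fcarrier_closed(4)[OF g g] fcarrier_closed(2)] ev_mult[OF g g] ..
      qed
      also have "\<dots> = 0" using yx[of i] by (simp add: ev_fconst ev_wd flip: wd_gen)
      finally show ?thesis .
    next
      case 2
      have "lk (i, b) + lk (j, c) = lk (j, c) + lk (i, b)"
        using 2(3) by (cases b; cases c) (auto simp: bat_def fun_eq_iff)
      then have "ev (wd [(i, b), (j, c)]) = (ev (wd [(j, c), (i, b)]) :: 'k salg)" by (simp add: ev_wd)
      moreover have "f = fsub (wd [(i, b), (j, c)]) (wd [(j, c), (i, b)])"
        unfolding 2(4) fcomm_def by (simp add: wd_fmul flip: wd_gen)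
      moreover have "wd [(i, b), (j, c)] \<in> (fcarrier m :: 'k ncpoly set)" "wd [(j, c), (i, b)] \<in> (fcarrier m :: 'k ncpoly set)"
        using 2(1,2) by (auto intro!: wd_carrier)
      ultimately show ?thesis by (simp add: evs)
    qed
    then show "f \<in> {f \<in> fcarrier m. ev f = 0}" using fc by simp
  qed
  then show "relideal m \<subseteq> a_kernel (FreeAlg m) typering (ev :: 'k ncpoly \<Rightarrow> 'k salg)"
    unfolding relideal_def ker[symmetric]
    by (intro ring.genideal_minimal ring_FreeAlg kernel_is_ideal)
  show "a_kernel (FreeAlg m) typering (ev :: 'k ncpoly \<Rightarrow> 'k salg) \<subseteq> relideal m"
    unfolding ker
  proof
    fix f :: "'k ncpoly" assume "f \<in> {f \<in> fcarrier m. ev f = 0}"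
    then have f: "f \<in> fcarrier m" "ev f = 0" by auto
    let ?S = "{w. f w \<noteq> 0}"
    have S: "finite ?S" "\<And>w. w \<in> ?S \<Longrightarrow> set w \<subseteq> {1..m} \<times> UNIV" using f(1) by (auto simp: fcarrier_def)
    have "(\<lambda>v. \<Sum>w\<in>U. f w * fsub (wd w) (wd (nf m (wk w))) v) \<in> relideal m" if "finite U" "U \<subseteq> ?S" for U
      using that
    proof (induction U)
      case empty
      then show ?case using relideal_zero by simp
    next
      case (insert w U)
      have "fsub (wd w) (wd (nf m (wk w)) :: 'k ncpoly) \<in> relideal m"
        using weq_nf[of w m "TYPE('k)"] S(2)[of w] insert.prems by (auto simp: weq_def)
      then have "fmul (fconst (f w)) (fsub (wd w) (wd (nf m (wk w)))) \<in> relideal m"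
        by (intro relideal_closed fcarrier_closed)
      from relideal_closed(1)[OF this] show ?case using insert by (simp add: fmul_const)
    qed
    from this[OF S(1) order_refl]
    have "(\<lambda>v. \<Sum>w\<in>?S. f w * fsub (wd w) (wd (nf m (wk w))) v) \<in> relideal m" .
    moreover have "(\<Sum>w\<in>?S. f w * fsub (wd w) (wd (nf m (wk w))) v) = f v" for v
    proof -
      have "(\<Sum>w\<in>?S. f w * wd w v) = (\<Sum>w\<in>?S. if w = v then f w else 0)"
        by (intro sum.cong refl) (auto simp: wd_def)
      then have 1: "(\<Sum>w\<in>?S. f w * wd w v) = f v" using S by simp
      have coeff: "(\<Sum>w\<in>{w\<in>?S. wk w = k}. f w) = 0" for k
      proof -
        have "Poly_Mapping.lookup (ev f) k = (\<Sum>w\<in>?S. if wk w = k then f w else 0)"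
          unfolding ev_def lookup_sum by (intro sum.cong refl) (auto simp: lookup_single when_def)
        then show ?thesis using f(2) sum.inter_filter[OF S(1), of f "\<lambda>w. wk w = k"] by simp
      qed
      have "(\<Sum>w\<in>?S. f w * wd (nf m (wk w)) v) = (\<Sum>k\<in>wk ` ?S. \<Sum>w\<in>{w\<in>?S. wk w = k}. f w * wd (nf m (wk w)) v)"
        by (rule sum.group[symmetric]) (use S in auto)
      also have "\<dots> = (\<Sum>k\<in>wk ` ?S. (\<Sum>w\<in>{w\<in>?S. wk w = k}. f w) * wd (nf m k) v)"
        unfolding sum_distrib_right by (intro sum.cong refl) auto
      also have "\<dots> = 0" by (simp only: coeff) simp
      finally show ?thesis using 1 by (simp add: fsub_def right_diff_distrib sum_subtractf)
    qed
    ultimately show "f \<in> relideal m" by simp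
  qed
qed

abbreviation SS :: "nat \<Rightarrow> 'k::field salg set" where "SS m \<equiv> SW {1..m} {1..m}"

lemma ev_image: "ev ` fcarrier m = (SS m :: 'k::field salg set)"
proof
  show "ev ` fcarrier m \<subseteq> (SS m :: 'k salg set)"
  proof
    fix z :: "'k salg" assume "z \<in> ev ` fcarrier m"
    then obtain f where f: "f \<in> fcarrier m" "z = ev f" by blast
    have *: "xd (wk w i) \<noteq> 0 \<or> yd (wk w i) \<noteq> 0 \<Longrightarrow> i \<in> {1..m}" if "set w \<subseteq> {1..m} \<times> UNIV" for w i
      using that
    proof (induction w)
      case (Cons l w)
      obtain j b where l: "l = (j, b)" by (cases l)
      show ?case using Cons l by (cases b; cases "i = j") (auto simp: bat_def)
    qed simp
    have "Poly_Mapping.single (wk w) (f w) \<in> SS m" if "f w \<noteq> 0" for w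
    proof -
      have w: "set w \<subseteq> {1..m} \<times> UNIV" using f(1) that by (auto simp: fcarrier_def)
      show ?thesis by (rule single_SW) (use *[OF w] in blast)+
    qed
    then show "z \<in> SS m" unfolding f(2) ev_def by (intro sring_sum) auto
  qed
  show "(SS m :: 'k salg set) \<subseteq> ev ` fcarrier m"
  proof
    fix z :: "'k salg" assume "z \<in> SS m"
    then show "z \<in> ev ` fcarrier m"
    proof (rule SW_induct)
      show "0 \<in> ev ` (fcarrier m :: 'k ncpoly set)"
        using fcarrier_closed(1) by (intro image_eqI[of _ _ "\<lambda>_. 0"]) (auto simp: ev_def)
      show "a + b \<in> ev ` fcarrier m" if ab: "a \<in> ev ` fcarrier m" "b \<in> ev ` fcarrier m" for a b :: "'k salg"
      proof -
        obtain f g where "f \<in> fcarrier m" "g \<in> fcarrier m" "a = ev f" "b = ev g" using ab by blast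
        then show ?thesis using ev_add[of f m g] fcarrier_closed(3)[of f m g] by (metis imageI)
      qed
      fix k and c :: 'k
      assume k: "\<And>i. xd (k i) \<noteq> 0 \<Longrightarrow> i \<in> {1..m}" "\<And>i. yd (k i) \<noteq> 0 \<Longrightarrow> i \<in> {1..m}"
      have "set (nf m k) \<subseteq> {1..m} \<times> UNIV" using set_blk[of k] unfolding nf_def by fastforce
      then have w: "wd (nf m k) \<in> fcarrier m" by (rule wd_carrier)
      have "wk (nf m k) = k" by (rule wk_nf) (use k in blast)
      then have "ev (fmul (fconst c) (wd (nf m k))) = Poly_Mapping.single k c"
        by (subst ev_mult[OF fcarrier_closed(2) w]) (auto simp: ev_fconst ev_wd mult_single)
      then show "Poly_Mapping.single k c \<in> ev ` fcarrier m"
        using fcarrier_closed(4)[OF fcarrier_closed(2) w, of c] by (metis imageI)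
    qed
  qed
qed

text \<open>The isomorphism of \<open>Sm m\<close> onto \<open>SS m\<close> induced by
  \<open>ev\<close>, which is constant on cosets of its kernel.\<close>

definition phi :: "'k::field ncpoly set \<Rightarrow> 'k salg" where "phi X = the_elem (ev ` X)"

lemma Sm_eq: "Sm m = FreeAlg m Quot relideal m"
  by (simp add: Sm_def relideal_def)

lemma ring_Sm: "ring (Sm m :: 'k::field ncpoly set ring)"
  unfolding Sm_eq by (rule ideal.quotient_is_ring[OF ideal_relideal])

lemma phi_props:
  shows phi_inj: "inj_on phi (carrier (Sm m :: 'k::field ncpoly set ring))"
    and phi_image: "phi ` carrier (Sm m :: 'k ncpoly set ring) = SS m"
    and phi_hom: "phi \<in> ring_hom (Sm m :: 'k ncpoly set ring) typering"
    and phi_toS: "f \<in> fcarrier m \<Longrightarrow> phi (toS m f) = ev f"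
    and toS_carrier: "f \<in> fcarrier m \<Longrightarrow> toS m f \<in> carrier (Sm m :: 'k ncpoly set ring)"
proof -
  interpret ring_hom_ring "FreeAlg m" typering "ev :: 'k ncpoly \<Rightarrow> 'k salg" by (rule ev_ring_hom)
  note k = ev_kernel[where 'k='k]
  show "phi \<in> ring_hom (Sm m :: 'k ncpoly set ring) typering"
    using the_elem_hom unfolding k Sm_eq phi_def .
  show "phi ` carrier (Sm m :: 'k ncpoly set ring) = SS m"
    using the_elem_surj unfolding k Sm_eq phi_def by (simp add: ev_image)
  show "inj_on phi (carrier (Sm m :: 'k ncpoly set ring))"
    using the_elem_inj unfolding k Sm_eq phi_def inj_on_def by blast
  show "f \<in> fcarrier m \<Longrightarrow> phi (toS m f) = ev f"
    using the_elem_simp[of f] unfolding k phi_def toS_def relideal_def[symmetric] by simp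
  show "f \<in> fcarrier m \<Longrightarrow> toS m f \<in> carrier (Sm m :: 'k ncpoly set ring)"
    unfolding Sm_eq toS_def relideal_def[symmetric] FactRing_simps by (auto simp: A_RCOSETS_def')
qed

section \<open>Row operations on determinants\<close>

context cring
begin

definition sg :: "(nat \<Rightarrow> nat) \<Rightarrow> 'a \<Rightarrow> 'a" where "sg p x = (if evenperm p then x else \<ominus> x)"

lemma sg_closed [simp]: "x \<in> carrier R \<Longrightarrow> sg p x \<in> carrier R"
  by (simp add: sg_def)

lemma sg_add: "x \<in> carrier R \<Longrightarrow> y \<in> carrier R \<Longrightarrow> sg p (x \<oplus> y) = sg p x \<oplus> sg p y"
  by (simp add: sg_def minus_add a_comm)

lemma sg_mult: "c \<in> carrier R \<Longrightarrow> x \<in> carrier R \<Longrightarrow> sg p (c \<otimes> x) = c \<otimes> sg p x"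
  by (simp add: sg_def r_minus)

lemma detn_sg: "detn R n M = finsum R (\<lambda>p. sg p (finprod R (\<lambda>i. M i (p i)) {..<n})) {p. p permutes {..<n}}"
  by (simp add: detn_def sg_def Let_def)

abbreviation rest :: "nat \<Rightarrow> (nat \<Rightarrow> nat \<Rightarrow> 'a) \<Rightarrow> nat \<Rightarrow> (nat \<Rightarrow> nat) \<Rightarrow> 'a" where
  "rest n M i p \<equiv> finprod R (\<lambda>k. M k (p k)) ({..<n} - {i})"

lemma finprod_split:
  assumes "\<And>i j. M i j \<in> carrier R" "i < n"
  shows "finprod R (\<lambda>k. M k (p k)) {..<n} = M i (p i) \<otimes> rest n M i p"
proof -
  have "{..<n} = insert i ({..<n} - {i})" using assms(2) by auto
  then have "finprod R (\<lambda>k. M k (p k)) {..<n} = finprod R (\<lambda>k. M k (p k)) (insert i ({..<n} - {i}))" by simp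
  also have "\<dots> = M i (p i) \<otimes> rest n M i p" using assms(1) by (subst finprod_insert) auto
  finally show ?thesis .
qed

text \<open>The factor of row i is isolated and \<open>rest\<close> does not see that row, so
  linearity in the row becomes visible.\<close>

lemma detn_replace_row:
  assumes "\<And>i j. M i j \<in> carrier R" "\<And>q. r q \<in> carrier R" "i < n"
  shows "detn R n (M(i := r)) = finsum R (\<lambda>p. sg p (r (p i) \<otimes> rest n M i p)) {p. p permutes {..<n}}"
proof -
  have "finprod R (\<lambda>k. (M(i := r)) k (p k)) {..<n} = r (p i) \<otimes> rest n M i p" for p
  proof -
    have "finprod R (\<lambda>k. (M(i := r)) k (p k)) {..<n} = (M(i := r)) i (p i) \<otimes> rest n (M(i := r)) i p"
      using assms by (intro finprod_split) auto
    also have "rest n (M(i := r)) i p = rest n M i p"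
      using assms(1) by (intro finprod_cong') auto
    finally show ?thesis by simp
  qed
  then show ?thesis by (simp add: detn_sg)
qed

lemma detn_scale_row:
  assumes M: "\<And>i j. M i j \<in> carrier R" and c: "c \<in> carrier R" and i: "i < n"
  shows "detn R n (M(i := \<lambda>q. c \<otimes> M i q)) = c \<otimes> detn R n M"
proof -
  have T: "rest n M i p \<in> carrier R" for p using M by (intro finprod_closed) auto
  have fin: "finite {p. p permutes {..<n}}" by (simp add: finite_permutations)
  have "detn R n (M(i := \<lambda>q. c \<otimes> M i q)) = finsum R (\<lambda>p. sg p ((c \<otimes> M i (p i)) \<otimes> rest n M i p)) {p. p permutes {..<n}}"
    using M c i by (intro detn_replace_row) auto
  also have "\<dots> = finsum R (\<lambda>p. c \<otimes> sg p (M i (p i) \<otimes> rest n M i p)) {p. p permutes {..<n}}"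
    using M c T by (intro finsum_cong') (auto simp: m_assoc sg_mult)
  also have "\<dots> = c \<otimes> finsum R (\<lambda>p. sg p (M i (p i) \<otimes> rest n M i p)) {p. p permutes {..<n}}"
    using M c T fin by (subst finsum_rdistr) auto
  also have "finsum R (\<lambda>p. sg p (M i (p i) \<otimes> rest n M i p)) {p. p permutes {..<n}} = detn R n (M(i := M i))"
    using M i by (intro detn_replace_row[symmetric]) auto
  finally show ?thesis by (simp only: fun_upd_triv)
qed

text \<open>The terms of p and \<open>p \<circ> s\<close> cancel in pairs; avoiding the argument
  that the determinant equals its negative keeps characteristic 2 included.\<close>

lemma detn_equal_rows:
  assumes M: "\<And>i j. M i j \<in> carrier R" and ij: "i < n" "j < n" "i \<noteq> j" and eq: "M i = M j"
  shows "detn R n M = \<zero>"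
proof -
  let ?P = "{p. p permutes {..<n}}"
  let ?E = "{p \<in> ?P. evenperm p}" and ?O = "{p \<in> ?P. \<not> evenperm p}"
  define s where "s = transpose i j"
  define t where "t p = finprod R (\<lambda>k. M k (p k)) {..<n}" for p
  have t: "t p \<in> carrier R" for p unfolding t_def using M by (intro finprod_closed) auto
  have fin: "finite ?P" by (simp add: finite_permutations)
  have s: "s permutes {..<n}" unfolding s_def using ij by (intro permutes_swap_id) auto
  have ss: "s \<circ> s = id" by (simp add: s_def)
  have even: "evenperm (p \<circ> s) \<longleftrightarrow> \<not> evenperm p" if "p permutes {..<n}" for p
  proof -
    have "permutation p" "permutation s" using that s permutation_permutes by blast+
    then show ?thesis using ij by (simp add: evenperm_comp s_def evenperm_swap)
  qed
  have O: "?O = (\<lambda>p. p \<circ> s) ` ?E"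
  proof
    show "?O \<subseteq> (\<lambda>p. p \<circ> s) ` ?E"
    proof
      fix p assume p: "p \<in> ?O"
      then have "p \<circ> s \<in> ?E" using even permutes_compose[OF s] by auto
      moreover have "p = (p \<circ> s) \<circ> s" using ss by (simp add: comp_assoc)
      ultimately show "p \<in> (\<lambda>p. p \<circ> s) ` ?E" by blast
    qed
    show "(\<lambda>p. p \<circ> s) ` ?E \<subseteq> ?O" using even permutes_compose[OF s] by auto
  qed
  have inj: "inj_on (\<lambda>p. p \<circ> s) ?E"
    by (rule inj_onI) (metis comp_assoc comp_id ss)
  have ts: "t (p \<circ> s) = t p" if "p permutes {..<n}" for p
  proof -
    have Ms: "M (s k) = M k" for k using eq by (auto simp: s_def transpose_def)
    have img: "s ` {..<n} = {..<n}" using s by (rule permutes_image)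
    have "t p = finprod R (\<lambda>k. M k (p k)) (s ` {..<n})" unfolding t_def img ..
    also have "\<dots> = finprod R (\<lambda>k. M (s k) (p (s k))) {..<n}"
      using M s by (intro finprod_reindex) (auto simp: permutes_inj_on)
    also have "\<dots> = t (p \<circ> s)" unfolding t_def Ms by simp
    finally show ?thesis by simp
  qed
  have "detn R n M = finsum R (\<lambda>p. sg p (t p)) (?E \<union> ?O)"
    unfolding detn_sg t_def by (rule arg_cong[of _ _ "finsum R _"]) auto
  also have "\<dots> = finsum R (\<lambda>p. sg p (t p)) ?E \<oplus> finsum R (\<lambda>p. sg p (t p)) ?O"
    using fin t by (intro finsum_Un_disjoint) auto
  also have "finsum R (\<lambda>p. sg p (t p)) ?E = finsum R t ?E"
    using t by (intro finsum_cong') (auto simp: sg_def)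
  also have "finsum R (\<lambda>p. sg p (t p)) ?O = finsum R (\<lambda>p. sg (p \<circ> s) (t (p \<circ> s))) ?E"
    unfolding O using t inj by (intro finsum_reindex) auto
  also have "\<dots> = finsum R (\<lambda>p. \<ominus> t p) ?E"
    using t even ts by (intro finsum_cong') (auto simp: sg_def)
  also have "finsum R t ?E \<oplus> finsum R (\<lambda>p. \<ominus> t p) ?E = finsum R (\<lambda>p. t p \<oplus> \<ominus> t p) ?E"
    using t by (intro finsum_addf[symmetric]) auto
  also have "\<dots> = \<zero>" using t by (simp add: r_neg)
  finally show ?thesis .
qed

lemma detn_add_row:
  assumes M: "\<And>i j. M i j \<in> carrier R" and a: "a \<in> carrier R" and ij: "i < n" "j < n" "i \<noteq> j"
  shows "detn R n (M(i := \<lambda>q. M i q \<oplus> a \<otimes> M j q)) = detn R n M"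
proof -
  let ?P = "{p. p permutes {..<n}}"
  have T: "rest n M i p \<in> carrier R" for p using M by (intro finprod_closed) auto
  have "detn R n (M(i := \<lambda>q. M i q \<oplus> a \<otimes> M j q)) = finsum R (\<lambda>p. sg p ((M i (p i) \<oplus> a \<otimes> M j (p i)) \<otimes> rest n M i p)) ?P"
    using M a ij by (intro detn_replace_row) auto
  also have "\<dots> = finsum R (\<lambda>p. sg p (M i (p i) \<otimes> rest n M i p) \<oplus> sg p ((a \<otimes> M j (p i)) \<otimes> rest n M i p)) ?P"
    using M a T by (intro finsum_cong') (auto simp: l_distr sg_add)
  also have "\<dots> = finsum R (\<lambda>p. sg p (M i (p i) \<otimes> rest n M i p)) ?P \<oplus> finsum R (\<lambda>p. sg p ((a \<otimes> M j (p i)) \<otimes> rest n M i p)) ?P"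
    using M a T by (intro finsum_addf) auto
  also have "finsum R (\<lambda>p. sg p (M i (p i) \<otimes> rest n M i p)) ?P = detn R n (M(i := M i))"
    using M ij by (intro detn_replace_row[symmetric]) auto
  also have "finsum R (\<lambda>p. sg p ((a \<otimes> M j (p i)) \<otimes> rest n M i p)) ?P = detn R n (M(i := \<lambda>q. a \<otimes> M j q))"
    using M a ij by (intro detn_replace_row[symmetric]) auto
  also have "M(i := \<lambda>q. a \<otimes> M j q) = (M(i := M j))(i := \<lambda>q. a \<otimes> (M(i := M j)) i q)" by simp
  also have "detn R n \<dots> = a \<otimes> detn R n (M(i := M j))"
    using M a ij by (intro detn_scale_row) auto
  also have "detn R n (M(i := M j)) = \<zero>"
    using M ij by (intro detn_equal_rows[of _ i n j]) auto
  finally show ?thesis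
    using a M by (simp add: detn_sg finsum_closed)
qed

text \<open>Row n is that of the identity, so only permutations fixing n contribute.\<close>

lemma detn_Suc:
  assumes M: "\<And>i j. M i j \<in> carrier R" and id: "\<And>j. M n j = idm R n j"
  shows "detn R (Suc n) M = detn R n M"
proof -
  define f where "f p = sg p (finprod R (\<lambda>i. M i (p i)) {..<Suc n})" for p
  have f: "f p \<in> carrier R" for p unfolding f_def using M by (intro sg_closed finprod_closed) auto
  have sub: "{p. p permutes {..<n}} \<subseteq> {p. p permutes {..<Suc n}}"
    by (auto intro: permutes_subset)
  have fin: "finite {p. p permutes {..<Suc n}}" by (simp add: finite_permutations)
  have prod: "finprod R (\<lambda>i. M i (p i)) {..<Suc n} = idm R n (p n) \<otimes> finprod R (\<lambda>i. M i (p i)) {..<n}" for p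
    using M by (subst lessThan_Suc, subst finprod_insert) (auto simp: id idm_def)
  have "f p = \<zero>" if "p \<in> {p. p permutes {..<Suc n}} - {p. p permutes {..<n}}" for p
  proof -
    have "p n \<noteq> n"
    proof
      assume "p n = n"
      have "p permutes {..<Suc n}" using that by simp
      then have "p permutes {..<n}"
        by (rule permutes_superset) (use \<open>p n = n\<close> in \<open>auto simp: less_Suc_eq\<close>)
      then show False using that by simp
    qed
    then have "idm R n (p n) = \<zero>" by (simp add: idm_def)
    moreover have "finprod R (\<lambda>i. M i (p i)) {..<n} \<in> carrier R" using M by (intro finprod_closed) auto
    ultimately show ?thesis unfolding f_def prod by (simp add: sg_def)
  qed
  then have "finsum R f {p. p permutes {..<Suc n}} = finsum R f {p. p permutes {..<n}}"
    using f fin sub by (intro add.finprod_mono_neutral_cong_right) auto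
  also have "\<dots> = detn R n M"
    unfolding detn_sg
  proof (rule finsum_cong')
    fix p assume "p \<in> {p. p permutes {..<n}}"
    then have "p n = n" by (auto simp: permutes_def)
    then show "f p = sg p (finprod R (\<lambda>i. M i (p i)) {..<n})"
      unfolding f_def prod using M by (simp add: idm_def finprod_closed Pi_def)
  qed (use M in \<open>auto intro!: finprod_closed\<close>)
  finally show ?thesis unfolding detn_sg f_def .
qed

definition bound :: "nat \<Rightarrow> (nat \<Rightarrow> nat \<Rightarrow> 'a) \<Rightarrow> bool" where
  "bound n M \<longleftrightarrow> (\<forall>i j. (n \<le> i \<or> n \<le> j) \<longrightarrow> M i j = idm R i j)"

text \<open>Row operations do not respect the least block; by \<open>detn_Suc\<close> every bounding
  block gives the same determinant.\<close>

lemma detinf_detn: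
  assumes M: "\<And>i j. M i j \<in> carrier R" and b: "bound n M"
  shows "detinf R M = detn R n M"
proof -
  define l where "l = (LEAST n. bound n M)"
  have l: "bound l M" unfolding l_def using b by (rule LeastI)
  have "l \<le> n" unfolding l_def using b by (rule Least_le)
  have "detn R (l + d) M = detn R l M" for d
  proof (induction d)
    case (Suc d)
    have "detn R (Suc (l + d)) M = detn R (l + d) M"
      using l M by (intro detn_Suc) (auto simp: bound_def)
    then show ?case using Suc by simp
  qed simp
  from this[of "n - l"] have "detn R n M = detn R l M" using \<open>l \<le> n\<close> by simp
  then show ?thesis unfolding detinf_def l_def bound_def by simp
qed

lemma detinf_idm: "detinf R (idm R) = \<one>"
proof -
  have "detinf R (idm R) = detn R 0 (idm R)"
    by (rule detinf_detn) (auto simp: idm_def bound_def)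
  also have "\<dots> = \<one>" by (simp add: detn_sg sg_def permutes_empty evenperm_id finsum_insert)
  finally show ?thesis .
qed

lemma detinf_add_row:
  assumes M: "\<And>i j. M i j \<in> carrier R" and a: "a \<in> carrier R" and ij: "i \<noteq> j" and b: "bound n M"
  shows "detinf R (M(i := \<lambda>q. M i q \<oplus> a \<otimes> M j q)) = detinf R M"
proof -
  \<comment> \<open>The block has to contain both rows of the operation.\<close>
  define k where "k = Suc (max n (max i j))"
  have bk: "bound k M" using b by (auto simp: bound_def k_def)
  have "bound k (M(i := \<lambda>q. M i q \<oplus> a \<otimes> M j q))"
    unfolding bound_def
  proof (intro allI impI)
    fix p q assume pq: "k \<le> p \<or> k \<le> q"
    show "(M(i := \<lambda>q. M i q \<oplus> a \<otimes> M j q)) p q = idm R p q"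
    proof (cases "p = i")
      case True
      then have "k \<le> q" using pq by (auto simp: k_def)
      then have "M i q = idm R i q" "M j q = \<zero>" using bk by (auto simp: bound_def idm_def k_def)
      then show ?thesis using True a by (simp add: idm_def)
    next
      case False
      then show ?thesis using bk pq by (auto simp: bound_def)
    qed
  qed
  then have "detinf R (M(i := \<lambda>q. M i q \<oplus> a \<otimes> M j q)) = detn R k (M(i := \<lambda>q. M i q \<oplus> a \<otimes> M j q))"
    using M a by (intro detinf_detn) auto
  also have "\<dots> = detn R k M" using M a ij by (intro detn_add_row) (auto simp: k_def)
  finally show ?thesis using detinf_detn[OF M bk] by simp
qed

lemma detinf_scale_row:
  assumes M: "\<And>i j. M i j \<in> carrier R" and c: "c \<in> carrier R" and b: "bound n M"
  shows "detinf R (M(0 := \<lambda>q. c \<otimes> M 0 q)) = c \<otimes> detinf R M"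
proof -
  define k where "k = Suc n"
  have bk: "bound k M" using b by (auto simp: bound_def k_def)
  have "bound k (M(0 := \<lambda>q. c \<otimes> M 0 q))"
    using bk c by (auto simp: bound_def k_def idm_def)
  then have "detinf R (M(0 := \<lambda>q. c \<otimes> M 0 q)) = detn R k (M(0 := \<lambda>q. c \<otimes> M 0 q))"
    using M c by (intro detinf_detn) auto
  also have "\<dots> = c \<otimes> detn R k M" using M c by (intro detn_scale_row) (auto simp: k_def)
  finally show ?thesis using detinf_detn[OF M bk] by simp
qed

end

section \<open>The general linear group and its determinant\<close>

declare One_nat_def [simp del]

lemma phi_mult: "a \<in> carrier (Sm m) \<Longrightarrow> b \<in> carrier (Sm m) \<Longrightarrow> phi (a \<otimes>\<^bsub>Sm m\<^esub> b) = phi a * phi b"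
  using ring_hom_mult[OF phi_hom] by fastforce

lemma phi_add: "a \<in> carrier (Sm m) \<Longrightarrow> b \<in> carrier (Sm m) \<Longrightarrow> phi (a \<oplus>\<^bsub>Sm m\<^esub> b) = phi a + phi b"
  using ring_hom_add[OF phi_hom] by fastforce

lemma phi_one: "phi \<one>\<^bsub>Sm m\<^esub> = 1"
  using ring_hom_one[OF phi_hom] by fastforce

lemma phi_zero: "phi \<zero>\<^bsub>Sm m\<^esub> = 0"
  using ring_hom_zero[OF phi_hom ring_Sm ring_typering] by fastforce

lemma phi_minus:
  fixes a :: "'k::field ncpoly set"
  assumes "a \<in> carrier (Sm m)" "b \<in> carrier (Sm m)" shows "phi (a \<ominus>\<^bsub>Sm m\<^esub> b) = phi a - phi b"
proof -
  interpret ring "Sm m :: 'k ncpoly set ring" by (rule ring_Sm)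
  have "phi ((a \<ominus>\<^bsub>Sm m\<^esub> b) \<oplus>\<^bsub>Sm m\<^esub> b) = phi a"
    using assms by (simp add: minus_eq a_assoc l_neg)
  then show ?thesis using assms by (simp add: phi_add eq_diff_eq)
qed

lemma phi_SS: "a \<in> carrier (Sm m) \<Longrightarrow> phi a \<in> SS m"
  using phi_image by blast

lemma phi_eqI: "a \<in> carrier (Sm m) \<Longrightarrow> b \<in> carrier (Sm m) \<Longrightarrow> phi a = phi b \<Longrightarrow> a = b"
  using phi_inj by (rule inj_onD)

lemma phi_finsum:
  fixes f :: "'i \<Rightarrow> 'k::field ncpoly set"
  assumes "finite I" "\<And>i. i \<in> I \<Longrightarrow> f i \<in> carrier (Sm m)"
  shows "phi (finsum (Sm m) f I) = (\<Sum>i\<in>I. phi (f i))"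
proof -
  interpret ring "Sm m :: 'k ncpoly set ring" by (rule ring_Sm)
  show ?thesis using assms
  proof (induction I)
    case empty
    then show ?case by (simp add: phi_zero)
  next
    case (insert i I)
    have "f i \<in> carrier (Sm m)" "f \<in> I \<rightarrow> carrier (Sm m)" using insert by auto
    then show ?case using insert by (simp add: finsum_insert phi_add)
  qed
qed

lemma fsupp_iff:
  "fsupp R A \<longleftrightarrow> (\<forall>i j. A i j \<in> carrier R) \<and> (\<exists>n. \<forall>i j. n \<le> i \<or> n \<le> j \<longrightarrow> A i j = idm R i j)"
proof -
  let ?S = "{(i, j). A i j \<noteq> idm R i j}"
  have "finite ?S \<longleftrightarrow> (\<exists>n. \<forall>i j. n \<le> i \<or> n \<le> j \<longrightarrow> A i j = idm R i j)"
  proof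
    assume "finite ?S"
    then have "finite (fst ` ?S \<union> snd ` ?S)" by simp
    then obtain n where n: "\<forall>k\<in>fst ` ?S \<union> snd ` ?S. k < n" using finite_nat_set_iff_bounded by blast
    have "A i j = idm R i j" if ij: "n \<le> i \<or> n \<le> j" for i j
    proof (rule ccontr)
      assume "A i j \<noteq> idm R i j"
      then have "(i, j) \<in> ?S" by simp
      then have "i \<in> fst ` ?S \<union> snd ` ?S" "j \<in> fst ` ?S \<union> snd ` ?S" by force+
      then have "i < n" "j < n" using n by blast+
      then show False using ij by simp
    qed
    then show "\<exists>n. \<forall>i j. n \<le> i \<or> n \<le> j \<longrightarrow> A i j = idm R i j" by blast
  next
    assume "\<exists>n. \<forall>i j. n \<le> i \<or> n \<le> j \<longrightarrow> A i j = idm R i j"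
    then obtain n where n: "\<forall>i j. n \<le> i \<or> n \<le> j \<longrightarrow> A i j = idm R i j" by blast
    then have "?S \<subseteq> {..<n} \<times> {..<n}" by (auto simp: not_le[symmetric])
    then show "finite ?S" by (rule finite_subset) simp
  qed
  then show ?thesis by (simp add: fsupp_def)
qed

lemma fsupp_carrier: "fsupp R A \<Longrightarrow> A i j \<in> carrier R"
  by (simp add: fsupp_def)

text \<open>Translates matrices over \<open>Sm m\<close> into column-finite matrices over the
  bicyclic algebra; \<open>fsupp\<close> guarantees that the columns are finite.\<close>

definition psi :: "'k::field ncpoly set imat \<Rightarrow> 'k salg cfm" where
  "psi A = Abs_cfm (\<lambda>i j. phi (A i j))"

lemma phi_idm: "phi (idm (Sm m) i j) = ent 1 i j"
  by (simp add: idm_def ent_one phi_one phi_zero)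

lemma ent_psi:
  assumes "fsupp (Sm m) A" shows "ent (psi A) i j = phi (A i j)"
proof -
  have "{p. phi (A p q) \<noteq> 0} \<subseteq> insert q (fst ` {(i, j). A i j \<noteq> idm (Sm m) i j})" for q
  proof
    fix p assume p: "p \<in> {p. phi (A p q) \<noteq> 0}"
    have "p = q" if "A p q = idm (Sm m) p q" using that p by (auto simp: phi_idm ent_one split: if_splits)
    then show "p \<in> insert q (fst ` {(i, j). A i j \<noteq> idm (Sm m) i j})" by force
  qed
  then have "\<forall>q. finite {p. phi (A p q) \<noteq> 0}"
    using assms unfolding fsupp_def by (meson finite_imageI finite_insert finite_subset)
  then show ?thesis unfolding psi_def by (subst Abs_cfm_inverse) auto
qed

lemma psi_Fin1:
  assumes "fsupp (Sm m) A" shows "psi A \<in> Fin1 (SS m)"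
proof -
  obtain n where n: "\<forall>i j. n \<le> i \<or> n \<le> j \<longrightarrow> A i j = idm (Sm m) i j" using assms fsupp_iff by blast
  have "fin (psi A - 1)" unfolding fin_def
    by (rule exI[of _ n]) (use n in \<open>simp add: ent_psi[OF assms] phi_idm\<close>)
  then show ?thesis unfolding Fin1_def mat_over_def
    by (simp add: ent_psi[OF assms] phi_SS fsupp_carrier[OF assms])
qed

text \<open>Recognizes a matrix by its entrywise image; finiteness of the support is recovered
  through injectivity of \<open>phi\<close>.\<close>

lemma psiI:
  fixes M :: "'k::field ncpoly set imat"
  assumes M: "\<And>i j. M i j \<in> carrier (Sm m)" and X: "X \<in> Fin1 (SS m)" and e: "\<And>i j. phi (M i j) = ent X i j"
  shows "fsupp (Sm m) M \<and> psi M = X"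
proof -
  obtain n where n: "\<forall>i j. n \<le> i \<or> n \<le> j \<longrightarrow> ent (X - 1) i j = 0"
    using X unfolding Fin1_def fin_def by blast
  interpret ring "Sm m :: 'k ncpoly set ring" by (rule ring_Sm)
  have "M i j = idm (Sm m) i j" if "n \<le> i \<or> n \<le> j" for i j
  proof (rule phi_eqI[OF M])
    show "idm (Sm m) i j \<in> carrier (Sm m :: 'k ncpoly set ring)" by (simp add: idm_def)
    have "ent (X - 1) i j = 0" using n that by blast
    then show "phi (M i j) = phi (idm (Sm m) i j)" by (simp add: e phi_idm)
  qed
  then have f: "fsupp (Sm m) M" unfolding fsupp_iff using M by blast
  moreover have "psi M = X" by (rule cfm_eqI) (simp add: ent_psi[OF f] e)
  ultimately show ?thesis by simp
qed

lemma psi_inj: 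
  assumes "fsupp (Sm m) A" "fsupp (Sm m) B" "psi A = psi B" shows "A = B"
proof (intro ext)
  fix i j
  show "A i j = B i j"
    using assms by (intro phi_eqI[of _ m]) (auto simp: fsupp_carrier simp flip: ent_psi)
qed

lemma psi_surj:
  assumes X: "X \<in> Fin1 (SS m)"
  obtains A where "fsupp (Sm m) A" "psi A = X"
proof -
  define A where "A = (\<lambda>i j. inv_into (carrier (Sm m)) phi (ent X i j))"
  have *: "ent X i j \<in> phi ` carrier (Sm m)" for i j
    using X unfolding phi_image Fin1_def mat_over_def by blast
  have "fsupp (Sm m) A \<and> psi A = X"
    using * by (intro psiI X) (auto simp: A_def inv_into_into f_inv_into_f)
  then show thesis using that by blast
qed

lemma psi_idm: "fsupp (Sm m) (idm (Sm m :: 'k::field ncpoly set ring)) \<and> psi (idm (Sm m :: 'k::field ncpoly set ring)) = 1"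
proof -
  interpret ring "Sm m :: 'k ncpoly set ring" by (rule ring_Sm)
  show ?thesis by (rule psiI) (auto simp: phi_idm, simp add: idm_def)
qed

lemma psi_mmult:
  fixes A :: "'k::field ncpoly set imat"
  assumes A: "fsupp (Sm m) A" and B: "fsupp (Sm m) B"
  shows "fsupp (Sm m) (mmult (Sm m) A B) \<and> psi (mmult (Sm m) A B) = psi A * psi B"
proof -
  interpret ring "Sm m :: 'k ncpoly set ring" by (rule ring_Sm)
  note c = fsupp_carrier[OF A] fsupp_carrier[OF B]
  show ?thesis
  proof (rule psiI)
    show "psi A * psi B \<in> Fin1 (SS m)" using assms by (simp add: psi_Fin1)
    fix i j
    show "mmult (Sm m) A B i j \<in> carrier (Sm m)"
      unfolding mmult_def using c by (intro finsum_closed) auto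
    let ?J = "{k. A i k \<noteq> \<zero>\<^bsub>Sm m\<^esub> \<and> B k j \<noteq> \<zero>\<^bsub>Sm m\<^esub>}"
    obtain n where n: "\<forall>i j. n \<le> i \<or> n \<le> j \<longrightarrow> A i j = idm (Sm m) i j" using A fsupp_iff by blast
    have "?J \<subseteq> insert i {..<n}"
    proof
      fix k assume "k \<in> ?J"
      then show "k \<in> insert i {..<n}" using n[rule_format, of i k] by (cases "k < n") (auto simp: idm_def split: if_splits)
    qed
    then have fin: "finite ?J" by (rule finite_subset) simp
    have "phi (mmult (Sm m) A B i j) = (\<Sum>k\<in>?J. phi (A i k) * phi (B k j))"
      unfolding mmult_def using c fin by (subst phi_finsum) (auto simp: phi_mult)
    also have "\<dots> = ent (psi A * psi B) i j"
      using fin by (subst ent_times[of ?J]) (auto simp: ent_psi[OF A] ent_psi[OF B] phi_zero)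
    finally show "phi (mmult (Sm m) A B i j) = ent (psi A * psi B) i j" .
  qed
qed

lemma GLinf_iff: "A \<in> GLinf (Sm m) \<longleftrightarrow> fsupp (Sm m) A \<and> psi A \<in> GLm (SS m)"
proof
  assume "A \<in> GLinf (Sm m)"
  then obtain B where B: "fsupp (Sm m) A" "fsupp (Sm m) B" "mmult (Sm m) A B = idm (Sm m)" "mmult (Sm m) B A = idm (Sm m)"
    unfolding GLinf_def by blast
  then have "psi A * psi B = 1" "psi B * psi A = 1" by (metis psi_mmult psi_idm)+
  then show "fsupp (Sm m) A \<and> psi A \<in> GLm (SS m)" using B(1,2) psi_Fin1 by (blast intro: GLmI)
next
  assume A: "fsupp (Sm m) A \<and> psi A \<in> GLm (SS m)"
  then obtain X where X: "X \<in> GLm (SS m)" "psi A * X = 1" "X * psi A = 1" using GLmE by blast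
  obtain B where B: "fsupp (Sm m) B" "psi B = X" using psi_surj[OF GLm_Fin1[OF X(1)]] by blast
  have "mmult (Sm m) A B = idm (Sm m)"
    by (rule psi_inj[of m]) (use A B X in \<open>simp_all add: psi_mmult psi_idm\<close>)
  moreover have "mmult (Sm m) B A = idm (Sm m)"
    by (rule psi_inj[of m]) (use A B X in \<open>simp_all add: psi_mmult psi_idm\<close>)
  ultimately show "A \<in> GLinf (Sm m)" unfolding GLinf_def using A B by blast
qed

lemma GLgrp_simps [simp]: "carrier (GLgrp R) = GLinf R" "monoid.mult (GLgrp R) = mmult R" "monoid.one (GLgrp R) = idm R"
  by (simp_all add: GLgrp_def)

lemma group_GLgrp: "group (GLgrp (Sm m :: 'k::field ncpoly set ring))"
proof (rule groupI)
  fix A B C :: "'k ncpoly set imat"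
  assume A: "A \<in> carrier (GLgrp (Sm m))"
  show "\<one>\<^bsub>GLgrp (Sm m)\<^esub> \<otimes>\<^bsub>GLgrp (Sm m)\<^esub> A = A"
    by (rule psi_inj[of m]) (use A in \<open>simp_all add: GLinf_iff psi_mmult psi_idm\<close>)
  show "\<exists>B\<in>carrier (GLgrp (Sm m)). B \<otimes>\<^bsub>GLgrp (Sm m)\<^esub> A = \<one>\<^bsub>GLgrp (Sm m)\<^esub>"
    using A by (auto simp: GLinf_def)
  assume B: "B \<in> carrier (GLgrp (Sm m))"
  then show "A \<otimes>\<^bsub>GLgrp (Sm m)\<^esub> B \<in> carrier (GLgrp (Sm m))"
    using A psi_mmult[of m A B] by (simp add: GLinf_iff)
  assume C: "C \<in> carrier (GLgrp (Sm m))"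
  have f: "fsupp (Sm m) A" "fsupp (Sm m) B" "fsupp (Sm m) C" using A B C by (simp_all add: GLinf_iff)
  show "A \<otimes>\<^bsub>GLgrp (Sm m)\<^esub> B \<otimes>\<^bsub>GLgrp (Sm m)\<^esub> C = A \<otimes>\<^bsub>GLgrp (Sm m)\<^esub> (B \<otimes>\<^bsub>GLgrp (Sm m)\<^esub> C)"
    by (rule psi_inj[of m]) (use f in \<open>simp_all add: psi_mmult mult.assoc\<close>)
qed (simp add: GLinf_iff psi_idm)

lemma psi_elem:
  fixes a :: "'k::field ncpoly set"
  assumes "i \<noteq> j" "a \<in> carrier (Sm m)"
  shows "fsupp (Sm m) (elem (Sm m) i j a) \<and> psi (elem (Sm m) i j a) = 1 + ue i j (phi a)"
proof -
  interpret ring "Sm m :: 'k ncpoly set ring" by (rule ring_Sm)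
  show ?thesis
  proof (rule psiI)
    show "1 + ue i j (phi a) \<in> Fin1 (SS m)" using assms by (intro Fin1_add) (auto simp: phi_SS)
    fix p q
    show "elem (Sm m) i j a p q \<in> carrier (Sm m)" using assms by (simp add: elem_def idm_def)
    show "phi (elem (Sm m) i j a p q) = ent (1 + ue i j (phi a)) p q"
      using assms by (auto simp: elem_def phi_idm ent_one ue.rep_eq)
  qed
qed

lemma scS_props: "scS m c \<in> carrier (Sm m)" "phi (scS m c) = Poly_Mapping.single 0 c"
  by (simp_all add: scS_def toS_carrier phi_toS fcarrier_closed ev_fconst)

lemma single_SS: "Poly_Mapping.single 0 c \<in> SS m"
  using phi_SS[OF scS_props(1)] by (simp add: scS_props)

lemma psi_mu:
  fixes c :: "'k::field"
  shows "fsupp (Sm m) (mu m c) \<and> psi (mu m c) = mum (Poly_Mapping.single 0 c)"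
proof -
  interpret ring "Sm m :: 'k ncpoly set ring" by (rule ring_Sm)
  show ?thesis
  proof (rule psiI)
    show "mum (Poly_Mapping.single 0 c) \<in> Fin1 (SS m)" by (intro mum_Fin1) (auto simp: single_SS)
    fix p q
    show "mu m c p q \<in> carrier (Sm m)" by (simp add: mu_def idm_def scS_props)
    show "phi (mu m c p q) = ent (mum (Poly_Mapping.single 0 c)) p q"
      by (auto simp: mu_def phi_idm ent_one ent_mum scS_props)
  qed
qed

lemma elem_GLinf: "i \<noteq> j \<Longrightarrow> a \<in> carrier (Sm m) \<Longrightarrow> elem (Sm m) i j a \<in> GLinf (Sm m)"
  using psi_elem[of i j a m] by (simp add: GLinf_iff Em_GLm Em_gen phi_SS)

lemma mu_mult: "mmult (Sm m) (mu m c) (mu m d) = mu m (c * d)"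
proof (rule psi_inj[of m])
  show "psi (mmult (Sm m) (mu m c) (mu m d)) = psi (mu m (c * d))"
    by (simp add: psi_mmult psi_mu mult_single flip: mum_mult)
qed (simp_all add: psi_mmult psi_mu)

lemma mu_one: "mu m 1 = idm (Sm m)"
  by (rule psi_inj[of m]) (simp_all add: psi_mu psi_idm)

lemma mu_GLinf:
  assumes "c \<noteq> 0" shows "mu m c \<in> GLinf (Sm m)"
proof -
  have "mmult (Sm m) (mu m c) (mu m (inverse c)) = idm (Sm m)" "mmult (Sm m) (mu m (inverse c)) (mu m c) = idm (Sm m)"
    using assms by (simp_all add: mu_mult mu_one)
  then show ?thesis unfolding GLinf_def using psi_mu by blast
qed

lemma Einf_subset: "Einf (Sm m) \<subseteq> GLinf (Sm m :: 'k::field ncpoly set ring)"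
proof -
  interpret group "GLgrp (Sm m :: 'k ncpoly set ring)" by (rule group_GLgrp)
  show ?thesis unfolding Einf_def
    by (rule subset_trans[OF generate_incl]) (auto simp: elem_GLinf)
qed

lemma Em_lift:
  assumes "X \<in> Em (SS m :: 'k::field salg set)" shows "\<exists>e\<in>Einf (Sm m). psi e = X"
  using assms
proof induction
  case Em_one
  have "idm (Sm m) \<in> Einf (Sm m :: 'k ncpoly set ring)"
    unfolding Einf_def using generate.one[of "GLgrp (Sm m)"] by (simp only: GLgrp_simps)
  then show ?case using psi_idm by blast
next
  case (Em_step i j b X)
  then obtain e where e: "e \<in> Einf (Sm m)" "psi e = X" by blast
  have "b \<in> phi ` carrier (Sm m :: 'k ncpoly set ring)" using Em_step(2) by (simp only: phi_image)
  then obtain a where a: "a \<in> carrier (Sm m)" "phi a = b" by (elim imageE) simp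
  have "elem (Sm m) i j a \<in> Einf (Sm m)" unfolding Einf_def using a Em_step(1) by (intro generate.incl) blast
  then have "mmult (Sm m) (elem (Sm m) i j a) e \<in> Einf (Sm m)"
    using e(1) generate.eng[of _ "GLgrp (Sm m)"] unfolding Einf_def GLgrp_simps by blast
  moreover have "psi (mmult (Sm m) (elem (Sm m) i j a) e) = (1 + ue i j b) * X"
    using psi_mmult[of m "elem (Sm m) i j a" e] psi_elem[OF Em_step(1) a(1)] e(2) a(2)
      GLinf_iff[THEN iffD1, OF subsetD[OF Einf_subset e(1)]] by simp
  ultimately show ?case by blast
qed

lemma decomposition:
  assumes A: "A \<in> GLinf (Sm m :: 'k::field ncpoly set ring)"
  obtains c e where "c \<noteq> 0" "e \<in> Einf (Sm m)" "A = mmult (Sm m) (mu m c) e"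
proof -
  have S: "sring (SS m :: 'k salg set)" by simp
  have "Good kconsts (SS m :: 'k salg set)" by (rule Good_SW) auto
  then obtain c' e' where c': "c' \<in> kconsts" and e': "e' \<in> Em (SS m)" "psi A = e' * mum c'"
    using A unfolding Good_def eqE_def GLinf_iff by blast
  obtain c where c: "c \<noteq> 0" "c' = Poly_Mapping.single 0 c" using c' by (auto simp: kconsts_def)
  define d' :: "'k salg" where "d' = Poly_Mapping.single 0 (inverse c)"
  have cd: "mum c' * mum d' = 1" "mum d' * mum c' = 1"
    using c by (simp_all add: d'_def mult_single flip: mum_mult)
  \<comment> \<open>\<open>Good\<close> yields the diagonal factor on the right; normality of the
    elementary group lets it change sides.\<close>
  have "mum d' * e' * mum c' \<in> Em (SS m)"
    by (intro Em_conj[OF S] mum_Fin1 cd e') (auto simp: c d'_def single_SS)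
  then obtain e where e: "e \<in> Einf (Sm m)" "psi e = mum d' * e' * mum c'" using Em_lift by blast
  have fe: "fsupp (Sm m) e" using e(1) Einf_subset[of m] GLinf_iff by blast
  have "A = mmult (Sm m) (mu m c) e"
  proof (rule psi_inj[of m])
    show "psi A = psi (mmult (Sm m) (mu m c) e)"
      using psi_mmult[of m "mu m c" e] psi_mu[of m c] fe e(2) c(2) e'(2) cd
      by (simp flip: mult.assoc)
  qed (use A fe in \<open>auto simp: GLinf_iff psi_mmult psi_mu\<close>)
  then show thesis using that c(1) e(1) by blast
qed

text \<open>Left multiplication as a row operation is the form to which the determinant lemmas
  apply.\<close>

lemma mmult_elem:
  fixes B :: "'k::field ncpoly set imat"
  assumes B: "fsupp (Sm m) B" and a: "i \<noteq> j" "a \<in> carrier (Sm m)"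
  shows "mmult (Sm m) (elem (Sm m) i j a) B = B(i := \<lambda>q. B i q \<oplus>\<^bsub>Sm m\<^esub> a \<otimes>\<^bsub>Sm m\<^esub> B j q)"
proof (intro ext)
  fix p q
  interpret ring "Sm m :: 'k ncpoly set ring" by (rule ring_Sm)
  note E = psi_elem[OF a] and P = psi_mmult[OF psi_elem[OF a, THEN conjunct1] B]
  note c = fsupp_carrier[OF B]
  show "mmult (Sm m) (elem (Sm m) i j a) B p q = (B(i := \<lambda>q. B i q \<oplus>\<^bsub>Sm m\<^esub> a \<otimes>\<^bsub>Sm m\<^esub> B j q)) p q"
  proof (rule phi_eqI[of _ m])
    show "mmult (Sm m) (elem (Sm m) i j a) B p q \<in> carrier (Sm m)" using P fsupp_carrier by blast
    show "(B(i := \<lambda>q. B i q \<oplus>\<^bsub>Sm m\<^esub> a \<otimes>\<^bsub>Sm m\<^esub> B j q)) p q \<in> carrier (Sm m)" using c a by simp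
    have "phi (mmult (Sm m) (elem (Sm m) i j a) B p q) = ent ((1 + ue i j (phi a)) * psi B) p q"
      using ent_psi[OF P[THEN conjunct1]] P E by simp
    also have "\<dots> = phi ((B(i := \<lambda>q. B i q \<oplus>\<^bsub>Sm m\<^esub> a \<otimes>\<^bsub>Sm m\<^esub> B j q)) p q)"
      using c a by (simp add: distrib_right ent_psi[OF B] phi_add phi_mult)
    finally show "phi (mmult (Sm m) (elem (Sm m) i j a) B p q) = phi ((B(i := \<lambda>q. B i q \<oplus>\<^bsub>Sm m\<^esub> a \<otimes>\<^bsub>Sm m\<^esub> B j q)) p q)" .
  qed
qed

lemma mmult_mu:
  fixes c :: "'k::field"
  assumes B: "fsupp (Sm m) B"
  shows "mmult (Sm m) (mu m c) B = B(0 := \<lambda>q. scS m c \<otimes>\<^bsub>Sm m\<^esub> B 0 q)"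
proof (intro ext)
  fix p q
  interpret ring "Sm m :: 'k ncpoly set ring" by (rule ring_Sm)
  note P = psi_mmult[OF psi_mu[THEN conjunct1] B, of c]
  note b = fsupp_carrier[OF B]
  show "mmult (Sm m) (mu m c) B p q = (B(0 := \<lambda>q. scS m c \<otimes>\<^bsub>Sm m\<^esub> B 0 q)) p q"
  proof (rule phi_eqI[of _ m])
    show "mmult (Sm m) (mu m c) B p q \<in> carrier (Sm m)" using P fsupp_carrier by blast
    show "(B(0 := \<lambda>q. scS m c \<otimes>\<^bsub>Sm m\<^esub> B 0 q)) p q \<in> carrier (Sm m)" using b by (simp add: scS_props)
    have "phi (mmult (Sm m) (mu m c) B p q) = ent (mum (Poly_Mapping.single 0 c) * psi B) p q"
      using ent_psi[OF P[THEN conjunct1]] P psi_mu[of m c] by simp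
    also have "\<dots> = ent (mum (Poly_Mapping.single 0 c)) p p * ent (psi B) p q"
      by (rule ent_times_single) (simp add: ent_mum)
    also have "\<dots> = phi ((B(0 := \<lambda>q. scS m c \<otimes>\<^bsub>Sm m\<^esub> B 0 q)) p q)"
      using b by (simp add: ent_psi[OF B] ent_mum phi_mult scS_props)
    finally show "phi (mmult (Sm m) (mu m c) B p q) = phi ((B(0 := \<lambda>q. scS m c \<otimes>\<^bsub>Sm m\<^esub> B 0 q)) p q)" .
  qed
qed


section \<open>The commutative quotient and its constants\<close>

lemma toS_hom: "toS m \<in> ring_hom (FreeAlg m) (Sm m :: 'k::field ncpoly set ring)"
proof -
  have "(toS m :: 'k ncpoly \<Rightarrow> _) = (+>\<^bsub>FreeAlg m\<^esub>) (relideal m)" by (simp add: toS_def relideal_def fun_eq_iff)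
  then show ?thesis unfolding Sm_eq using ideal.rcos_ring_hom[OF ideal_relideal[of m]] by simp
qed

lemma xyS_carrier:
  assumes "i \<in> {1..m}"
  shows "xS m i \<in> carrier (Sm m :: 'k::field ncpoly set ring)" "yS m i \<in> carrier (Sm m :: 'k::field ncpoly set ring)"
  using assms by (simp_all add: xS_def yS_def toS_carrier gen_carrier)

lemma E00_carrier:
  assumes "i \<in> {1..m}" shows "E00 m i \<in> carrier (Sm m :: 'k::field ncpoly set ring)"
proof -
  interpret ring "Sm m :: 'k ncpoly set ring" by (rule ring_Sm)
  show ?thesis using assms unfolding E00_def by (intro minus_closed m_closed one_closed xyS_carrier)
qed

lemma ideal_am: "ideal (am m) (Sm m :: 'k::field ncpoly set ring)"
  unfolding am_def by (rule ring.genideal_ideal[OF ring_Sm]) (auto intro: E00_carrier)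

lemma E00_am: "i \<in> {1..m} \<Longrightarrow> E00 m i \<in> (am m :: 'k::field ncpoly set set)"
  unfolding am_def by (rule subsetD[OF ring.genideal_self[OF ring_Sm]]) (auto intro: E00_carrier)

lemma ring_Lm: "ring (Lm m :: 'k::field ncpoly set set ring)"
  unfolding Lm_def by (rule ideal.quotient_is_ring[OF ideal_am])

lemma toL_hom: "toL m \<in> ring_hom (Sm m) (Lm m :: 'k::field ncpoly set set ring)"
proof -
  have "toL m = (+>\<^bsub>Sm m\<^esub>) (am m :: 'k ncpoly set set)" by (simp add: toL_def fun_eq_iff)
  then show ?thesis unfolding Lm_def using ideal.rcos_ring_hom[OF ideal_am[of m]] by simp
qed

lemma toL_simps:
  fixes a b :: "'k::field ncpoly set"
  shows "a \<in> carrier (Sm m) \<Longrightarrow> toL m a \<in> carrier (Lm m)"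
    "a \<in> carrier (Sm m) \<Longrightarrow> b \<in> carrier (Sm m) \<Longrightarrow> toL m (a \<oplus>\<^bsub>Sm m\<^esub> b) = toL m a \<oplus>\<^bsub>Lm m\<^esub> toL m b"
    "a \<in> carrier (Sm m) \<Longrightarrow> b \<in> carrier (Sm m) \<Longrightarrow> toL m (a \<otimes>\<^bsub>Sm m\<^esub> b) = toL m a \<otimes>\<^bsub>Lm m\<^esub> toL m b"
    "toL m \<one>\<^bsub>Sm m\<^esub> = (\<one>\<^bsub>Lm m\<^esub> :: 'k ncpoly set set)" "toL m \<zero>\<^bsub>Sm m\<^esub> = (\<zero>\<^bsub>Lm m\<^esub> :: 'k ncpoly set set)"
proof -
  note r = ring_hom_closed[OF toL_hom[of m]] ring_hom_add[OF toL_hom[of m]] ring_hom_mult[OF toL_hom[of m]]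
  show "a \<in> carrier (Sm m) \<Longrightarrow> toL m a \<in> carrier (Lm m)"
    "a \<in> carrier (Sm m) \<Longrightarrow> b \<in> carrier (Sm m) \<Longrightarrow> toL m (a \<oplus>\<^bsub>Sm m\<^esub> b) = toL m a \<oplus>\<^bsub>Lm m\<^esub> toL m b"
    "a \<in> carrier (Sm m) \<Longrightarrow> b \<in> carrier (Sm m) \<Longrightarrow> toL m (a \<otimes>\<^bsub>Sm m\<^esub> b) = toL m a \<otimes>\<^bsub>Lm m\<^esub> toL m b"
    by (simp_all only: r)
  show "toL m \<one>\<^bsub>Sm m\<^esub> = (\<one>\<^bsub>Lm m\<^esub> :: 'k ncpoly set set)" by (rule ring_hom_one[OF toL_hom])
  show "toL m \<zero>\<^bsub>Sm m\<^esub> = (\<zero>\<^bsub>Lm m\<^esub> :: 'k ncpoly set set)" by (rule ring_hom_zero[OF toL_hom ring_Sm ring_Lm])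
qed

lemma toL_am: "a \<in> am m \<Longrightarrow> toL m a = (\<zero>\<^bsub>Lm m\<^esub> :: 'k::field ncpoly set set)"
proof -
  assume a: "a \<in> (am m :: 'k ncpoly set set)"
  interpret ring "Sm m :: 'k ncpoly set ring" by (rule ring_Sm)
  interpret I: ideal "am m" "Sm m :: 'k ncpoly set ring" by (rule ideal_am)
  show ?thesis using I.a_rcos_const[OF a] by (simp add: toL_def Lm_def FactRing_def)
qed

definition frL :: "nat \<Rightarrow> 'k::field ncpoly \<Rightarrow> 'k ncpoly set set" where
  "frL m f = toL m (toS m f)"

lemma frL_simps:
  fixes f g :: "'k::field ncpoly"
  shows "f \<in> fcarrier m \<Longrightarrow> frL m f \<in> carrier (Lm m)"
    "f \<in> fcarrier m \<Longrightarrow> g \<in> fcarrier m \<Longrightarrow> frL m (\<lambda>w. f w + g w) = frL m f \<oplus>\<^bsub>Lm m\<^esub> frL m g"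
    "f \<in> fcarrier m \<Longrightarrow> g \<in> fcarrier m \<Longrightarrow> frL m (fmul f g) = frL m f \<otimes>\<^bsub>Lm m\<^esub> frL m g"
    "frL m (fconst 1) = (\<one>\<^bsub>Lm m\<^esub> :: 'k ncpoly set set)" "frL m (\<lambda>_. 0) = (\<zero>\<^bsub>Lm m\<^esub> :: 'k ncpoly set set)"
proof -
  have h: "frL m \<in> ring_hom (FreeAlg m) (Lm m :: 'k ncpoly set set ring)"
    using ring_hom_trans[OF toS_hom toL_hom] by (simp add: frL_def[abs_def] comp_def)
  note r = ring_hom_closed[OF h] ring_hom_add[OF h] ring_hom_mult[OF h] ring_hom_one[OF h] ring_hom_zero[OF h ring_FreeAlg ring_Lm]
  show "f \<in> fcarrier m \<Longrightarrow> frL m f \<in> carrier (Lm m)"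
    "f \<in> fcarrier m \<Longrightarrow> g \<in> fcarrier m \<Longrightarrow> frL m (\<lambda>w. f w + g w) = frL m f \<oplus>\<^bsub>Lm m\<^esub> frL m g"
    "f \<in> fcarrier m \<Longrightarrow> g \<in> fcarrier m \<Longrightarrow> frL m (fmul f g) = frL m f \<otimes>\<^bsub>Lm m\<^esub> frL m g"
    "frL m (fconst 1) = (\<one>\<^bsub>Lm m\<^esub> :: 'k ncpoly set set)" "frL m (\<lambda>_. 0) = (\<zero>\<^bsub>Lm m\<^esub> :: 'k ncpoly set set)"
    using r by (simp_all only: FreeAlg_simps)
qed

lemma frL_surj:
  assumes "z \<in> carrier (Lm m :: 'k::field ncpoly set set ring)"
  obtains f where "f \<in> fcarrier m" "z = frL m f"
proof -
  obtain s where s: "s \<in> carrier (Sm m)" "z = toL m s"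
    using assms by (auto simp: Lm_def FactRing_def A_RCOSETS_def' toL_def)
  obtain f where "f \<in> fcarrier m" "s = toS m f"
    using s(1) by (auto simp: Sm_def FactRing_def A_RCOSETS_def' toS_def)
  then show thesis using that s by (simp add: frL_def)
qed

text \<open>The elements commuting with z form a subring, and constants are central already in the
  free algebra, so the generators decide.\<close>

lemma frL_commute:
  assumes z: "z \<in> carrier (Lm m :: 'k::field ncpoly set set ring)"
    and gen: "\<And>l. l \<in> {1..m} \<times> UNIV \<Longrightarrow> z \<otimes>\<^bsub>Lm m\<^esub> frL m (gen l) = frL m (gen l) \<otimes>\<^bsub>Lm m\<^esub> z"
    and f: "f \<in> fcarrier m"
  shows "z \<otimes>\<^bsub>Lm m\<^esub> frL m f = frL m f \<otimes>\<^bsub>Lm m\<^esub> z"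
proof -
  interpret ring "Lm m :: 'k ncpoly set set ring" by (rule ring_Lm)
  have mul: "z \<otimes>\<^bsub>Lm m\<^esub> (a \<otimes>\<^bsub>Lm m\<^esub> b) = (a \<otimes>\<^bsub>Lm m\<^esub> b) \<otimes>\<^bsub>Lm m\<^esub> z"
    if "a \<in> carrier (Lm m)" "b \<in> carrier (Lm m)" "z \<otimes>\<^bsub>Lm m\<^esub> a = a \<otimes>\<^bsub>Lm m\<^esub> z" "z \<otimes>\<^bsub>Lm m\<^esub> b = b \<otimes>\<^bsub>Lm m\<^esub> z" for a b
    using that z by (metis m_assoc)
  have word: "z \<otimes>\<^bsub>Lm m\<^esub> frL m (wd w) = frL m (wd w) \<otimes>\<^bsub>Lm m\<^esub> z" if "set w \<subseteq> {1..m} \<times> UNIV" for w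
    using that
  proof (induction w)
    case Nil
    then show ?case using z by (simp add: wd_gen frL_simps)
  next
    case (Cons l w)
    have l: "gen l \<in> (fcarrier m :: 'k ncpoly set)" using Cons.prems by (cases l) (auto intro: gen_carrier)
    have w: "wd w \<in> (fcarrier m :: 'k ncpoly set)" using Cons.prems by (intro wd_carrier) auto
    have "frL m (wd (l # w)) = frL m (gen l) \<otimes>\<^bsub>Lm m\<^esub> (frL m (wd w) :: 'k ncpoly set set)"
      using wd_fmul[where 'k='k, of "[l]" w] frL_simps(3)[OF l w] by (simp add: wd_gen)
    moreover have "l \<in> {1..m} \<times> UNIV" "set w \<subseteq> {1..m} \<times> UNIV" using Cons.prems by auto
    ultimately show ?case using mul[OF frL_simps(1)[OF l] frL_simps(1)[OF w]] gen Cons.IH by simp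
  qed
  have const: "z \<otimes>\<^bsub>Lm m\<^esub> frL m (fconst c) = frL m (fconst c) \<otimes>\<^bsub>Lm m\<^esub> z" for c
  proof -
    obtain g where g: "g \<in> fcarrier m" "z = frL m g" using frL_surj[OF z] .
    have "fmul g (fconst c) = fmul (fconst c) g" by (simp add: fmul_const mult.commute)
    then show ?thesis using g by (metis frL_simps(3) fcarrier_closed(2))
  qed
  show ?thesis using f
  proof (induction rule: fcarrier_induct)
    case zero
    then show ?case using z by (simp add: frL_simps)
  next
    case (add f g)
    then show ?case using z by (simp add: frL_simps l_distr r_distr)
  next
    case (word w c)
    have w: "wd w \<in> (fcarrier m :: 'k ncpoly set)" using word by (rule wd_carrier)
    show ?case unfolding frL_simps(3)[OF fcarrier_closed(2) w]
      by (intro mul frL_simps w fcarrier_closed const \<open>set w \<subseteq> _ \<Longrightarrow> _\<close> word)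
  qed
qed

text \<open>The relations handle different indices. For x_i and y_i the product in the other order
  also becomes 1, because \<open>E00\<close> vanishes in the quotient. Identities in
  \<open>Sm m\<close> are checked through \<open>ev\<close>.\<close>

lemma frL_letters_commute:
  assumes "l \<in> {1..m} \<times> UNIV" "l' \<in> {1..m} \<times> UNIV"
  shows "frL m (gen l) \<otimes>\<^bsub>Lm m\<^esub> frL m (gen l') = frL m (gen l') \<otimes>\<^bsub>Lm m\<^esub> (frL m (gen l) :: 'k::field ncpoly set set)"
proof -
  obtain i b j b' where l: "l = (i, b)" "l' = (j, b')" "i \<in> {1..m}" "j \<in> {1..m}" using assms by auto
  have g: "gen l \<in> (fcarrier m :: 'k ncpoly set)" "gen l' \<in> (fcarrier m :: 'k ncpoly set)"
    using l by (auto intro: gen_carrier)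
  consider "i \<noteq> j" | "l = l'" | "i = j" "b \<noteq> b'" using l by blast
  then show ?thesis
  proof cases
    case 1
    have "fmul (gen l) (gen l') = (wd [l, l'] :: 'k ncpoly)" "fmul (gen l') (gen l) = (wd [l', l] :: 'k ncpoly)"
      using wd_fmul[where 'k='k, of "[l]" "[l']"] wd_fmul[where 'k='k, of "[l']" "[l]"] by (simp_all add: wd_gen)
    moreover have "wk [l, l'] = wk [l', l]"
      using 1 l by (cases b; cases b') (auto simp: bat_def fun_eq_iff)
    ultimately have "ev (fmul (gen l) (gen l')) = (ev (fmul (gen l') (gen l)) :: 'k salg)"
      by (simp only: ev_wd)
    then have "toS m (fmul (gen l) (gen l')) = (toS m (fmul (gen l') (gen l)) :: 'k ncpoly set)"
      using g by (intro phi_eqI[of _ m]) (simp_all add: toS_carrier phi_toS fcarrier_closed)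
    then show ?thesis using g by (metis frL_def frL_simps(3))
  next
    case 3
    interpret ring "Lm m :: 'k ncpoly set set ring" by (rule ring_Lm)
    interpret S: ring "Sm m :: 'k ncpoly set ring" by (rule ring_Sm)
    let ?x = "gen (i, True) :: 'k ncpoly" and ?y = "gen (i, False) :: 'k ncpoly"
    note xy = gen_carrier[OF l(3), where 'a='k]
    note c = xyS_carrier[OF l(3), where 'k='k]
    have "fmul ?y ?x = wd [(i, False), (i, True)]"
      using wd_fmul[where 'k='k, of "[(i, False)]" "[(i, True)]"] by (simp add: wd_gen)
    moreover have "wk [(i, False), (i, True)] = 0"
      by (auto simp: bat_def fun_eq_iff plus_bicyc_def zero_bicyc_def)
    ultimately have "ev (fmul ?y ?x) = ev (fconst 1)" by (simp only: ev_wd ev_fconst)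
    then have "toS m (fmul ?y ?x) = toS m (fconst 1)"
      using xy by (intro phi_eqI[of _ m]) (simp_all add: toS_carrier phi_toS fcarrier_closed)
    then have yx: "frL m ?y \<otimes>\<^bsub>Lm m\<^esub> frL m ?x = \<one>\<^bsub>Lm m\<^esub>"
      using xy by (metis frL_def frL_simps(3,4))
    have "E00 m i \<oplus>\<^bsub>Sm m\<^esub> (xS m i \<otimes>\<^bsub>Sm m\<^esub> yS m i) = (\<one>\<^bsub>Sm m\<^esub> :: 'k ncpoly set)"
      using c unfolding E00_def by (simp add: S.minus_eq S.a_assoc S.l_neg)
    then have "toL m (E00 m i) \<oplus>\<^bsub>Lm m\<^esub> toL m (xS m i \<otimes>\<^bsub>Sm m\<^esub> yS m i) = (\<one>\<^bsub>Lm m\<^esub> :: 'k ncpoly set set)"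
      using c E00_carrier[OF l(3), where 'k='k] by (metis S.m_closed toL_simps(2,4))
    then have "frL m ?x \<otimes>\<^bsub>Lm m\<^esub> frL m ?y = \<one>\<^bsub>Lm m\<^esub>"
      using c toL_am[OF E00_am[OF l(3), where 'k='k]] by (simp add: toL_simps frL_def xS_def yS_def)
    then show ?thesis using yx 3 l by (cases b; cases b') auto
  qed simp
qed

text \<open>The centralizer argument is used twice: first for a generator against everything, then
  for an arbitrary element against the generators.\<close>

lemma cring_Lm: "cring (Lm m :: 'k::field ncpoly set set ring)"
proof (rule cring.intro[OF ring_Lm])
  interpret ring "Lm m :: 'k ncpoly set set ring" by (rule ring_Lm)
  show "comm_monoid (Lm m :: 'k ncpoly set set ring)"
  proof (rule monoid_comm_monoidI)
    fix y z assume y: "y \<in> carrier (Lm m :: 'k ncpoly set set ring)" and z: "z \<in> carrier (Lm m :: 'k ncpoly set set ring)"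
    obtain f where f: "f \<in> fcarrier m" "y = frL m f" using frL_surj[OF y] .
    obtain g where g: "g \<in> fcarrier m" "z = frL m g" using frL_surj[OF z] .
    have gen: "gen l \<in> (fcarrier m :: 'k ncpoly set)" if "l \<in> {1..m} \<times> UNIV" for l
      using that by (cases l) (auto intro: gen_carrier)
    have "y \<otimes>\<^bsub>Lm m\<^esub> frL m (gen l) = frL m (gen l) \<otimes>\<^bsub>Lm m\<^esub> y" if "l \<in> {1..m} \<times> UNIV" for l
      using frL_commute[OF frL_simps(1)[OF gen[OF that]] frL_letters_commute[OF that] f(1)] f(2) by simp
    then show "y \<otimes>\<^bsub>Lm m\<^esub> z = z \<otimes>\<^bsub>Lm m\<^esub> y"
      using frL_commute[OF y _ g(1)] g(2) by simp
  qed
qed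

text \<open>The augmentation sending every monoid element to 1 kills each 1 - x_i y_i, hence
  \<open>am\<close>, and is the identity on constants.\<close>

lemma inj_scL: "inj (scL m :: 'k::field \<Rightarrow> _)"
proof (rule injI)
  fix c d :: 'k assume eq: "scL m c = scL m d"
  interpret S: ring "Sm m :: 'k ncpoly set ring" by (rule ring_Sm)
  define h :: "'k salg \<Rightarrow> 'k" where "h = lin (\<lambda>_. 1) (\<lambda>c. c)"
  have h: "shom h UNIV" and hs: "h (Poly_Mapping.single k a) = a" for k a
    unfolding h_def using shom_lin[of "\<lambda>c::'k. c" "\<lambda>_::nat \<Rightarrow> bicyc. 1"] by simp_all
  have "h \<circ> phi \<in> ring_hom (Sm m :: 'k ncpoly set ring) typering"
    using h by (intro ring_hom_memI) (auto simp: shom_def phi_mult phi_add phi_one)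
  then have H: "ring_hom_ring (Sm m :: 'k ncpoly set ring) typering (h \<circ> phi)"
    by (rule ring_hom_ringI2[OF ring_Sm ring_typering])
  have ker: "a_kernel (Sm m :: 'k ncpoly set ring) typering (h \<circ> phi) = {s \<in> carrier (Sm m). h (phi s) = 0}"
    by (simp add: a_kernel_def')
  have h0: "h (p - q) = h p - h q" for p q
    using h unfolding shom_def by (metis UNIV_I add_diff_cancel diff_add_cancel)
  have "h (phi (E00 m i)) = 0" if i: "i \<in> {1..m}" for i
  proof -
    have "phi (xS m i) = (smono (wk [(i, True)]) :: 'k salg)" "phi (yS m i) = (smono (wk [(i, False)]) :: 'k salg)"
      unfolding xS_def yS_def phi_toS[OF gen_carrier[OF i]] by (rule ev_wd[of "[_]", unfolded wd_gen])+
    then have "phi (E00 m i) = 1 - smono (wk [(i, True)]) * (smono (wk [(i, False)]) :: 'k salg)"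
      unfolding E00_def using xyS_carrier[OF i, where 'k='k] by (simp add: phi_minus phi_mult phi_one)
    then show ?thesis using h by (simp add: h0 shom_def mult_single hs)
  qed
  then have "am m \<subseteq> a_kernel (Sm m :: 'k ncpoly set ring) typering (h \<circ> phi)"
    unfolding am_def by (intro S.genideal_minimal ring_hom_ring.kernel_is_ideal[OF H]) (auto simp: ker E00_carrier)
  moreover interpret I: ideal "am m" "Sm m :: 'k ncpoly set ring" by (rule ideal_am)
  have "scS m c \<in> am m +>\<^bsub>Sm m\<^esub> scS m c"
    by (rule I.a_rcos_self) (simp add: scS_props)
  then have "scS m c \<in> am m +>\<^bsub>Sm m\<^esub> scS m d" using eq by (simp add: scL_def toL_def)
  then obtain a where a: "a \<in> am m" "scS m c = a \<oplus>\<^bsub>Sm m\<^esub> scS m d" by (auto simp: a_r_coset_def')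
  have "Poly_Mapping.single 0 c = phi a + Poly_Mapping.single 0 d"
    using arg_cong[OF a(2), of phi] a(1) by (simp add: scS_props phi_add I.Icarr)
  then have "h (Poly_Mapping.single 0 c) = h (phi a) + h (Poly_Mapping.single 0 d)"
    using h by (simp add: shom_def)
  moreover have "h (phi a) = 0" using calculation a(1) ker by blast
  ultimately show "c = d" by (simp add: hs)
qed


section \<open>The determinant on decomposed matrices\<close>

lemma toL_matrix:
  assumes B: "fsupp (Sm m) B"
  shows "toL m (B i j) \<in> carrier (Lm m)" "\<exists>n. cring.bound (Lm m) n (\<lambda>i j. toL m (B i j))"
proof -
  show "toL m (B i j) \<in> carrier (Lm m)" by (intro toL_simps fsupp_carrier[OF B])
  obtain n where "\<forall>i j. n \<le> i \<or> n \<le> j \<longrightarrow> B i j = idm (Sm m) i j" using B fsupp_iff by blast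
  then have "cring.bound (Lm m) n (\<lambda>i j. toL m (B i j))"
    unfolding cring.bound_def[OF cring_Lm] by (auto simp: idm_def toL_simps)
  then show "\<exists>n. cring.bound (Lm m) n (\<lambda>i j. toL m (B i j))" ..
qed

lemma detbar_elem:
  fixes B :: "'k::field ncpoly set imat"
  assumes B: "fsupp (Sm m) B" and a: "i \<noteq> j" "a \<in> carrier (Sm m)"
  shows "detbar m (mmult (Sm m) (elem (Sm m) i j a) B) = detbar m B"
proof -
  interpret S: ring "Sm m :: 'k ncpoly set ring" by (rule ring_Sm)
  define M where "M = (\<lambda>i j. toL m (B i j))"
  obtain n where n: "cring.bound (Lm m) n M" using toL_matrix(2)[OF B] unfolding M_def ..
  have M: "M i j \<in> carrier (Lm m)" for i j unfolding M_def by (rule toL_matrix(1)[OF B])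
  have "(\<lambda>p q. toL m (mmult (Sm m) (elem (Sm m) i j a) B p q)) = M(i := \<lambda>q. M i q \<oplus>\<^bsub>Lm m\<^esub> toL m a \<otimes>\<^bsub>Lm m\<^esub> M j q)"
    unfolding mmult_elem[OF B a] M_def using a fsupp_carrier[OF B] by (intro ext) (simp add: toL_simps)
  then show ?thesis
    unfolding detbar_def
    using cring.detinf_add_row[OF cring_Lm M toL_simps(1)[OF a(2)] a(1) n] by (simp add: M_def)
qed

lemma detbar_mu:
  fixes B :: "'k::field ncpoly set imat"
  assumes B: "fsupp (Sm m) B"
  shows "detbar m (mmult (Sm m) (mu m c) B) = scL m c \<otimes>\<^bsub>Lm m\<^esub> detbar m B"
proof -
  define M where "M = (\<lambda>i j. toL m (B i j))"
  obtain n where n: "cring.bound (Lm m) n M" using toL_matrix(2)[OF B] unfolding M_def ..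
  have M: "M i j \<in> carrier (Lm m)" for i j unfolding M_def by (rule toL_matrix(1)[OF B])
  have "(\<lambda>p q. toL m (mmult (Sm m) (mu m c) B p q)) = M(0 := \<lambda>q. scL m c \<otimes>\<^bsub>Lm m\<^esub> M 0 q)"
    unfolding mmult_mu[OF B] M_def using fsupp_carrier[OF B] by (intro ext) (simp add: toL_simps scL_def scS_props)
  moreover have "scL m c \<in> carrier (Lm m)" unfolding scL_def by (intro toL_simps scS_props)
  ultimately show ?thesis
    unfolding detbar_def
    using cring.detinf_scale_row[OF cring_Lm M _ n, of "scL m c"] by (simp add: M_def)
qed

lemma detbar_idm: "detbar m (idm (Sm m :: 'k::field ncpoly set ring)) = \<one>\<^bsub>Lm m\<^esub>"
proof -
  have "(\<lambda>i j. toL m (idm (Sm m :: 'k ncpoly set ring) i j)) = idm (Lm m)"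
    by (intro ext) (simp add: idm_def toL_simps)
  then show ?thesis unfolding detbar_def using cring.detinf_idm[OF cring_Lm] by simp
qed

lemma detbar_Einf:
  assumes "e \<in> Einf (Sm m :: 'k::field ncpoly set ring)" "B \<in> GLinf (Sm m)"
  shows "detbar m (mmult (Sm m) e B) = detbar m B"
proof -
  interpret G: group "GLgrp (Sm m :: 'k ncpoly set ring)" by (rule group_GLgrp)
  let ?H = "{elem (Sm m) i j a | i j a. i \<noteq> j \<and> a \<in> carrier (Sm m :: 'k ncpoly set ring)}"
  have H: "detbar m (mmult (Sm m) h B) = detbar m B" if "h \<in> ?H" "B \<in> GLinf (Sm m)" for h B
  proof -
    obtain i j a where "h = elem (Sm m) i j a" "i \<noteq> j" "a \<in> carrier (Sm m)" using \<open>h \<in> ?H\<close> by blast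
    then show ?thesis using detbar_elem[of m B i j a] \<open>B \<in> GLinf (Sm m)\<close> by (simp add: GLinf_iff)
  qed
  have sub: "h \<in> GLinf (Sm m)" if "h \<in> generate (GLgrp (Sm m)) ?H" for h
    using that Einf_subset unfolding Einf_def by blast
  have HG: "h \<in> GLinf (Sm m)" if "h \<in> ?H" for h using generate.incl[OF that] by (rule sub)
  have "e \<in> generate (GLgrp (Sm m)) ?H" using assms(1) unfolding Einf_def .
  then show ?thesis using assms(2)
  proof (induction arbitrary: B rule: generate.induct)
    case one
    then show ?case using G.l_one[of B] by simp
  next
    case (incl h)
    then show ?case by (rule H)
  next
    case (inv h)
    \<comment> \<open>\<open>h\<close> times this matrix is \<open>B\<close>, so invariance under
      \<open>h\<close> gives invariance under its inverse.\<close>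
    let ?B = "mmult (Sm m) (inv\<^bsub>GLgrp (Sm m)\<^esub> h) B"
    have h: "h \<in> carrier (GLgrp (Sm m))" using HG[OF inv(1)] by simp
    have B: "B \<in> carrier (GLgrp (Sm m))" using inv by simp
    have "?B \<in> GLinf (Sm m)" using G.m_closed[OF G.inv_closed[OF h] B] by simp
    moreover have "mmult (Sm m) h ?B = B" using G.inv_solve_left[of "?B" h B] h B G.m_closed[OF G.inv_closed[OF h] B] by simp
    ultimately show ?case using H[OF inv(1), of ?B] by simp
  next
    case (eng h1 h2)
    have c: "h1 \<in> GLinf (Sm m)" "h2 \<in> GLinf (Sm m)" using eng(1,2) sub by blast+
    have "mmult (Sm m) (mmult (Sm m) h1 h2) B = mmult (Sm m) h1 (mmult (Sm m) h2 B)"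
      using G.m_assoc[of h1 h2 B] c eng.prems by simp
    moreover have "mmult (Sm m) h2 B \<in> GLinf (Sm m)" using G.m_closed[of h2 B] c eng.prems by simp
    ultimately show ?case using eng.IH eng.prems by simp
  qed
qed

lemma scL_simps:
  fixes c :: "'k::field"
  shows "scL m c \<in> carrier (Lm m)" "scL m c \<otimes>\<^bsub>Lm m\<^esub> scL m d = scL m (c * d)" "scL m (1 :: 'k) = \<one>\<^bsub>Lm m\<^esub>"
proof -
  have e: "scL m = (\<lambda>c::'k. frL m (fconst c))" by (simp add: scL_def scS_def frL_def fun_eq_iff)
  have "fmul (fconst c) (fconst d) = fconst (c * d)" unfolding fmul_const by (simp add: fconst_def fun_eq_iff)
  then show "scL m c \<otimes>\<^bsub>Lm m\<^esub> scL m d = scL m (c * d)"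
    unfolding e using frL_simps(3)[OF fcarrier_closed(2) fcarrier_closed(2), of m c d] by simp
  show "scL m c \<in> carrier (Lm m)" "scL m (1 :: 'k) = \<one>\<^bsub>Lm m\<^esub>"
    unfolding e by (intro frL_simps fcarrier_closed)+
qed

lemma detbar_decomposed:
  fixes c :: "'k::field"
  assumes "e \<in> Einf (Sm m)" shows "detbar m (mmult (Sm m) (mu m c) e) = scL m c"
proof -
  interpret G: group "GLgrp (Sm m :: 'k ncpoly set ring)" by (rule group_GLgrp)
  interpret L: ring "Lm m :: 'k ncpoly set set ring" by (rule ring_Lm)
  have e: "e \<in> GLinf (Sm m)" using assms Einf_subset by blast
  have "idm (Sm m) \<in> GLinf (Sm m :: 'k ncpoly set ring)" using G.one_closed by simp
  then have "detbar m e = \<one>\<^bsub>Lm m\<^esub>"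
    using detbar_Einf[OF assms, of "idm (Sm m)"] G.r_one[of e] e detbar_idm by simp
  then show ?thesis using e by (simp add: GLinf_iff detbar_mu scL_simps)
qed

text \<open>Read off from the decomposition of a: \<open>detbar\<close> ignores the elementary
  factor, and the diagonal factor multiplies one row by a constant.\<close>

lemma detbar_mult:
  assumes a: "a \<in> GLinf (Sm m :: 'k::field ncpoly set ring)" and b: "b \<in> GLinf (Sm m)"
  shows "detbar m (mmult (Sm m) a b) = detbar m a \<otimes>\<^bsub>Lm m\<^esub> detbar m b"
proof -
  interpret G: group "GLgrp (Sm m :: 'k ncpoly set ring)" by (rule group_GLgrp)
  obtain c e where ce: "c \<noteq> 0" "e \<in> Einf (Sm m)" "a = mmult (Sm m) (mu m c) e" using decomposition[OF a] .
  have e: "e \<in> GLinf (Sm m)" using ce Einf_subset by blast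
  have "mmult (Sm m) a b = mmult (Sm m) (mu m c) (mmult (Sm m) e b)"
    unfolding ce(3) using G.m_assoc[of "mu m c" e b] e b mu_GLinf[OF ce(1), of m] by simp
  moreover have "mmult (Sm m) e b \<in> GLinf (Sm m)" using G.m_closed[of e b] e b by simp
  ultimately have "detbar m (mmult (Sm m) a b) = scL m c \<otimes>\<^bsub>Lm m\<^esub> detbar m b"
    by (simp add: GLinf_iff detbar_mu detbar_Einf[OF ce(2) b])
  then show ?thesis unfolding ce(3) by (simp add: detbar_decomposed[OF ce(2)])
qed

lemma scL_Units: "c \<noteq> (0 :: 'k::field) \<Longrightarrow> scL m c \<in> Units (Lm m)"
  unfolding Units_def using scL_simps(2)[of m c "inverse c"] scL_simps(2)[of m "inverse c" c]
  by (auto simp: scL_simps intro!: bexI[of _ "scL m (inverse c)"])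

lemma group_Kstar: "group (Kstar :: 'k::field monoid)"
  by (rule groupI) (auto simp: Kstar_def, metis left_inverse nonzero_imp_inverse_nonzero)

text \<open>All parts follow from three facts: every element is some \<open>mu m c\<close> times an
  elementary matrix, \<open>detbar\<close> of such a product is \<open>scL m c\<close>, and
  \<open>scL\<close> is injective.\<close>

lemma GL_structure:
  fixes m :: nat
  defines "S \<equiv> (Sm m :: 'k::field ncpoly set ring)" and "L \<equiv> (Lm m :: 'k ncpoly set set ring)"
  defines "G \<equiv> GLgrp S"
  shows "detbar m \<in> hom G (units_of L)"
    and "inj_on (scL m :: 'k \<Rightarrow> _) {c. c \<noteq> 0}"
    and "detbar m ` GLinf S = scL m ` {c :: 'k. c \<noteq> 0}"
    and "Einf S = kernel G (units_of L) (detbar m)"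
    and "subgroup (UK m) G"
    and "Einf S \<lhd> G"
    and "UK m \<inter> Einf S = {idm S}"
    and "UK m <#>\<^bsub>G\<^esub> Einf S = GLinf S"
    and "\<forall>a\<in>GLinf S. (\<exists>!(c, e). c \<noteq> (0::'k) \<and> e \<in> Einf S \<and> a = mmult S (mu m c) e)
     \<and> (\<forall>c::'k. c \<noteq> 0 \<and> detbar m a = scL m c \<longrightarrow> mu m c \<in> GLinf S
            \<and> inv\<^bsub>G\<^esub> (mu m c) \<otimes>\<^bsub>G\<^esub> a \<in> Einf S \<and> a = mmult S (mu m c) (inv\<^bsub>G\<^esub> (mu m c) \<otimes>\<^bsub>G\<^esub> a))"
    and "K1 S \<cong> (Kstar :: 'k monoid)"
proof -
  have G_simps [simp]: "carrier G = GLinf S" "monoid.mult G = mmult S" "monoid.one G = idm S"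
    by (simp_all add: G_def)
  interpret G: group G unfolding G_def S_def by (rule group_GLgrp)
  interpret L: cring L unfolding L_def by (rule cring_Lm)
  note decomp = decomposition[of _ m, where 'k='k, folded S_def]
  note val = detbar_decomposed[of _ m, where 'k='k, folded S_def]
  have sub: "Einf S \<subseteq> GLinf S" unfolding S_def by (rule Einf_subset)
  have mu: "mu m c \<in> GLinf S" if "c \<noteq> (0::'k)" for c unfolding S_def using that by (rule mu_GLinf)
  have prod: "mmult S (mu m c) e \<in> GLinf S" if "c \<noteq> (0::'k)" "e \<in> Einf S" for c e
    using G.m_closed[of "mu m c" e] mu[OF that(1)] that(2) sub by auto
  have inj: "scL m c = scL m d \<longleftrightarrow> c = d" for c d :: 'k using inj_scL by (rule inj_eq)
  have unit: "detbar m a \<in> Units L" if a: "a \<in> GLinf S" for a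
  proof -
    obtain c e where "c \<noteq> 0" "e \<in> Einf S" "a = mmult S (mu m c) e" using decomp[OF a] .
    then show ?thesis unfolding L_def by (simp add: val scL_Units)
  qed
  have hom: "detbar m \<in> hom G (units_of L)"
    by (rule homI) (simp_all add: units_of_def unit, simp add: S_def L_def detbar_mult)
  have hom1: "detbar m ` GLinf S = scL m ` {c :: 'k. c \<noteq> 0}"
  proof
    show "detbar m ` GLinf S \<subseteq> scL m ` {c :: 'k. c \<noteq> 0}"
      using decomp val by (smt (verit) image_subsetI image_eqI mem_Collect_eq)
    show "scL m ` {c :: 'k. c \<noteq> 0} \<subseteq> detbar m ` GLinf S"
    proof
      fix z assume "z \<in> scL m ` {c :: 'k. c \<noteq> 0}"
      then obtain c where c: "c \<noteq> 0" "z = scL m (c :: 'k)" by blast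
      have "idm S \<in> Einf S" unfolding Einf_def G_def[symmetric] using generate.one[of G] by simp
      then have "z = detbar m (mmult S (mu m c) (idm S))" "mmult S (mu m c) (idm S) \<in> GLinf S"
        using val prod c by simp_all
      then show "z \<in> detbar m ` GLinf S" by blast
    qed
  qed
  have one: "monoid.one (units_of L) = scL m (1 :: 'k)" by (simp add: units_of_def L_def scL_simps)
  have Eone: "mmult S (mu m 1) e = e" if "e \<in> Einf S" for e
    using that sub G.l_one[of e] by (auto simp: mu_one S_def)
  have ker: "Einf S = kernel G (units_of L) (detbar m)"
  proof
    show "Einf S \<subseteq> kernel G (units_of L) (detbar m)"
      using sub val[of _ 1] Eone by (auto simp: kernel_def one)
    show "kernel G (units_of L) (detbar m) \<subseteq> Einf S"
    proof
      fix a assume "a \<in> kernel G (units_of L) (detbar m)"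
      then have a: "a \<in> GLinf S" "detbar m a = scL m (1 :: 'k)" by (simp_all add: kernel_def one)
      obtain c e where ce: "c \<noteq> 0" "e \<in> Einf S" "a = mmult S (mu m c) e" using decomp[OF a(1)] .
      then have "c = 1" using a(2) val inj by simp
      then show "a \<in> Einf S" using ce Eone by simp
    qed
  qed
  interpret U: group "units_of L" by (rule L.units_group)
  interpret h: group_hom G "units_of L" "detbar m" by unfold_locales (rule hom)
  have normal: "Einf S \<lhd> G" unfolding ker by (rule h.normal_kernel)
  have inv_mu: "inv\<^bsub>G\<^esub> (mu m c) = mu m (inverse c)" if "c \<noteq> (0::'k)" for c
    using that mu by (intro G.inv_equality) (auto simp: S_def mu_mult mu_one)
  have UK: "subgroup (UK m) G"
  proof (rule G.subgroupI)
    show "UK m \<subseteq> carrier G" using mu by (auto simp: UK_def)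
    show "UK m \<noteq> {}" by (auto simp: UK_def intro: exI[of _ 1])
    show "inv\<^bsub>G\<^esub> a \<in> UK m" if "a \<in> UK m" for a using that inv_mu by (auto simp: UK_def)
    show "a \<otimes>\<^bsub>G\<^esub> b \<in> UK m" if "a \<in> UK m" "b \<in> UK m" for a b
      using that by (auto simp: UK_def S_def mu_mult)
  qed
  have idE: "idm S \<in> Einf S" using G.one_closed normal[THEN normal_imp_subgroup, THEN subgroup.one_closed] by simp
  have detmu: "detbar m (mu m c) = scL m c" if "c \<noteq> (0::'k)" for c
    using val[OF idE, of c] G.r_one[of "mu m c"] mu[OF that] by simp
  have meet: "UK m \<inter> Einf S = {idm S}"
  proof
    show "UK m \<inter> Einf S \<subseteq> {idm S}"
    proof
      fix a assume a: "a \<in> UK m \<inter> Einf S"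
      then obtain c where c: "c \<noteq> 0" "a = mu m (c :: 'k)" by (auto simp: UK_def)
      have "detbar m a = scL m (1 :: 'k)" using a unfolding ker kernel_def one by simp
      then have "c = 1" using c detmu inj by simp
      then show "a \<in> {idm S}" using c by (simp add: mu_one S_def)
    qed
    show "{idm S} \<subseteq> UK m \<inter> Einf S" using idE mu_one[of m, where 'a='k] by (auto simp: UK_def S_def image_iff intro!: exI[of _ 1])
  qed
  have span: "UK m <#>\<^bsub>G\<^esub> Einf S = GLinf S"
  proof
    show "UK m <#>\<^bsub>G\<^esub> Einf S \<subseteq> GLinf S" using prod by (auto simp: set_mult_def UK_def)
    show "GLinf S \<subseteq> UK m <#>\<^bsub>G\<^esub> Einf S"
    proof
      fix a assume "a \<in> GLinf S"
      then obtain c e where "c \<noteq> 0" "e \<in> Einf S" "a = mmult S (mu m c) e" using decomp by blast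
      then show "a \<in> UK m <#>\<^bsub>G\<^esub> Einf S" by (auto simp: set_mult_def UK_def)
    qed
  qed
  have cancel: "inv\<^bsub>G\<^esub> (mu m c) \<otimes>\<^bsub>G\<^esub> mmult S (mu m c) e = e" if "c \<noteq> (0::'k)" "e \<in> Einf S" for c e
    using G.inv_solve_left'[of e "mu m c" "mmult S (mu m c) e"] mu[OF that(1)] that(2) sub prod[OF that] by auto
  have unique: "(\<exists>!(c, e). c \<noteq> (0::'k) \<and> e \<in> Einf S \<and> a = mmult S (mu m c) e)
     \<and> (\<forall>c::'k. c \<noteq> 0 \<and> detbar m a = scL m c \<longrightarrow> mu m c \<in> GLinf S
            \<and> inv\<^bsub>G\<^esub> (mu m c) \<otimes>\<^bsub>G\<^esub> a \<in> Einf S \<and> a = mmult S (mu m c) (inv\<^bsub>G\<^esub> (mu m c) \<otimes>\<^bsub>G\<^esub> a))"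
    if a: "a \<in> GLinf S" for a
  proof
    obtain c e where ce: "c \<noteq> 0" "e \<in> Einf S" "a = mmult S (mu m c) e" using decomp[OF a] .
    have inv_a: "inv\<^bsub>G\<^esub> (mu m c) \<otimes>\<^bsub>G\<^esub> a = e"
      using cancel[OF ce(1,2)] unfolding ce(3)[symmetric] .
    have same: "d = c \<and> f = e" if "d \<noteq> 0" "f \<in> Einf S" "a = mmult S (mu m d) f" for d f
    proof -
      have "d = c" using val[OF that(2), of d] val[OF ce(2), of c] that(3) ce(3) inj by simp
      moreover have "f = inv\<^bsub>G\<^esub> (mu m d) \<otimes>\<^bsub>G\<^esub> a"
        using cancel[OF that(1,2)] unfolding that(3)[symmetric] by (rule sym)
      ultimately show ?thesis using inv_a by blast
    qed
    show "\<exists>!(c, e). c \<noteq> (0::'k) \<and> e \<in> Einf S \<and> a = mmult S (mu m c) e"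
    proof (rule ex1I[of _ "(c, e)"])
      show "case (c, e) of (c, e) \<Rightarrow> c \<noteq> (0::'k) \<and> e \<in> Einf S \<and> a = mmult S (mu m c) e"
        unfolding prod.case using ce by blast
      fix p :: "'k \<times> 'k ncpoly set imat"
      assume p: "case p of (c, e) \<Rightarrow> c \<noteq> 0 \<and> e \<in> Einf S \<and> a = mmult S (mu m c) e"
      obtain d f where q: "p = (d, f)" by (cases p)
      show "p = (c, e)" using same[of d f] p unfolding q prod.case by blast
    qed
    show "\<forall>d::'k. d \<noteq> 0 \<and> detbar m a = scL m d \<longrightarrow> mu m d \<in> GLinf S
            \<and> inv\<^bsub>G\<^esub> (mu m d) \<otimes>\<^bsub>G\<^esub> a \<in> Einf S \<and> a = mmult S (mu m d) (inv\<^bsub>G\<^esub> (mu m d) \<otimes>\<^bsub>G\<^esub> a)"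
    proof (intro allI impI)
      fix d :: 'k assume d: "d \<noteq> 0 \<and> detbar m a = scL m d"
      then have "d = c" using val[OF ce(2), of c] ce(3) inj by simp
      then show "mu m d \<in> GLinf S \<and> inv\<^bsub>G\<^esub> (mu m d) \<otimes>\<^bsub>G\<^esub> a \<in> Einf S \<and> a = mmult S (mu m d) (inv\<^bsub>G\<^esub> (mu m d) \<otimes>\<^bsub>G\<^esub> a)"
        using inv_a ce mu by metis
    qed
  qed
  have K1: "K1 S \<cong> (Kstar :: 'k monoid)"
  proof -
    \<comment> \<open>\<open>detbar\<close> takes values in L_m; f reads them back in K and is a
      surjection onto \<open>Kstar\<close> with kernel \<open>Einf S\<close>.\<close>
    define f where "f a = (THE c :: 'k. detbar m a = scL m c)" for a
    have f: "f a = c" if "detbar m a = scL m c" for a c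
      unfolding f_def using that inj by (intro the_equality) auto
    have det: "\<exists>c::'k. c \<noteq> 0 \<and> detbar m a = scL m c" if "a \<in> GLinf S" for a
      using hom1 that by blast
    have "f \<in> hom G Kstar"
    proof (rule homI)
      fix a assume "a \<in> carrier G"
      then show "f a \<in> carrier Kstar" using det[of a] f by (auto simp: Kstar_def)
    next
      fix a b assume ab: "a \<in> carrier G" "b \<in> carrier G"
      obtain c d :: 'k where cd: "detbar m a = scL m c" "detbar m b = scL m d" using ab det by fastforce
      then have "detbar m (a \<otimes>\<^bsub>G\<^esub> b) = scL m (c * d)"
        using ab by (simp add: S_def detbar_mult scL_simps)
      then show "f (a \<otimes>\<^bsub>G\<^esub> b) = f a \<otimes>\<^bsub>Kstar\<^esub> f b" using f cd by (simp add: Kstar_def)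
    qed
    then interpret f: group_hom G "Kstar :: 'k monoid" f
      using group_Kstar by (intro group_hom.intro group_hom_axioms.intro G.is_group) auto
    have "f ` carrier G = carrier Kstar"
    proof
      show "f ` carrier G \<subseteq> carrier Kstar" using f.hom_closed by blast
      show "carrier Kstar \<subseteq> f ` carrier G"
      proof
        fix c :: 'k assume "c \<in> carrier Kstar"
        then have "c \<noteq> 0" by (simp add: Kstar_def)
        then have "f (mu m c) = c" "mu m c \<in> carrier G" using f detmu mu by simp_all
        then show "c \<in> f ` carrier G" by (metis image_eqI)
      qed
    qed
    then have "G Mod kernel G Kstar f \<cong> (Kstar :: 'k monoid)" by (rule f.FactGroup_iso)
    moreover have "kernel G Kstar f = Einf S"
    proof -
      have "f a = 1 \<longleftrightarrow> detbar m a = scL m (1 :: 'k)" if a: "a \<in> GLinf S" for a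
      proof -
        obtain c :: 'k where c: "detbar m a = scL m c" using det[OF a] by blast
        show ?thesis unfolding f[OF c] unfolding c inj ..
      qed
      then show ?thesis unfolding ker by (auto simp: kernel_def one Kstar_def)
    qed
    ultimately show ?thesis by (simp add: K1_def G_def)
  qed
  have inj': "inj_on (scL m :: 'k \<Rightarrow> _) {c. c \<noteq> 0}" using inj_scL by (rule inj_on_subset) simp
  show "detbar m \<in> hom G (units_of L)"
    "inj_on (scL m :: 'k \<Rightarrow> _) {c. c \<noteq> 0}"
    "detbar m ` GLinf S = scL m ` {c :: 'k. c \<noteq> 0}"
    "Einf S = kernel G (units_of L) (detbar m)"
    "subgroup (UK m) G"
    "Einf S \<lhd> G"
    "UK m \<inter> Einf S = {idm S}"
    "UK m <#>\<^bsub>G\<^esub> Einf S = GLinf S"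
    "\<forall>a\<in>GLinf S. (\<exists>!(c, e). c \<noteq> (0::'k) \<and> e \<in> Einf S \<and> a = mmult S (mu m c) e)
     \<and> (\<forall>c::'k. c \<noteq> 0 \<and> detbar m a = scL m c \<longrightarrow> mu m c \<in> GLinf S
            \<and> inv\<^bsub>G\<^esub> (mu m c) \<otimes>\<^bsub>G\<^esub> a \<in> Einf S \<and> a = mmult S (mu m c) (inv\<^bsub>G\<^esub> (mu m c) \<otimes>\<^bsub>G\<^esub> a))"
    "K1 S \<cong> (Kstar :: 'k monoid)"
    by ((fact hom inj' hom1 ker UK normal meet span K1) | (rule ballI, erule unique))+
qed

text \<open>The conjuncts below do not all mention \<open>'k\<close>, so their base fields are independent type variables.\<close>

theorem theorem4p5:
  fixes m :: nat
  assumes "m \<ge> 1"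
  shows
    \<comment> \<open>(1) det-bar is a hom GL_inf(S_m) -> L_m^*, with image exactly K^* (embedded injectively)\<close>
    "detbar m \<in> hom (GLgrp (Sm m)) (units_of (Lm m))
     \<and> inj_on (scL m :: 'k::field \<Rightarrow> _) {c. c \<noteq> 0}
     \<and> detbar m ` GLinf (Sm m) = scL m ` {c :: 'k. c \<noteq> 0}
     \<comment> \<open>E_inf(S_m) = ker det-bar\<close>
     \<and> Einf (Sm m) = kernel (GLgrp (Sm m)) (units_of (Lm m)) (detbar m :: _ \<Rightarrow> 'k ncpoly set set)
     \<comment> \<open>GL_inf(S_m) = U(K) \<ltimes> E_inf(S_m)\<close>
     \<and> subgroup (UK m) (GLgrp (Sm m))
     \<and> Einf (Sm m) \<lhd> GLgrp (Sm m)
     \<and> UK m \<inter> Einf (Sm m) = {idm (Sm m)}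
     \<and> UK m <#>\<^bsub>GLgrp (Sm m)\<^esub> Einf (Sm m) = GLinf (Sm m)
     \<comment> \<open>unique decomposition a = mu(lambda) e with lambda = det-bar(a), e = mu(lambda)^-1 a\<close>
     \<and> (\<forall>a \<in> GLinf (Sm m).
          (\<exists>!(c, e). c \<noteq> (0::'k) \<and> e \<in> Einf (Sm m) \<and> a = mmult (Sm m) (mu m c) e)
        \<and> (\<forall>c::'k. c \<noteq> 0 \<and> detbar m a = scL m c \<longrightarrow>
              mu m c \<in> GLinf (Sm m)
            \<and> inv\<^bsub>GLgrp (Sm m)\<^esub> (mu m c) \<otimes>\<^bsub>GLgrp (Sm m)\<^esub> a \<in> Einf (Sm m)
            \<and> a = mmult (Sm m) (mu m c) (inv\<^bsub>GLgrp (Sm m)\<^esub> (mu m c) \<otimes>\<^bsub>GLgrp (Sm m)\<^esub> a)))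
     \<comment> \<open>(2) K_1(S_m) is isomorphic to K^*\<close>
     \<and> K1 (Sm m :: 'k ncpoly set ring) \<cong> (Kstar :: 'k monoid)"
  by (intro conjI GL_structure)

end
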